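(* Let $\lambda\in\mathbb P^+$. The $\mathfrak{gl}(m|n)$-module $L_{\pi_{st}}(\lambda)$ is a KW-module if and only if all its nonzero Kazhdan-Lusztig polynomials $K_{\lambda,\mu}(q)$, $\mu\in\mathbb P^+$, are monomials. In this case, $K_{\lambda,\mu}(q)=q^{l_{\lambda,\mu}}$ whenever $K_{\lambda,\mu}(q)\neq0$.
   Context: $\mathfrak g=\mathfrak{gl}(m|n)$ over $\mathbb C$, $\mathfrak h$ the diagonal Cartan subalgebra, $\{\varepsilon_1,\dots,\varepsilon_m;\delta_1,\dots,\delta_n\}$ the basis of $\mathfrak h^*$ dual to the diagonal matrix units, with $(\varepsilon_i,\varepsilon_j)=\delta_{ij}=-(\delta_i,\delta_j)$, $(\varepsilon_i,\delta_j)=0$. Even roots $\{\varepsilon_i-\varepsilon_j\}_{i\neq j}\cup\{\delta_k-\delta_l\}_{k\neq l}$, odd roots $\{\pm(\varepsilon_i-\delta_k)\}$. All sets of simple roots $\pi$ considered have positive even roots $\Delta_{\bar0}^+=\{\varepsilon_i-\varepsilon_j\}_{i<j}\cup\{\delta_k-\delta_l\}_{k<l}$; $\pi_{st}=\{\varepsilon_1-\varepsilon_2,\dots,\varepsilon_{m-1}-\varepsilon_m,\varepsilon_m-\delta_1,\delta_1-\delta_2,\dots,\delta_{n-1}-\delta_n\}$. $\rho_\pi=\frac12\sum_{\alpha\in\Delta^+_{\bar0}}\alpha-\frac12\sum_{\alpha\in\Delta^+_{\bar1}}\alpha$, $\lambda^\rho_\pi=\lambda+\rho_\pi$; $L_\pi(\lambda)$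 is the simple highest weight module. $\mathbb P^+$ is the set of weights $\mu$ with $2(\mu,\alpha)/(\alpha,\alpha)\in\mathbb Z_{\ge0}$ for $\alpha\in\Delta^+_{\bar0}$ and $(\mu^\rho_\pi,\varepsilon_i),(\mu^\rho_\pi,\delta_j)\in\mathbb Z$ for all $i,j$. A $\lambda^\rho$-maximal isotropic set is a set of linearly independent roots $\{\beta_1,\dots,\beta_r\}$ with $(\beta_i,\beta_j)=0=(\lambda^\rho,\beta_i)$ for all $i,j$, of maximal possible cardinality. A finite dimensional simple module $L$ is a KW-module if $L\cong L_\pi(\lambda')$ for some $\pi$ and $\lambda'$ such that $\pi$ contains a $(\lambda')^\rho$-maximal isotropic set. Weight diagrams: for $\mu\in\mathbb P^+$ write $\mu+\rho_{\pi_{st}}=\sum a_i\varepsilon_i-\sum b_j\delta_j$. The weight diagram $D_\mu$ assigns to $t\in\mathbb Z$ the symbol $\times$ if $t\in\{a_i\}\cap\{b_j\}$, $>$ if $t\in\{a_i\}\setminus\{b_j\}$, $<$ if $t\in\{b_j\}\setminus\{a_i\}$, and otherwise $t$ is an empty spot. Right moves: given a weight diagram with its $\times$'s labeled by $1,\dots,r$, process the $\times$'s starting with the rightmost and going left; each $\times$ marks the next empty spot to its right that is not yet marked. The right move $R_i$ moves the $\times$ labeled $i$ to the spot it marked (labels move with the $\times$'s, and marks are recomputed for each new diagram). Label the $\times$'s of $D_\mu$ from left to right by $1,\dots,r$. A right path from $D_\mu$ to $D_\lambda$ is a sequence of right moves $\theta=R_{i_1}\circ\dots\circ R_{i_k}$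 with $i_1\le\dots\le i_k$ and $\theta(D_\mu)=D_\lambda$ (as unlabeled diagrams); its length is $l(\theta)=k$. If right paths from $D_\mu$ to $D_\lambda$ exist, exactly one of them sends, for each $i$, the $i$-th $\times$ of $D_\mu$ (from the left) to the location of the $i$-th $\times$ of $D_\lambda$; it is called the trivial path and its length is denoted $l_{\lambda,\mu}$. The (generalized) Kazhdan-Lusztig polynomials of $L_{\pi_{st}}(\lambda)$ are (by a result of Brundan) $K_{\lambda,\mu}(q)=\sum_{\theta}q^{l(\theta)}$, the sum over all right paths $\theta$ from $D_\mu$ to $D_\lambda$. *)

theory Defs
  imports
    Complex_Main
    "HOL-Library.Function_Algebras"
    "HOL-Computational_Algebra.Polynomial"
    "Jordan_Normal_Form.Matrix"
begin

section \<open>Weights and roots of gl(m|n)\<close>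

text \<open>
  Indices are 0-based. A weight is given by its coordinates in the basis
  \<open>\<epsilon>\<^sub>1, \<dots>, \<epsilon>\<^sub>m, \<delta>\<^sub>1, \<dots>, \<delta>\<^sub>n\<close> of the dual of the diagonal Cartan subalgebra: position
  \<open>a < m\<close> holds the coefficient of \<open>\<epsilon>\<^bsub>a+1\<^esub>\<close>, position \<open>m + k\<close> with \<open>k < n\<close> that of \<open>\<delta>\<^bsub>k+1\<^esub>\<close>,
  and all further positions are zero.
\<close>

type_synonym weight = "nat \<Rightarrow> complex"

definition weights :: "nat \<Rightarrow> nat \<Rightarrow> weight set" where
  "weights m n = {\<mu>. \<forall>a\<ge>m + n. \<mu> a = 0}"

definition eps :: "nat \<Rightarrow> weight" where
  "eps i = (\<lambda>a. if a = i then 1 else 0)"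

definition del :: "nat \<Rightarrow> nat \<Rightarrow> weight" where
  "del m k = (\<lambda>a. if a = m + k then 1 else 0)"

definition wscale :: "complex \<Rightarrow> weight \<Rightarrow> weight" where
  "wscale c \<mu> = (\<lambda>a. c * \<mu> a)"

definition form :: "nat \<Rightarrow> nat \<Rightarrow> weight \<Rightarrow> weight \<Rightarrow> complex" where
  "form m n \<mu> \<nu> = (\<Sum>i<m. \<mu> i * \<nu> i) - (\<Sum>k<n. \<mu> (m + k) * \<nu> (m + k))"

definition even_roots :: "nat \<Rightarrow> nat \<Rightarrow> weight set" where
  "even_roots m n =
     {eps i - eps j | i j. i < m \<and> j < m \<and> i \<noteq> j} \<union>
     {del m k - del m l | k l. k < n \<and> l < n \<and> k \<noteq> l}"

definition odd_roots :: "nat \<Rightarrow> nat \<Rightarrow> weight set" where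
  "odd_roots m n =
     {eps i - del m k | i k. i < m \<and> k < n} \<union> {del m k - eps i | i k. i < m \<and> k < n}"

definition roots :: "nat \<Rightarrow> nat \<Rightarrow> weight set" where
  "roots m n = even_roots m n \<union> odd_roots m n"

definition pos_even_roots :: "nat \<Rightarrow> nat \<Rightarrow> weight set" where
  "pos_even_roots m n =
     {eps i - eps j | i j. i < j \<and> j < m} \<union> {del m k - del m l | k l. k < l \<and> l < n}"

definition nonneg_span :: "weight set \<Rightarrow> weight set" where
  "nonneg_span \<pi> = {\<Sum>\<beta>\<in>\<pi>. wscale (of_nat (c \<beta>)) \<beta> | c :: weight \<Rightarrow> nat. True}"

definition pos_roots :: "nat \<Rightarrow> nat \<Rightarrow> weight set \<Rightarrow> weight set" where
  "pos_roots m n \<pi> = roots m n \<inter> nonneg_span \<pi>"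

text \<open>The last condition fixes the positive even roots once and for all.\<close>

definition simple_root_set :: "nat \<Rightarrow> nat \<Rightarrow> weight set \<Rightarrow> bool" where
  "simple_root_set m n \<pi> \<longleftrightarrow>
     \<pi> \<subseteq> roots m n \<and>
     \<not> module.dependent wscale \<pi> \<and>
     (\<forall>\<alpha>\<in>roots m n. \<alpha> \<in> nonneg_span \<pi> \<or> - \<alpha> \<in> nonneg_span \<pi>) \<and>
     pos_roots m n \<pi> \<inter> even_roots m n = pos_even_roots m n"

definition pi_st :: "nat \<Rightarrow> nat \<Rightarrow> weight set" where
  "pi_st m n =
     {eps i - eps (i + 1) | i. i + 1 < m} \<union>
     (if 0 < m \<and> 0 < n then {eps (m - 1) - del m 0} else {}) \<union>
     {del m k - del m (k + 1) | k. k + 1 < n}"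

definition rho :: "nat \<Rightarrow> nat \<Rightarrow> weight set \<Rightarrow> weight" where
  "rho m n \<pi> =
     wscale (1 / 2) (\<Sum>\<alpha>\<in>pos_even_roots m n. \<alpha>) -
     wscale (1 / 2) (\<Sum>\<alpha>\<in>pos_roots m n \<pi> \<inter> odd_roots m n. \<alpha>)"

text \<open>
  The integrality condition does not depend on the chosen set of simple roots: any two
  \<open>\<rho>\<close>'s differ by a sum of odd roots.
\<close>

definition P_plus :: "nat \<Rightarrow> nat \<Rightarrow> weight set" where
  "P_plus m n =
     {\<mu> \<in> weights m n.
        (\<forall>\<alpha>\<in>pos_even_roots m n. 2 * form m n \<mu> \<alpha> / form m n \<alpha> \<alpha> \<in> \<nat>) \<and>
        (\<forall>i<m. form m n (\<mu> + rho m n (pi_st m n)) (eps i) \<in> \<int>) \<and>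
        (\<forall>k<n. form m n (\<mu> + rho m n (pi_st m n)) (del m k) \<in> \<int>)}"


section \<open>Modules over gl(m|n)\<close>

definition gl :: "nat \<Rightarrow> nat \<Rightarrow> complex mat set" where
  "gl m n = carrier_mat (m + n) (m + n)"

text \<open>Parities are the numbers 0 (even: block diagonal) and 1 (odd: off-diagonal blocks).\<close>

definition gl_part :: "nat \<Rightarrow> nat \<Rightarrow> nat \<Rightarrow> complex mat set" where
  "gl_part m n p =
     {x \<in> gl m n. \<forall>a<m + n. \<forall>b<m + n. (a < m \<longleftrightarrow> b < m) \<noteq> (p = 0) \<longrightarrow> x $$ (a, b) = 0}"

text \<open>The superbracket of homogeneous elements \<open>x\<close>, \<open>y\<close> of parities \<open>p\<close>, \<open>q\<close>.\<close>

definition sbracket :: "nat \<Rightarrow> nat \<Rightarrow> complex mat \<Rightarrow> complex mat \<Rightarrow> complex mat" where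
  "sbracket p q x y = x * y - (- 1) ^ (p * q) \<cdot>\<^sub>m (y * x)"

definition cartan :: "nat \<Rightarrow> nat \<Rightarrow> complex mat set" where
  "cartan m n = {h \<in> gl m n. diagonal_mat h}"

definition weight_eval :: "nat \<Rightarrow> nat \<Rightarrow> weight \<Rightarrow> complex mat \<Rightarrow> complex" where
  "weight_eval m n \<mu> h = (\<Sum>a<m + n. \<mu> a * h $$ (a, a))"

definition root_space :: "nat \<Rightarrow> nat \<Rightarrow> weight \<Rightarrow> complex mat set" where
  "root_space m n \<alpha> =
     {x \<in> gl m n. \<forall>h\<in>cartan m n. h * x - x * h = weight_eval m n \<alpha> h \<cdot>\<^sub>m x}"

text \<open>
  A module lives on a subspace of an ambient complex vector space \<open>'v\<close>; it is the sum of the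
  homogeneous parts \<open>grade M 0\<close> and \<open>grade M 1\<close>.
\<close>

record 'v smodule =
  scl :: "complex \<Rightarrow> 'v \<Rightarrow> 'v"
  grade :: "nat \<Rightarrow> 'v set"
  act :: "complex mat \<Rightarrow> 'v \<Rightarrow> 'v"

definition space :: "('v::ab_group_add) smodule \<Rightarrow> 'v set" where
  "space M = {v + w | v w. v \<in> grade M 0 \<and> w \<in> grade M 1}"

definition gl_module :: "nat \<Rightarrow> nat \<Rightarrow> ('v::ab_group_add) smodule \<Rightarrow> bool" where
  "gl_module m n M \<longleftrightarrow>
     vector_space (scl M) \<and>
     module.subspace (scl M) (grade M 0) \<and> module.subspace (scl M) (grade M 1) \<and>
     grade M 0 \<inter> grade M 1 = {0} \<and>
     (\<forall>x\<in>gl m n. \<forall>v\<in>space M. \<forall>w\<in>space M. act M x (v + w) = act M x v + act M x w) \<and>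
     (\<forall>x\<in>gl m n. \<forall>c. \<forall>v\<in>space M. act M x (scl M c v) = scl M c (act M x v)) \<and>
     (\<forall>x\<in>gl m n. \<forall>y\<in>gl m n. \<forall>v\<in>space M. act M (x + y) v = act M x v + act M y v) \<and>
     (\<forall>x\<in>gl m n. \<forall>c. \<forall>v\<in>space M. act M (c \<cdot>\<^sub>m x) v = scl M c (act M x v)) \<and>
     (\<forall>p\<in>{0, 1}. \<forall>q\<in>{0, 1}. \<forall>x\<in>gl_part m n p. \<forall>v\<in>grade M q.
        act M x v \<in> grade M ((p + q) mod 2)) \<and>
     (\<forall>p\<in>{0, 1}. \<forall>q\<in>{0, 1}. \<forall>x\<in>gl_part m n p. \<forall>y\<in>gl_part m n q. \<forall>v\<in>space M.
        act M (sbracket p q x y) v =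
          act M x (act M y v) - scl M ((- 1) ^ (p * q)) (act M y (act M x v)))"

definition submodule :: "nat \<Rightarrow> nat \<Rightarrow> ('v::ab_group_add) smodule \<Rightarrow> 'v set \<Rightarrow> bool" where
  "submodule m n M W \<longleftrightarrow>
     module.subspace (scl M) W \<and>
     W = {v + w | v w. v \<in> W \<inter> grade M 0 \<and> w \<in> W \<inter> grade M 1} \<and>
     (\<forall>x\<in>gl m n. \<forall>w\<in>W. act M x w \<in> W)"

definition simple_module :: "nat \<Rightarrow> nat \<Rightarrow> ('v::ab_group_add) smodule \<Rightarrow> bool" where
  "simple_module m n M \<longleftrightarrow>
     gl_module m n M \<and> space M \<noteq> {0} \<and>
     (\<forall>W. submodule m n M W \<longrightarrow> W = {0} \<or> W = space M)"

definition finite_dim :: "('v::ab_group_add) smodule \<Rightarrow> bool" where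
  "finite_dim M \<longleftrightarrow> (\<exists>B. finite B \<and> B \<subseteq> space M \<and> module.span (scl M) B = space M)"

definition module_iso ::
  "nat \<Rightarrow> nat \<Rightarrow> ('v::ab_group_add) smodule \<Rightarrow> ('w::ab_group_add) smodule \<Rightarrow> bool" where
  "module_iso m n M N \<longleftrightarrow>
     (\<exists>f. bij_betw f (space M) (space N) \<and>
          (\<forall>v\<in>space M. \<forall>w\<in>space M. f (v + w) = f v + f w) \<and>
          (\<forall>c. \<forall>v\<in>space M. f (scl M c v) = scl N c (f v)) \<and>
          (\<forall>p\<in>{0, 1}. f ` grade M p = grade N p) \<and>
          (\<forall>x\<in>gl m n. \<forall>v\<in>space M. f (act M x v) = act N x (f v)))"

definition highest_weight_module ::
  "nat \<Rightarrow> nat \<Rightarrow> weight set \<Rightarrow> weight \<Rightarrow> ('v::ab_group_add) smodule \<Rightarrow> bool" where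
  "highest_weight_module m n \<pi> \<mu> M \<longleftrightarrow>
     gl_module m n M \<and>
     (\<exists>v \<in> grade M 0 \<union> grade M 1.
        v \<noteq> 0 \<and>
        (\<forall>h\<in>cartan m n. act M h v = scl M (weight_eval m n \<mu> h) v) \<and>
        (\<forall>\<alpha>\<in>pos_roots m n \<pi>. \<forall>x\<in>root_space m n \<alpha>. act M x v = 0) \<and>
        (\<forall>W. submodule m n M W \<and> v \<in> W \<longrightarrow> W = space M))"

text \<open>
  \<open>is_L m n \<pi> \<mu> M\<close> says that \<open>M\<close> is the simple highest weight module \<open>L\<^sub>\<pi>(\<mu>)\<close>. As the highest
  weight vector may have either parity, this determines \<open>M\<close> up to isomorphism and parity shift.
\<close>

definition is_L ::
  "nat \<Rightarrow> nat \<Rightarrow> weight set \<Rightarrow> weight \<Rightarrow> ('v::ab_group_add) smodule \<Rightarrow> bool" where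
  "is_L m n \<pi> \<mu> M \<longleftrightarrow> simple_module m n M \<and> highest_weight_module m n \<pi> \<mu> M"


section \<open>KW-modules\<close>

definition isotropic_sets :: "nat \<Rightarrow> nat \<Rightarrow> weight \<Rightarrow> weight set set" where
  "isotropic_sets m n \<nu> =
     {S. S \<subseteq> roots m n \<and> \<not> module.dependent wscale S \<and>
         (\<forall>\<beta>\<in>S. \<forall>\<gamma>\<in>S. form m n \<beta> \<gamma> = 0) \<and> (\<forall>\<beta>\<in>S. form m n \<nu> \<beta> = 0)}"

definition maximal_isotropic :: "nat \<Rightarrow> nat \<Rightarrow> weight \<Rightarrow> weight set \<Rightarrow> bool" where
  "maximal_isotropic m n \<nu> S \<longleftrightarrow>
     S \<in> isotropic_sets m n \<nu> \<and> (\<forall>T\<in>isotropic_sets m n \<nu>. card T \<le> card S)"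

definition KW_module :: "nat \<Rightarrow> nat \<Rightarrow> ('v::ab_group_add) smodule \<Rightarrow> bool" where
  "KW_module m n M \<longleftrightarrow>
     simple_module m n M \<and> finite_dim M \<and>
     (\<exists>\<pi> \<mu> (N :: 'v smodule).
        simple_root_set m n \<pi> \<and> \<mu> \<in> weights m n \<and> is_L m n \<pi> \<mu> N \<and> module_iso m n M N \<and>
        (\<exists>S\<subseteq>\<pi>. maximal_isotropic m n (\<mu> + rho m n \<pi>) S))"


section \<open>Weight diagrams, right paths and Kazhdan-Lusztig polynomials\<close>

datatype symbol = Times | Gt | Lt | Empty

type_synonym diagram = "int \<Rightarrow> symbol"

definition diagram_of :: "nat \<Rightarrow> nat \<Rightarrow> weight \<Rightarrow> diagram" where
  "diagram_of m n \<mu> =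
     (let \<nu> = \<mu> + rho m n (pi_st m n);
          A = {t :: int. \<exists>i<m. \<nu> i = of_int t};
          B = {t :: int. \<exists>k<n. - \<nu> (m + k) = of_int t}
      in (\<lambda>t. if t \<in> A \<and> t \<in> B then Times
              else if t \<in> A then Gt
              else if t \<in> B then Lt
              else Empty))"

definition crosses :: "diagram \<Rightarrow> int list" where
  "crosses D = sorted_list_of_set {t. D t = Times}"

text \<open>
  \<open>marks D xs M\<close> lists the pairs (cross, marked spot) when the crosses in \<open>xs\<close> are processed in the
  given order and the spots in \<open>M\<close> are already marked.
\<close>

fun marks :: "diagram \<Rightarrow> int list \<Rightarrow> int set \<Rightarrow> (int \<times> int) list" where
  "marks D [] M = []"
| "marks D (x # xs) M =
     (let t = (LEAST t. x < t \<and> D t = Empty \<and> t \<notin> M) in (x, t) # marks D xs (insert t M))"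

definition marked_spot :: "diagram \<Rightarrow> int \<Rightarrow> int" where
  "marked_spot D x = the (map_of (marks D (rev (crosses D)) {}) x)"

text \<open>A labeled diagram is a diagram with the position of the cross with label \<open>i\<close>, for each \<open>i\<close>.\<close>

type_synonym labeled_diagram = "diagram \<times> (nat \<Rightarrow> int)"

definition right_move :: "nat \<Rightarrow> labeled_diagram \<Rightarrow> labeled_diagram" where
  "right_move i E =
     (let D = fst E; x = snd E i; t = marked_spot D x
      in (D(x := Empty, t := Times), (snd E)(i := t)))"

definition label_lr :: "diagram \<Rightarrow> labeled_diagram" where
  "label_lr D = (D, \<lambda>i. crosses D ! (i - 1))"

text \<open>
  The list \<open>[i\<^sub>1, \<dots>, i\<^sub>k]\<close> stands for the composition of right moves whose last listed move is
  performed first.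
\<close>

definition path_map :: "nat list \<Rightarrow> labeled_diagram \<Rightarrow> labeled_diagram" where
  "path_map \<theta> E = foldr right_move \<theta> E"

definition right_paths :: "diagram \<Rightarrow> diagram \<Rightarrow> nat list set" where
  "right_paths D D' =
     {\<theta>. set \<theta> \<subseteq> {1..length (crosses D)} \<and> sorted \<theta> \<and> fst (path_map \<theta> (label_lr D)) = D'}"

definition trivial_path :: "diagram \<Rightarrow> diagram \<Rightarrow> nat list \<Rightarrow> bool" where
  "trivial_path D D' \<theta> \<longleftrightarrow>
     \<theta> \<in> right_paths D D' \<and>
     (\<forall>i\<in>{1..length (crosses D)}. snd (path_map \<theta> (label_lr D)) i = crosses D' ! (i - 1))"

definition trivial_length :: "nat \<Rightarrow> nat \<Rightarrow> weight \<Rightarrow> weight \<Rightarrow> nat" where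
  "trivial_length m n lam \<mu> = length (THE \<theta>. trivial_path (diagram_of m n \<mu>) (diagram_of m n lam) \<theta>)"

text \<open>Brundan's path formula for the generalized Kazhdan-Lusztig polynomials.\<close>

definition KL :: "nat \<Rightarrow> nat \<Rightarrow> weight \<Rightarrow> weight \<Rightarrow> int poly" where
  "KL m n lam \<mu> =
     (\<Sum>\<theta>\<in>right_paths (diagram_of m n \<mu>) (diagram_of m n lam). monom 1 (length \<theta>))"

definition is_monomial :: "int poly \<Rightarrow> bool" where
  "is_monomial p \<longleftrightarrow> (\<exists>c k. c \<noteq> 0 \<and> p = monom c k)"

end

theory Submission
  imports Defs
begin

text \<open>
  Let \<open>A\<close> and \<open>B\<close> be the sets of the \<open>a\<^sub>i\<close> and of the \<open>b\<^sub>j\<close> that define the weight diagram of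
  \<open>\<lambda>\<close>. Call the diagram totally connected if no spot between two crosses is empty. Both sides of the
  equivalence are shown to mean that the diagram of \<open>\<lambda>\<close> is totally connected
  (\<open>KW_iff_totally_connected\<close>, \<open>monomial_iff_totally_connected\<close>).

  Paths. Suppose that a cross jumps over another cross in a right path. The cross that was jumped over
  marks an empty spot to the left of the landing place, and from then on no cross can land between it and
  that spot: the spot stays empty, and crosses stay on both sides of it (\<open>frozen_gap\<close>). So no jump
  occurs in a right path to a totally connected diagram. Such a path keeps the order of the crosses,
  hence it is the trivial path, and it is unique (\<open>right_path_to_connected_is_trivial\<close>,
  \<open>trivial_path_unique\<close>). If the diagram of \<open>\<lambda>\<close> has neighbouring crosses at \<open>x < y\<close> with an empty
  spot between them, there is a diagram with crosses at \<open>x\<close> and at the last spot to the left of \<open>x\<close>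
  that is not occupied by \<open>>\<close> or \<open><\<close>, and without a cross at \<open>y\<close>. Either the cross at \<open>x\<close>
  moves to \<open>y\<close> and the other one takes its place, or the other one jumps over \<open>x\<close> and goes to \<open>y\<close>
  itself. The second way saves two moves, so two different powers of \<open>q\<close> occur
  (\<open>two_right_paths\<close>).

  Words. The sets of simple roots with the fixed positive even roots are the shuffles of
  \<open>\<epsilon>\<^sub>1, \<dots>, \<epsilon>\<^sub>m\<close> with \<open>\<delta>\<^sub>1, \<dots>, \<delta>\<^sub>n\<close> (\<open>simple_root_set_ordering\<close>). A simple module \<open>L\<close> has one
  highest weight for each shuffle, and this weight together with \<open>\<rho>\<close> is written as a word: the letter
  \<open>Ep t\<close> stands for an \<open>\<epsilon>\<close> with coordinate \<open>t\<close>, the letter \<open>De t\<close> for a \<open>\<delta>\<close> with coordinate \<open>-t\<close>.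
  An odd reflection exchanges neighbours \<open>Ep s\<close>, \<open>De t\<close> without changing them if \<open>s \<noteq> t\<close>, and turns
  \<open>Ep s\<close>, \<open>De s\<close> into \<open>De (s+1)\<close>, \<open>Ep (s+1)\<close>. A word is determined by its types because a simple
  module has only one singular vector for each order (\<open>hwv_unique\<close>). Since \<open>L\<close> is finite dimensional,
  neighbouring letters \<open>Ep\<close> have decreasing values and neighbouring letters \<open>De\<close> increasing ones
  (\<open>dominant_words_realized\<close>).

  In this language \<open>L\<close> is a KW-module if and only if it realizes a word in which some disjoint pairs of
  neighbours \<open>Ep s\<close>, \<open>De s\<close> have been chosen such that no value is shared by a remaining \<open>Ep\<close> and a
  remaining \<open>De\<close>. From the word of a totally connected diagram such a word is reached by letting the
  pairs climb from the leftmost cross to the rightmost one: they pass the spots \<open>>\<close> and \<open><\<close>, absorb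
  every cross that they meet, and could only be stopped by an empty spot (\<open>climb_step\<close>). Conversely,
  take a word with chosen pairs and as few inversions as possible. Dominance forces all pairs to stand
  next to each other with one common value (\<open>neighbouring_pairs\<close>). This is the final word of the climb
  of a totally connected diagram, and by uniqueness that diagram is the one of \<open>\<lambda>\<close>
  (\<open>blocks_imp_totally_connected\<close>).
\<close>

section \<open>Words and odd reflections\<close>

text \<open>
  A word lists the coordinates of a weight along a shuffle of the \<open>\<epsilon>\<close>'s and \<open>\<delta>\<close>'s. The sign in
  \<open>De t\<close>, which stands for the coordinate \<open>-t\<close>, makes the root of a pair \<open>Ep t\<close>, \<open>De t\<close> orthogonal to
  the weight.
\<close>

datatype letter = Ep int | De int

definition pairs :: "nat \<Rightarrow> int \<Rightarrow> letter list" where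
  "pairs k t = concat (replicate k [Ep t, De t])"

lemma pairs_0 [simp]: "pairs 0 t = []"
  by (simp add: pairs_def)

lemma pairs_Suc: "pairs (Suc k) t = [Ep t, De t] @ pairs k t"
  by (simp add: pairs_def)

text \<open>
  The result of reflecting every pair of a run, \<open>[De t, Ep t]\<close> repeated, becomes a run of pairs again
  once a letter of the same value stands at one of its ends. This is what lets a run of pairs pass a
  spot \<open>>\<close> or \<open><\<close> and absorb a cross.
\<close>

lemma pairs_rotate:
  "Ep t # concat (replicate k [De t, Ep t]) @ De t # z = pairs (Suc k) t @ z"
  "Ep t # concat (replicate k [De t, Ep t]) @ z = pairs k t @ Ep t # z"
  "concat (replicate k [De t, Ep t]) @ De t # z = De t # pairs k t @ z"
proof -
  show two: "Ep t # concat (replicate k [De t, Ep t]) @ z = pairs k t @ Ep t # z" for z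
    by (induction k) (auto simp: pairs_def)
  show "Ep t # concat (replicate k [De t, Ep t]) @ De t # z = pairs (Suc k) t @ z"
    unfolding two pairs_def by (induction k) auto
  show "concat (replicate k [De t, Ep t]) @ De t # z = De t # pairs k t @ z"
    by (induction k) (auto simp: pairs_def)
qed

definition desc :: "int set \<Rightarrow> int list" where
  "desc A = rev (sorted_list_of_set A)"

definition asc :: "int set \<Rightarrow> int list" where
  "asc A = sorted_list_of_set A"

lemma set_asc [simp]: "finite A \<Longrightarrow> set (asc A) = A"
  and set_desc [simp]: "finite A \<Longrightarrow> set (desc A) = A"
  by (auto simp: asc_def desc_def)

lemma asc_empty [simp]: "asc {} = []" and desc_empty [simp]: "desc {} = []"
  by (auto simp: asc_def desc_def)

lemma asc_eqI: "sorted_wrt (<) xs \<Longrightarrow> asc (set xs) = xs"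
  unfolding asc_def by (simp add: strict_sorted_equal)

lemma sorted_asc: "sorted_wrt (<) (asc A)"
  by (simp add: asc_def)

lemma desc_eq_rev_asc: "desc A = rev (asc A)"
  by (simp add: asc_def desc_def)

lemma desc_eqI: "sorted_wrt (>) xs \<Longrightarrow> desc (set xs) = xs"
proof -
  assume "sorted_wrt (>) xs"
  then have "sorted_wrt (<) (rev xs)"
    by (simp add: sorted_wrt_rev)
  from asc_eqI[OF this] show ?thesis
    by (simp add: desc_eq_rev_asc)
qed

lemma sorted_desc: "sorted_wrt (>) (desc A)"
  using sorted_asc[of A] by (simp add: desc_eq_rev_asc sorted_wrt_rev)

lemma asc_insert_max:
  assumes "finite A" "\<forall>a\<in>A. a < x"
  shows "asc (insert x A) = asc A @ [x]"
proof -
  have "sorted_wrt (<) (asc A @ [x])"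
    using assms sorted_asc[of A] by (auto simp: sorted_wrt_append)
  from asc_eqI[OF this] show ?thesis using assms by simp
qed

lemma asc_insert_min:
  assumes "finite A" "\<forall>a\<in>A. x < a"
  shows "asc (insert x A) = x # asc A"
proof -
  have "sorted_wrt (<) (x # asc A)"
    using assms sorted_asc[of A] by auto
  from asc_eqI[OF this] show ?thesis using assms by simp
qed

lemma desc_insert_max:
  assumes "finite A" "\<forall>a\<in>A. a < x" shows "desc (insert x A) = x # desc A"
  using asc_insert_max[OF assms] by (simp add: desc_eq_rev_asc)

lemma desc_insert_min:
  assumes "finite A" "\<forall>a\<in>A. x < a" shows "desc (insert x A) = desc A @ [x]"
  using asc_insert_min[OF assms] by (simp add: desc_eq_rev_asc)

text \<open>
  The word of a diagram for the standard set of simple roots.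
\<close>

definition std_word :: "int set \<Rightarrow> int set \<Rightarrow> letter list" where
  "std_word A B = map Ep (desc A) @ map De (asc B)"

text \<open>
  The word obtained when everything at spots up to \<open>t\<close> has been processed: the crosses up to \<open>t\<close> have
  become pairs of value \<open>t\<close>, the symbols \<open><\<close> up to \<open>t\<close> stand to the left of them and the symbols \<open>>\<close>
  to the right.
\<close>

definition climbed :: "int set \<Rightarrow> int set \<Rightarrow> int \<Rightarrow> letter list" where
  "climbed A B t =
     map Ep (desc {x \<in> A. t < x}) @ map De (asc {x \<in> B - A. x \<le> t}) @
     pairs (card {x \<in> A \<inter> B. x \<le> t}) t @
     map Ep (desc {x \<in> A - B. x \<le> t}) @ map De (asc {x \<in> B. t < x})"

text \<open>
  The two rules are the effect of an odd reflection on a weight plus \<open>\<rho>\<close>: nothing changes if the root is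
  not orthogonal to it, and otherwise the root is added.
\<close>

locale reflection_closed =
  fixes R :: "letter list \<Rightarrow> bool"
  assumes typical: "s \<noteq> t \<Longrightarrow> R (u @ Ep s # De t # z) = R (u @ De t # Ep s # z)"
    and atypical: "R (u @ Ep s # De s # z) = R (u @ De (s + 1) # Ep (s + 1) # z)"
begin

lemma pass_De:
  assumes "t \<notin> set es"
  shows "R (u @ De t # map Ep es @ z) = R (u @ map Ep es @ De t # z)"
  using assms
proof (induction es arbitrary: u)
  case (Cons e es)
  then have "R (u @ De t # map Ep (e # es) @ z) = R ((u @ [Ep e]) @ De t # map Ep es @ z)"
    using typical[of e t u "map Ep es @ z"] by auto
  also have "\<dots> = R ((u @ [Ep e]) @ map Ep es @ De t # z)"
    using Cons by (intro Cons.IH) auto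
  finally show ?case by simp
qed simp

lemma pass_Ep:
  assumes "t \<notin> set ds"
  shows "R (u @ Ep t # map De ds @ z) = R (u @ map De ds @ Ep t # z)"
  using assms
proof (induction ds arbitrary: u)
  case (Cons d ds)
  then have "R (u @ Ep t # map De (d # ds) @ z) = R ((u @ [De d]) @ Ep t # map De ds @ z)"
    using typical[of t d u "map De ds @ z"] by auto
  also have "\<dots> = R ((u @ [De d]) @ map De ds @ Ep t # z)"
    using Cons by (intro Cons.IH) auto
  finally show ?case by simp
qed simp

lemma shift_pairs:
  "R (u @ pairs k t @ z) = R (u @ concat (replicate k [De (t + 1), Ep (t + 1)]) @ z)"
proof (induction k arbitrary: u)
  case (Suc k)
  have "R (u @ pairs (Suc k) t @ z) = R ((u @ [De (t + 1), Ep (t + 1)]) @ pairs k t @ z)"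
    using atypical[of u t "pairs k t @ z"] by (simp add: pairs_Suc)
  also have "\<dots> = R (u @ concat (replicate (Suc k) [De (t + 1), Ep (t + 1)]) @ z)"
    unfolding Suc.IH by simp
  finally show ?case .
qed simp

text \<open>
  Every letter of value \<open>t + 1\<close> reaches the run of pairs of value \<open>t\<close> without meeting an equal value.
  Reflecting all pairs raises them to \<open>t + 1\<close>, and the letter closes the run up. At an empty spot there is
  no such letter, and the reflected run would not consist of pairs.
\<close>

lemma climb_step:
  assumes fin: "finite A" "finite B"
    and ne: "t + 1 \<in> A \<union> B \<or> {x \<in> A \<inter> B. x \<le> t} = {}"
  shows "R (climbed A B t) = R (climbed A B (t + 1))"
proof -
  let ?t = "t + 1"
  define k where "k = card {x \<in> A \<inter> B. x \<le> t}"
  define u where "u = map Ep (desc {x \<in> A. ?t < x})"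
  define d where "d = asc {x \<in> B - A. x \<le> t}"
  define e where "e = desc {x \<in> A - B. x \<le> t}"
  define z where "z = map De (asc {x \<in> B. ?t < x})"
  have e: "?t \<notin> set e" and d: "?t \<notin> set d"
    using fin by (auto simp: d_def e_def)
  have zE: "R (w @ Ep ?t # z) = R (w @ z @ [Ep ?t])" for w
    using pass_Ep[of ?t "asc {x \<in> B. ?t < x}" w "[]"] fin by (simp add: z_def)
  have gt: "t < x \<longleftrightarrow> x = ?t \<or> ?t < x" and le: "x \<le> ?t \<longleftrightarrow> x = ?t \<or> x \<le> t" for x
    by auto
  consider "?t \<in> A" "?t \<in> B" | "?t \<in> A" "?t \<notin> B" | "?t \<notin> A" "?t \<in> B"
    | "?t \<notin> A" "?t \<notin> B" "k = 0"
    using ne unfolding k_def by (metis UnE card.empty)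
  then show ?thesis
  proof cases
    case 1
    have sets: "{x \<in> A. t < x} = insert ?t {x \<in> A. ?t < x}"
      "{x \<in> B. t < x} = insert ?t {x \<in> B. ?t < x}"
      "{x \<in> B - A. x \<le> ?t} = {x \<in> B - A. x \<le> t}" "{x \<in> A - B. x \<le> ?t} = {x \<in> A - B. x \<le> t}"
      "{x \<in> A \<inter> B. x \<le> ?t} = insert ?t {x \<in> A \<inter> B. x \<le> t}"
      using 1 by (auto simp: gt le)
    have l: "climbed A B t = u @ Ep ?t # map De d @ pairs k t @ map Ep e @ De ?t # z"
      unfolding climbed_def k_def u_def d_def e_def z_def sets(1,2)
      using fin by (simp add: desc_insert_min asc_insert_min)
    have r: "climbed A B ?t = u @ map De d @ pairs (Suc k) ?t @ map Ep e @ z"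
      unfolding climbed_def k_def u_def d_def e_def z_def sets(3-5)
      using fin by simp
    have "R (climbed A B t) = R ((u @ map De d @ Ep ?t # pairs k t) @ map Ep e @ De ?t # z)"
      unfolding l using pass_Ep[OF d, of u "pairs k t @ map Ep e @ De ?t # z"] by simp
    also have "\<dots> = R ((u @ map De d @ [Ep ?t]) @ pairs k t @ (De ?t # map Ep e @ z))"
      unfolding pass_De[OF e, symmetric] by simp
    also have "\<dots> = R (climbed A B ?t)"
      unfolding shift_pairs r by (simp only: pairs_rotate(1) append.assoc append_Cons append_Nil)
    finally show ?thesis .
  next
    case 2
    have sets: "{x \<in> A. t < x} = insert ?t {x \<in> A. ?t < x}"
      "{x \<in> B. t < x} = {x \<in> B. ?t < x}"
      "{x \<in> B - A. x \<le> ?t} = {x \<in> B - A. x \<le> t}"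
      "{x \<in> A - B. x \<le> ?t} = insert ?t {x \<in> A - B. x \<le> t}"
      "{x \<in> A \<inter> B. x \<le> ?t} = {x \<in> A \<inter> B. x \<le> t}"
      using 2 by (auto simp: gt le)
    have l: "climbed A B t = u @ Ep ?t # map De d @ pairs k t @ map Ep e @ z"
      unfolding climbed_def k_def u_def d_def e_def z_def sets(1,2)
      using fin by (simp add: desc_insert_min asc_insert_min)
    have r: "climbed A B ?t = u @ map De d @ pairs k ?t @ Ep ?t # map Ep e @ z"
      unfolding climbed_def k_def u_def d_def e_def z_def sets(3-5)
      using fin by (simp add: desc_insert_max)
    have "R (climbed A B t) = R ((u @ map De d @ [Ep ?t]) @ pairs k t @ map Ep e @ z)"
      unfolding l using pass_Ep[OF d, of u "pairs k t @ map Ep e @ z"] by simp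
    also have "\<dots> = R (climbed A B ?t)"
      unfolding shift_pairs r by (simp only: pairs_rotate(2) append.assoc append_Cons append_Nil)
    finally show ?thesis .
  next
    case 3
    have sets: "{x \<in> A. t < x} = {x \<in> A. ?t < x}"
      "{x \<in> B. t < x} = insert ?t {x \<in> B. ?t < x}"
      "{x \<in> B - A. x \<le> ?t} = insert ?t {x \<in> B - A. x \<le> t}"
      "{x \<in> A - B. x \<le> ?t} = {x \<in> A - B. x \<le> t}"
      "{x \<in> A \<inter> B. x \<le> ?t} = {x \<in> A \<inter> B. x \<le> t}"
      using 3 by (auto simp: gt le)
    have l: "climbed A B t = u @ map De d @ pairs k t @ map Ep e @ De ?t # z"
      unfolding climbed_def k_def u_def d_def e_def z_def sets(1,2)
      using fin by (simp add: desc_insert_min asc_insert_min)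
    have r: "climbed A B ?t = u @ map De d @ De ?t # pairs k ?t @ map Ep e @ z"
      unfolding climbed_def k_def u_def d_def e_def z_def sets(3-5)
      using fin by (simp add: asc_insert_max)
    have "R (climbed A B t) = R ((u @ map De d) @ pairs k t @ De ?t # map Ep e @ z)"
      unfolding l using pass_De[OF e, of "u @ map De d @ pairs k t" z] by simp
    also have "\<dots> = R (climbed A B ?t)"
      unfolding shift_pairs r by (simp only: pairs_rotate(3) append.assoc append_Cons append_Nil)
    finally show ?thesis .
  next
    case 4
    have sets: "{x \<in> A. t < x} = {x \<in> A. ?t < x}" "{x \<in> B. t < x} = {x \<in> B. ?t < x}"
      "{x \<in> B - A. x \<le> ?t} = {x \<in> B - A. x \<le> t}" "{x \<in> A - B. x \<le> ?t} = {x \<in> A - B. x \<le> t}"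
      "{x \<in> A \<inter> B. x \<le> ?t} = {x \<in> A \<inter> B. x \<le> t}"
      using 4 by (auto simp: gt le)
    show ?thesis
      using \<open>k = 0\<close> unfolding climbed_def sets k_def by simp
  qed
qed

end

definition totally_connected :: "int set \<Rightarrow> int set \<Rightarrow> bool" where
  "totally_connected A B \<longleftrightarrow>
     (\<forall>x\<in>A \<inter> B. \<forall>y\<in>A \<inter> B. \<forall>t. x < t \<and> t < y \<longrightarrow> t \<in> A \<union> B)"

context reflection_closed begin

text \<open>
  Below all symbols the climbed word is the standard word, so the climb can start there.
\<close>

lemma std_word_climbed:
  assumes fin: "finite A" "finite B"
    and con: "\<And>x t. x \<in> A \<inter> B \<Longrightarrow> x < t \<Longrightarrow> t \<le> s \<Longrightarrow> t \<in> A \<union> B"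
  shows "R (std_word A B) = R (climbed A B s)"
proof -
  have "finite (A \<union> B)" using fin by simp
  then obtain l where l: "\<forall>x\<in>A \<union> B. l < x" "l \<le> s"
  proof -
    assume h: "\<And>l. \<forall>x\<in>A \<union> B. l < x \<Longrightarrow> l \<le> s \<Longrightarrow> thesis"
    let ?l = "Min (insert s (A \<union> B)) - 1"
    have "\<forall>x\<in>insert s (A \<union> B). ?l < x"
    proof
      fix x assume "x \<in> insert s (A \<union> B)"
      then have "Min (insert s (A \<union> B)) \<le> x" using fin by (intro Min_le) auto
      then show "?l < x" by simp
    qed
    then show thesis by (intro h[of ?l]) auto
  qed
  have "std_word A B = climbed A B l"
  proof -
    have "{x \<in> A. l < x} = A" "{x \<in> B. l < x} = B" "{x \<in> B - A. x \<le> l} = {}"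
      "{x \<in> A - B. x \<le> l} = {}" "{x \<in> A \<inter> B. x \<le> l} = {}"
      using l(1) by (auto simp: not_le)
    then show ?thesis unfolding std_word_def climbed_def
      by (simp only: card.empty pairs_0 asc_empty desc_empty list.map append_Nil)
  qed
  moreover have "l + int n \<le> s \<Longrightarrow> R (climbed A B l) = R (climbed A B (l + int n))" for n
  proof (induction n)
    case (Suc n)
    have "l + int n + 1 \<in> A \<union> B \<or> {x \<in> A \<inter> B. x \<le> l + int n} = {}"
      using con[of _ "l + int n + 1"] Suc.prems by auto
    from climb_step[OF fin this] Suc show ?case
      by (simp add: algebra_simps)
  qed simp
  from this[of "nat (s - l)"] have "R (climbed A B l) = R (climbed A B s)"
    using l(2) by simp
  ultimately show ?thesis by simp
qed

text \<open>
  The climb goes on up to the rightmost cross. Above it no value is shared.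
\<close>

lemma totally_connected_imp_pairs:
  assumes fin: "finite A" "finite B" and tc: "totally_connected A B" and R: "R (std_word A B)"
  obtains u k s z where "R (u @ pairs k s @ z)"
    and "\<And>a. Ep a \<in> set (u @ z) \<Longrightarrow> De a \<notin> set (u @ z)"
    and "k > 0 \<Longrightarrow> Ep s \<notin> set (u @ z) \<and> De s \<notin> set (u @ z)"
proof (cases "A \<inter> B = {}")
  case True
  with that[of "std_word A B" 0 0 "[]"] R fin show ?thesis
    by (auto simp: std_word_def)
next
  case False
  define s where "s = Max (A \<inter> B)"
  have s: "s \<in> A \<inter> B" "\<And>x. x \<in> A \<inter> B \<Longrightarrow> x \<le> s"
    using False fin by (auto simp: s_def intro: Max_in Max_ge simp del: Int_iff)
  have "R (climbed A B s)"
    using std_word_climbed[OF fin, of s] tc s R unfolding totally_connected_def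
    by (metis IntD1 UnI1 order_le_less)
  moreover define u where "u = map Ep (desc {x \<in> A. s < x}) @ map De (asc {x \<in> B - A. x \<le> s})"
  moreover define z where "z = map Ep (desc {x \<in> A - B. x \<le> s}) @ map De (asc {x \<in> B. s < x})"
  ultimately have "R (u @ pairs (card {x \<in> A \<inter> B. x \<le> s}) s @ z)"
    by (simp add: climbed_def)
  moreover have E: "Ep a \<in> set (u @ z) \<Longrightarrow> a \<in> A \<and> (s < a \<or> a \<notin> B)"
    and D: "De a \<in> set (u @ z) \<Longrightarrow> a \<in> B \<and> (s < a \<or> a \<notin> A)" for a
    using fin by (auto simp: u_def z_def)
  moreover have "Ep a \<in> set (u @ z) \<Longrightarrow> De a \<notin> set (u @ z)" for a
    using E[of a] D[of a] s(2)[of a] by auto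
  ultimately show ?thesis
    using that s by blast
qed

end

text \<open>
  A word with chosen pairs. \<open>CE\<close> and \<open>CD\<close> are the letters outside the pairs, called core letters, and
  \<open>ED\<close>, \<open>DE\<close> are the two kinds of pairs of equal neighbours.
\<close>

datatype block = CE int | CD int | ED int | DE int

fun letters :: "block \<Rightarrow> letter list" where
  "letters (CE t) = [Ep t]"
| "letters (CD t) = [De t]"
| "letters (ED t) = [Ep t, De t]"
| "letters (DE t) = [De t, Ep t]"

definition block_word :: "block list \<Rightarrow> letter list" where
  "block_word bs = concat (map letters bs)"

lemma block_word_simps [simp]:
  "block_word [] = []" "block_word (b # bs) = letters b @ block_word bs" "block_word (bs @ cs) = block_word bs @ block_word cs"
  "block_word (map CE us) = map Ep us" "block_word (map CD us) = map De us"
  "block_word (replicate k (ED s)) = pairs k s"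
proof -
  show "block_word (map CE us) = map Ep us" "block_word (map CD us) = map De us"
    by (induction us) (auto simp: block_word_def)
  show "block_word (replicate k (ED s)) = pairs k s"
    by (induction k) (auto simp: block_word_def pairs_def)
qed (simp_all add: block_word_def)

fun inversions :: "letter list \<Rightarrow> nat" where
  "inversions [] = 0"
| "inversions (Ep t # w) = inversions w"
| "inversions (De t # w) = inversions w + length (filter (\<lambda>x. case x of Ep _ \<Rightarrow> True | De _ \<Rightarrow> False) w)"

text \<open>
  The values at the two places may differ because an odd reflection can change them.
\<close>

lemma inversions_swap:
  "inversions (u @ De a # Ep b # z) = Suc (inversions (u @ Ep c # De d # z))"
proof (induction u)
  case (Cons x u)
  then show ?case by (cases x) auto
qed simp

definition core_disjoint :: "block list \<Rightarrow> bool" where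
  "core_disjoint bs \<longleftrightarrow> (\<forall>t. CE t \<in> set bs \<longrightarrow> CD t \<notin> set bs)"

definition core_block :: "block \<Rightarrow> bool" where
  "core_block b \<longleftrightarrow> (\<exists>t. b = CE t \<or> b = CD t)"

lemma core_blocks_split:
  assumes "\<forall>b\<in>set cs. core_block b" and "\<And>b1 v u b2. cs \<noteq> b1 @ CD v # CE u # b2"
  obtains us vs where "cs = map CE us @ map CD vs"
  using assms
proof (induction cs arbitrary: thesis)
  case (Cons c cs)
  have "cs \<noteq> b1 @ CD v # CE u # b2" for b1 v u b2
    using Cons.prems(3)[of "c # b1"] by auto
  with Cons obtain us vs where cs: "cs = map CE us @ map CD vs"
    by auto
  consider t where "c = CE t" | t where "c = CD t"
    using Cons.prems(2) by (auto simp: core_block_def)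
  then show ?case
  proof cases
    case 1
    with cs Cons.prems(1)[of "t # us" vs] show ?thesis by simp
  next
    case 2
    have "us = []"
      using Cons.prems(3)[of "[]" t "hd us" "map CE (tl us) @ map CD vs"] cs 2
      by (cases us) auto
    with 2 cs Cons.prems(1)[of "[]" "t # vs"] show ?thesis by simp
  qed
qed auto

lemma single_run_of_pairs:
  assumes "\<forall>b\<in>set bs. core_block b \<or> (\<exists>s. b = ED s)"
    and "\<And>b1 s cs t b2. bs = b1 @ ED s # cs @ ED t # b2 \<Longrightarrow> \<forall>b\<in>set cs. core_block b \<Longrightarrow> cs = [] \<and> s = t"
  shows "\<exists>b0 k s b1. bs = b0 @ replicate k (ED s) @ b1 \<and>
    (\<forall>b\<in>set b0. core_block b) \<and> (\<forall>b\<in>set b1. core_block b)"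
  using assms
proof (induction bs)
  case (Cons x bs)
  have "\<exists>b0 k s b1. bs = b0 @ replicate k (ED s) @ b1 \<and>
    (\<forall>b\<in>set b0. core_block b) \<and> (\<forall>b\<in>set b1. core_block b)"
  proof (rule Cons.IH)
    show "\<forall>b\<in>set bs. core_block b \<or> (\<exists>s. b = ED s)"
      using Cons.prems(1) by simp
    show "cs = [] \<and> s = t"
      if "bs = b1 @ ED s # cs @ ED t # b2" "\<forall>b\<in>set cs. core_block b" for b1 s cs t b2
      using Cons.prems(2)[of "x # b1" s cs t b2] that by simp
  qed
  then obtain b0 k s b1 where bs: "bs = b0 @ replicate k (ED s) @ b1"
    and core: "\<forall>b\<in>set b0. core_block b" "\<forall>b\<in>set b1. core_block b"
    by blast
  consider "core_block x" | t where "x = ED t"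
    using Cons.prems(1) by auto
  then show ?case
  proof cases
    case 1
    with core show ?thesis
      by (intro exI[of _ "x # b0"] exI[of _ k] exI[of _ s] exI[of _ b1]) (simp add: bs)
  next
    case 2
    show ?thesis
    proof (cases k)
      case 0
      with core 2 show ?thesis
        by (intro exI[of _ "[]"] exI[of _ 1] exI[of _ t] exI[of _ "b0 @ b1"]) (auto simp: bs)
    next
      case (Suc l)
      then have "b0 = [] \<and> t = s"
        using core(1) 2 by (intro Cons.prems(2)[of "[]" t b0 s "replicate l (ED s) @ b1"]) (simp_all add: bs)
      with core 2 show ?thesis
        by (intro exI[of _ "[]"] exI[of _ "Suc k"] exI[of _ s] exI[of _ b1]) (simp add: bs)
    qed
  qed
qed (auto intro: exI[of _ "[]"])

lemma sorted_wrt_adjacent: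
  assumes "transp r" and "\<And>u a b z. es = u @ a # b # z \<Longrightarrow> r a b"
  shows "sorted_wrt r es"
  using assms(2)
proof (induction es)
  case (Cons e es)
  have "sorted_wrt r es"
  proof (rule Cons.IH)
    fix u a b z assume "es = u @ a # b # z"
    then show "r a b" using Cons.prems[of "e # u"] by simp
  qed
  then show ?case
    using Cons.prems[of "[]" e "hd es" "tl es"] assms(1) by (cases es) (auto dest: transpD)
qed simp

text \<open>
  The crosses are the \<open>k\<close> greatest spots up to \<open>s\<close> outside \<open>F\<close>.
\<close>

lemma fill_crosses:
  fixes F :: "int set"
  assumes "finite F"
  obtains C where "finite C" "card C = k" "C \<inter> F = {}" "\<And>x. x \<in> C \<Longrightarrow> x \<le> s"
    "\<And>x t. x \<in> C \<Longrightarrow> x < t \<Longrightarrow> t \<le> s \<Longrightarrow> t \<in> C \<union> F"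
proof (induction k arbitrary: thesis)
  case 0
  from 0[of "{}"] show ?case by simp
next
  case (Suc k)
  from Suc.IH obtain C where C: "finite C" "card C = k" "C \<inter> F = {}" "\<And>x. x \<in> C \<Longrightarrow> x \<le> s"
    "\<And>x t. x \<in> C \<Longrightarrow> x < t \<Longrightarrow> t \<le> s \<Longrightarrow> t \<in> C \<union> F"
    by blast
  have "\<exists>n. s - int n \<notin> C \<union> F"
  proof (rule ccontr)
    assume "\<not> ?thesis"
    then have "range (\<lambda>n. s - int n) \<subseteq> C \<union> F" by auto
    then have "finite (range (\<lambda>n. s - int n))"
      using C(1) assms finite_subset by blast
    moreover have "inj (\<lambda>n. s - int n)" by (auto intro: injI)
    ultimately show False using finite_imageD infinite_UNIV_nat by blast
  qed
  define n where "n = (LEAST n. s - int n \<notin> C \<union> F)"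
  have n: "s - int n \<notin> C \<union> F" "\<And>i. i < n \<Longrightarrow> s - int i \<in> C \<union> F"
    using LeastI_ex[OF \<open>\<exists>n. s - int n \<notin> C \<union> F\<close>] not_less_Least by (auto simp: n_def)
  have above: "t \<in> C \<union> F" if "s - int n < t" "t \<le> s" for t
    using n(2)[of "nat (s - t)"] that by simp
  show ?case
  proof (rule Suc.prems[of "insert (s - int n) C"])
    show "t \<in> insert (s - int n) C \<union> F" if "x \<in> insert (s - int n) C" "x < t" "t \<le> s" for x t
      using that C(5)[of x t] above[of t] by auto
  qed (use C n(1) in auto)
qed

text \<open>
  Dominance at the even simple roots, for every order.
\<close>

locale dominant_words = reflection_closed +
  assumes dominant_Ep: "R (u @ Ep a # Ep b # z) \<Longrightarrow> b < a"
    and dominant_De: "R (u @ De a # De b # z) \<Longrightarrow> a < b"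
begin

lemma sorted_Ep_run: "R (u @ map Ep es @ z) \<Longrightarrow> sorted_wrt (>) es"
proof (rule sorted_wrt_adjacent)
  fix u' a b z' assume "R (u @ map Ep es @ z)" "es = u' @ a # b # z'"
  then show "a > b" using dominant_Ep[of "u @ map Ep u'" a b "map Ep z' @ z"] by simp
qed (auto intro: transpI)

lemma sorted_De_run: "R (u @ map De ds @ z) \<Longrightarrow> sorted_wrt (<) ds"
proof (rule sorted_wrt_adjacent)
  fix u' a b z' assume "R (u @ map De ds @ z)" "ds = u' @ a # b # z'"
  then show "a < b" using dominant_De[of "u @ map De u'" a b "map De z' @ z"] by simp
qed (auto intro: transpI)

text \<open>
  All exchanges that reduce the number of inversions are excluded in a minimal representation. If a pair
  has the same value as a core letter \<open>Ep\<close> to its right or a core letter \<open>De\<close> to its left, they can change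
  places, and the pair loses one unit. So in the minimal representation the values differ, and dominance
  decides in which direction. The
  exchanges do not alter the core letters, so disjointness is kept.
\<close>

lemma minimal_blocks:
  assumes "R (block_word bs)" "core_disjoint bs"
  obtains bs' where "R (block_word bs')" "core_disjoint bs'"
    "\<And>b1 s b2. bs' \<noteq> b1 @ DE s # b2"
    "\<And>b1 v u b2. bs' \<noteq> b1 @ CD v # CE u # b2"
    "\<And>b1 s u b2. bs' = b1 @ ED s # CE u # b2 \<Longrightarrow> u < s"
    "\<And>b1 s v b2. bs' = b1 @ CD v # ED s # b2 \<Longrightarrow> v < s"
proof -
  define P where "P bs \<longleftrightarrow> R (block_word bs) \<and> core_disjoint bs" for bs
  have "P bs" using assms by (simp add: P_def)
  \<comment> \<open>Minimality concerns all representations of all words that satisfy the hypothesis.\<close>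
  define bs' where "bs' = arg_min (inversions \<circ> block_word) P"
  have "P bs'" and least: "\<And>cs. P cs \<Longrightarrow> inversions (block_word bs') \<le> inversions (block_word cs)"
    using arg_min_nat_lemma[of P bs "inversions \<circ> block_word", OF \<open>P bs\<close>] by (auto simp: bs'_def)
  then have R: "R (block_word bs')" and cd: "core_disjoint bs'" by (auto simp: P_def)
  have 1: "bs' \<noteq> b1 @ DE s # b2" for b1 s b2
  proof
    assume bs': "bs' = b1 @ DE s # b2"
    have "P (b1 @ ED (s - 1) # b2)"
      using R cd atypical[of "block_word b1" "s - 1" "block_word b2"] by (auto simp: P_def bs' core_disjoint_def)
    from least[OF this] show False
      by (simp add: bs' inversions_swap[of _ s s _ "s - 1" "s - 1"])
  qed
  have 2: "bs' \<noteq> b1 @ CD v # CE u # b2" for b1 v u b2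
  proof
    assume bs': "bs' = b1 @ CD v # CE u # b2"
    then have "u \<noteq> v" using cd by (auto simp: core_disjoint_def)
    then have "P (b1 @ CE u # CD v # b2)"
      using R cd typical[of u v "block_word b1" "block_word b2"] by (auto simp: P_def bs' core_disjoint_def)
    from least[OF this] show False
      by (simp add: bs' inversions_swap[of _ v u _ u v])
  qed
  have 3: "u < s" if bs': "bs' = b1 @ ED s # CE u # b2" for b1 s u b2
  proof -
    have "u \<noteq> s"
    proof
      assume "u = s"
      then have "P (b1 @ CE s # ED (s - 1) # b2)"
        using R cd atypical[of "block_word b1 @ [Ep s]" "s - 1" "block_word b2"]
        by (auto simp: P_def bs' core_disjoint_def)
      from least[OF this] show False
        using inversions_swap[of "block_word b1 @ [Ep s]" s s "block_word b2" "s - 1" "s - 1"]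
        by (simp add: bs' \<open>u = s\<close>)
    qed
    then have "R (block_word b1 @ Ep s # Ep u # De s # block_word b2)"
      using R typical[of u s "block_word b1 @ [Ep s]" "block_word b2"] by (simp add: bs')
    then show "u < s" by (rule dominant_Ep)
  qed
  have 4: "v < s" if bs': "bs' = b1 @ CD v # ED s # b2" for b1 s v b2
  proof -
    have "v \<noteq> s"
    proof
      assume "v = s"
      then have "P (b1 @ ED (s - 1) # CD s # b2)"
        using R cd atypical[of "block_word b1" "s - 1" "De s # block_word b2"]
        by (auto simp: P_def bs' core_disjoint_def)
      from least[OF this] show False
        using inversions_swap[of "block_word b1" s s "De s # block_word b2" "s - 1" "s - 1"]
        by (simp add: bs' \<open>v = s\<close>)
    qed
    then have "R ((block_word b1 @ [Ep s]) @ De v # De s # block_word b2)"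
      using R typical[of s v "block_word b1" "De s # block_word b2"] by (simp add: bs')
    then show "v < s" by (rule dominant_De)
  qed
  show thesis
    by (rule that[OF R cd]) (use 1 2 3 4 in blast)+
qed

text \<open>
  Between two neighbouring pairs only core letters \<open>Ep\<close> and then core letters \<open>De\<close> can stand. Moving the
  \<open>De\<close> of the first pair to the right and the \<open>Ep\<close> of the second pair to the left brings letters of one
  type together, and the two comparisons that dominance yields contradict each other.
\<close>

lemma neighbouring_pairs:
  assumes R: "R (u @ [Ep s, De s] @ map Ep us @ map De vs @ [Ep t, De t] @ z)"
    and us: "us \<noteq> [] \<Longrightarrow> hd us < s" and vs: "vs \<noteq> [] \<Longrightarrow> last vs < t"
  shows "us = [] \<and> vs = [] \<and> s = t"
proof -
  have sus: "sorted_wrt (>) us" and svs: "sorted_wrt (<) vs"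
    using sorted_Ep_run[of "u @ [Ep s, De s]" us "map De vs @ [Ep t, De t] @ z"]
      sorted_De_run[of "u @ [Ep s, De s] @ map Ep us" vs "[Ep t, De t] @ z"] R by simp_all
  have us_less: "\<forall>x\<in>set us. x < s"
    using us sus by (cases us) auto
  have vs_less: "\<forall>x\<in>set vs. x < t"
    using vs svs by (cases vs rule: rev_cases) (auto simp: sorted_wrt_append)
  have right: "R (u @ Ep s # map Ep us @ De s # map De vs @ [Ep t, De t] @ z)"
    using R pass_De[of s us "u @ [Ep s]" "map De vs @ [Ep t, De t] @ z"] us_less by auto
  have left: "R (u @ [Ep s, De s] @ map Ep us @ Ep t # map De vs @ De t # z)"
    using R pass_Ep[of t vs "u @ [Ep s, De s] @ map Ep us" "De t # z"] vs_less by auto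
  have st: "s < t" if "vs \<noteq> []"
  proof -
    have "s < hd vs"
      using that right dominant_De[of "u @ Ep s # map Ep us" s "hd vs" "map De (tl vs) @ [Ep t, De t] @ z"]
      by (cases vs) auto
    then show ?thesis using vs_less that by (cases vs) auto
  qed
  have ts: "t < s" if "us \<noteq> []"
  proof -
    have "t < last us"
      using that left dominant_Ep[of "u @ [Ep s, De s] @ map Ep (butlast us)" "last us" t "map De vs @ De t # z"]
      by (cases us rule: rev_cases) auto
    then show ?thesis using us_less that by (cases us rule: rev_cases) auto
  qed
  have no_vs: "vs = []"
  proof (rule ccontr)
    assume "vs \<noteq> []"
    with st ts have us: "us = []" and "s < t" by auto
    then have "R (u @ Ep s # Ep t # De s # map De vs @ De t # z)"
      using left typical[of t s "u @ [Ep s]" "map De vs @ De t # z"] by simp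
    from dominant_Ep[OF this] \<open>s < t\<close> show False by simp
  qed
  have no_us: "us = []"
  proof (rule ccontr)
    assume "us \<noteq> []"
    then have "t < s" by (rule ts)
    then have "R ((u @ Ep s # map Ep us @ [Ep t]) @ De s # De t # z)"
      using right no_vs typical[of t s "u @ Ep s # map Ep us" "De t # z"] by simp
    from dominant_De[OF this] \<open>t < s\<close> show False by simp
  qed
  have "s = t"
  proof (rule ccontr)
    assume "s \<noteq> t"
    then have r: "R (u @ Ep s # Ep t # De s # De t # z)"
      using R no_us no_vs typical[of t s "u @ [Ep s]" "De t # z"] by simp
    from dominant_Ep[OF this] dominant_De[of "u @ [Ep s, Ep t]" s t z] r show False by simp
  qed
  with no_us no_vs show ?thesis by simp
qed

text \<open>
  A minimal representation is one run of pairs of a common value \<open>s\<close> with all core letters outside,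
  separated by \<open>s\<close> as in a climbed word. Putting as many crosses as there are pairs on the greatest free
  spots up to \<open>s\<close> gives a diagram whose climb ends in this word.
\<close>

theorem blocks_imp_totally_connected:
  assumes "R (block_word bs)" "core_disjoint bs"
  obtains A B where "finite A" "finite B" "totally_connected A B" "R (std_word A B)"
proof -
  from minimal_blocks[OF assms] obtain bs where R: "R (block_word bs)" and cd: "core_disjoint bs"
    and noDE: "\<And>b1 s b2. bs \<noteq> b1 @ DE s # b2"
    and noCDCE: "\<And>b1 v u b2. bs \<noteq> b1 @ CD v # CE u # b2"
    and EDCE: "\<And>b1 s u b2. bs = b1 @ ED s # CE u # b2 \<Longrightarrow> u < s"
    and CDED: "\<And>b1 s v b2. bs = b1 @ CD v # ED s # b2 \<Longrightarrow> v < s"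
    by blast
  have split: thesis' if "bs = x @ cs @ y" "\<forall>b\<in>set cs. core_block b"
    "\<And>us vs. cs = map CE us @ map CD vs \<Longrightarrow> thesis'" for x cs y thesis'
  proof (rule core_blocks_split[OF that(2)])
    fix b1 v u b2 show "cs \<noteq> b1 @ CD v # CE u # b2"
      using noCDCE[of "x @ b1" v u "b2 @ y"] that(1) by auto
  qed (use that(3) in auto)
  have "\<forall>b\<in>set bs. core_block b \<or> (\<exists>s. b = ED s)"
  proof
    fix b assume "b \<in> set bs"
    then obtain x y where "bs = x @ b # y"
      by (meson split_list)
    then show "core_block b \<or> (\<exists>s. b = ED s)"
      using noDE[of x _ y] by (cases b) (auto simp: core_block_def)
  qed
  moreover have "cs = [] \<and> s = t"
    if bs: "bs = b1 @ ED s # cs @ ED t # b2" and core: "\<forall>b\<in>set cs. core_block b" for b1 s cs t b2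
  proof -
    obtain us vs where cs: "cs = map CE us @ map CD vs"
      using split[of "b1 @ [ED s]" cs "ED t # b2"] bs core by auto
    have "us = [] \<and> vs = [] \<and> s = t"
    proof (rule neighbouring_pairs)
      show "R (block_word b1 @ [Ep s, De s] @ map Ep us @ map De vs @ [Ep t, De t] @ block_word b2)"
        using R by (simp add: bs cs)
      show "us \<noteq> [] \<Longrightarrow> hd us < s"
        using EDCE[of b1 s "hd us" "map CE (tl us) @ map CD vs @ ED t # b2"] bs cs
        by (cases us) auto
      show "vs \<noteq> [] \<Longrightarrow> last vs < t"
        using CDED[of "b1 @ ED s # map CE us @ map CD (butlast vs)" "last vs" t b2] bs cs
        by (cases vs rule: rev_cases) auto
    qed
    with cs show ?thesis by simp
  qed
  ultimately obtain b0 k s b1 where bs: "bs = b0 @ replicate k (ED s) @ b1"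
    and core: "\<forall>b\<in>set b0. core_block b" "\<forall>b\<in>set b1. core_block b"
    using single_run_of_pairs[of bs] by blast
  show thesis
  proof (cases k)
    case 0
    then have "\<forall>b\<in>set bs. core_block b"
      using core by (auto simp: bs)
    then obtain us vs where "bs = map CE us @ map CD vs"
      using split[of "[]" bs "[]"] by auto
    with R cd have r: "R (map Ep us @ map De vs)" and disj: "set us \<inter> set vs = {}"
      by (auto simp: core_disjoint_def)
    have "sorted_wrt (>) us" "sorted_wrt (<) vs"
      using r sorted_Ep_run[of "[]" us] sorted_De_run[of "map Ep us" vs "[]"] by auto
    then have "R (std_word (set us) (set vs))"
      using r by (simp add: std_word_def asc_eqI desc_eqI)
    then show thesis
      using that[of "set us" "set vs"] disj by (auto simp: totally_connected_def)
  next
    case (Suc l)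
    obtain e1 d0 where b0: "b0 = map CE e1 @ map CD d0"
      using split[of "[]" b0 "replicate k (ED s) @ b1"] bs core by auto
    obtain e0 d1 where b1: "b1 = map CE e0 @ map CD d1"
      using split[of "b0 @ replicate k (ED s)" b1 "[]"] bs core by auto
    have r: "R (map Ep e1 @ map De d0 @ pairs k s @ map Ep e0 @ map De d1)"
      using R by (simp add: bs b0 b1)
    have pairs_snoc: "pairs k s = pairs l s @ [Ep s, De s]"
      using pairs_rotate(2)[of s l "[De s]"] pairs_rotate(1)[of s l "[]"] Suc by simp
    have sorted: "sorted_wrt (>) e1" "sorted_wrt (<) d0" "sorted_wrt (>) e0" "sorted_wrt (<) d1"
      using r sorted_Ep_run[of "[]" e1] sorted_De_run[of "map Ep e1" d0]
        sorted_Ep_run[of "map Ep e1 @ map De d0 @ pairs k s" e0]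
        sorted_De_run[of "map Ep e1 @ map De d0 @ pairs k s @ map Ep e0" d1 "[]"] by auto
    have d0: "\<forall>x\<in>set d0. x < s"
    proof (cases d0 rule: rev_cases)
      case (snoc ds d)
      then have "d < s"
        using CDED[of "map CE e1 @ map CD ds" d s "replicate l (ED s) @ b1"] bs b0 Suc by simp
      then show ?thesis using sorted(2) snoc by (auto simp: sorted_wrt_append)
    qed simp
    have e0: "\<forall>x\<in>set e0. x < s"
    proof (cases e0)
      case (Cons e es)
      have "bs = (b0 @ replicate l (ED s)) @ ED s # CE e # map CE es @ map CD d1"
        using bs b1 Suc Cons by (simp add: replicate_append_same[symmetric])
      then have "e < s" by (rule EDCE)
      then show ?thesis using sorted(3) Cons by auto
    qed simp
    have e1: "\<forall>x\<in>set e1. s < x"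
    proof (cases e1 rule: rev_cases)
      case (snoc es e)
      have "R (map Ep es @ Ep e # Ep s # map De d0 @ De s # pairs l s @ map Ep e0 @ map De d1)"
        using r d0 pass_Ep[of s d0 "map Ep e1" "De s # pairs l s @ map Ep e0 @ map De d1"] snoc Suc
        by (auto simp: pairs_Suc)
      from dominant_Ep[OF this] show ?thesis
        using sorted(1) snoc by (auto simp: sorted_wrt_append)
    qed simp
    have d1: "\<forall>x\<in>set d1. s < x"
    proof (cases d1)
      case (Cons d ds)
      have "R ((map Ep e1 @ map De d0 @ pairs l s @ Ep s # map Ep e0) @ De s # De d # map De ds)"
        using r e0 pass_De[of s e0 "map Ep e1 @ map De d0 @ pairs l s @ [Ep s]" "map De d1"] Cons
        by (auto simp: pairs_snoc)
      from dominant_De[OF this] show ?thesis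
        using sorted(4) Cons by auto
    qed simp
    have disj: "(set e0 \<union> set e1) \<inter> (set d0 \<union> set d1) = {}"
      using cd by (auto simp: core_disjoint_def bs b0 b1)
    \<comment> \<open>The diagram is recovered: its core is given by the core letters, and \<open>C\<close> is the set of its crosses.\<close>
    define F where "F = set e0 \<union> set e1 \<union> set d0 \<union> set d1"
    have "finite F" by (simp add: F_def)
    from fill_crosses[OF this, of k s] obtain C where C: "finite C" "card C = k" "C \<inter> F = {}"
      "\<And>x. x \<in> C \<Longrightarrow> x \<le> s" "\<And>x t. x \<in> C \<Longrightarrow> x < t \<Longrightarrow> t \<le> s \<Longrightarrow> t \<in> C \<union> F"
      by metis
    define A where "A = set e0 \<union> set e1 \<union> C"
    define B where "B = set d0 \<union> set d1 \<union> C"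
    have AB: "A \<inter> B = C" "A \<union> B = C \<union> F"
      using disj C(3) by (auto simp: A_def B_def F_def)
    have fin: "finite A" "finite B" using C(1) by (auto simp: A_def B_def)
    have "{x \<in> A. s < x} = set e1" "{x \<in> B. s < x} = set d1"
      using e0 e1 d0 d1 C(4) by (fastforce simp: A_def B_def)+
    moreover have "{x \<in> B - A. x \<le> s} = set d0" "{x \<in> A - B. x \<le> s} = set e0"
      using e0 e1 d0 d1 C(3,4) disj by (fastforce simp: A_def B_def F_def)+
    moreover have "{x \<in> A \<inter> B. x \<le> s} = C"
      unfolding AB using C(4) by auto
    ultimately have "climbed A B s = map Ep e1 @ map De d0 @ pairs k s @ map Ep e0 @ map De d1"
      unfolding climbed_def using sorted C(2) by (simp add: asc_eqI desc_eqI)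
    moreover have "R (std_word A B) = R (climbed A B s)"
      using C(5) AB by (intro std_word_climbed fin) auto
    moreover have "totally_connected A B"
      unfolding totally_connected_def AB using C(4,5) by (meson less_imp_le order.trans order.strict_trans2)
    ultimately show thesis using that fin r by auto
  qed
qed

end

section \<open>Right moves and right paths\<close>

definition finite_diagram :: "diagram \<Rightarrow> bool" where
  "finite_diagram D \<longleftrightarrow> finite {t. D t \<noteq> Empty}"

definition empty_count :: "diagram \<Rightarrow> int \<Rightarrow> int \<Rightarrow> nat" where
  "empty_count D x u = card {t. x < t \<and> t \<le> u \<and> D t = Empty}"

text \<open>
  The left end counts here but not in \<open>empty_count\<close>: the spot marked by a cross at \<open>x\<close> is then the first
  \<open>u\<close> at which both counts agree.
\<close>

definition cross_count :: "diagram \<Rightarrow> int \<Rightarrow> int \<Rightarrow> nat" where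
  "cross_count D x u = card {t. x \<le> t \<and> t \<le> u \<and> D t = Times}"

lemma finite_between [simp]:
  "finite {t :: int. x < t \<and> t \<le> u \<and> Q t}" "finite {t :: int. x \<le> t \<and> t \<le> u \<and> Q t}"
  "finite {t :: int. x < t \<and> t < u \<and> Q t}" "finite {t :: int. x \<le> t \<and> t < u \<and> Q t}"
  by (rule finite_subset[of _ "{x..u}"]; auto)+

lemma Least_int:
  fixes x :: int
  assumes "P a" and "\<And>t. P t \<Longrightarrow> x < t"
  shows "P (LEAST t. P t)" and "P t \<Longrightarrow> (LEAST t. P t) \<le> t"
proof -
  have ex: "\<exists>n. P (x + int n)"
    using assms by (intro exI[of _ "nat (a - x)"]) force
  define n where "n = (LEAST n. P (x + int n))"
  have P: "P (x + int n)" using LeastI_ex[OF ex] by (simp add: n_def)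
  have le: "x + int n \<le> t" if "P t" for t
  proof -
    have "P (x + int (nat (t - x)))" using that assms(2)[of t] by simp
    then have "n \<le> nat (t - x)" unfolding n_def by (rule Least_le)
    then show ?thesis using assms(2)[OF that] by linarith
  qed
  have "(LEAST t. P t) = x + int n"
    by (rule Least_equality) (use P le in auto)
  then show "P (LEAST t. P t)" "P t \<Longrightarrow> (LEAST t. P t) \<le> t" using P le by auto
qed

lemma map_of_marks:
  assumes "distinct (ys @ x # zs)"
  shows "the (map_of (marks D (ys @ x # zs) M) x) =
    (LEAST t. x < t \<and> D t = Empty \<and> t \<notin> M \<union> (\<lambda>y. the (map_of (marks D (ys @ x # zs) M) y)) ` set ys)"
  using assms
proof (induction ys arbitrary: M)
  case (Cons y ys)
  define t where "t = (LEAST t. y < t \<and> D t = Empty \<and> t \<notin> M)"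
  define g where "g a = the (map_of (marks D ((y # ys) @ x # zs) M) a)" for a
  define h where "h a = the (map_of (marks D (ys @ x # zs) (insert t M)) a)" for a
  have gh: "g a = h a" if "a \<noteq> y" for a
    using that by (simp add: g_def h_def Let_def t_def)
  have gy: "g y = t"
    by (simp add: g_def Let_def t_def)
  have "g ` set ys = h ` set ys"
  proof (rule image_cong)
    fix a assume "a \<in> set ys"
    then have "a \<noteq> y" using Cons.prems by auto
    then show "g a = h a" by (rule gh)
  qed simp
  then have "M \<union> g ` set (y # ys) = insert t M \<union> h ` set ys"
    by (simp add: gy)
  moreover have "h x = (LEAST s. x < s \<and> D s = Empty \<and> s \<notin> insert t M \<union> h ` set ys)"
    unfolding h_def using Cons.prems by (intro Cons.IH) simp
  moreover have "g x = h x" using Cons.prems by (intro gh) auto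
  ultimately show ?case
    unfolding g_def[symmetric] by simp
qed (simp add: Let_def)

locale fin_diagram =
  fixes D :: diagram
  assumes fin: "finite_diagram D"
begin

lemma finite_times: "finite {t. D t = Times}"
  using fin unfolding finite_diagram_def by (rule rev_finite_subset) auto

lemma set_crosses: "set (crosses D) = {t. D t = Times}"
  by (simp add: crosses_def finite_times)

lemma sorted_crosses: "sorted_wrt (<) (crosses D)"
  by (simp add: crosses_def)

lemma marked_spot_eq:
  assumes "D x = Times"
  shows "marked_spot D x =
    (LEAST t. x < t \<and> D t = Empty \<and> t \<notin> marked_spot D ` {y. D y = Times \<and> x < y})"
proof -
  have "x \<in> set (crosses D)" using assms by (simp add: set_crosses)
  then obtain zs ys where c: "crosses D = zs @ x # ys" by (meson split_list)
  have "sorted_wrt (<) (zs @ x # ys)" using sorted_crosses c by simp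
  then have "set ys = {y \<in> set (crosses D). x < y}" unfolding c by (auto simp: sorted_wrt_append)
  then have "set (rev ys) = {y. D y = Times \<and> x < y}" by (auto simp: set_crosses)
  moreover have "distinct (rev ys @ x # rev zs)"
    using c distinct_sorted_list_of_set[of "{t. D t = Times}"] by (auto simp: crosses_def)
  ultimately show ?thesis
    using map_of_marks[of "rev ys" x "rev zs" D "{}"] unfolding marked_spot_def c
    by (simp add: image_def)
qed

lemma marked_spot:
  assumes "D x = Times"
  shows "x < marked_spot D x" "D (marked_spot D x) = Empty"
    and marked_spot_neq: "\<And>y. D y = Times \<Longrightarrow> x < y \<Longrightarrow> marked_spot D x \<noteq> marked_spot D y"
    and marked_spot_le: "\<And>t. x < t \<Longrightarrow> D t = Empty \<Longrightarrow> t \<notin> marked_spot D ` {y. D y = Times \<and> x < y} \<Longrightarrow>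
      marked_spot D x \<le> t"
proof -
  let ?P = "\<lambda>t. x < t \<and> D t = Empty \<and> t \<notin> marked_spot D ` {y. D y = Times \<and> x < y}"
  have "finite ({t. D t \<noteq> Empty} \<union> marked_spot D ` {y. D y = Times \<and> x < y})" (is "finite ?F")
    using fin finite_times by (auto simp: finite_diagram_def)
  then have "infinite ({x<..} - ?F)"
    using infinite_Ioi[of x] by (simp add: Diff_infinite_finite)
  then have "{x<..} - ?F \<noteq> {}" by (rule infinite_imp_nonempty)
  then obtain a where "a \<in> {x<..} - ?F" by blast
  then have "?P a" by blast
  have above: "x < t" if "?P t" for t
    using that by blast
  note eq = marked_spot_eq[OF assms]
  have P: "?P (marked_spot D x)"
    by (rule ssubst[where P = ?P, OF eq]) (rule Least_int(1)[of ?P a x, OF \<open>?P a\<close> above])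
  then show "x < marked_spot D x" "D (marked_spot D x) = Empty" by (blast, blast)
  show "marked_spot D x \<noteq> marked_spot D y" if "D y = Times" "x < y" for y
    using P that by blast
  have least: "marked_spot D x \<le> t" if "?P t" for t
    by (rule ssubst[where P = "\<lambda>a. a \<le> t", OF eq]) (rule Least_int(2)[of ?P a x, OF \<open>?P a\<close> above that])
  show "marked_spot D x \<le> t" if "x < t" "D t = Empty" "t \<notin> marked_spot D ` {y. D y = Times \<and> x < y}" for t
    by (rule least) (intro conjI that)
qed

text \<open>
  The marks form a system of nested arcs: when \<open>y\<close> is processed the spot that \<open>x\<close> will mark is still free.
\<close>

lemma marked_spot_nested:
  assumes "D x = Times" "D y = Times" "x < y" "y < marked_spot D x"
  shows "marked_spot D y < marked_spot D x"
proof -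
  have "marked_spot D y \<le> marked_spot D x"
  proof (rule marked_spot_le[OF assms(2)])
    show "marked_spot D x \<notin> marked_spot D ` {z. D z = Times \<and> y < z}"
      using marked_spot_neq[OF assms(1)] assms(3) by force
  qed (use assms marked_spot in auto)
  then show ?thesis using marked_spot_neq[OF assms(1,2,3)] by simp
qed

text \<open>
  By nesting, the crosses in an arc mark exactly the empty spots in it. This turns the recursive marking
  into a local condition on the diagram.
\<close>

lemma marked_spot_balance:
  assumes "D x = Times"
  shows "\<And>u. x \<le> u \<Longrightarrow> u < marked_spot D x \<Longrightarrow> empty_count D x u < cross_count D x u"
    and "cross_count D x (marked_spot D x) \<le> empty_count D x (marked_spot D x)"
proof -
  fix u assume u: "x \<le> u" "u < marked_spot D x"
  let ?T = "{t. x < t \<and> t \<le> u \<and> D t = Times}"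
  have "{t. x < t \<and> t \<le> u \<and> D t = Empty} \<subseteq> marked_spot D ` ?T"
  proof
    fix t assume t: "t \<in> {t. x < t \<and> t \<le> u \<and> D t = Empty}"
    then have "t \<in> marked_spot D ` {y. D y = Times \<and> x < y}"
      using marked_spot_le[OF assms, of t] u by force
    then obtain y where y: "t = marked_spot D y" "D y = Times" "x < y" by auto
    then have "y < t" using marked_spot(1)[of y] by simp
    then show "t \<in> marked_spot D ` ?T" using y t by auto
  qed
  then have "empty_count D x u \<le> card ?T"
    unfolding empty_count_def by (rule surj_card_le[rotated]) simp
  also have "\<dots> < cross_count D x u"
  proof -
    have "{t. x \<le> t \<and> t \<le> u \<and> D t = Times} = insert x ?T" using assms u by auto
    then show ?thesis by (simp add: cross_count_def)
  qed
  finally show "empty_count D x u < cross_count D x u" .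
next
  let ?t = "marked_spot D x"
  let ?T = "{t. x \<le> t \<and> t \<le> ?t \<and> D t = Times}"
  have "inj_on (marked_spot D) ?T"
    by (rule linorder_inj_onI) (use marked_spot_neq in auto)
  moreover have "marked_spot D ` ?T \<subseteq> {t. x < t \<and> t \<le> ?t \<and> D t = Empty}"
  proof
    fix s assume "s \<in> marked_spot D ` ?T"
    then obtain y where y: "s = marked_spot D y" "x \<le> y" "y \<le> ?t" "D y = Times" by auto
    moreover have "y \<noteq> ?t" using y marked_spot(2)[OF assms] by auto
    ultimately show "s \<in> {t. x < t \<and> t \<le> ?t \<and> D t = Empty}"
      using marked_spot[OF y(4)] marked_spot_nested[OF assms y(4)] by (cases "x = y") auto
  qed
  ultimately show "cross_count D x ?t \<le> empty_count D x ?t"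
    unfolding cross_count_def empty_count_def by (intro card_inj_on_le) auto
qed

lemma marked_spotI:
  assumes "D x = Times" "x < t" "cross_count D x t \<le> empty_count D x t"
    and "\<And>u. x \<le> u \<Longrightarrow> u < t \<Longrightarrow> empty_count D x u < cross_count D x u"
  shows "marked_spot D x = t"
proof (rule ccontr)
  assume "marked_spot D x \<noteq> t"
  then consider "marked_spot D x < t" | "t < marked_spot D x" by linarith
  then show False
  proof cases
    case 1
    with assms(4)[of "marked_spot D x"] marked_spot(1)[OF assms(1)] marked_spot_balance(2)[OF assms(1)]
    show ?thesis by simp
  next
    case 2
    with marked_spot_balance(1)[OF assms(1), of t] assms(2,3) show ?thesis by simp
  qed
qed

end

definition labelled :: "nat \<Rightarrow> labeled_diagram \<Rightarrow> bool" where
  "labelled r E \<longleftrightarrow> finite_diagram (fst E) \<and> inj_on (snd E) {1..r} \<and>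
     {t. fst E t = Times} = snd E ` {1..r}"

lemma labelled_Times: "labelled r E \<Longrightarrow> i \<in> {1..r} \<Longrightarrow> fst E (snd E i) = Times"
  unfolding labelled_def by blast

lemma labelled_fin: "labelled r E \<Longrightarrow> fin_diagram (fst E)"
  by (simp add: labelled_def fin_diagram_def)

lemma right_move_simps:
  "fst (right_move i E) = (fst E)(snd E i := Empty, marked_spot (fst E) (snd E i) := Times)"
  "snd (right_move i E) = (snd E)(i := marked_spot (fst E) (snd E i))"
  by (simp_all add: right_move_def Let_def)

lemma labelled_right_move:
  assumes "labelled r E" "i \<in> {1..r}"
  shows "labelled r (right_move i E)"
proof -
  interpret fin_diagram "fst E" using assms(1) by (rule labelled_fin)
  have D: "fst E (snd E i) = Times" using assms by (rule labelled_Times)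
  define t where "t = marked_spot (fst E) (snd E i)"
  have t: "fst E t = Empty" "snd E i < t" using marked_spot[OF D] by (auto simp: t_def)
  have T: "{t. fst E t = Times} = snd E ` {1..r}" and inj: "inj_on (snd E) {1..r}"
    using assms by (auto simp: labelled_def)
  have new: "t \<notin> snd E ` {1..r}"
  proof
    assume "t \<in> snd E ` {1..r}"
    then have "t \<in> {t. fst E t = Times}" by (simp only: T)
    with t(1) show False by simp
  qed
  have "{s. fst (right_move i E) s \<noteq> Empty} \<subseteq> insert t {s. fst E s \<noteq> Empty}"
    by (auto simp: right_move_simps t_def)
  then have "finite_diagram (fst (right_move i E))"
    using fin unfolding finite_diagram_def by (rule finite_subset[OF _ finite.insertI])
  moreover have "inj_on (snd (right_move i E)) {1..r}"
    unfolding right_move_simps t_def[symmetric] using inj new by (intro inj_on_fun_updI) auto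
  moreover have "{s. fst (right_move i E) s = Times} = snd (right_move i E) ` {1..r}"
  proof -
    have "{s. fst (right_move i E) s = Times} = insert t ({s. fst E s = Times} - {snd E i})"
      unfolding right_move_simps t_def[symmetric] using t by auto
    also have "\<dots> = insert t (snd E ` ({1..r} - {i}))"
      unfolding T using inj_on_image_set_diff[OF inj, of "{1..r}" "{i}"] assms(2) by simp
    also have "\<dots> = snd (right_move i E) ` {1..r}"
      unfolding right_move_simps t_def[symmetric] using assms(2) by auto
    finally show ?thesis .
  qed
  ultimately show ?thesis by (simp add: labelled_def)
qed

lemma right_move_less:
  assumes "labelled r E" "i \<in> {1..r}" shows "snd E i < snd (right_move i E) i"
  using fin_diagram.marked_spot(1)[OF labelled_fin labelled_Times] assms
  by (simp add: right_move_simps)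

lemma path_map_simps [simp]:
  "path_map [] E = E" "path_map (i # \<theta>) E = right_move i (path_map \<theta> E)"
  "path_map (\<theta> @ \<theta>') E = path_map \<theta> (path_map \<theta>' E)"
  by (simp_all add: path_map_def)

lemma labelled_path_map:
  "labelled r E \<Longrightarrow> set \<theta> \<subseteq> {1..r} \<Longrightarrow> labelled r (path_map \<theta> E)"
  by (induction \<theta>) (auto intro: labelled_right_move)

lemma path_map_mono:
  "labelled r E \<Longrightarrow> set \<theta> \<subseteq> {1..r} \<Longrightarrow> snd E j \<le> snd (path_map \<theta> E) j"
proof (induction \<theta>)
  case (Cons i \<theta>)
  then have "labelled r (path_map \<theta> E)" "i \<in> {1..r}"
    using labelled_path_map[of r E \<theta>] by simp_all
  from right_move_less[OF this] Cons show ?case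
    by (cases "i = j") (auto simp: right_move_simps)
qed simp

lemma path_map_unmoved:
  "j \<notin> set \<theta> \<Longrightarrow> snd (path_map \<theta> E) j = snd E j"
  by (induction \<theta>) (auto simp: right_move_simps)

text \<open>
  The moves of the largest label come first. If the first labels of two paths differ, the larger one
  is never moved in the other path, although its cross ends at the same spot.
\<close>

lemma path_determined_by_labels:
  assumes "labelled r E" "sorted \<theta>" "sorted \<theta>'" "set \<theta> \<subseteq> {1..r}" "set \<theta>' \<subseteq> {1..r}"
    and "\<And>i. i \<in> {1..r} \<Longrightarrow> snd (path_map \<theta> E) i = snd (path_map \<theta>' E) i"
  shows "\<theta> = \<theta>'"
  using assms
proof (induction \<theta> arbitrary: \<theta>' E rule: rev_induct)
  have moved: "snd E j < snd (path_map (\<theta> @ [j]) E) j"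
    if "labelled r E" "set (\<theta> @ [j]) \<subseteq> {1..r}" for E \<theta> and j
  proof -
    have "snd E j < snd (right_move j E) j" using that by (intro right_move_less) auto
    also have "\<dots> \<le> snd (path_map \<theta> (right_move j E)) j"
      using that by (intro path_map_mono[of r] labelled_right_move) auto
    finally show ?thesis by simp
  qed
  {
    case Nil
    then show ?case
      using moved[of E "butlast \<theta>'" "last \<theta>'"] by (cases \<theta>' rule: rev_cases) force+
  next
    case (snoc i \<theta>)
    show ?case
    proof (cases \<theta>' rule: rev_cases)
      case Nil
      with snoc.prems moved[of E \<theta> i] show ?thesis by force
    next
      case (snoc \<theta>'' j)
      have le: "\<forall>k\<in>set (\<theta> @ [i]). k \<le> i" "\<forall>k\<in>set (\<theta>'' @ [j]). k \<le> j"
        using snoc.prems(2,3) snoc by (auto simp: sorted_append)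
      have ij: "i \<in> {1..r}" "j \<in> {1..r}" using snoc.prems(4,5) snoc by auto
      have "\<not> i < j"
      proof
        assume "i < j"
        then have "j \<notin> set (\<theta> @ [i])" using le by force
        then have "snd (path_map (\<theta> @ [i]) E) j = snd E j" by (rule path_map_unmoved)
        moreover have "snd E j < snd (path_map \<theta>' E) j"
          using moved[of E \<theta>'' j] snoc.prems snoc by simp
        ultimately show False using snoc.prems(6)[of j] ij by simp
      qed
      moreover have "\<not> j < i"
      proof
        assume "j < i"
        then have "i \<notin> set \<theta>'" using le snoc by force
        then have "snd (path_map \<theta>' E) i = snd E i" by (rule path_map_unmoved)
        moreover have "snd E i < snd (path_map (\<theta> @ [i]) E) i"
          using moved[of E \<theta> i] snoc.prems by simp
        ultimately show False using snoc.prems(6)[of i] ij by simp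
      qed
      ultimately have "i = j" by simp
      have "\<theta> = \<theta>''"
      proof (rule snoc.IH)
        show "labelled r (right_move i E)" using snoc.prems(1) ij by (intro labelled_right_move) auto
        show "snd (path_map \<theta> (right_move i E)) k = snd (path_map \<theta>'' (right_move i E)) k"
          if "k \<in> {1..r}" for k
          using snoc.prems(6)[OF that] snoc \<open>i = j\<close> by simp
      qed (use snoc.prems snoc in \<open>auto simp: sorted_append\<close>)
      with snoc \<open>i = j\<close> show ?thesis by simp
    qed
  }
qed

lemma labelled_label_lr:
  assumes "finite_diagram D"
  shows "labelled (length (crosses D)) (label_lr D)"
    and "\<And>i j. i \<in> {1..length (crosses D)} \<Longrightarrow> j \<in> {1..length (crosses D)} \<Longrightarrow> i < j \<Longrightarrow>
      snd (label_lr D) i < snd (label_lr D) j"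
proof -
  interpret fin_diagram D using assms by (rule fin_diagram.intro)
  let ?r = "length (crosses D)"
  show lt: "snd (label_lr D) i < snd (label_lr D) j" if "i \<in> {1..?r}" "j \<in> {1..?r}" "i < j" for i j
    using that sorted_crosses by (auto simp: label_lr_def sorted_wrt_iff_nth_less)
  have "{t. D t = Times} = (\<lambda>i. crosses D ! (i - 1)) ` {1..?r}"
  proof -
    have "(\<lambda>i. crosses D ! (i - 1)) ` {1..?r} = (\<lambda>i. crosses D ! (i - 1)) ` Suc ` {0..<?r}"
      by (simp only: image_Suc_atLeastLessThan atLeastLessThanSuc_atLeastAtMost One_nat_def)
    also have "\<dots> = nth (crosses D) ` {0..<?r}"
      by (simp only: image_image diff_Suc_1)
    also have "\<dots> = {t. D t = Times}"
      using nth_image[of ?r "crosses D"] set_crosses by simp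
    finally show ?thesis by simp
  qed
  moreover have "inj_on (snd (label_lr D)) {1..?r}"
    by (rule linorder_inj_onI) (use lt in fastforce)+
  ultimately show "labelled ?r (label_lr D)" using assms by (simp add: labelled_def label_lr_def)
qed

lemma sum_labels:
  "labelled r E \<Longrightarrow> (\<Sum>i\<in>{1..r}. snd E i) = \<Sum>{t. fst E t = Times}"
  unfolding labelled_def by (metis (no_types, lifting) sum.reindex_cong)

lemma length_path_le:
  "labelled r E \<Longrightarrow> set \<theta> \<subseteq> {1..r} \<Longrightarrow>
    int (length \<theta>) + (\<Sum>i\<in>{1..r}. snd E i) \<le> (\<Sum>i\<in>{1..r}. snd (path_map \<theta> E) i)"
proof (induction \<theta>)
  case (Cons i \<theta>)
  let ?E = "path_map \<theta> E"
  have E: "labelled r ?E" "i \<in> {1..r}" using Cons.prems labelled_path_map[of r E \<theta>] by simp_all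
  have "(\<Sum>j\<in>{1..r}. snd ?E j) < (\<Sum>j\<in>{1..r}. snd (right_move i ?E) j)"
    using right_move_less[OF E] E(2)
    by (intro sum_strict_mono_ex1) (auto simp: right_move_simps)
  with Cons show ?case by simp
qed simp

text \<open>
  Every move increases the sum of the positions of the crosses.
\<close>

lemma finite_right_paths:
  assumes "finite_diagram D" shows "finite (right_paths D D')"
proof -
  let ?r = "length (crosses D)"
  define N where "N = nat (\<Sum>{t. D' t = Times} - \<Sum>{t. D t = Times})"
  have "right_paths D D' \<subseteq> {\<theta>. set \<theta> \<subseteq> {1..?r} \<and> length \<theta> \<le> N}"
  proof
    fix \<theta> assume \<theta>: "\<theta> \<in> right_paths D D'"
    then have s: "set \<theta> \<subseteq> {1..?r}" and f: "fst (path_map \<theta> (label_lr D)) = D'"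
      by (auto simp: right_paths_def)
    note l = labelled_label_lr(1)[OF assms]
    have "int (length \<theta>) + \<Sum>{t. D t = Times} \<le> \<Sum>{t. D' t = Times}"
      using length_path_le[OF l s] sum_labels[OF l] sum_labels[OF labelled_path_map[OF l s]] f
      by (simp add: label_lr_def)
    then show "\<theta> \<in> {\<theta>. set \<theta> \<subseteq> {1..?r} \<and> length \<theta> \<le> N}" using s by (auto simp: N_def)
  qed
  then show ?thesis by (rule finite_subset) (rule finite_lists_length_le, simp)
qed

definition ordered_labels :: "nat \<Rightarrow> labeled_diagram \<Rightarrow> bool" where
  "ordered_labels r E \<longleftrightarrow> (\<forall>i\<in>{1..r}. \<forall>j\<in>{1..r}. i < j \<longrightarrow> snd E i < snd E j)"

text \<open>
  A cross at \<open>z\<close>, an empty spot \<open>z'\<close> to its right, and a cross beyond it. The inequality says that no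
  cross from the left of \<open>z\<close> can mark a spot up to \<open>z'\<close>, and the last condition says that the crosses
  that may still move are outside. So \<open>z'\<close> stays empty.
\<close>

definition frozen_gap :: "nat \<Rightarrow> nat \<Rightarrow> labeled_diagram \<Rightarrow> bool" where
  "frozen_gap r h E \<longleftrightarrow> (\<exists>z z' k. z < z' \<and> fst E z = Times \<and> fst E z' = Empty \<and>
     k \<in> {1..r} \<and> z' < snd E k \<and>
     (\<forall>u. z \<le> u \<and> u \<le> z' \<longrightarrow> empty_count (fst E) z u \<le> cross_count (fst E) z u) \<and>
     (\<forall>j\<in>{1..r}. j \<le> h \<longrightarrow> snd E j \<notin> {z..z'}))"

lemma frozen_gap_mono: "frozen_gap r h E \<Longrightarrow> h' \<le> h \<Longrightarrow> frozen_gap r h' E"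
  unfolding frozen_gap_def by (meson le_trans)

lemma empty_count_cong:
  "(\<And>t. x < t \<Longrightarrow> t \<le> u \<Longrightarrow> D t = D' t) \<Longrightarrow> empty_count D x u = empty_count D' x u"
  unfolding empty_count_def by (rule arg_cong[where f = card]) auto

lemma cross_count_cong:
  "(\<And>t. x \<le> t \<Longrightarrow> t \<le> u \<Longrightarrow> D t = D' t) \<Longrightarrow> cross_count D x u = cross_count D' x u"
  unfolding cross_count_def by (rule arg_cong[where f = card]) auto

lemma empty_count_split:
  "x \<le> y \<Longrightarrow> y \<le> u \<Longrightarrow> empty_count D x u = empty_count D x y + empty_count D y u"
  unfolding empty_count_def by (subst card_Un_disjoint[symmetric]) (auto intro!: arg_cong[where f = card])

lemma cross_count_split:
  "x \<le> y \<Longrightarrow> y \<le> u \<Longrightarrow> cross_count D x u = cross_count D x (y - 1) + cross_count D y u"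
  unfolding cross_count_def by (subst card_Un_disjoint[symmetric]) (auto intro!: arg_cong[where f = card])

text \<open>
  If a cross at \<open>q < z\<close> marked a spot in the gap, the balance of its arc would be attained there,
  whereas the part before \<open>z\<close> is in strict deficit and the part from \<open>z\<close> on cannot make up for it.
\<close>

lemma frozen_gap_step:
  assumes "labelled r E" "i \<in> {1..r}" "frozen_gap r i E"
  shows "frozen_gap r i (right_move i E)"
proof -
  interpret fin_diagram "fst E" using assms(1) by (rule labelled_fin)
  obtain z z' k where g: "z < z'" "fst E z = Times" "fst E z' = Empty" "k \<in> {1..r}" "z' < snd E k"
    and bal: "\<And>u. z \<le> u \<Longrightarrow> u \<le> z' \<Longrightarrow> empty_count (fst E) z u \<le> cross_count (fst E) z u"
    and out: "\<And>j. j \<in> {1..r} \<Longrightarrow> j \<le> i \<Longrightarrow> snd E j \<notin> {z..z'}"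
    using assms(3) unfolding frozen_gap_def by blast
  define D where "D = fst E"
  define q where "q = snd E i"
  define t where "t = marked_spot D q"
  have q: "D q = Times" using labelled_Times[OF assms(1,2)] by (simp add: D_def q_def)
  have t: "q < t" "D t = Empty" using marked_spot q unfolding D_def t_def by auto
  have q_out: "q \<notin> {z..z'}" using out[OF assms(2)] by (simp add: q_def)
  have t_out: "t \<notin> {z..z'}"
  proof
    assume tz: "t \<in> {z..z'}"
    then have "q < z" using q_out t by auto
    have "t \<noteq> z" using t g(2) by (auto simp: D_def)
    have "empty_count D q (z - 1) < cross_count D q (z - 1)"
      using marked_spot_balance(1)[of q "z - 1"] q tz \<open>q < z\<close> unfolding D_def t_def by auto
    moreover have "empty_count D z t \<le> cross_count D z t" using bal[of t] tz by (simp add: D_def)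
    moreover have "empty_count D q t = empty_count D q (z - 1) + empty_count D z t"
    proof -
      have "empty_count D q t = empty_count D q (z - 1) + empty_count D (z - 1) t"
        using \<open>q < z\<close> tz by (intro empty_count_split) auto
      moreover have "empty_count D (z - 1) t = empty_count D z t"
        unfolding empty_count_def
      proof (rule arg_cong[where f = card], rule Collect_cong)
        fix s show "(z - 1 < s \<and> s \<le> t \<and> D s = Empty) = (z < s \<and> s \<le> t \<and> D s = Empty)"
          using g(2) by (cases "s = z") (auto simp: D_def)
      qed
      ultimately show ?thesis by simp
    qed
    moreover have "cross_count D q t = cross_count D q (z - 1) + cross_count D z t"
      using \<open>q < z\<close> tz by (intro cross_count_split) auto
    moreover have "cross_count D q t \<le> empty_count D q t"
      using marked_spot_balance(2)[of q] q unfolding D_def t_def by auto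
    ultimately show False by linarith
  qed
  let ?E = "right_move i E"
  have D': "fst ?E s = D s" if "s \<in> {z..z'}" for s
    using that q_out t_out by (auto simp: right_move_simps D_def q_def t_def)
  have p': "snd ?E = (snd E)(i := t)" by (simp add: right_move_simps D_def q_def t_def)
  show ?thesis unfolding frozen_gap_def
  proof (intro exI conjI)
    show "z < z'" "k \<in> {1..r}" by fact+
    show "fst ?E z = Times" "fst ?E z' = Empty" using D' g by (auto simp: D_def)
    show "z' < snd ?E k" using g(5) t(1) by (auto simp: p' q_def)
    show "\<forall>u. z \<le> u \<and> u \<le> z' \<longrightarrow> empty_count (fst ?E) z u \<le> cross_count (fst ?E) z u"
    proof (intro allI impI)
      fix u assume u: "z \<le> u \<and> u \<le> z'"
      have "empty_count (fst ?E) z u = empty_count D z u" "cross_count (fst ?E) z u = cross_count D z u"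
        using u D' by (auto intro!: empty_count_cong cross_count_cong)
      then show "empty_count (fst ?E) z u \<le> cross_count (fst ?E) z u" using bal[of u] u by (simp add: D_def)
    qed
    show "\<forall>j\<in>{1..r}. j \<le> i \<longrightarrow> snd ?E j \<notin> {z..z'}" using out t_out by (auto simp: p')
  qed
qed

text \<open>
  A move that passes no cross keeps the order. If it passes a cross at \<open>z\<close>, the arc of \<open>z\<close> ends in an
  empty spot before the landing place. The crosses in this arc have larger labels, so they are not moved
  any more.
\<close>

lemma ordered_step:
  assumes "labelled r E" "i \<in> {1..r}" "ordered_labels r E"
  shows "ordered_labels r (right_move i E) \<or> frozen_gap r i (right_move i E)"
proof -
  interpret fin_diagram "fst E" using assms(1) by (rule labelled_fin)
  define D where "D = fst E"
  define q where "q = snd E i"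
  define t where "t = marked_spot D q"
  have q: "D q = Times" using labelled_Times[OF assms(1,2)] by (simp add: D_def q_def)
  have t: "q < t" "D t = Empty" using marked_spot q unfolding D_def t_def by auto
  have ord: "snd E j < snd E k" if "j \<in> {1..r}" "k \<in> {1..r}" "j < k" for j k
    using assms(3) that by (auto simp: ordered_labels_def)
  let ?E = "right_move i E"
  have p': "snd ?E = (snd E)(i := t)" by (simp add: right_move_simps D_def q_def t_def)
  show ?thesis
  proof (cases "\<exists>k\<in>{1..r}. q < snd E k \<and> snd E k < t")
    case False
    have "ordered_labels r ?E" unfolding ordered_labels_def
    proof (intro ballI impI)
      fix j k assume jk: "j \<in> {1..r}" "k \<in> {1..r}" "j < k"
      have "t < snd E k" if "i < k"
      proof -
        have "q < snd E k" using ord[OF assms(2) jk(2) that] by (simp add: q_def)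
        moreover have "snd E k \<noteq> t" using labelled_Times[OF assms(1) jk(2)] t(2) by (auto simp: D_def)
        ultimately show ?thesis using False jk(2) by force
      qed
      then show "snd ?E j < snd ?E k"
        using ord[OF jk] t(1) jk(3) by (auto simp: p' q_def)
    qed
    then show ?thesis ..
  next
    case True
    then obtain k where k: "k \<in> {1..r}" "q < snd E k" "snd E k < t" by blast
    define z where "z = snd E k"
    define z' where "z' = marked_spot D z"
    have z: "D z = Times" using labelled_Times[OF assms(1) k(1)] by (simp add: D_def z_def)
    have z': "z < z'" "D z' = Empty" using marked_spot z unfolding D_def z'_def by auto
    have "z' < t" using marked_spot_nested[of q z] q z k unfolding D_def z'_def t_def z_def by auto
    have out: "snd E j \<notin> {z..z'}" if "j \<in> {1..r}" "j \<le> i" for j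
      using ord[OF that(1) assms(2)] that(2) k(2) by (cases "i = j") (auto simp: q_def z_def)
    have D': "fst ?E s = D s" if "s \<in> {z..z'}" for s
      using that k \<open>z' < t\<close> by (auto simp: right_move_simps D_def q_def t_def z_def)
    have bal: "empty_count D z u \<le> cross_count D z u" if "z \<le> u" "u \<le> z'" for u
    proof (cases "u = z'")
      case False
      then show ?thesis
        using marked_spot_balance(1)[of z u] z that unfolding D_def z'_def by auto
    next
      case True
      have "empty_count D z (z' - 1) < cross_count D z (z' - 1)"
        using marked_spot_balance(1)[of z "z' - 1"] z z' unfolding D_def z'_def by auto
      moreover have "empty_count D z u = empty_count D z (z' - 1) + empty_count D (z' - 1) u"
        using z'(1) True by (intro empty_count_split) auto
      moreover have "empty_count D (z' - 1) u \<le> 1"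
      proof -
        have "{t. z' - 1 < t \<and> t \<le> u \<and> D t = Empty} \<subseteq> {z'}" using True by auto
        then have "card {t. z' - 1 < t \<and> t \<le> u \<and> D t = Empty} \<le> card {z'}" by (intro card_mono) auto
        then show ?thesis by (simp add: empty_count_def)
      qed
      moreover have "cross_count D z (z' - 1) \<le> cross_count D z u"
        unfolding cross_count_def using True by (intro card_mono) auto
      ultimately show ?thesis by linarith
    qed
    have "frozen_gap r i ?E" unfolding frozen_gap_def
    proof (intro exI conjI)
      show "z < z'" "i \<in> {1..r}" by fact+
      show "fst ?E z = Times" "fst ?E z' = Empty" using D' z z' by auto
      show "z' < snd ?E i" using \<open>z' < t\<close> by (simp add: p')
      show "\<forall>u. z \<le> u \<and> u \<le> z' \<longrightarrow> empty_count (fst ?E) z u \<le> cross_count (fst ?E) z u"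
      proof (intro allI impI)
        fix u assume u: "z \<le> u \<and> u \<le> z'"
        have "empty_count (fst ?E) z u = empty_count D z u" "cross_count (fst ?E) z u = cross_count D z u"
          using u D' by (auto intro!: empty_count_cong cross_count_cong)
        then show "empty_count (fst ?E) z u \<le> cross_count (fst ?E) z u" using bal[of u] u by simp
      qed
      show "\<forall>j\<in>{1..r}. j \<le> i \<longrightarrow> snd ?E j \<notin> {z..z'}"
        using out \<open>z' < t\<close> by (auto simp: p')
    qed
    then show ?thesis ..
  qed
qed

lemma ordered_or_frozen:
  assumes "labelled r E" "ordered_labels r E" "sorted (h # \<theta>)" "set \<theta> \<subseteq> {1..r}"
  shows "ordered_labels r (path_map \<theta> E) \<or> frozen_gap r h (path_map \<theta> E)"
  using assms(3,4)
proof (induction \<theta> arbitrary: h)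
  case (Cons i \<theta>)
  have "labelled r (path_map \<theta> E)" "i \<in> {1..r}"
    using Cons.prems assms(1) labelled_path_map[of r E \<theta>] by simp_all
  moreover have "ordered_labels r (path_map \<theta> E) \<or> frozen_gap r i (path_map \<theta> E)"
    using Cons.prems by (intro Cons.IH) auto
  ultimately have "ordered_labels r (path_map (i # \<theta>) E) \<or> frozen_gap r i (path_map (i # \<theta>) E)"
    using ordered_step frozen_gap_step by (metis path_map_simps(2))
  then show ?case using frozen_gap_mono[of r i "path_map (i # \<theta>) E" h] Cons.prems by auto
qed (use assms(2) in simp)

lemma ordered_labels_crosses:
  assumes "labelled r E" "ordered_labels r E" "i \<in> {1..r}"
  shows "snd E i = crosses (fst E) ! (i - 1)"
proof -
  interpret fin_diagram "fst E" using assms(1) by (rule labelled_fin)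
  have "sorted_wrt (<) (map (snd E) [1..<Suc r])"
    unfolding sorted_wrt_map using assms(2) by (auto simp: ordered_labels_def sorted_wrt_iff_nth_less nth_append simp del: upt_Suc)
  moreover have "set (map (snd E) [1..<Suc r]) = {t. fst E t = Times}"
    using assms(1) unfolding labelled_def by (auto simp: atLeastLessThanSuc_atLeastAtMost)
  ultimately have "crosses (fst E) = map (snd E) [1..<Suc r]"
    unfolding crosses_def by (metis asc_def asc_eqI)
  then show ?thesis using assms(3) by (auto simp: nth_append simp del: upt_Suc)
qed

text \<open>
  A frozen gap would leave an empty spot between two crosses of the target.
\<close>

lemma right_path_to_connected_is_trivial:
  assumes "finite_diagram D"
    and tc: "\<And>x y t. D' x = Times \<Longrightarrow> D' y = Times \<Longrightarrow> x < t \<Longrightarrow> t < y \<Longrightarrow> D' t \<noteq> Empty"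
    and \<theta>: "\<theta> \<in> right_paths D D'"
  shows "trivial_path D D' \<theta>"
proof -
  let ?r = "length (crosses D)"
  let ?E = "path_map \<theta> (label_lr D)"
  have s: "set \<theta> \<subseteq> {1..?r}" "sorted \<theta>" and f: "fst ?E = D'"
    using \<theta> by (auto simp: right_paths_def)
  note l = labelled_label_lr[OF assms(1)]
  have lab: "labelled ?r ?E" by (rule labelled_path_map[OF l(1) s(1)])
  have "ordered_labels ?r ?E \<or> frozen_gap ?r 0 ?E"
    using l s by (intro ordered_or_frozen) (auto simp: ordered_labels_def)
  moreover have "\<not> frozen_gap ?r 0 ?E"
  proof
    assume "frozen_gap ?r 0 ?E"
    then obtain z z' k where "z < z'" "D' z = Times" "D' z' = Empty" "k \<in> {1..?r}" "z' < snd ?E k"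
      unfolding frozen_gap_def f by blast
    then show False using tc[of z "snd ?E k" z'] labelled_Times[OF lab] f by auto
  qed
  ultimately have "ordered_labels ?r ?E" by blast
  from ordered_labels_crosses[OF lab this] show ?thesis
    unfolding trivial_path_def using \<theta> f by simp
qed

lemma trivial_path_unique:
  assumes "finite_diagram D" "trivial_path D D' \<theta>" "trivial_path D D' \<theta>'"
  shows "\<theta> = \<theta>'"
  using assms(2,3) labelled_label_lr(1)[OF assms(1)] unfolding trivial_path_def right_paths_def
  by (intro path_determined_by_labels) auto

section \<open>Two right paths to a diagram with a gap\<close>

text \<open>
  The spots that are not occupied by \<open>>\<close> or \<open><\<close>. Right moves change only the symbols on these spots.
\<close>

definition noncore :: "diagram \<Rightarrow> int \<Rightarrow> bool" where
  "noncore D t \<longleftrightarrow> D t = Times \<or> D t = Empty"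

definition with_crosses :: "diagram \<Rightarrow> int set \<Rightarrow> diagram" where
  "with_crosses D S = (\<lambda>t. if noncore D t then if t \<in> S then Times else Empty else D t)"

lemma with_crosses_simps:
  "with_crosses D S t = Times \<longleftrightarrow> noncore D t \<and> t \<in> S"
  "with_crosses D S t = Empty \<longleftrightarrow> noncore D t \<and> t \<notin> S"
  "with_crosses D S t = Gt \<longleftrightarrow> D t = Gt"
  "with_crosses D S t = Lt \<longleftrightarrow> D t = Lt"
  by (auto simp: with_crosses_def noncore_def)

lemma finite_with_crosses:
  assumes "finite_diagram D" "finite S"
  shows "finite_diagram (with_crosses D S)"
proof -
  have "{t. with_crosses D S t \<noteq> Empty} \<subseteq> {t. D t \<noteq> Empty} \<union> S"
    by (auto simp: with_crosses_simps noncore_def)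
  then show ?thesis using assms unfolding finite_diagram_def by (meson finite_UnI finite_subset)
qed

lemma with_own_crosses: "with_crosses D {t. D t = Times} = D"
  by (rule ext) (auto simp: with_crosses_def noncore_def)

lemma next_noncore:
  assumes "noncore D q" "x < q"
  obtains e where "x < e" "e \<le> q" "noncore D e" "\<And>u. x < u \<Longrightarrow> u < e \<Longrightarrow> \<not> noncore D u"
proof -
  let ?P = "\<lambda>t. x < t \<and> noncore D t"
  have q: "?P q" using assms by simp
  have above: "x < t" if "?P t" for t using that by simp
  show thesis
  proof (rule that[of "LEAST t. ?P t"])
    show "x < (LEAST t. ?P t)" "noncore D (LEAST t. ?P t)"
      using Least_int(1)[of ?P q x, OF q above] by blast+
    show "(LEAST t. ?P t) \<le> q" by (rule Least_int(2)[of ?P q x, OF q above q])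
    show "\<not> noncore D u" if "x < u" "u < (LEAST t. ?P t)" for u
      using Least_int(2)[of ?P q x u, OF q above] that by linarith
  qed
qed

definition gap :: "diagram \<Rightarrow> int \<Rightarrow> int \<Rightarrow> nat" where
  "gap D x y = card {u. x < u \<and> u \<le> y \<and> noncore D u}"

lemma gap_self [simp]: "gap D x x = 0"
  unfolding gap_def by (subst card_0_eq) auto

lemma gap_step:
  assumes "x < e" "e \<le> q" "noncore D e" "\<And>u. x < u \<Longrightarrow> u < e \<Longrightarrow> \<not> noncore D u"
  shows "gap D x q = Suc (gap D e q)"
proof -
  have "{u. x < u \<and> u \<le> q \<and> noncore D u} = insert e {u. e < u \<and> u \<le> q \<and> noncore D u}"
    using assms by force
  then show ?thesis by (simp add: gap_def)
qed

text \<open>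
  All diagrams on a right path have the same core, so a labelled diagram is determined by the positions
  of the labels.
\<close>

locale core_diagram =
  fixes D :: diagram and r :: nat
  assumes fin: "finite_diagram D"
begin

definition state :: "(nat \<Rightarrow> int) \<Rightarrow> labeled_diagram" where
  "state p = (with_crosses D (p ` {1..r}), p)"

definition placement :: "(nat \<Rightarrow> int) \<Rightarrow> bool" where
  "placement p \<longleftrightarrow> inj_on p {1..r} \<and> (\<forall>k\<in>{1..r}. noncore D (p k))"

lemma labelled_state: "placement p \<Longrightarrow> labelled r (state p)"
  unfolding labelled_def state_def placement_def
  by (auto simp: with_crosses_simps intro!: finite_with_crosses fin)

lemma right_move_state:
  assumes "placement p" "i \<in> {1..r}" "marked_spot (with_crosses D (p ` {1..r})) (p i) = t"
  shows "right_move i (state p) = state (p(i := t))" and "placement (p(i := t))"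
proof -
  let ?D = "with_crosses D (p ` {1..r})"
  interpret d: fin_diagram ?D
    using labelled_fin[OF labelled_state[OF assms(1)]] by (simp add: state_def)
  have "?D (p i) = Times"
    using assms(1,2) by (auto simp: with_crosses_simps placement_def)
  from d.marked_spot(2)[OF this, unfolded assms(3)] have t: "noncore D t" "t \<notin> p ` {1..r}"
    by (simp_all add: with_crosses_simps)
  have inj: "inj_on p {1..r}" using assms(1) by (simp add: placement_def)
  have "p(i := t) ` {1..r} = insert t (p ` {1..r} - {p i})"
    using inj_on_image_set_diff[OF inj, of "{1..r}" "{i}"] assms(2) by auto
  moreover have "?D(p i := Empty, t := Times) = with_crosses D (insert t (p ` {1..r} - {p i}))"
    using assms(1,2) t by (auto simp: with_crosses_def placement_def fun_eq_iff)
  ultimately show "right_move i (state p) = state (p(i := t))"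
    unfolding state_def right_move_def Let_def fst_conv snd_conv assms(3) by simp
  show "placement (p(i := t))"
    using assms(1) t by (auto simp: placement_def intro: inj_on_fun_updI)
qed

text \<open>
  A cross with no other cross in its way visits every spot outside the core.
\<close>

lemma slide:
  assumes "placement p" "i \<in> {1..r}" "p i \<le> q" "noncore D q"
    and "\<And>k. k \<in> {1..r} \<Longrightarrow> p k \<notin> {p i<..q}"
  shows "path_map (replicate (gap D (p i) q) i) (state p) = state (p(i := q))"
    and "placement (p(i := q))"
proof -
  have "path_map (replicate (gap D (p i) q) i) (state p) = state (p(i := q)) \<and> placement (p(i := q))"
    using assms
  proof (induction "gap D (p i) q" arbitrary: p)
    case 0
    have "p i = q"
    proof (rule ccontr)
      assume "p i \<noteq> q"
      then have "q \<in> {u. p i < u \<and> u \<le> q \<and> noncore D u}" using 0 by auto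
      then have "gap D (p i) q \<noteq> 0" unfolding gap_def by (subst card_0_eq) auto
      with 0 show False by simp
    qed
    with 0 show ?case by (simp add: fun_upd_idem)
  next
    case (Suc n)
    have "p i \<noteq> q"
    proof
      assume "p i = q"
      then have "gap D (p i) q = 0" by simp
      with Suc.hyps(2) show False by simp
    qed
    then have "p i < q" using Suc.prems by simp
    from next_noncore[OF Suc.prems(4) this] obtain e where
      e: "p i < e" "e \<le> q" "noncore D e" "\<And>u. p i < u \<Longrightarrow> u < e \<Longrightarrow> \<not> noncore D u" by blast
    have n: "n = gap D e q" using gap_step[OF e] Suc.hyps(2) by simp
    let ?D = "with_crosses D (p ` {1..r})"
    interpret d: fin_diagram ?D
      using labelled_fin[OF labelled_state[OF Suc.prems(1)]] by (simp add: state_def)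
    have e_free: "e \<notin> p ` {1..r}" using Suc.prems(5) e(1,2) by fastforce
    have pi: "?D (p i) = Times"
      using Suc.prems(1,2) by (auto simp: with_crosses_simps placement_def)
    have "marked_spot ?D (p i) = e"
    proof (rule d.marked_spotI[OF pi e(1)])
      have "{t. p i \<le> t \<and> t \<le> e \<and> ?D t = Times} \<subseteq> {p i}"
      proof
        fix t assume t: "t \<in> {t. p i \<le> t \<and> t \<le> e \<and> ?D t = Times}"
        then have "noncore D t" "t \<noteq> e" using e_free by (auto simp: with_crosses_simps)
        then show "t \<in> {p i}" using e(4)[of t] t by force
      qed
      then have "cross_count ?D (p i) e \<le> card {p i}"
        unfolding cross_count_def by (rule card_mono[rotated]) simp
      also have "\<dots> = card {e}" by simp
      also have "\<dots> \<le> empty_count ?D (p i) e"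
        unfolding empty_count_def using e(1,3) e_free
        by (intro card_mono) (simp_all add: with_crosses_simps)
      finally show "cross_count ?D (p i) e \<le> empty_count ?D (p i) e" .
      fix u assume u: "p i \<le> u" "u < e"
      have "\<not> (p i < t \<and> t \<le> u \<and> ?D t = Empty)" for t
        using e(4)[of t] u(2) by (auto simp: with_crosses_simps)
      then have "empty_count ?D (p i) u = 0" by (simp add: empty_count_def)
      also have "0 < cross_count ?D (p i) u"
        unfolding cross_count_def using pi u(1) by (subst card_gt_0_iff) auto
      finally show "empty_count ?D (p i) u < cross_count ?D (p i) u" .
    qed
    note move = right_move_state[OF Suc.prems(1,2) this]
    let ?p = "p(i := e)"
    have IH: "path_map (replicate n i) (state ?p) = state (?p(i := q)) \<and> placement (?p(i := q))"
      unfolding n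
    proof (rule Suc.hyps(1)[of ?p, unfolded fun_upd_same])
      show "?p k \<notin> {e<..q}" if "k \<in> {1..r}" for k
        using Suc.prems(5)[OF that] e by auto
    qed (use n move(2) Suc.prems(2,4) e(2) in simp_all)
    have "replicate (gap D (p i) q) i = replicate n i @ [i]"
      unfolding Suc.hyps(2)[symmetric] by (simp add: replicate_append_same)
    then have "path_map (replicate (gap D (p i) q) i) (state p) = path_map (replicate n i) (state ?p)"
      by (simp add: move(1))
    with IH show ?case by simp
  qed
  then show "path_map (replicate (gap D (p i) q) i) (state p) = state (p(i := q))"
    "placement (p(i := q))" by auto
qed

text \<open>
  The labels up to \<open>n\<close> are moved to their targets from the right to the left. The other labels are
  already at target positions, in any order.
\<close>

lemma slide_lower_labels:
  assumes "placement q" "n \<le> r"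
    and "\<And>j. j \<in> {1..n} \<Longrightarrow> q j = X j" "\<And>j. j \<in> {n + 1..r} \<Longrightarrow> q j \<in> Y ` {n + 1..r}"
    and "\<And>i j. i \<in> {1..n} \<Longrightarrow> j \<in> {1..n} \<Longrightarrow> i < j \<Longrightarrow> X i < X j"
    and "\<And>i j. i \<in> {1..r} \<Longrightarrow> j \<in> {1..r} \<Longrightarrow> i < j \<Longrightarrow> Y i < Y j"
    and "\<And>j. j \<in> {1..n} \<Longrightarrow> X j \<le> Y j" "\<And>j. j \<in> {1..r} \<Longrightarrow> noncore D (Y j)"
  shows "fst (path_map (concat (map (\<lambda>j. replicate (gap D (X j) (Y j)) j) [1..<Suc n])) (state q)) =
    with_crosses D (Y ` {1..r})"
  using assms
proof (induction n arbitrary: q)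
  case 0
  have "inj_on Y {1..r}"
    by (rule linorder_inj_onI) (use 0(6) in force)+
  then have "q ` {1..r} = Y ` {1..r}"
    using 0(1,4) by (intro card_subset_eq) (auto simp: placement_def card_image)
  then show ?case by (simp add: state_def)
next
  case (Suc n)
  let ?i = "Suc n"
  have i: "?i \<in> {1..r}" and qi: "q ?i = X ?i" using Suc.prems(2,3) by auto
  have free: "q k \<notin> {q ?i<..Y ?i}" if k: "k \<in> {1..r}" for k
  proof (cases "k \<le> n")
    case True
    then have "X k < X ?i" using k by (intro Suc.prems(5)) auto
    moreover have "q k = X k" using True k by (intro Suc.prems(3)) auto
    ultimately show ?thesis using qi by simp
  next
    case False
    show ?thesis
    proof (cases "k = ?i")
      case False
      then have "q k \<in> Y ` {Suc n + 1..r}" using \<open>\<not> k \<le> n\<close> k by (intro Suc.prems(4)) auto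
      then obtain j where "j \<in> {Suc n + 1..r}" "q k = Y j" by blast
      moreover from this have "Y ?i < Y j" using i by (intro Suc.prems(6)) auto
      ultimately show ?thesis by simp
    qed simp
  qed
  have XY: "q ?i \<le> Y ?i" using Suc.prems(7)[of ?i] qi by simp
  note s = slide[OF Suc.prems(1) i XY Suc.prems(8)[OF i] free]
  have "fst (path_map (concat (map (\<lambda>j. replicate (gap D (X j) (Y j)) j) [1..<Suc n])) (state (q(?i := Y ?i)))) =
    with_crosses D (Y ` {1..r})"
  proof (rule Suc.IH)
    show "placement (q(?i := Y ?i))" by (rule s(2))
    show "(q(?i := Y ?i)) j \<in> Y ` {n + 1..r}" if "j \<in> {n + 1..r}" for j
    proof (cases "j = ?i")
      case False
      then have "q j \<in> Y ` {Suc n + 1..r}" using that by (intro Suc.prems(4)) auto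
      then show ?thesis using False by auto
    qed (use i in auto)
    show "(q(?i := Y ?i)) j = X j" if "j \<in> {1..n}" for j
      using Suc.prems(3)[of j] that by auto
    show "X i < X j" if "i \<in> {1..n}" "j \<in> {1..n}" "i < j" for i j
      using that by (intro Suc.prems(5)) auto
    show "X j \<le> Y j" if "j \<in> {1..n}" for j
      using that by (intro Suc.prems(7)) auto
  qed (use Suc.prems(2) in simp, (rule Suc.prems(6,8); assumption)+)
  moreover have "[1..<Suc ?i] = [1..<Suc n] @ [?i]" by simp
  ultimately show ?case using s(1) by (simp add: qi del: upt_Suc)
qed

end

lemma sorted_concat_replicate:
  "sorted (concat (map (\<lambda>j. replicate (f j) j) [1..<Suc n]))"
  by (induction n) (auto simp: sorted_append)

text \<open>
  Let \<open>p\<close> and \<open>p + 1\<close> be the labels of neighbouring crosses \<open>Y p < Y (p + 1)\<close> with an empty spot between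
  them. In the source diagram the cross \<open>p + 1\<close> is at \<open>Y p\<close>, the cross \<open>p\<close> at the next spot \<open>w\<close> to its
  left outside the core, and the lower labels are far to the left, where they are in nobody's way.
\<close>

theorem two_right_paths:
  assumes fin: "finite_diagram D" and xy: "D x = Times" "D e = Empty" "D y = Times" "x < e" "e < y"
  obtains D0 \<theta>1 \<theta>2 where "finite_diagram D0" "\<And>t. D0 t = Gt \<longleftrightarrow> D t = Gt" "\<And>t. D0 t = Lt \<longleftrightarrow> D t = Lt"
    "card {t. D0 t = Times} = card {t. D t = Times}"
    "\<theta>1 \<in> right_paths D0 D" "\<theta>2 \<in> right_paths D0 D" "length \<theta>1 \<noteq> length \<theta>2"
proof -
  interpret fd: fin_diagram D using fin by (rule fin_diagram.intro)
  define r where "r = length (crosses D)"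
  define Y where "Y = snd (label_lr D)"
  have lab: "labelled r (D, Y)" and Y_less: "\<And>i j. i \<in> {1..r} \<Longrightarrow> j \<in> {1..r} \<Longrightarrow> i < j \<Longrightarrow> Y i < Y j"
    using labelled_label_lr[OF fin] by (auto simp: r_def Y_def label_lr_def)
  have Y_cross: "{t. D t = Times} = Y ` {1..r}" using lab by (simp add: labelled_def)
  have Y_noncore: "noncore D (Y j)" if "j \<in> {1..r}" for j
    using labelled_Times[OF lab that] by (simp add: noncore_def)
  interpret core_diagram D r using fin by (rule core_diagram.intro)
  \<comment> \<open>The crosses next to the empty spot \<open>e\<close> have the labels \<open>p\<close> and \<open>p + 1\<close>.\<close>
  define p where "p = Max {j \<in> {1..r}. Y j < e}"
  have "x \<in> Y ` {1..r}" "y \<in> Y ` {1..r}" unfolding Y_cross[symmetric] using xy by simp_all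
  then obtain jx jy where j: "jx \<in> {1..r}" "Y jx = x" "jy \<in> {1..r}" "Y jy = y" by blast
  have "p \<in> {j \<in> {1..r}. Y j < e}"
    unfolding p_def using j xy by (intro Max_in) auto
  then have p: "p \<in> {1..r}" "Y p < e" by auto
  have p_max: "j \<le> p" if "j \<in> {1..r}" "Y j < e" for j
    unfolding p_def using that by (intro Max_ge) auto
  have "p < jy" using Y_less[of jy p] p j xy by (cases jy p rule: linorder_cases) auto
  then have p1: "p + 1 \<in> {1..r}" using j by auto
  have "Y (p + 1) \<noteq> e" using labelled_Times[OF lab p1] xy by auto
  then have Yp1: "e < Y (p + 1)" using p_max[OF p1] by force
  have e_noncore: "noncore D e" using xy by (simp add: noncore_def)
  \<comment> \<open>The cross at \<open>Y p\<close> marks \<open>e1\<close>, so a cross that jumps over it lands on \<open>e2\<close>.\<close>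
  obtain e1 where e1: "Y p < e1" "e1 \<le> e" "noncore D e1" "\<And>u. Y p < u \<Longrightarrow> u < e1 \<Longrightarrow> \<not> noncore D u"
    using next_noncore[OF e_noncore p(2)] by blast
  obtain e2 where e2: "e1 < e2" "e2 \<le> Y (p + 1)" "noncore D e2" "\<And>u. e1 < u \<Longrightarrow> u < e2 \<Longrightarrow> \<not> noncore D u"
    using next_noncore[OF Y_noncore[OF p1], of e1] e1 Yp1 by auto
  \<comment> \<open>All spots up to \<open>K\<close> are empty. They serve as starting places for the lower labels.\<close>
  define K where "K = Min (insert e {t. D t \<noteq> Empty}) - 1"
  have finN: "finite {t. D t \<noteq> Empty}" using fin by (simp add: finite_diagram_def)
  have K: "D t = Empty" if "t \<le> K" for t
  proof (rule ccontr)
    assume "D t \<noteq> Empty"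
    then have "K + 1 \<le> t" unfolding K_def using finN by (simp add: Min_le_iff)
    with that show False by simp
  qed
  have K_Y: "K < Y j" if "j \<in> {1..r}" for j
    using K[of "Y j"] labelled_Times[OF lab that] by (cases "Y j \<le> K") auto
  define w where "w = Max {u. K \<le> u \<and> u < Y p \<and> noncore D u}"
  have w_in: "w \<in> {u. K \<le> u \<and> u < Y p \<and> noncore D u}"
    unfolding w_def
  proof (rule Max_in)
    show "{u. K \<le> u \<and> u < Y p \<and> noncore D u} \<noteq> {}"
      using K[of K] K_Y[OF p(1)] by (auto simp: noncore_def)
  qed simp
  have w_max: "\<not> noncore D u" if "w < u" "u < Y p" for u
  proof
    assume "noncore D u"
    then have "u \<le> w" unfolding w_def using that w_in by (intro Max_ge) auto
    with that show False by simp
  qed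
  have w: "K \<le> w" "w < Y p" "noncore D w" using w_in by auto
  define X where "X j = (if j < p then K - int (p - j) else if j = p then w else if j = p + 1 then Y p else Y j)" for j
  have X_less: "X i < X j" if ij: "i \<in> {1..r}" "j \<in> {1..r}" "i < j" for i j
  proof -
    consider "j < p" | "i < p" "j = p" | "i < p" "p < j" | "i = p" "p < j" | "p < i"
      using ij by linarith
    then show ?thesis
    proof cases
      case 3
      then show ?thesis using ij K_Y[of j] K_Y[OF p(1)] by (auto simp: X_def)
    next
      case 4
      then show ?thesis using ij Y_less[of p j] w p by (auto simp: X_def)
    next
      case 5
      then show ?thesis using ij Y_less[of i j] Y_less[of p j] p by (auto simp: X_def)
    qed (use ij w in \<open>auto simp: X_def\<close>)
  qed
  have X_noncore: "noncore D (X j)" if "j \<in> {1..r}" for j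
    using that K[of "X j"] w Y_noncore p by (auto simp: X_def noncore_def)
  have "inj_on X {1..r}"
    by (rule linorder_inj_onI) (use X_less in force)+
  then have X_place: "placement X"
    unfolding placement_def using X_noncore by blast
  have X_notin: "t \<notin> X ` {1..r}" if "Y p < t" "t \<le> Y (p + 1)" for t
  proof
    assume "t \<in> X ` {1..r}"
    then obtain j where j: "j \<in> {1..r}" "t = X j" by blast
    consider "j < p" | "j = p" | "j = p + 1" | "p + 1 < j" by linarith
    then show False
      using j that w K_Y[OF p(1)] Y_less[OF p1 j(1)] by cases (auto simp: X_def)
  qed
  define D0 where "D0 = with_crosses D (X ` {1..r})"
  have lab0: "labelled r (D0, X)" using labelled_state[OF X_place] by (simp add: state_def D0_def)
  have fin0: "finite_diagram D0" using lab0 by (simp add: labelled_def)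
  have cards: "card {t. D0 t = Times} = r" "card {t. D t = Times} = r"
    using lab0 lab by (auto simp: labelled_def card_image)
  have r0: "length (crosses D0) = r" using cards(1) by (simp add: crosses_def)
  define p0 where "p0 = snd (label_lr D0)"
  have p0: "p0 j = X j" if "j \<in> {1..r}" for j
  proof -
    have "ordered_labels r (D0, X)" using X_less by (auto simp: ordered_labels_def)
    from ordered_labels_crosses[OF lab0 this that] show ?thesis by (simp add: p0_def label_lr_def)
  qed
  have p0_image: "p0 ` {1..r} = X ` {1..r}" using p0 by (rule image_cong[OF refl])
  have start: "label_lr D0 = state p0"
    unfolding state_def p0_image D0_def[symmetric] by (simp add: p0_def label_lr_def)
  have p0_place: "placement p0"
    using X_place p0 inj_on_cong[of "{1..r}" p0 X] by (simp add: placement_def)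
  define rest where "rest = concat (map (\<lambda>j. replicate (gap D (X j) (Y j)) j) [1..<Suc (p - 1)])"
  have rest_set: "set rest \<subseteq> {1..p - 1}" unfolding rest_def by (auto simp del: upt_Suc)
  have finish: "fst (path_map rest (state q)) = D"
    if q: "placement q" "\<And>j. j \<in> {1..p - 1} \<Longrightarrow> q j = X j" "\<And>j. j \<in> {p..r} \<Longrightarrow> q j \<in> Y ` {p..r}" for q
  proof -
    have pr: "p - 1 \<le> r" "p - 1 + 1 = p" using p by auto
    have "fst (path_map rest (state q)) = with_crosses D (Y ` {1..r})"
      unfolding rest_def
    proof (rule slide_lower_labels[OF q(1) pr(1) q(2) _ _ Y_less _ Y_noncore])
      show "q j \<in> Y ` {p - 1 + 1..r}" if "j \<in> {p - 1 + 1..r}" for j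
        using q(3)[of j] that unfolding pr(2) by simp
      show "X i < X j" if "i \<in> {1..p - 1}" "j \<in> {1..p - 1}" "i < j" for i j
        using that p by (intro X_less) auto
      show "X j \<le> Y j" if "j \<in> {1..p - 1}" for j
        using K_Y[of j] that p by (auto simp: X_def)
    qed auto
    then show ?thesis by (simp only: Y_cross[symmetric] with_own_crosses)
  qed
  \<comment> \<open>In the first path the labels keep their order, in the second one label \<open>p\<close> jumps over label \<open>p + 1\<close>.\<close>
  define \<theta>1 where "\<theta>1 = rest @ replicate (gap D w (Y p)) p @ replicate (gap D (Y p) (Y (p + 1))) (p + 1)"
  define \<theta>2 where "\<theta>2 = rest @ replicate (gap D e2 (Y (p + 1))) p @ [p]"
  have Xp: "X p = w" "X (p + 1) = Y p" by (auto simp: X_def)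
  have p0p: "p0 p = w" "p0 (p + 1) = Y p" using p0[OF p(1)] p0[OF p1] Xp by auto
  have p0_notin: "p0 k \<notin> {Y p<..Y (p + 1)}" if "k \<in> {1..r}" for k
    using X_notin[of "X k"] p0[OF that] that by auto
  have Yp: "Y p < Y (p + 1)" using p Yp1 by simp
  note s1 = slide[OF p0_place p1, unfolded p0p, OF less_imp_le[OF Yp] Y_noncore[OF p1] p0_notin]
  let ?p1 = "p0(p + 1 := Y (p + 1))"
  have s2: "path_map (replicate (gap D (?p1 p) (Y p)) p) (state ?p1) = state (?p1(p := Y p)) \<and>
      placement (?p1(p := Y p))"
  proof (intro conjI slide[OF s1(2) p(1)])
    show "?p1 p \<le> Y p" "?p1 p \<le> Y p" using w p0p by auto
    show "?p1 k \<notin> {?p1 p<..Y p}" "?p1 k \<notin> {?p1 p<..Y p}" if k: "k \<in> {1..r}" for k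
    proof -
      show "?p1 k \<notin> {?p1 p<..Y p}"
      proof (cases "k = p + 1")
        case True then show ?thesis using Yp by simp
      next
        case False
        then have "noncore D (?p1 k)" using s1(2) k unfolding placement_def by blast
        moreover have "?p1 k \<noteq> Y p"
        proof
          assume "?p1 k = Y p"
          then have "p0 k = p0 (p + 1)" using False p0p by simp
          then show False using p0_place k p1 False by (auto simp: placement_def dest: inj_onD)
        qed
        ultimately show ?thesis using w_max[of "?p1 k"] p0p by auto
      qed
      then show "?p1 k \<notin> {?p1 p<..Y p}" .
    qed
  qed (use Y_noncore[OF p(1)] in auto)
  have end1: "fst (path_map \<theta>1 (label_lr D0)) = D"
  proof -
    let ?q = "?p1(p := Y p)"
    have "path_map (replicate (gap D w (Y p)) p @ replicate (gap D (Y p) (Y (p + 1))) (p + 1)) (label_lr D0) = state ?q"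
      using s1(1) s2 by (simp add: start p0p)
    moreover have "fst (path_map rest (state ?q)) = D"
    proof (rule finish)
      show "placement ?q" using s2 by simp
      show "?q j = X j" if "j \<in> {1..p - 1}" for j using that p p0[of j] by auto
      show "?q j \<in> Y ` {p..r}" if "j \<in> {p..r}" for j
      proof -
        consider "j = p" | "j = p + 1" | "p + 1 < j" using \<open>j \<in> {p..r}\<close> by force
        then show ?thesis using that p p1 p0[of j] by cases (auto simp: X_def)
      qed
    qed
    ultimately show ?thesis by (simp add: \<theta>1_def)
  qed
  \<comment> \<open>Between \<open>w\<close> and \<open>e2\<close> there are two crosses and two empty spots, and the balance is attained at \<open>e2\<close> first.\<close>
  have jump: "marked_spot (with_crosses D (p0 ` {1..r})) (p0 p) = e2"
  proof -
    have D0: "with_crosses D (p0 ` {1..r}) = D0" by (simp only: D0_def p0_image)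
    interpret d0: fin_diagram D0 using fin0 by (rule fin_diagram.intro)
    have Dw: "D0 w = Times" using labelled_Times[OF lab0 p(1)] Xp by simp
    have DY: "D0 (Y p) = Times" using labelled_Times[OF lab0 p1] Xp by simp
    have free: "D0 t \<noteq> Times" if "Y p < t" "t \<le> e2" for t
      using X_notin[of t] that e2(2) by (auto simp: D0_def with_crosses_simps)
    have low: "\<not> noncore D t \<Longrightarrow> D0 t \<noteq> Times \<and> D0 t \<noteq> Empty" for t
      by (auto simp: D0_def with_crosses_simps)
    have De: "D0 e1 = Empty" "D0 e2 = Empty"
      using X_notin[of e1] X_notin[of e2] e1 e2 by (auto simp: D0_def with_crosses_simps)
    have "marked_spot D0 w = e2"
    proof (rule d0.marked_spotI[OF Dw])
      show "w < e2" using w e1 e2 by simp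
      have "{t. w \<le> t \<and> t \<le> e2 \<and> D0 t = Times} \<subseteq> {w, Y p}"
      proof
        fix t assume t: "t \<in> {t. w \<le> t \<and> t \<le> e2 \<and> D0 t = Times}"
        then have "\<not> Y p < t" using free by auto
        moreover have "\<not> (w < t \<and> t < Y p)" using t w_max[of t] low[of t] by auto
        ultimately show "t \<in> {w, Y p}" using t by auto
      qed
      then have "cross_count D0 w e2 \<le> card {w, Y p}"
        unfolding cross_count_def by (intro card_mono) auto
      also have "\<dots> = 2" using w by simp
      also have "2 = card {e1, e2}" using e2 by simp
      also have "\<dots> \<le> empty_count D0 w e2"
        unfolding empty_count_def using De w e1 e2 by (intro card_mono) auto
      finally show "cross_count D0 w e2 \<le> empty_count D0 w e2" .
      fix u assume u: "w \<le> u" "u < e2"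
      have sub: "{t. w < t \<and> t \<le> u \<and> D0 t = Empty} \<subseteq> {e1}"
      proof
        fix t assume t: "t \<in> {t. w < t \<and> t \<le> u \<and> D0 t = Empty}"
        then have n: "noncore D t" using low[of t] by blast
        have "\<not> t < Y p" using w_max[of t] n t by auto
        moreover have "t \<noteq> Y p" using t DY by auto
        ultimately have "\<not> t < e1" using e1(4)[of t] n by linarith
        moreover have "\<not> e1 < t" using e2(4)[of t] n t u(2) by auto
        ultimately show "t \<in> {e1}" by simp
      qed
      show "empty_count D0 w u < cross_count D0 w u"
      proof (cases "u < Y p")
        case True
        then have "e1 \<notin> {t. w < t \<and> t \<le> u \<and> D0 t = Empty}" using e1 by auto
        then have "{t. w < t \<and> t \<le> u \<and> D0 t = Empty} = {}" using sub by blast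
        then have "empty_count D0 w u = 0" by (simp only: empty_count_def card.empty)
        also have "0 < cross_count D0 w u"
          unfolding cross_count_def using Dw u(1) by (subst card_gt_0_iff) auto
        finally show ?thesis .
      next
        case False
        have "empty_count D0 w u \<le> card {e1}"
          unfolding empty_count_def using sub by (intro card_mono) auto
        also have "\<dots> < card {w, Y p}" using w by simp
        also have "\<dots> \<le> cross_count D0 w u"
          unfolding cross_count_def using Dw DY False w by (intro card_mono) auto
        finally show ?thesis .
      qed
    qed
    then show ?thesis by (simp only: D0 p0p)
  qed
  note m = right_move_state[OF p0_place p(1) jump]
  let ?p2 = "p0(p := e2)"
  have s3: "path_map (replicate (gap D (?p2 p) (Y (p + 1))) p) (state ?p2) = state (?p2(p := Y (p + 1))) \<and>
      placement (?p2(p := Y (p + 1)))"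
  proof (intro conjI slide[OF m(2) p(1)])
    show "?p2 k \<notin> {?p2 p<..Y (p + 1)}" "?p2 k \<notin> {?p2 p<..Y (p + 1)}" if "k \<in> {1..r}" for k
      using p0_notin[OF that] e1 e2 by auto
  qed (use Y_noncore[OF p1] e2 in auto)
  have end2: "fst (path_map \<theta>2 (label_lr D0)) = D"
  proof -
    let ?q = "?p2(p := Y (p + 1))"
    have "path_map (replicate (gap D e2 (Y (p + 1))) p @ [p]) (label_lr D0) = state ?q"
      using m(1) s3 by (simp add: start)
    moreover have "fst (path_map rest (state ?q)) = D"
    proof (rule finish)
      show "placement ?q" using s3 by simp
      show "?q j = X j" if "j \<in> {1..p - 1}" for j using that p p0[of j] by auto
      show "?q j \<in> Y ` {p..r}" if "j \<in> {p..r}" for j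
      proof -
        consider "j = p" | "j = p + 1" | "p + 1 < j" using \<open>j \<in> {p..r}\<close> by force
        then show ?thesis using that p p1 p0[of j] by cases (auto simp: X_def)
      qed
    qed
    ultimately show ?thesis by (simp add: \<theta>2_def)
  qed
  have "gap D (Y p) (Y (p + 1)) = Suc (Suc (gap D e2 (Y (p + 1))))"
    using gap_step[OF e1(1) _ e1(3,4), of "Y (p + 1)"] gap_step[OF e2] e2 by auto
  moreover have "gap D w (Y p) = Suc (gap D (Y p) (Y p))"
    using w(2) w_max Y_noncore[OF p(1)] by (intro gap_step) auto
  ultimately have "length \<theta>1 \<noteq> length \<theta>2" by (simp add: \<theta>1_def \<theta>2_def)
  moreover have "\<theta>1 \<in> right_paths D0 D" "\<theta>2 \<in> right_paths D0 D"
  proof -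
    have "sorted rest" unfolding rest_def by (rule sorted_concat_replicate)
    moreover have below: "j \<le> p \<and> j \<le> Suc p" if "j \<in> set rest" for j
      using rest_set that by fastforce
    ultimately have "sorted \<theta>1" "sorted \<theta>2"
      unfolding \<theta>1_def \<theta>2_def sorted_append using below by (auto simp: sorted_append)
    moreover have "set \<theta>1 \<subseteq> {1..r}" "set \<theta>2 \<subseteq> {1..r}"
    proof -
      have "set rest \<subseteq> {1..r}"
        by (rule subset_trans[OF rest_set]) (use p in auto)
      then show "set \<theta>1 \<subseteq> {1..r}" "set \<theta>2 \<subseteq> {1..r}"
        unfolding \<theta>1_def \<theta>2_def using p(1) p1 by (auto simp: set_replicate_conv_if)
    qed
    ultimately show "\<theta>1 \<in> right_paths D0 D" "\<theta>2 \<in> right_paths D0 D"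
      using end1 end2 r0 by (auto simp: right_paths_def)
  qed
  ultimately show thesis
    using that[OF fin0] cards by (simp add: D0_def with_crosses_simps)
qed

section \<open>Highest weight vectors in a simple module\<close>

primrec pos :: "nat list \<Rightarrow> nat \<Rightarrow> nat" where
  "pos [] a = 0"
| "pos (x # xs) a = (if x = a then 0 else Suc (pos xs a))"

lemma pos_append: "pos (u @ w) a = (if a \<in> set u then pos u a else length u + pos w a)"
  by (induction u) auto

lemma pos_less_length: "a \<in> set u \<Longrightarrow> pos u a < length u"
  by (induction u) auto

lemma pos_inj: "a \<in> set u \<Longrightarrow> pos u a = pos u b \<Longrightarrow> a = b"
  by (induction u) (auto split: if_splits)

definition before :: "nat list \<Rightarrow> nat \<Rightarrow> nat \<Rightarrow> bool" where
  "before \<sigma> a b \<longleftrightarrow> a \<in> set \<sigma> \<and> b \<in> set \<sigma> \<and> pos \<sigma> a < pos \<sigma> b"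

lemma before_linear: "a \<in> set \<sigma> \<Longrightarrow> b \<in> set \<sigma> \<Longrightarrow> a \<noteq> b \<Longrightarrow> before \<sigma> a b \<or> before \<sigma> b a"
  using pos_inj[of a \<sigma> b] by (cases "pos \<sigma> a" "pos \<sigma> b" rule: linorder_cases) (auto simp: before_def)

text \<open>
  Exchanging two neighbours changes the order of this pair only, and no element lies between them.
\<close>

lemma before_adjacent:
  assumes "distinct (u @ a # b # z)"
  shows "before (u @ a # b # z) a b"
    and "before (u @ a # b # z) c b \<Longrightarrow> c \<noteq> a \<Longrightarrow> before (u @ a # b # z) c a"
    and "before (u @ a # b # z) a d \<Longrightarrow> d \<noteq> b \<Longrightarrow> before (u @ a # b # z) b d"
    and "before (u @ b # a # z) c d \<Longrightarrow> (c, d) \<noteq> (b, a) \<Longrightarrow>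
      before (u @ a # b # z) c d \<and> (c, d) \<noteq> (a, b)"
proof -
  have ab: "a \<notin> set u" "b \<notin> set u" "a \<noteq> b" using assms by auto
  have P: "pos (u @ a # b # z) x = (if x \<in> set u then pos u x else if x = a then length u
      else if x = b then Suc (length u) else Suc (Suc (length u + pos z x)))"
    and P': "pos (u @ b # a # z) x = (if x \<in> set u then pos u x else if x = b then length u
      else if x = a then Suc (length u) else Suc (Suc (length u + pos z x)))" for x
    by (auto simp: pos_append)
  have L: "x \<in> set u \<Longrightarrow> pos u x < length u" for x by (rule pos_less_length)
  show "before (u @ a # b # z) a b"
    using ab by (simp add: before_def P)
  show "before (u @ a # b # z) c a" if "before (u @ a # b # z) c b" "c \<noteq> a"
    using that ab L[of c] by (cases "c \<in> set u"; cases "c = b") (simp_all add: before_def P)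
  show "before (u @ a # b # z) b d" if "before (u @ a # b # z) a d" "d \<noteq> b"
    using that ab L[of d] by (cases "d \<in> set u"; cases "d = a") (simp_all add: before_def P)
  show "before (u @ a # b # z) c d \<and> (c, d) \<noteq> (a, b)"
    if swapped: "before (u @ b # a # z) c d" "(c, d) \<noteq> (b, a)"
  proof -
    have other: "pos (u @ b # a # z) x = pos (u @ a # b # z) x" if "x \<noteq> a" "x \<noteq> b" for x
      using that by (simp only: P P' if_False)
    have far: "pos (u @ a # b # z) x < length u \<or> Suc (length u) < pos (u @ a # b # z) x"
      if "x \<noteq> a" "x \<noteq> b" for x
      using that L[of x] by (simp add: P)
    have at: "pos (u @ a # b # z) a = length u" "pos (u @ a # b # z) b = Suc (length u)"
      "pos (u @ b # a # z) a = Suc (length u)" "pos (u @ b # a # z) b = length u"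
      using ab by (simp_all add: P P')
    have lt: "pos (u @ b # a # z) c < pos (u @ b # a # z) d" and cd: "c \<in> set (u @ a # b # z)" "d \<in> set (u @ a # b # z)"
      using swapped(1) by (auto simp: before_def)
    have "pos (u @ a # b # z) c < pos (u @ a # b # z) d \<and> (c, d) \<noteq> (a, b)"
    proof (cases "c = a \<or> c = b")
      case True
      then show ?thesis
        using lt at swapped(2) far[of d] other[of d] by (cases "d = a \<or> d = b") auto
    next
      case False
      then show ?thesis
        using lt at far[of c] other[of c] other[of d] by (cases "d = a \<or> d = b") auto
    qed
    with cd show ?thesis unfolding before_def by blast
  qed
qed

text \<open>
  Neighbouring transpositions generate all permutations.
\<close>

lemma swap_invariant_perm:
  assumes swap: "\<And>u p q z. Q (u @ p # q # z) \<Longrightarrow> mset (u @ p # q # z) = mset w \<Longrightarrow> Q (u @ q # p # z)"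
    and "mset w' = mset w" "Q w'"
  shows "Q w"
proof -
  have front: "Q (v @ p # u @ z)" if "Q (v @ u @ p # z)" "mset (v @ u @ p # z) = mset w" for v u p z
    using that
  proof (induction u arbitrary: z rule: rev_induct)
    case (snoc q u)
    have "Q ((v @ u) @ p # q # z)"
      by (rule swap[of "v @ u" q p z]) (use snoc.prems in simp_all)
    then show ?case using snoc.IH[of "q # z"] snoc.prems by (simp add: add_mset_commute)
  qed simp
  have "Q (v @ y)" if "Q (v @ y')" "mset y' = mset y" "mset (v @ y) = mset w" for v y y'
    using that
  proof (induction y arbitrary: v y')
    case (Cons p y)
    then have "p \<in> set y'" by (metis list.set_intros(1) set_mset_mset)
    then obtain u z where y': "y' = u @ p # z" by (meson split_list)
    have "Q ((v @ [p]) @ u @ z)"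
      using Cons.prems y' by (simp add: front)
    then show ?case
      using Cons.IH[of "v @ [p]" "u @ z"] Cons.prems y' by simp
  qed simp
  from this[of "[]" w' w] assms(2,3) show ?thesis by simp
qed

text \<open>
  The action of the matrix units \<open>X a b\<close> of \<open>gl(m|n)\<close> on a superspace with even part \<open>G0\<close> and odd part
  \<open>G1\<close>. The last assumption is the superbracket of two matrix units, solved for the first product.
\<close>

locale gl_action = vector_space scale
  for scale :: "complex \<Rightarrow> 'v::ab_group_add \<Rightarrow> 'v" (infixr \<open>*s\<close> 75) +
  fixes G0 G1 :: "'v set" and X :: "nat \<Rightarrow> nat \<Rightarrow> 'v \<Rightarrow> 'v" and m n :: nat
  assumes subspace_G: "subspace (G0)" "subspace (G1)"
    and G_disjoint: "G0 \<inter> G1 = {0}"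
    and X_add: "\<And>a b v w. \<lbrakk>a < m + n; b < m + n; v \<in> {v + w | v w. v \<in> G0 \<and> w \<in> G1}; w \<in> {v + w | v w. v \<in> G0 \<and> w \<in> G1}\<rbrakk>
      \<Longrightarrow> X a b (v + w) = X a b v + X a b w"
    and X_scale: "\<And>a b c v. \<lbrakk>a < m + n; b < m + n; v \<in> {v + w | v w. v \<in> G0 \<and> w \<in> G1}\<rbrakk>
      \<Longrightarrow> X a b (c *s v) = c *s X a b v"
    and X_even: "\<And>a b. \<lbrakk>a < m + n; b < m + n; (a < m) = (b < m)\<rbrakk> \<Longrightarrow> X a b ` G0 \<subseteq> G0 \<and> X a b ` G1 \<subseteq> G1"
    and X_odd: "\<And>a b. \<lbrakk>a < m + n; b < m + n; (a < m) \<noteq> (b < m)\<rbrakk> \<Longrightarrow> X a b ` G0 \<subseteq> G1 \<and> X a b ` G1 \<subseteq> G0"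
    and X_comm: "\<And>a b c d v. \<lbrakk>a < m + n; b < m + n; c < m + n; d < m + n; v \<in> {v + w | v w. v \<in> G0 \<and> w \<in> G1}\<rbrakk>
      \<Longrightarrow> X a b (X c d v) =
        (if (a < m) \<noteq> (b < m) \<and> (c < m) \<noteq> (d < m) then - 1 else 1) *s X c d (X a b v) +
        (if b = c then X a d v else 0) -
        (if (a < m) \<noteq> (b < m) \<and> (c < m) \<noteq> (d < m) then - 1 else 1) *s (if d = a then X c b v else 0)"
begin

definition V :: "'v set" where
  "V = {v + w | v w. v \<in> G0 \<and> w \<in> G1}"

definition homogeneous :: "'v \<Rightarrow> bool" where
  "homogeneous v \<longleftrightarrow> v \<in> G0 \<or> v \<in> G1"

abbreviation N :: nat where "N \<equiv> m + n"

definition super_sign :: "nat \<Rightarrow> nat \<Rightarrow> nat \<Rightarrow> nat \<Rightarrow> complex" where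
  "super_sign a b c d = (if (a < m) \<noteq> (b < m) \<and> (c < m) \<noteq> (d < m) then - 1 else 1)"

lemma X_comm':
  "\<lbrakk>a < N; b < N; c < N; d < N; v \<in> V\<rbrakk> \<Longrightarrow> X a b (X c d v) =
     super_sign a b c d *s X c d (X a b v) + (if b = c then X a d v else 0) -
     super_sign a b c d *s (if d = a then X c b v else 0)"
  unfolding V_def super_sign_def by (rule X_comm)

lemma subspace_V: "subspace V"
  unfolding V_def using subspace_sums[OF subspace_G] by simp

lemma homogeneous_V: "homogeneous v \<Longrightarrow> v \<in> V"
  unfolding homogeneous_def V_def using subspace_0[OF subspace_G(1)] subspace_0[OF subspace_G(2)]
  by (metis (mono_tags, lifting) add.left_neutral add.right_neutral mem_Collect_eq)

lemma homogeneous_X: "homogeneous v \<Longrightarrow> a < N \<Longrightarrow> b < N \<Longrightarrow> homogeneous (X a b v)"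
  unfolding homogeneous_def using X_even[of a b] X_odd[of a b] by blast

lemma add_X: "a < N \<Longrightarrow> b < N \<Longrightarrow> v \<in> V \<Longrightarrow> w \<in> V \<Longrightarrow> X a b (v + w) = X a b v + X a b w"
  and scale_X: "a < N \<Longrightarrow> b < N \<Longrightarrow> v \<in> V \<Longrightarrow> X a b (c *s v) = c *s X a b v"
  unfolding V_def by (fact X_add X_scale)+

lemma X_V: "a < N \<Longrightarrow> b < N \<Longrightarrow> v \<in> V \<Longrightarrow> X a b v \<in> V"
proof -
  assume a: "a < N" "b < N" "v \<in> V"
  then obtain v0 v1 where v: "v = v0 + v1" "v0 \<in> G0" "v1 \<in> G1" by (auto simp: V_def)
  then have h: "homogeneous v0" "homogeneous v1" by (auto simp: homogeneous_def)
  then show ?thesis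
    using a v(1) by (simp add: add_X homogeneous_V homogeneous_X subspace_add[OF subspace_V])
qed

lemmas V_closed = X_V subspace_add[OF subspace_V] subspace_diff[OF subspace_V]
  subspace_scale[OF subspace_V] subspace_0[OF subspace_V]

lemma X_0 [simp]: "a < N \<Longrightarrow> b < N \<Longrightarrow> X a b 0 = 0"
  using scale_X[of a b 0 0] V_closed(5) by simp

lemma span_V: "S \<subseteq> V \<Longrightarrow> span S \<subseteq> V"
  by (rule span_minimal[OF _ subspace_V])

lemma X_span:
  assumes "a < N" "b < N" "S \<subseteq> V" "subspace W" "\<And>s. s \<in> S \<Longrightarrow> X a b s \<in> W" "u \<in> span S"
  shows "X a b u \<in> W"
proof -
  have "u \<in> V \<and> X a b u \<in> W"
    using assms(6)
  proof (induction rule: span_induct_alt)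
    case base
    then show ?case using V_closed(5) assms by (simp add: subspace_0)
  next
    case (step c x y)
    then have "x \<in> V" "y \<in> V" "X a b x \<in> W" "X a b y \<in> W" using assms by auto
    then show ?case using assms(1,2,4)
      by (simp add: V_closed add_X scale_X subspace_add subspace_scale)
  qed
  then show ?thesis ..
qed

text \<open>
  The first letter of the word acts last.
\<close>

definition word_act :: "(nat \<times> nat) list \<Rightarrow> 'v \<Rightarrow> 'v" where
  "word_act ws v = foldr (\<lambda>(a, b). X a b) ws v"

lemma word_act_simps [simp]: "word_act [] v = v" "word_act ((a, b) # ws) v = X a b (word_act ws v)"
  "word_act (ws @ ws') v = word_act ws (word_act ws' v)"
  by (simp_all add: word_act_def)

definition units :: "(nat \<times> nat) set" where
  "units = {..<N} \<times> {..<N}"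

lemma homogeneous_word_act: "homogeneous v \<Longrightarrow> ws \<in> lists units \<Longrightarrow> homogeneous (word_act ws v)"
  by (induction ws) (auto simp: units_def homogeneous_X)

lemma word_act_V: "v \<in> V \<Longrightarrow> ws \<in> lists units \<Longrightarrow> word_act ws v \<in> V"
  by (induction ws) (auto simp: units_def X_V)

definition graded :: "'v set \<Rightarrow> bool" where
  "graded W \<longleftrightarrow> W = {v + w | v w. v \<in> W \<inter> G0 \<and> w \<in> W \<inter> G1}"

lemma graded_span:
  assumes "\<And>s. s \<in> S \<Longrightarrow> homogeneous s"
  shows "graded (span S)"
proof -
  have z: "0 \<in> G0" "0 \<in> G1" using subspace_G by (auto intro: subspace_0)
  have "\<exists>v w. u = v + w \<and> v \<in> span S \<inter> G0 \<and> w \<in> span S \<inter> G1" if "u \<in> span S" for u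
    using that
  proof (induction rule: span_induct_alt)
    case base
    show ?case using z by (intro exI[of _ 0]) (auto simp: span_zero)
  next
    case (step c x y)
    then obtain v w where y: "y = v + w" "v \<in> span S \<inter> G0" "w \<in> span S \<inter> G1" by blast
    have span: "c *s x + v \<in> span S" "c *s x + w \<in> span S"
      using y step(1) by (simp_all add: span_add span_scale span_base)
    consider "x \<in> G0" | "x \<in> G1" using assms[OF step(1)] by (auto simp: homogeneous_def)
    then show ?case
    proof cases
      case 1
      then have "c *s x + v \<in> span S \<inter> G0"
        using y(2) span subspace_G(1) by (simp add: subspace_add subspace_scale)
      then show ?thesis using y by (intro exI[of _ "c *s x + v"] exI[of _ w]) (simp add: add.assoc)
    next
      case 2
      then have "c *s x + w \<in> span S \<inter> G1"
        using y(3) span subspace_G(2) by (simp add: subspace_add subspace_scale)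
      then show ?thesis using y by (intro exI[of _ v] exI[of _ "c *s x + w"]) (simp add: algebra_simps)
    qed
  qed
  then show ?thesis unfolding graded_def by (auto intro: span_add)
qed

definition stable :: "'v set \<Rightarrow> bool" where
  "stable W \<longleftrightarrow> subspace W \<and> graded W \<and> (\<forall>a<N. \<forall>b<N. \<forall>w\<in>W. X a b w \<in> W)"

definition weight_vector :: "weight \<Rightarrow> 'v \<Rightarrow> bool" where
  "weight_vector \<mu> v \<longleftrightarrow> v \<in> V \<and> (\<forall>a<N. X a a v = \<mu> a *s v)"

lemma weight_vector_X:
  assumes "weight_vector \<mu> v" "c < N" "d < N"
  shows "weight_vector (\<mu> + eps c - eps d) (X c d v)"
  unfolding weight_vector_def
proof (intro conjI allI impI)
  show "X c d v \<in> V" using assms by (auto simp: weight_vector_def X_V)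
  fix a assume a: "a < N"
  have v: "v \<in> V" "X a a v = \<mu> a *s v" using assms a by (auto simp: weight_vector_def)
  have "X a a (X c d v) = X c d (X a a v) + (if a = c then X a d v else 0) - (if d = a then X c a v else 0)"
    using X_comm'[of a a c d v] a assms v by (simp add: super_sign_def)
  also have "\<dots> = (\<mu> + eps c - eps d) a *s X c d v"
    using assms v by (auto simp: scale_X eps_def algebra_simps)
  finally show "X a a (X c d v) = (\<mu> + eps c - eps d) a *s X c d v" .
qed

text \<open>
  Highest weight vectors are considered for arbitrary orders of the \<open>m + n\<close> coordinates. Orders that
  also permute the \<open>\<epsilon>\<close>'s or the \<open>\<delta>\<close>'s among themselves occur when negative even root vectors are shown to
  act nilpotently.
\<close>

definition hwv :: "nat list \<Rightarrow> weight \<Rightarrow> 'v \<Rightarrow> bool" where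
  "hwv \<sigma> \<mu> v \<longleftrightarrow> homogeneous v \<and> v \<noteq> 0 \<and> weight_vector \<mu> v \<and>
     (\<forall>a b. before \<sigma> a b \<longrightarrow> X a b v = 0)"

definition ordering :: "nat list \<Rightarrow> bool" where
  "ordering \<sigma> \<longleftrightarrow> distinct \<sigma> \<and> set \<sigma> = {..<N}"

definition lower :: "nat list \<Rightarrow> (nat \<times> nat) set" where
  "lower \<sigma> = {(a, b). before \<sigma> b a}"

lemma lower_units: "ordering \<sigma> \<Longrightarrow> lower \<sigma> \<subseteq> units"
  by (auto simp: lower_def units_def ordering_def before_def)

text \<open>
  Any matrix unit can be commuted through a word of lowering operators by induction on its length,
  because the commutators are again matrix units.
\<close>

lemma stable_lower_span:
  assumes "ordering \<sigma>" "hwv \<sigma> \<mu> v"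
  shows "stable (span ((\<lambda>ws. word_act ws v) ` lists (lower \<sigma>)))" (is "stable (span ?S)")
proof -
  have hv: "homogeneous v" and vV: "v \<in> V" using assms(2) by (auto simp: hwv_def homogeneous_V)
  have sub: "lists (lower \<sigma>) \<subseteq> lists units" using lower_units[OF assms(1)] by (rule lists_mono)
  have hS: "homogeneous s" if "s \<in> ?S" for s using that sub hv by (auto intro: homogeneous_word_act)
  then have SV: "?S \<subseteq> V" using homogeneous_V by blast
  have lowerW: "X a b u \<in> span ?S" if "(a, b) \<in> lower \<sigma>" "u \<in> span ?S" for a b u
  proof (rule X_span[OF _ _ SV subspace_span _ that(2)])
    show "a < N" "b < N" using that lower_units[OF assms(1)] by (auto simp: units_def)
    show "X a b s \<in> span ?S" if "s \<in> ?S" for s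
    proof -
      from that obtain ws where "s = word_act ws v" "ws \<in> lists (lower \<sigma>)" by blast
      then have "X a b s = word_act ((a, b) # ws) v" "(a, b) # ws \<in> lists (lower \<sigma>)"
        using \<open>(a, b) \<in> lower \<sigma>\<close> by auto
      then show ?thesis by (intro span_base) blast
    qed
  qed
  have word: "X a b (word_act ws v) \<in> span ?S" if "ws \<in> lists (lower \<sigma>)" "a < N" "b < N" for a b ws
    using that
  proof (induction ws arbitrary: a b rule: list.induct)
    case Nil
    have vS: "v \<in> span ?S" by (rule span_base) (auto intro: image_eqI[of _ _ "[]"])
    have "a \<in> set \<sigma>" "b \<in> set \<sigma>" using Nil assms(1) by (auto simp: ordering_def)
    then consider "a = b" | "before \<sigma> a b" | "(a, b) \<in> lower \<sigma>"
      using before_linear by (auto simp: lower_def)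
    then show ?case
    proof cases
      case 1
      then have "X a b v = \<mu> a *s v" using assms(2) Nil by (simp add: hwv_def weight_vector_def)
      then show ?thesis using vS by (simp add: span_scale)
    next
      case 2
      then have "X a b v = 0" using assms(2) by (simp add: hwv_def)
      then show ?thesis by (simp add: span_zero)
    next
      case 3
      then show ?thesis using lowerW vS by simp
    qed
  next
    case (Cons p ws)
    obtain c d where p: "p = (c, d)" by force
    have cd: "(c, d) \<in> lower \<sigma>" "c < N" "d < N" "ws \<in> lists (lower \<sigma>)"
      using Cons p lower_units[OF assms(1)] by (auto simp: units_def)
    have V: "word_act ws v \<in> V" using cd sub vV by (intro word_act_V) auto
    have IH: "X a b (word_act ws v) \<in> span ?S" if "a < N" "b < N" for a b
      using Cons.IH cd(4) that by blast
    have "X c d (X a b (word_act ws v)) \<in> span ?S"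
      using IH[OF Cons.prems(2,3)] by (rule lowerW[OF cd(1)])
    moreover have "(if b = c then X a d (word_act ws v) else 0) \<in> span ?S"
      "(if d = a then X c b (word_act ws v) else 0) \<in> span ?S"
      using IH cd Cons.prems(2,3) by (simp_all add: span_zero)
    ultimately show ?case
      unfolding p word_act_simps X_comm'[OF Cons.prems(2,3) cd(2,3) V]
      by (intro span_add span_diff span_scale)
  qed
  show ?thesis unfolding stable_def
  proof (intro conjI allI impI ballI)
    show "subspace (span ?S)" by (rule subspace_span)
    show "graded (span ?S)" by (rule graded_span) (rule hS)
    show "X a b w \<in> span ?S" if "a < N" "b < N" "w \<in> span ?S" for a b w
    proof (rule X_span[OF that(1,2) SV subspace_span _ that(3)])
      show "X a b s \<in> span ?S" if "s \<in> ?S" for s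
        using that word \<open>a < N\<close> \<open>b < N\<close> by auto
    qed
  qed
qed

text \<open>
  The eigenvalue on a vector of weight \<open>\<mu>\<close> of the diagonal matrix with entries \<open>- pos \<sigma> a\<close>. Lowering
  operators decrease it by positive integers.
\<close>

definition height :: "nat list \<Rightarrow> weight \<Rightarrow> complex" where
  "height \<sigma> \<mu> = (\<Sum>a<N. - of_nat (pos \<sigma> a) * \<mu> a)"

definition height_op :: "nat list \<Rightarrow> 'v \<Rightarrow> 'v" where
  "height_op \<sigma> u = (\<Sum>a<N. (- of_nat (pos \<sigma> a)) *s X a a u)"

lemma height_op_add: "u \<in> V \<Longrightarrow> w \<in> V \<Longrightarrow> height_op \<sigma> (u + w) = height_op \<sigma> u + height_op \<sigma> w"
  unfolding height_op_def sum.distrib[symmetric] by (intro sum.cong) (simp_all add: add_X scale_right_distrib)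

lemma height_op_scale: "u \<in> V \<Longrightarrow> height_op \<sigma> (c *s u) = c *s height_op \<sigma> u"
  unfolding height_op_def scale_sum_right by (intro sum.cong) (simp_all add: scale_X mult.commute)

lemma height_op_V: "u \<in> V \<Longrightarrow> height_op \<sigma> u \<in> V"
  unfolding height_op_def by (intro subspace_sum[OF subspace_V]) (simp add: V_closed subspace_neg[OF subspace_V])

lemma height_op_weight_vector: "weight_vector \<mu> u \<Longrightarrow> height_op \<sigma> u = height \<sigma> \<mu> *s u"
  unfolding height_op_def height_def scale_sum_left by (intro sum.cong) (auto simp: weight_vector_def)

text \<open>
  The product of \<open>height_op - (d - i)\<close> for \<open>i < k\<close>. It annihilates the eigenvectors with eigenvalue
  \<open>d - i\<close>, \<open>i < k\<close>, and acts by a nonzero number on eigenvectors with other eigenvalues.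
\<close>

primrec ladder :: "nat list \<Rightarrow> complex \<Rightarrow> nat \<Rightarrow> 'v \<Rightarrow> 'v" where
  "ladder \<sigma> d 0 u = u"
| "ladder \<sigma> d (Suc k) u = height_op \<sigma> (ladder \<sigma> d k u) - (d - of_nat k) *s ladder \<sigma> d k u"

lemma ladder_V: "u \<in> V \<Longrightarrow> ladder \<sigma> d k u \<in> V"
  by (induction k) (auto intro: V_closed height_op_V)

lemma ladder_add: "u \<in> V \<Longrightarrow> w \<in> V \<Longrightarrow> ladder \<sigma> d k (u + w) = ladder \<sigma> d k u + ladder \<sigma> d k w"
  by (induction k) (simp_all add: height_op_add ladder_V scale_right_distrib)

lemma ladder_scale: "u \<in> V \<Longrightarrow> ladder \<sigma> d k (c *s u) = c *s ladder \<sigma> d k u"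
  by (induction k) (simp_all add: height_op_scale ladder_V scale_right_diff_distrib mult.commute)

lemma height_op_0 [simp]: "height_op \<sigma> 0 = 0"
  by (simp add: height_op_def)

lemma ladder_weight_vector:
  assumes "weight_vector \<mu> u"
  shows "ladder \<sigma> d k u = (\<Prod>i<k. height \<sigma> \<mu> - d + of_nat i) *s u"
proof (induction k)
  case (Suc k)
  have "u \<in> V" using assms by (simp add: weight_vector_def)
  then show ?case
    by (simp add: Suc.IH height_op_scale height_op_weight_vector[OF assms] algebra_simps flip: scale_left_diff_distrib scale_left_distrib)
qed simp

text \<open>
  This subspace contains the eigenvectors with eigenvalues \<open>d\<close>, \<open>d - 1\<close>, and so on. It replaces a
  decomposition of the module into eigenspaces.
\<close>

definition below :: "nat list \<Rightarrow> complex \<Rightarrow> 'v set" where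
  "below \<sigma> d = {u \<in> V. \<exists>k. ladder \<sigma> d k u = 0}"

lemma ladder_zero_mono: "ladder \<sigma> d k u = 0 \<Longrightarrow> k \<le> l \<Longrightarrow> ladder \<sigma> d l u = 0"
  by (induction l) (auto simp: le_Suc_eq)

lemma subspace_below: "subspace (below \<sigma> d)"
proof (rule subspaceI)
  show "0 \<in> below \<sigma> d" by (auto simp: below_def V_closed intro: exI[of _ 0])
  show "c *s u \<in> below \<sigma> d" if "u \<in> below \<sigma> d" for c u
    using that by (auto simp: below_def V_closed ladder_scale)
  show "u + w \<in> below \<sigma> d" if uw: "u \<in> below \<sigma> d" "w \<in> below \<sigma> d" for u w
  proof -
    obtain k l where "ladder \<sigma> d k u = 0" "ladder \<sigma> d l w = 0" using uw by (auto simp: below_def)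
    then have "ladder \<sigma> d (max k l) u = 0" "ladder \<sigma> d (max k l) w = 0"
      by (auto intro: ladder_zero_mono)
    then have "ladder \<sigma> d (max k l) (u + w) = 0"
      using uw by (simp add: ladder_add below_def)
    then show ?thesis using uw by (auto simp: below_def V_closed)
  qed
qed

lemma below_weight_vector:
  assumes "weight_vector \<mu> u" "u \<noteq> 0"
  shows "u \<in> below \<sigma> d \<longleftrightarrow> (\<exists>i::nat. height \<sigma> \<mu> = d - of_nat i)"
proof
  assume "u \<in> below \<sigma> d"
  then obtain k where "ladder \<sigma> d k u = 0" by (auto simp: below_def)
  then obtain i where "height \<sigma> \<mu> - d + of_nat i = 0"
    using assms(2) by (auto simp: ladder_weight_vector[OF assms(1)])
  then show "\<exists>i::nat. height \<sigma> \<mu> = d - of_nat i"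
    by (intro exI[of _ i]) (simp add: algebra_simps)
next
  assume "\<exists>i::nat. height \<sigma> \<mu> = d - of_nat i"
  then obtain i :: nat where "height \<sigma> \<mu> = d - of_nat i" by blast
  then have "ladder \<sigma> d (Suc i) u = 0"
    by (simp add: ladder_weight_vector[OF assms(1)] del: ladder.simps)
  then show "u \<in> below \<sigma> d"
    unfolding below_def using assms(1)
    by (intro CollectI conjI exI[of _ "Suc i"]) (simp_all add: weight_vector_def del: ladder.simps)
qed

lemma height_lower:
  assumes "ordering \<sigma>" "(c, d) \<in> lower \<sigma>"
  shows "height \<sigma> (\<mu> + eps c - eps d) = height \<sigma> \<mu> - of_nat (pos \<sigma> c - pos \<sigma> d)"
    and "0 < pos \<sigma> c - pos \<sigma> d"
proof -
  have cd: "c < N" "d < N" "pos \<sigma> d < pos \<sigma> c"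
    using assms by (auto simp: lower_def before_def ordering_def)
  have "height \<sigma> (\<mu> + eps c - eps d) =
      height \<sigma> \<mu> + (\<Sum>a<N. if a = c then - of_nat (pos \<sigma> a) else 0) - (\<Sum>a<N. if a = d then - of_nat (pos \<sigma> a) else 0)"
    unfolding height_def sum.distrib[symmetric] sum_subtractf[symmetric]
    by (intro sum.cong) (auto simp: eps_def algebra_simps)
  then show "height \<sigma> (\<mu> + eps c - eps d) = height \<sigma> \<mu> - of_nat (pos \<sigma> c - pos \<sigma> d)"
    using cd by (simp add: of_nat_diff)
  show "0 < pos \<sigma> c - pos \<sigma> d" using cd by simp
qed

lemma lower_word_weight:
  assumes "ordering \<sigma>" "weight_vector \<mu> v" "ws \<in> lists (lower \<sigma>)"
  shows "\<exists>\<nu> i. weight_vector \<nu> (word_act ws v) \<and> height \<sigma> \<nu> = height \<sigma> \<mu> - of_nat i \<and> (ws \<noteq> [] \<longrightarrow> 0 < i)"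
  using assms(3)
proof (induction ws rule: list.induct)
  case Nil
  then show ?case using assms(2) by (intro exI[of _ \<mu>] exI[of _ 0]) simp
next
  case (Cons p ws)
  obtain c d where p: "p = (c, d)" by force
  have cd: "(c, d) \<in> lower \<sigma>" "c < N" "d < N"
    using Cons.prems p lower_units[OF assms(1)] by (auto simp: units_def)
  obtain \<nu> i where \<nu>: "weight_vector \<nu> (word_act ws v)" "height \<sigma> \<nu> = height \<sigma> \<mu> - of_nat i"
    using Cons by auto
  define h where "h = pos \<sigma> c - pos \<sigma> d"
  have "height \<sigma> (\<nu> + eps c - eps d) = height \<sigma> \<mu> - of_nat (i + h)" "0 < i + h"
    using height_lower(1)[OF assms(1) cd(1), of \<nu>] height_lower(2)[OF assms(1) cd(1)] \<nu>(2)
    unfolding h_def[symmetric] by simp_all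
  with weight_vector_X[OF \<nu>(1) cd(2,3)] show ?case
    unfolding p word_act_simps by blast
qed

end

locale simple_gl_action = gl_action +
  assumes simple: "\<And>W. stable W \<Longrightarrow> W \<noteq> {0} \<Longrightarrow> W = V"
begin

lemma V_lower_span:
  assumes "ordering \<sigma>" "hwv \<sigma> \<mu> v"
  shows "V = span ((\<lambda>ws. word_act ws v) ` lists (lower \<sigma>))"
proof -
  have "v \<in> span ((\<lambda>ws. word_act ws v) ` lists (lower \<sigma>))"
    by (rule span_base) (auto intro: image_eqI[of _ _ "[]"])
  moreover have "v \<noteq> 0" using assms(2) by (simp add: hwv_def)
  ultimately show ?thesis using simple[OF stable_lower_span[OF assms]] by blast
qed

text \<open>
  The module is spanned by vectors whose heights are at most that of the highest weight vector.
\<close>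

lemma height_le:
  assumes "ordering \<sigma>" "hwv \<sigma> \<mu> v" "weight_vector \<mu>' w" "w \<noteq> 0"
  shows "\<exists>i::nat. height \<sigma> \<mu>' = height \<sigma> \<mu> - of_nat i"
proof -
  have v: "weight_vector \<mu> v" using assms(2) by (simp add: hwv_def)
  have "word_act ws v \<in> below \<sigma> (height \<sigma> \<mu>)" if "ws \<in> lists (lower \<sigma>)" for ws
  proof (cases "word_act ws v = 0")
    case False
    with lower_word_weight[OF assms(1) v that] below_weight_vector show ?thesis by blast
  qed (simp add: subspace_0[OF subspace_below])
  then have "V \<subseteq> below \<sigma> (height \<sigma> \<mu>)"
    unfolding V_lower_span[OF assms(1,2)] by (intro span_minimal subspace_below) auto
  then have "w \<in> below \<sigma> (height \<sigma> \<mu>)"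
    using assms(3) by (auto simp: weight_vector_def)
  then show ?thesis using below_weight_vector[OF assms(3,4)] by simp
qed

text \<open>
  Each of two highest weight vectors is at most as high as the other one, so the heights agree. The
  component of \<open>w\<close> outside the line of \<open>v\<close> is spanned by lower vectors and has the same height as \<open>v\<close>,
  hence it vanishes.
\<close>

theorem hwv_unique:
  assumes "ordering \<sigma>" "hwv \<sigma> \<mu> v" "hwv \<sigma> \<mu>' w" "a < N"
  shows "\<mu>' a = \<mu> a"
proof -
  have v: "weight_vector \<mu> v" "v \<noteq> 0" and w: "weight_vector \<mu>' w" "w \<noteq> 0"
    using assms by (auto simp: hwv_def)
  have vV: "v \<in> V" "w \<in> V" using v w by (auto simp: weight_vector_def)
  obtain i j :: nat where ij: "height \<sigma> \<mu>' = height \<sigma> \<mu> - of_nat i" "height \<sigma> \<mu> = height \<sigma> \<mu>' - of_nat j"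
    using height_le[OF assms(1,2) w] height_le[OF assms(1,3) v] by blast
  have "of_nat i = height \<sigma> \<mu> - height \<sigma> \<mu>'" "of_nat j = height \<sigma> \<mu>' - height \<sigma> \<mu>"
    by (simp add: ij(1)) (subst ij(2), simp)
  then have "of_nat (i + j) = (0 :: complex)" by simp
  then have "i + j = 0" by (simp only: of_nat_eq_0_iff)
  then have h: "height \<sigma> \<mu>' = height \<sigma> \<mu>" using \<open>height \<sigma> \<mu>' = height \<sigma> \<mu> - of_nat i\<close> by simp
  have "(\<lambda>ws. word_act ws v) ` lists (lower \<sigma>) = insert v ((\<lambda>ws. word_act ws v) ` (lists (lower \<sigma>) - {[]}))"
    by (auto intro: image_eqI[of _ _ "[]"])
  then have "w \<in> span (insert v ((\<lambda>ws. word_act ws v) ` (lists (lower \<sigma>) - {[]})))"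
    using vV(2) V_lower_span[OF assms(1,2)] by simp
  then obtain c where c: "w - c *s v \<in> span ((\<lambda>ws. word_act ws v) ` (lists (lower \<sigma>) - {[]}))"
    by (auto simp: span_breakdown_eq)
  have "word_act ws v \<in> below \<sigma> (height \<sigma> \<mu> - 1)" if ws: "ws \<in> lists (lower \<sigma>)" "ws \<noteq> []" for ws
  proof (cases "word_act ws v = 0")
    case False
    obtain \<nu> i where \<nu>: "weight_vector \<nu> (word_act ws v)" "height \<sigma> \<nu> = height \<sigma> \<mu> - of_nat i" "0 < i"
      using lower_word_weight[OF assms(1) v(1) ws(1)] ws(2) by blast
    then have "height \<sigma> \<nu> = height \<sigma> \<mu> - 1 - of_nat (i - 1)" by (simp add: of_nat_diff)
    then show ?thesis using below_weight_vector[OF \<nu>(1) False] by blast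
  qed (simp add: subspace_0[OF subspace_below])
  then have "w - c *s v \<in> below \<sigma> (height \<sigma> \<mu> - 1)"
    using c span_minimal[OF _ subspace_below, of "(\<lambda>ws. word_act ws v) ` (lists (lower \<sigma>) - {[]})" \<sigma> "height \<sigma> \<mu> - 1"] by blast
  then obtain k where k: "ladder \<sigma> (height \<sigma> \<mu> - 1) k (w - c *s v) = 0" by (auto simp: below_def)
  have "ladder \<sigma> (height \<sigma> \<mu> - 1) k (w + (- c) *s v) =
      (\<Prod>i<k. 1 + of_nat i) *s (w + (- c) *s v)"
    using vV by (simp add: ladder_add ladder_scale V_closed ladder_weight_vector[OF v(1)]
        ladder_weight_vector[OF w(1)] h scale_right_distrib mult.commute del: scale_minus_left)
  moreover have "(\<Prod>i<k. 1 + of_nat i :: complex) \<noteq> 0"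
    by (simp flip: of_nat_Suc)
  ultimately have "w = c *s v" using k by simp
  then have "c \<noteq> 0" using w(2) by auto
  have "\<mu>' a *s w = \<mu> a *s w"
    using v(1) w(1) assms(4) vV \<open>w = c *s v\<close> unfolding weight_vector_def
    by (metis scale_X scale_left_commute)
  then show ?thesis using w(2) by simp
qed

end

section \<open>Odd and even reflections, dominance and finite dimension\<close>

context gl_action begin

lemma funpow_X_V: "a < N \<Longrightarrow> b < N \<Longrightarrow> v \<in> V \<Longrightarrow> (X a b ^^ j) v \<in> V"
  by (induction j) (simp_all add: X_V)

lemma funpow_X_add: "a < N \<Longrightarrow> b < N \<Longrightarrow> v \<in> V \<Longrightarrow> w \<in> V \<Longrightarrow>
    (X a b ^^ j) (v + w) = (X a b ^^ j) v + (X a b ^^ j) w"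
  by (induction j) (simp_all add: add_X funpow_X_V)

lemma funpow_X_scale: "a < N \<Longrightarrow> b < N \<Longrightarrow> v \<in> V \<Longrightarrow> (X a b ^^ j) (c *s v) = c *s (X a b ^^ j) v"
  by (induction j) (simp_all add: scale_X funpow_X_V)

lemma funpow_X_0: "a < N \<Longrightarrow> b < N \<Longrightarrow> (X a b ^^ j) 0 = 0"
  by (induction j) simp_all

lemma homogeneous_funpow_X: "a < N \<Longrightarrow> b < N \<Longrightarrow> homogeneous v \<Longrightarrow> homogeneous ((X a b ^^ j) v)"
  by (induction j) (simp_all add: homogeneous_X)

lemma weight_vector_funpow:
  assumes "weight_vector \<mu> v" "a < N" "b < N"
  shows "weight_vector (\<lambda>i. \<mu> i + of_nat j * (eps b i - eps a i)) ((X b a ^^ j) v)"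
proof (induction j)
  case (Suc j)
  have "(\<lambda>i. \<mu> i + of_nat j * (eps b i - eps a i)) + eps b - eps a =
      (\<lambda>i. \<mu> i + of_nat (Suc j) * (eps b i - eps a i))"
    by (rule ext) (simp add: algebra_simps)
  with weight_vector_X[OF Suc assms(3,2)] show ?case by simp
qed (simp add: assms)

lemma ordering_swap:
  "ordering (u @ a # b # z) \<Longrightarrow> ordering (u @ b # a # z)"
  "ordering (u @ a # b # z) \<Longrightarrow> a < N \<and> b < N \<and> a \<noteq> b"
  by (auto simp: ordering_def)

text \<open>
  For neighbours \<open>a\<close>, \<open>b\<close> the bracket with the lowering operator sends every other positive root vector
  to a positive root vector other than that of \<open>(a, b)\<close>, or to zero.
\<close>

lemma raise_funpow:
  assumes \<sigma>: "ordering (u @ a # b # z)" and v: "hwv (u @ a # b # z) \<mu> v"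
    and "before (u @ a # b # z) c d" "(c, d) \<noteq> (a, b)"
  shows "X c d ((X b a ^^ j) v) = 0"
  using assms(3,4)
proof (induction j arbitrary: c d)
  case 0
  then show ?case using v by (simp add: hwv_def)
next
  case (Suc j)
  note ab = ordering_swap(2)[OF \<sigma>]
  have dist: "distinct (u @ a # b # z)" using \<sigma> by (simp add: ordering_def)
  have cd: "c < N" "d < N" using Suc.prems \<sigma> by (auto simp: before_def ordering_def)
  have V: "(X b a ^^ j) v \<in> V" using v ab by (simp add: funpow_X_V homogeneous_V hwv_def)
  have "(if d = b then X c a ((X b a ^^ j) v) else 0) = 0"
  proof (cases "d = b")
    case True
    then have "c \<noteq> a" using Suc.prems by auto
    then have "X c a ((X b a ^^ j) v) = 0"
      using Suc.prems True ab by (intro Suc.IH before_adjacent(2)[OF dist]) auto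
    then show ?thesis by simp
  qed simp
  moreover have "(if a = c then X b d ((X b a ^^ j) v) else 0) = 0"
  proof (cases "a = c")
    case True
    then have "d \<noteq> b" using Suc.prems by auto
    then have "X b d ((X b a ^^ j) v) = 0"
      using Suc.prems True ab by (intro Suc.IH before_adjacent(3)[OF dist]) auto
    then show ?thesis by (metis True)
  qed simp
  ultimately show ?case
    using X_comm'[OF cd _ _ V, of b a] ab Suc.IH[OF Suc.prems] by simp
qed

text \<open>
  The basic formula of \<open>sl(2)\<close>.
\<close>

lemma raise_lowered:
  assumes "ordering (u @ a # b # z)" "hwv (u @ a # b # z) \<mu> v" "(a < m) = (b < m)"
  shows "X a b ((X b a ^^ Suc j) v) = (of_nat (Suc j) * (\<mu> a - \<mu> b - of_nat j)) *s (X b a ^^ j) v"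
proof (induction j)
  note ab = ordering_swap(2)[OF assms(1)]
  have v: "v \<in> V" "weight_vector \<mu> v" using assms(2) by (auto simp: hwv_def homogeneous_V)
  have step: "X a b ((X b a ^^ Suc j) v) =
      X b a (X a b ((X b a ^^ j) v)) + (\<mu> a - \<mu> b - 2 * of_nat j) *s (X b a ^^ j) v" for j
  proof -
    let ?w = "(X b a ^^ j) v"
    have w: "weight_vector (\<lambda>i. \<mu> i + of_nat j * (eps b i - eps a i)) ?w"
      using weight_vector_funpow[OF v(2)] ab by blast
    then have "?w \<in> V" "X a a ?w = (\<mu> a - of_nat j) *s ?w" "X b b ?w = (\<mu> b + of_nat j) *s ?w"
      using ab by (simp_all add: weight_vector_def eps_def)
    then have "X a b (X b a ?w) = X b a (X a b ?w) + (\<mu> a - of_nat j) *s ?w - (\<mu> b + of_nat j) *s ?w"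
      using X_comm'[of a b b a ?w] ab assms(3) by (simp add: super_sign_def)
    also have "\<dots> = X b a (X a b ?w) + (\<mu> a - \<mu> b - 2 * of_nat j) *s ?w"
      by (simp add: algebra_simps flip: scale_left_diff_distrib scale_left_distrib)
    finally show ?thesis by simp
  qed
  {
    case 0
    have "X a b v = 0" using assms(1,2) before_adjacent(1)[of u a b z] by (simp add: hwv_def ordering_def)
    then show ?case using step[of 0] ab by simp
  next
    case (Suc j)
    let ?w = "(X b a ^^ Suc j) v"
    have "X b a (X a b ?w) = (of_nat (Suc j) * (\<mu> a - \<mu> b - of_nat j)) *s ?w"
      unfolding Suc using ab v by (simp add: scale_X funpow_X_V del: of_nat_Suc)
    then have "X a b ((X b a ^^ Suc (Suc j)) v) =
        (of_nat (Suc j) * (\<mu> a - \<mu> b - of_nat j) + (\<mu> a - \<mu> b - 2 * of_nat (Suc j))) *s ?w"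
      unfolding step[of "Suc j"] by (simp only: scale_left_distrib)
    also have "of_nat (Suc j) * (\<mu> a - \<mu> b - of_nat j) + (\<mu> a - \<mu> b - 2 * of_nat (Suc j)) =
        of_nat (Suc (Suc j)) * (\<mu> a - \<mu> b - of_nat (Suc j))"
      by (simp add: algebra_simps)
    finally show ?case .
  }
qed

theorem nilpotent_imp_integral:
  assumes "ordering (u @ a # b # z)" "hwv (u @ a # b # z) \<mu> v" "(a < m) = (b < m)"
    and "(X b a ^^ j) v = 0"
  shows "\<mu> a - \<mu> b \<in> \<nat>"
proof -
  \<comment> \<open>Raising the first vanishing power gives zero, and the coefficient in the \<open>sl(2)\<close> formula must vanish.\<close>
  define l where "l = (LEAST j. (X b a ^^ j) v = 0)"
  have l: "(X b a ^^ l) v = 0" unfolding l_def using assms(4) by (rule LeastI)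
  have "v \<noteq> 0" using assms(2) by (simp add: hwv_def)
  with l obtain i where i: "l = Suc i" by (cases l) auto
  have "(X b a ^^ i) v \<noteq> 0"
    using not_less_Least[of i "\<lambda>j. (X b a ^^ j) v = 0"] i by (auto simp: l_def)
  moreover have "X a b ((X b a ^^ Suc i) v) = 0"
    using l i ordering_swap(2)[OF assms(1)] by simp
  ultimately have "of_nat (Suc i) * (\<mu> a - \<mu> b - of_nat i) = 0"
    unfolding raise_lowered[OF assms(1-3)] by simp
  then have "\<mu> a - \<mu> b = of_nat i"
    by (simp del: of_nat_Suc)
  then show ?thesis by simp
qed

lemma self_negative_imp_zero: "x = - x \<Longrightarrow> x = (0 :: 'v)"
proof -
  assume "x = - x"
  then have "x + x = 0" by (metis add.right_inverse)
  then have "2 *s x = 0"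
    using scale_left_distrib[of 1 1 x] by simp
  then show ?thesis by simp
qed

end

context simple_gl_action begin

text \<open>
  This is how vectors are shown to vanish: a singular vector of another weight is zero.
\<close>

lemma no_other_hwv:
  assumes "ordering \<sigma>" "hwv \<sigma> \<mu> v" "homogeneous w" "weight_vector \<mu>' w" "a < N" "\<mu>' a \<noteq> \<mu> a"
    and "\<And>c d. before \<sigma> c d \<Longrightarrow> X c d w = 0"
  shows "w = 0"
proof (rule ccontr)
  assume "w \<noteq> 0"
  with assms have "hwv \<sigma> \<mu>' w" by (simp add: hwv_def)
  from hwv_unique[OF assms(1,2) this assms(5)] assms(6) show False by simp
qed

text \<open>
  Since the root is isotropic, lowering twice gives zero, and raising the lowered vector multiplies \<open>v\<close>
  by \<open>\<mu> a + \<mu> b\<close>. If this number is zero the lowered vector is singular and hence zero.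
\<close>

theorem odd_reflection:
  assumes \<sigma>: "ordering (u @ a # b # z)" and v: "hwv (u @ a # b # z) \<mu> v"
    and odd: "(a < m) \<noteq> (b < m)"
  shows "\<mu> a + \<mu> b \<noteq> 0 \<Longrightarrow> hwv (u @ b # a # z) (\<mu> + eps b - eps a) (X b a v)"
    and "\<mu> a + \<mu> b = 0 \<Longrightarrow> hwv (u @ b # a # z) \<mu> v"
proof -
  note ab = ordering_swap(2)[OF \<sigma>]
  have dist: "distinct (u @ a # b # z)" using \<sigma> by (simp add: ordering_def)
  have hom: "homogeneous v" "v \<noteq> 0" and wv: "weight_vector \<mu> v"
    and kill: "before (u @ a # b # z) c d \<Longrightarrow> X c d v = 0" for c d
    using v by (auto simp: hwv_def)
  have vV: "v \<in> V" using hom by (simp add: homogeneous_V)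
  have ef: "X a b (X b a v) = (\<mu> a + \<mu> b) *s v"
  proof -
    have "X a b v = 0" using kill before_adjacent(1)[OF dist] by simp
    moreover have "X a a v = \<mu> a *s v" "X b b v = \<mu> b *s v" using wv ab by (auto simp: weight_vector_def)
    moreover have "super_sign a b b a = - 1" using odd by (auto simp: super_sign_def)
    ultimately show ?thesis using X_comm'[of a b b a v] ab vV by (simp add: scale_left_distrib)
  qed
  have ff: "X b a (X b a v) = 0"
  proof (rule self_negative_imp_zero)
    have "super_sign b a b a = - 1" using odd by (auto simp: super_sign_def)
    then show "X b a (X b a v) = - X b a (X b a v)"
      using X_comm'[of b a b a v] ab vV by simp
  qed
  have f: "homogeneous (X b a v)" "weight_vector (\<mu> + eps b - eps a) (X b a v)"
    using homogeneous_X[OF hom(1)] weight_vector_X[OF wv] ab by auto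
  have raise: "X c d (X b a v) = 0" if "before (u @ a # b # z) c d" "(c, d) \<noteq> (a, b)" for c d
    using raise_funpow[OF \<sigma> v that, of 1] by simp
  have new: "before (u @ a # b # z) c d \<and> (c, d) \<noteq> (a, b)"
    if "before (u @ b # a # z) c d" "(c, d) \<noteq> (b, a)" for c d
    using before_adjacent(4)[OF dist that] .
  show "hwv (u @ b # a # z) (\<mu> + eps b - eps a) (X b a v)" if "\<mu> a + \<mu> b \<noteq> 0"
    unfolding hwv_def
  proof (intro conjI allI impI f)
    show "X b a v \<noteq> 0" using ef that hom ab by auto
    show "X c d (X b a v) = 0" if "before (u @ b # a # z) c d" for c d
      using that ff new[OF that] raise[of c d] by (cases "(c, d) = (b, a)") auto
  qed
  show "hwv (u @ b # a # z) \<mu> v" if eq: "\<mu> a + \<mu> b = 0"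
  proof -
    have fz: "X b a v = 0"
    proof (rule no_other_hwv[OF \<sigma> v f, of a])
      show "a < N" using ab by simp
      show "(\<mu> + eps b - eps a) a \<noteq> \<mu> a" using ab by (simp add: eps_def)
      show "X c d (X b a v) = 0" if "before (u @ a # b # z) c d" for c d
        using that raise[of c d] ef eq by (cases "(c, d) = (a, b)") auto
    qed
    show ?thesis unfolding hwv_def
    proof (intro conjI allI impI hom wv)
      show "X c d v = 0" if "before (u @ b # a # z) c d" for c d
        using that fz new[OF that] kill[of c d] by (cases "(c, d) = (b, a)") auto
    qed
  qed
qed

text \<open>
  The \<open>(k + 1)\<close>-fold lowered vector is singular for the old order, the \<open>k\<close>-fold one is nonzero and
  singular for the new order.
\<close>

theorem even_reflection:
  assumes \<sigma>: "ordering (u @ a # b # z)" and v: "hwv (u @ a # b # z) \<mu> v"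
    and even: "(a < m) = (b < m)" and k: "\<mu> a - \<mu> b = of_nat k"
  shows "(X b a ^^ Suc k) v = 0"
    and "hwv (u @ b # a # z) (\<lambda>i. \<mu> i + of_nat k * (eps b i - eps a i)) ((X b a ^^ k) v)"
proof -
  note ab = ordering_swap(2)[OF \<sigma>]
  have dist: "distinct (u @ a # b # z)" using \<sigma> by (simp add: ordering_def)
  have hom: "homogeneous v" "v \<noteq> 0" and wv: "weight_vector \<mu> v"
    using v by (auto simp: hwv_def)
  note wt = weight_vector_funpow[OF wv, of a b]
  note hm = homogeneous_funpow_X[OF _ _ hom(1), of b a]
  show z: "(X b a ^^ Suc k) v = 0"
  proof (rule no_other_hwv[OF \<sigma> v])
    show "homogeneous ((X b a ^^ Suc k) v)" by (rule hm) (use ab in auto)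
    show "weight_vector (\<lambda>i. \<mu> i + of_nat (Suc k) * (eps b i - eps a i)) ((X b a ^^ Suc k) v)"
      by (rule wt) (use ab in auto)
    show "a < N" using ab by simp
    show "\<mu> a + of_nat (Suc k) * (eps b a - eps a a) \<noteq> \<mu> a"
      using ab by (simp add: eps_def del: of_nat_Suc)
    show "X c d ((X b a ^^ Suc k) v) = 0" if "before (u @ a # b # z) c d" for c d
    proof (cases "(c, d) = (a, b)")
      case True
      then show ?thesis using raise_lowered[OF \<sigma> v even, of k] k by simp
    next
      case False
      show ?thesis by (rule raise_funpow[OF \<sigma> v that False])
    qed
  qed
  have nz: "(X b a ^^ j) v \<noteq> 0" if "j \<le> k" for j
    using that
  proof (induction j)
    case (Suc j)
    have "of_nat (Suc j) * (\<mu> a - \<mu> b - of_nat j) \<noteq> 0"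
      unfolding k using Suc.prems by (simp del: of_nat_Suc)
    then have "X a b ((X b a ^^ Suc j) v) \<noteq> 0"
      unfolding raise_lowered[OF \<sigma> v even] using Suc by simp
    then show ?case using ab X_0[of a b] by metis
  qed (use hom in simp)
  show "hwv (u @ b # a # z) (\<lambda>i. \<mu> i + of_nat k * (eps b i - eps a i)) ((X b a ^^ k) v)"
    unfolding hwv_def
  proof (intro conjI allI impI)
    show "X c d ((X b a ^^ k) v) = 0" if "before (u @ b # a # z) c d" for c d
    proof (cases "(c, d) = (b, a)")
      case True
      then show ?thesis using z by simp
    next
      case False
      then show ?thesis using raise_funpow[OF \<sigma> v] before_adjacent(4)[OF dist that False] by blast
    qed
  qed (use nz hm wt ab in auto)
qed

end

context gl_action begin

definition nilpotent_part :: "nat \<Rightarrow> nat \<Rightarrow> 'v set" where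
  "nilpotent_part a b = {w \<in> V. \<exists>k. (X a b ^^ k) w = 0}"

lemma funpow_X_zero_mono:
  "a < N \<Longrightarrow> b < N \<Longrightarrow> (X a b ^^ k) w = 0 \<Longrightarrow> k \<le> l \<Longrightarrow> (X a b ^^ l) w = 0"
  by (induction l) (auto simp: le_Suc_eq)

lemma subspace_nilpotent_part:
  assumes "a < N" "b < N" shows "subspace (nilpotent_part a b)"
proof (rule subspaceI)
  show "0 \<in> nilpotent_part a b" by (auto simp: nilpotent_part_def V_closed intro: exI[of _ 0])
  show "c *s u \<in> nilpotent_part a b" if "u \<in> nilpotent_part a b" for c u
    using that assms by (auto simp: nilpotent_part_def V_closed funpow_X_scale)
  show "u + w \<in> nilpotent_part a b" if uw: "u \<in> nilpotent_part a b" "w \<in> nilpotent_part a b" for u w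
  proof -
    obtain k l where "(X a b ^^ k) u = 0" "(X a b ^^ l) w = 0" using uw by (auto simp: nilpotent_part_def)
    then have "(X a b ^^ max k l) u = 0" "(X a b ^^ max k l) w = 0"
      using assms by (auto intro: funpow_X_zero_mono)
    then have "(X a b ^^ max k l) (u + w) = 0"
      using uw assms by (simp add: funpow_X_add nilpotent_part_def)
    then show ?thesis using uw by (auto simp: nilpotent_part_def V_closed)
  qed
qed

lemma graded_nilpotent_part:
  assumes ab: "a < N" "b < N" and even: "(a < m) = (b < m)"
  shows "graded (nilpotent_part a b)"
proof -
  have pres: "(X a b ^^ k) u \<in> G0" if "u \<in> G0" for k u
    using that X_even[OF ab even] by (induction k) auto
  have pres1: "(X a b ^^ k) u \<in> G1" if "u \<in> G1" for k u
    using that X_even[OF ab even] by (induction k) auto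
  have "\<exists>v w. u = v + w \<and> v \<in> nilpotent_part a b \<inter> G0 \<and> w \<in> nilpotent_part a b \<inter> G1"
    if u: "u \<in> nilpotent_part a b" for u
  proof -
    obtain v w where vw: "u = v + w" "v \<in> G0" "w \<in> G1"
      using u by (auto simp: nilpotent_part_def V_def)
    then have V: "v \<in> V" "w \<in> V" using homogeneous_V by (auto simp: homogeneous_def)
    obtain k where "(X a b ^^ k) u = 0" using u by (auto simp: nilpotent_part_def)
    then have s: "(X a b ^^ k) v + (X a b ^^ k) w = 0" using vw V ab by (simp add: funpow_X_add)
    then have "(X a b ^^ k) v = - (X a b ^^ k) w" by (rule eq_neg_iff_add_eq_0[THEN iffD2])
    then have "(X a b ^^ k) v \<in> G1"
      using pres1[OF vw(3)] subspace_neg[OF subspace_G(2)] by simp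
    then have "(X a b ^^ k) v = 0" using pres[OF vw(2), of k] G_disjoint by blast
    then show ?thesis using s vw V by (auto simp: nilpotent_part_def)
  qed
  then show ?thesis
    unfolding graded_def using subspace_add[OF subspace_nilpotent_part[OF ab]] by blast
qed

text \<open>
  Closure under an operator follows from closure under its commutator with \<open>X a b\<close>, by induction on the
  power of \<open>X a b\<close> that annihilates the vector.
\<close>

lemma nilpotent_part_transfer:
  assumes ab: "a < N" "b < N" "(a < m) = (b < m)" and cd: "c < N" "d < N"
    and bracket: "\<And>w. w \<in> nilpotent_part a b \<Longrightarrow>
      (if b = c then X a d w else 0) - (if d = a then X c b w else 0) \<in> nilpotent_part a b"
    and w: "w \<in> nilpotent_part a b"
  shows "X c d w \<in> nilpotent_part a b"
proof -
  have "X c d w \<in> nilpotent_part a b" if "w \<in> V" "(X a b ^^ k) w = 0" for k w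
    using that
  proof (induction k arbitrary: w)
    case 0
    then show ?case using cd by (simp add: subspace_0[OF subspace_nilpotent_part] ab)
  next
    case (Suc k)
    have "(X a b ^^ k) (X a b w) = 0" using Suc.prems by (simp add: funpow_swap1)
    then have "X c d (X a b w) \<in> nilpotent_part a b"
      using Suc ab by (simp add: X_V)
    moreover have "w \<in> nilpotent_part a b" using Suc.prems unfolding nilpotent_part_def by blast
    then have "(if b = c then X a d w else 0) - (if d = a then X c b w else 0) \<in> nilpotent_part a b"
      by (rule bracket)
    ultimately have "X c d (X a b w) + ((if b = c then X a d w else 0) - (if d = a then X c b w else 0)) \<in> nilpotent_part a b"
      by (rule subspace_add[OF subspace_nilpotent_part[OF ab(1,2)]])
    then have "X a b (X c d w) \<in> nilpotent_part a b"
      using X_comm'[OF ab(1,2) cd Suc.prems(1)] ab(3) by (simp add: super_sign_def add_diff_eq)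
    then obtain l where "(X a b ^^ Suc l) (X c d w) = 0"
      by (auto simp: nilpotent_part_def funpow_swap1)
    then show ?case using Suc.prems(1) cd by (auto simp: nilpotent_part_def X_V simp del: funpow.simps)
  qed
  then show ?thesis using w by (auto simp: nilpotent_part_def)
qed

text \<open>
  The commutator of \<open>X a b\<close> with a matrix unit is a combination of matrix units that are closer to
  commuting with \<open>X a b\<close>: three steps suffice, ending with the unit \<open>X b a\<close>.
\<close>

lemma stable_nilpotent_part:
  assumes ab: "a < N" "b < N" "(a < m) = (b < m)" "a \<noteq> b"
  shows "stable (nilpotent_part a b)"
proof -
  note t = nilpotent_part_transfer[OF ab(1-3)]
  note sub = subspace_nilpotent_part[OF ab(1,2)]
  \<comment> \<open>First the matrix units that commute with \<open>X a b\<close>, then those whose commutators are of this kind.\<close>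
  have one: "X c d w \<in> nilpotent_part a b"
    if "c < N" "d < N" "b \<noteq> c" "d \<noteq> a" "w \<in> nilpotent_part a b" for c d w
    using that by (intro t) (auto simp: subspace_0[OF sub])
  have two: "X c d w \<in> nilpotent_part a b"
    if cd: "c < N" "d < N" and nd: "b \<noteq> c \<or> d \<noteq> a" and w0: "w \<in> nilpotent_part a b" for c d w
  proof (rule t[OF cd _ w0])
    fix w assume w: "w \<in> nilpotent_part a b"
    consider "b = c" "d \<noteq> a" | "b \<noteq> c" "d = a" | "b \<noteq> c" "d \<noteq> a" using nd by blast
    then show "(if b = c then X a d w else 0) - (if d = a then X c b w else 0) \<in> nilpotent_part a b"
    proof cases
      case 1
      then show ?thesis using one[of a d w] ab w cd by simp
    next
      case 2
      then show ?thesis using one[of c b w] ab w cd subspace_neg[OF sub] by simp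
    qed (simp add: subspace_0[OF sub])
  qed
  have three: "X b a w \<in> nilpotent_part a b" if "w \<in> nilpotent_part a b" for w
  proof (rule t[OF ab(2,1) _ that])
    fix w assume "w \<in> nilpotent_part a b"
    then show "(if b = b then X a a w else 0) - (if a = a then X b b w else 0) \<in> nilpotent_part a b"
      using two[of a a w] two[of b b w] ab by (simp add: subspace_diff[OF sub])
  qed
  show ?thesis unfolding stable_def
  proof (intro conjI allI impI ballI)
    show "X c d w \<in> nilpotent_part a b" if "c < N" "d < N" "w \<in> nilpotent_part a b" for c d w
      using two[OF that(1,2) _ that(3)] three[OF that(3)] by (cases "b \<noteq> c \<or> d \<noteq> a") auto
  qed (use sub graded_nilpotent_part ab in auto)
qed

end

context simple_gl_action begin

lemma locally_nilpotent:
  assumes "a < N" "b < N" "(a < m) = (b < m)" "a \<noteq> b" "w \<in> V" "w \<noteq> 0" "(X a b ^^ k) w = 0" "u \<in> V"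
  shows "\<exists>k. (X a b ^^ k) u = 0"
proof -
  have "w \<in> nilpotent_part a b" using assms by (auto simp: nilpotent_part_def)
  then have "nilpotent_part a b = V"
    using simple[OF stable_nilpotent_part[OF assms(1-4)]] assms(6) by blast
  then show ?thesis using assms(8) by (auto simp: nilpotent_part_def)
qed

text \<open>
  Dominance allows moving \<open>a\<close> to the left by even reflections. In the step the exchanged entries of the
  weight are original entries in their original order, so their difference is again a natural number.
\<close>

lemma lowered_to_front:
  assumes "hwv [0..<N] lam v" "a < N" "j \<le> a" "(a - j < m) = (a < m)"
    and dom: "\<And>c. Suc c < N \<Longrightarrow> (c < m) = (Suc c < m) \<Longrightarrow> lam c - lam (Suc c) \<in> \<nat>"
  shows "\<exists>\<mu> w. hwv ([0..<a - j] @ a # [a - j..<a] @ [Suc a..<N]) \<mu> w \<and>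
    (\<forall>c<a - j. \<mu> c = lam c) \<and> \<mu> a = lam (a - j)"
  using assms(3,4)
proof (induction j)
  case 0
  have "[0..<N] = [0..<a] @ a # [Suc a..<N]"
    using assms(2) upt_add_eq_append[of 0 a "N - a"] by (simp add: upt_conv_Cons)
  then show ?case using assms(1) by auto
next
  case (Suc j)
  define c where "c = a - Suc j"
  have c: "a - j = Suc c" "c < a" using Suc.prems by (auto simp: c_def)
  have par: "(Suc c < m) = (a < m)" "(c < m) = (a < m)"
    using Suc.prems c by (auto simp: c_def)
  have "\<exists>\<mu> w. hwv ([0..<a - j] @ a # [a - j..<a] @ [Suc a..<N]) \<mu> w \<and>
    (\<forall>c<a - j. \<mu> c = lam c) \<and> \<mu> a = lam (a - j)"
    using par Suc.prems by (intro Suc.IH) (simp_all add: c)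
  then obtain \<mu> w where w: "hwv ([0..<c] @ c # a # [Suc c..<a] @ [Suc a..<N]) \<mu> w"
    and \<mu>: "\<forall>d<Suc c. \<mu> d = lam d" "\<mu> a = lam (Suc c)"
    unfolding c by auto
  have ord: "ordering ([0..<c] @ c # a # [Suc c..<a] @ [Suc a..<N])"
    using c assms(2) by (auto simp: ordering_def)
  have "lam c - lam (Suc c) \<in> \<nat>" using c assms(2) par by (intro dom) auto
  then obtain k where "\<mu> c - \<mu> a = of_nat k" using \<mu> by (auto elim: Nats_cases)
  from even_reflection(2)[OF ord w par(2) this]
  have "hwv ([0..<c] @ a # [c..<a] @ [Suc a..<N]) (\<lambda>i. \<mu> i + of_nat k * (eps a i - eps c i)) ((X a c ^^ k) w)"
    using c by (simp add: upt_conv_Cons)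
  moreover have "of_nat k = lam c - lam (Suc c)"
    using \<mu> \<open>\<mu> c - \<mu> a = of_nat k\<close> by simp
  then have "\<mu> a + of_nat k * (eps a a - eps c a) = lam c"
    using c \<mu> by (simp add: eps_def)
  moreover have "\<mu> d + of_nat k * (eps a d - eps c d) = lam d" if "d < c" for d
    using c \<mu> that by (simp add: eps_def)
  ultimately show ?case unfolding c_def[symmetric] by blast
qed

text \<open>
  It is enough to find one nonzero vector that is annihilated. For a negative even root this is the
  highest weight vector for an order in which the root is positive.
\<close>

theorem dominant_locally_nilpotent:
  assumes v: "hwv [0..<N] lam v"
    and dom: "\<And>c. Suc c < N \<Longrightarrow> (c < m) = (Suc c < m) \<Longrightarrow> lam c - lam (Suc c) \<in> \<nat>"
    and ab: "a < N" "b < N" "(a < m) = (b < m)" "a \<noteq> b" and u: "u \<in> V"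
  shows "\<exists>k. (X a b ^^ k) u = 0"
proof (cases "a < b")
  case True
  have pos: "pos [0..<N] x = x" if "x < N" for x
    using that
  proof (induction "N - x")
    case (Suc k)
    have "[0..<N] = [0..<x] @ x # [Suc x..<N]"
      using Suc.prems upt_add_eq_append[of 0 x "N - x"] by (simp add: upt_conv_Cons)
    then show ?case by (simp add: pos_append)
  qed simp
  have "before [0..<N] a b" using ab True by (simp add: before_def pos)
  then have "(X a b ^^ 1) v = 0" using v by (simp add: hwv_def)
  then show ?thesis
    using locally_nilpotent[OF ab _ _ _ u] v by (metis homogeneous_V hwv_def)
next
  case False
  then have "b < a" using ab by simp
  have "\<exists>\<mu> w. hwv ([0..<a - (a - b)] @ a # [a - (a - b)..<a] @ [Suc a..<N]) \<mu> w \<and>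
    (\<forall>c<a - (a - b). \<mu> c = lam c) \<and> \<mu> a = lam (a - (a - b))"
    using ab \<open>b < a\<close> by (intro lowered_to_front[OF v ab(1) _ _ dom]) auto
  then obtain \<mu> w where w: "hwv ([0..<b] @ a # [b..<a] @ [Suc a..<N]) \<mu> w" using \<open>b < a\<close> by auto
  have "before ([0..<b] @ a # [b..<a] @ [Suc a..<N]) a b"
    using \<open>b < a\<close> by (simp add: before_def pos_append)
  then have "(X a b ^^ 1) w = 0" using w by (simp add: hwv_def)
  then show ?thesis
    using locally_nilpotent[OF ab _ _ _ u] w by (metis homogeneous_V hwv_def)
qed

definition power_word :: "(nat \<times> nat) list \<Rightarrow> ((nat \<times> nat) \<Rightarrow> nat) \<Rightarrow> (nat \<times> nat) list" where
  "power_word ps f = concat (map (\<lambda>p. replicate (f p) p) ps)"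

lemma lower_bracket_closed:
  assumes "(a, b) \<in> lower \<sigma>" "(b, d) \<in> lower \<sigma>" shows "(a, d) \<in> lower \<sigma>"
  using assms by (auto simp: lower_def before_def)

lemma finite_ordered_words:
  assumes "set ps \<subseteq> units" "v \<in> V"
    and nil: "\<And>a b u. (a, b) \<in> set ps \<Longrightarrow> u \<in> V \<Longrightarrow> \<exists>k. (X a b ^^ k) u = 0"
  shows "\<exists>B. finite B \<and> B \<subseteq> V \<and> (\<forall>f. word_act (power_word ps f) v \<in> span B)"
  using assms(1,3)
proof (induction ps)
  case Nil
  then show ?case using assms(2)
    by (intro exI[of _ "{v}"]) (auto simp: power_word_def intro: span_base)
next
  case (Cons p ps)
  obtain a b where p: "p = (a, b)" by force
  have ab: "a < N" "b < N" using Cons.prems p by (auto simp: units_def)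
  have "\<exists>B. finite B \<and> B \<subseteq> V \<and> (\<forall>f. word_act (power_word ps f) v \<in> span B)"
    using Cons.prems by (intro Cons.IH) auto
  then obtain B where B: "finite B" "B \<subseteq> V" "\<And>f. word_act (power_word ps f) v \<in> span B" by blast
  have "\<forall>u\<in>B. \<exists>k. (X a b ^^ k) u = 0" using Cons.prems(2)[of a b] p B(2) by auto
  then obtain K where K: "\<And>u. u \<in> B \<Longrightarrow> (X a b ^^ K u) u = 0" by metis
  define B' where "B' = (\<lambda>(u, k). (X a b ^^ k) u) ` (SIGMA u:B. {..<K u})"
  have B'V: "B' \<subseteq> V" using B(2) ab by (auto simp: B'_def intro: funpow_X_V)
  have pow: "(X a b ^^ k) u \<in> span B'" if "u \<in> B" for u k
  proof (cases "k < K u")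
    case True
    then show ?thesis using that by (intro span_base) (auto simp: B'_def intro!: image_eqI[of _ _ "(u, k)"])
  next
    case False
    then have "(X a b ^^ k) u = 0" using funpow_X_zero_mono[OF ab K[OF that]] by simp
    then show ?thesis by (simp add: span_zero)
  qed
  have powspan: "(X a b ^^ k) u \<in> span B'" if "u \<in> span B" for u k
  proof -
    have "u \<in> V \<and> (X a b ^^ k) u \<in> span B'"
      using that
    proof (induction rule: span_induct_alt)
      case base
      then show ?case by (simp add: V_closed funpow_X_0[OF ab] span_zero)
    next
      case (step c x y)
      then have "x \<in> V" using B(2) by blast
      with step pow[OF step(1)] show ?case
        by (simp add: V_closed funpow_X_add[OF ab] funpow_X_scale[OF ab] span_add span_scale)
    qed
    then show ?thesis ..
  qed
  have "word_act (power_word (p # ps) f) v \<in> span B'" for f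
  proof -
    have "word_act (replicate k p @ ws) v = (X a b ^^ k) (word_act ws v)" for k ws
      by (induction k) (simp_all add: p)
    then show ?thesis using powspan[OF B(3)[of f]] by (simp add: power_word_def)
  qed
  moreover have "finite B'" using B(1) by (auto simp: B'_def)
  ultimately show ?case using B'V by blast
qed

lemma mset_power_word:
  assumes "distinct ps" "set w \<subseteq> set ps"
  shows "mset (power_word ps (count (mset w))) = mset w"
proof (rule multiset_eqI)
  fix x
  have "count (mset (power_word ps f)) x = (if x \<in> set ps then f x else 0)" for f
    using assms(1) by (induction ps) (auto simp: power_word_def)
  then show "count (mset (power_word ps (count (mset w)))) x = count (mset w) x"
    using assms(2) by (auto simp: count_eq_zero_iff)
qed

lemma word_act_linear:
  assumes "set ws \<subseteq> units" "x \<in> V" "y \<in> V"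
  shows "word_act ws (c *s x + y) = c *s word_act ws x + word_act ws y" "word_act ws 0 = 0"
proof -
  have "word_act ws (c *s x + y) = c *s word_act ws x + word_act ws y \<and> word_act ws 0 = 0"
    using assms(1)
  proof (induction ws)
    case (Cons p ws)
    then obtain a b where p: "p = (a, b)" "a < N" "b < N" by (auto simp: units_def)
    have "word_act ws x \<in> V" "word_act ws y \<in> V" using Cons.prems assms by (auto intro: word_act_V)
    with Cons p show ?case by (simp add: add_X scale_X V_closed)
  qed simp
  then show "word_act ws (c *s x + y) = c *s word_act ws x + word_act ws y" "word_act ws 0 = 0" by auto
qed

text \<open>
  The spanning half of the Poincare-Birkhoff-Witt theorem: exchanging neighbouring letters changes the
  vector by a scalar factor and by vectors of shorter words.
\<close>

lemma reorder_words:
  assumes \<sigma>: "ordering \<sigma>" and vV: "v \<in> V" and W: "subspace W" and ps: "set ps = lower \<sigma>" "distinct ps"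
    and blocks: "\<And>f. word_act (power_word ps f) v \<in> W"
    and ws: "ws \<in> lists (lower \<sigma>)"
  shows "word_act ws v \<in> W"
  using ws
proof (induction "length ws" arbitrary: ws rule: less_induct)
  case less
  note lu = lower_units[OF \<sigma>]
  define b where "b = power_word ps (count (mset ws))"
  have b: "mset b = mset ws" "word_act b v \<in> W"
    unfolding b_def using mset_power_word[OF ps(2), of ws] less.prems ps(1) blocks by auto
  show ?case
  proof (rule swap_invariant_perm[where Q = "\<lambda>ws. word_act ws v \<in> W", OF _ b])
    fix u p q z
    assume in_W: "word_act (u @ p # q # z) v \<in> W" and mset: "mset (u @ p # q # z) = mset ws"
    have set: "set (u @ p # q # z) \<subseteq> lower \<sigma>"
      using mset_eq_setD[OF mset] less.prems by auto
    have len: "length (u @ p # q # z) = length ws" using mset by (metis mset_eq_length)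
    obtain a b c d where p: "p = (a, b)" and q: "q = (c, d)" by force
    have ab: "(a, b) \<in> lower \<sigma>" "a < N" "b < N" and cd: "(c, d) \<in> lower \<sigma>" "c < N" "d < N"
      using set lu p q by (auto simp: units_def)
    have uu: "set u \<subseteq> units" and z: "word_act z v \<in> V" using set lu vV by (auto intro!: word_act_V)
    define w where "w = word_act z v"
    define s where "s = super_sign c d a b"
    have shorter: "word_act (u @ r # z) v \<in> W" if "r \<in> lower \<sigma>" for r
      using that set len by (intro less.hyps) auto
    have t1: "word_act u (if d = a then X c b w else 0) \<in> W"
    proof (cases "d = a")
      case True
      then show ?thesis using shorter[of "(c, b)"] lower_bracket_closed[of c d \<sigma> b] ab cd by (simp add: w_def)
    qed (simp add: word_act_linear(2)[OF uu V_closed(5) V_closed(5)] subspace_0[OF W])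
    have t2: "word_act u (if b = c then X a d w else 0) \<in> W"
    proof (cases "b = c")
      case True
      then show ?thesis using shorter[of "(a, d)"] lower_bracket_closed[of a b \<sigma> d] ab cd by (simp add: w_def)
    qed (simp add: word_act_linear(2)[OF uu V_closed(5) V_closed(5)] subspace_0[OF W])
    have wV: "w \<in> V" using z by (simp add: w_def)
    have V: "X a b (X c d w) \<in> V" "(if d = a then X c b w else 0) \<in> V" "(if b = c then X a d w else 0) \<in> V"
      using wV ab cd by (auto simp: V_closed)
    have "X c d (X a b w) = s *s X a b (X c d w) + ((- s) *s (if b = c then X a d w else 0) + (if d = a then X c b w else 0))"
      using X_comm'[OF cd(2,3) ab(2,3) wV] by (simp add: s_def algebra_simps)
    then have "word_act u (X c d (X a b w)) = s *s word_act u (X a b (X c d w)) +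
        ((- s) *s word_act u (if b = c then X a d w else 0) + word_act u (if d = a then X c b w else 0))"
      by (simp only: word_act_linear(1)[OF uu V(3,2)] word_act_linear(1)[OF uu V(1) V_closed(2)[OF V_closed(4)[OF V(3)] V(2)]])
    also have "\<dots> \<in> W"
      using in_W t1 t2 by (intro subspace_add[OF W] subspace_scale[OF W]) (simp_all add: p q w_def)
    finally show "word_act (u @ q # p # z) v \<in> W" by (simp add: p q w_def)
  qed
qed

text \<open>
  The module is spanned by ordered products of powers of lowering operators, and each of these acts
  locally nilpotently: the even ones by dominance, the odd ones because their squares are zero.
\<close>

theorem dominant_finite_dimensional:
  assumes v: "hwv [0..<N] lam v"
    and dom: "\<And>c. Suc c < N \<Longrightarrow> (c < m) = (Suc c < m) \<Longrightarrow> lam c - lam (Suc c) \<in> \<nat>"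
  shows "\<exists>B. finite B \<and> B \<subseteq> V \<and> span B = V"
proof -
  let ?\<sigma> = "[0..<N]"
  have \<sigma>: "ordering ?\<sigma>" by (auto simp: ordering_def)
  have "finite (lower ?\<sigma>)" using lower_units[OF \<sigma>] by (rule finite_subset) (simp add: units_def)
  then obtain ps where ps: "set ps = lower ?\<sigma>" "distinct ps" using finite_distinct_list by blast
  have nil: "\<exists>k. (X a b ^^ k) u = 0" if "(a, b) \<in> lower ?\<sigma>" "u \<in> V" for a b u
  proof -
    have ab: "a < N" "b < N" "a \<noteq> b" using that lower_units[OF \<sigma>] by (auto simp: units_def lower_def before_def)
    show ?thesis
    proof (cases "(a < m) = (b < m)")
      case True
      then show ?thesis using dominant_locally_nilpotent[OF v dom ab(1,2) _ ab(3) that(2)] by blast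
    next
      case False
      have "X a b (X a b u) = 0"
      proof (rule self_negative_imp_zero)
        have "super_sign a b a b = - 1" using False by (auto simp: super_sign_def)
        then show "X a b (X a b u) = - X a b (X a b u)"
          using X_comm'[of a b a b u] ab that(2) by simp
      qed
      then have "(X a b ^^ 2) u = 0" by (simp add: numeral_2_eq_2)
      then show ?thesis ..
    qed
  qed
  have vV: "v \<in> V" using v by (simp add: hwv_def homogeneous_V)
  obtain B where B: "finite B" "B \<subseteq> V" "\<And>f. word_act (power_word ps f) v \<in> span B"
    using finite_ordered_words[of ps v] nil ps lower_units[OF \<sigma>] vV by metis
  have "V \<subseteq> span B"
    unfolding V_lower_span[OF \<sigma> v]
    by (rule span_minimal) (use reorder_words[OF \<sigma> vV subspace_span ps B(3)] in auto)
  then have "span B = V" using span_V[OF B(2)] by (rule subset_antisym[rotated])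
  with B(1,2) show ?thesis by blast
qed

end

section \<open>Sets of simple roots and orders of the coordinates\<close>

interpretation weights: vector_space wscale
  by unfold_locales (auto simp: wscale_def algebra_simps fun_eq_iff)

lemma del_eq_eps: "del m k = eps (m + k)"
  by (simp add: del_def eps_def)

lemma eps_apply: "eps a c = (if c = a then 1 else 0)"
  by (simp add: eps_def)

text \<open>
  With one numbering of all coordinates every root, even or odd, is a difference of two basis vectors.
\<close>

definition gl_root :: "nat \<Rightarrow> nat \<Rightarrow> weight" where
  "gl_root a b = eps a - eps b"

lemma root_apply: "gl_root a b c = (if c = a then 1 else 0) - (if c = b then 1 else 0)"
  by (simp add: gl_root_def eps_apply)

lemma root_inj: "a \<noteq> b \<Longrightarrow> gl_root a b = gl_root c d \<longleftrightarrow> a = c \<and> b = d"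
proof
  assume ab: "a \<noteq> b" and eq: "gl_root a b = gl_root c d"
  have "gl_root a b a = gl_root c d a" "gl_root a b b = gl_root c d b" by (simp_all add: eq)
  then show "a = c \<and> b = d"
    using ab by (simp add: root_apply split: if_splits)
qed simp

lemma root_neq_0: "a \<noteq> b \<Longrightarrow> gl_root a b \<noteq> 0"
proof
  assume ab: "a \<noteq> b" and eq: "gl_root a b = 0"
  have "gl_root a b a = 0" by (simp add: eq)
  then show False using ab by (simp add: root_apply)
qed

lemma root_add: "gl_root a b + gl_root b c = gl_root a c"
  by (simp add: gl_root_def)

lemma root_uminus: "- gl_root a b = gl_root b a"
  by (simp add: gl_root_def)

lemma even_roots_eq:
  "even_roots m n = {gl_root a b | a b. a < m + n \<and> b < m + n \<and> a \<noteq> b \<and> (a < m \<longleftrightarrow> b < m)}" (is "_ = ?R")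
proof
  show "even_roots m n \<subseteq> ?R"
  proof
    fix x assume "x \<in> even_roots m n"
    then consider i j where "x = gl_root i j" "i < m" "j < m" "i \<noteq> j"
      | k l where "x = gl_root (m + k) (m + l)" "k < n" "l < n" "k \<noteq> l"
      unfolding even_roots_def del_eq_eps gl_root_def by blast
    then show "x \<in> ?R"
    proof cases
      case 1
      then show ?thesis by (intro CollectI exI[of _ i] exI[of _ j]) simp
    next
      case 2
      then show ?thesis by (intro CollectI exI[of _ "m + k"] exI[of _ "m + l"]) simp
    qed
  qed
  show "?R \<subseteq> even_roots m n"
  proof
    fix x assume "x \<in> ?R"
    then obtain a b where x: "x = gl_root a b" "a < m + n" "b < m + n" "a \<noteq> b" "a < m \<longleftrightarrow> b < m" by blast
    show "x \<in> even_roots m n"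
    proof (cases "a < m")
      case True
      then show ?thesis unfolding even_roots_def using x gl_root_def by blast
    next
      case False
      then have "a = m + (a - m)" "b = m + (b - m)" "a - m < n" "b - m < n" "a - m \<noteq> b - m" using x by auto
      then show ?thesis unfolding even_roots_def del_eq_eps using x(1) gl_root_def by fastforce
    qed
  qed
qed

lemma pos_even_roots_eq:
  "pos_even_roots m n = {gl_root a b | a b. a < b \<and> b < m + n \<and> (a < m \<longleftrightarrow> b < m)}" (is "_ = ?R")
proof
  show "pos_even_roots m n \<subseteq> ?R"
  proof
    fix x assume "x \<in> pos_even_roots m n"
    then consider i j where "x = gl_root i j" "i < j" "j < m"
      | k l where "x = gl_root (m + k) (m + l)" "k < l" "l < n"
      unfolding pos_even_roots_def del_eq_eps gl_root_def by blast
    then show "x \<in> ?R"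
    proof cases
      case 1
      then show ?thesis by (intro CollectI exI[of _ i] exI[of _ j]) simp
    next
      case 2
      then show ?thesis by (intro CollectI exI[of _ "m + k"] exI[of _ "m + l"]) simp
    qed
  qed
  show "?R \<subseteq> pos_even_roots m n"
  proof
    fix x assume "x \<in> ?R"
    then obtain a b where x: "x = gl_root a b" "a < b" "b < m + n" "a < m \<longleftrightarrow> b < m" by blast
    show "x \<in> pos_even_roots m n"
    proof (cases "a < m")
      case True
      then show ?thesis unfolding pos_even_roots_def using x gl_root_def by blast
    next
      case False
      then have "a = m + (a - m)" "b = m + (b - m)" "a - m < b - m" "b - m < n" using x by auto
      then show ?thesis unfolding pos_even_roots_def del_eq_eps using x(1) gl_root_def by fastforce
    qed
  qed
qed

lemma odd_roots_eq:
  "odd_roots m n = {gl_root a b | a b. a < m + n \<and> b < m + n \<and> (a < m) \<noteq> (b < m)}" (is "_ = ?R")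
proof
  show "odd_roots m n \<subseteq> ?R"
  proof
    fix x assume "x \<in> odd_roots m n"
    then consider i k where "x = gl_root i (m + k)" "i < m" "k < n"
      | i k where "x = gl_root (m + k) i" "i < m" "k < n"
      unfolding odd_roots_def del_eq_eps gl_root_def by blast
    then show "x \<in> ?R"
    proof cases
      case 1
      then show ?thesis by (intro CollectI exI[of _ i] exI[of _ "m + k"]) simp
    next
      case 2
      then show ?thesis by (intro CollectI exI[of _ "m + k"] exI[of _ i]) simp
    qed
  qed
  show "?R \<subseteq> odd_roots m n"
  proof
    fix x assume "x \<in> ?R"
    then obtain a b where x: "x = gl_root a b" "a < m + n" "b < m + n" "(a < m) \<noteq> (b < m)" by blast
    show "x \<in> odd_roots m n"
    proof (cases "a < m")
      case True
      then have "b = m + (b - m)" "b - m < n" using x by auto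
      then show ?thesis unfolding odd_roots_def del_eq_eps using x(1) True gl_root_def by fastforce
    next
      case False
      then have "a = m + (a - m)" "a - m < n" "b < m" using x by auto
      then show ?thesis unfolding odd_roots_def del_eq_eps using x(1) gl_root_def by fastforce
    qed
  qed
qed

lemma roots_eq: "roots m n = {gl_root a b | a b. a < m + n \<and> b < m + n \<and> a \<noteq> b}"
  unfolding roots_def even_roots_eq odd_roots_eq by blast

lemma finite_roots: "finite (roots m n)"
proof -
  have "roots m n \<subseteq> (\<lambda>(a, b). gl_root a b) ` ({..<m + n} \<times> {..<m + n})"
    unfolding roots_eq by auto
  then show ?thesis by (rule finite_subset) simp
qed

text \<open>
  The sums of coordinates over suitable sets serve as dual functionals.
\<close>

lemma independent_by_sums:
  assumes "\<And>\<beta>. \<beta> \<in> S \<Longrightarrow> \<exists>J. sum \<beta> J \<noteq> 0 \<and> (\<forall>\<gamma>\<in>S - {\<beta>}. sum \<gamma> J = 0)"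
  shows "weights.independent S"
proof
  assume "weights.dependent S"
  then obtain \<beta> where \<beta>: "\<beta> \<in> S" "\<beta> \<in> weights.span (S - {\<beta>})"
    unfolding weights.dependent_def by blast
  from assms[OF \<beta>(1)] obtain J where J: "sum \<beta> J \<noteq> 0" "\<forall>\<gamma>\<in>S - {\<beta>}. sum \<gamma> J = 0" by blast
  have "sum x J = 0" if "x \<in> weights.span (S - {\<beta>})" for x
    using that
  proof (induction rule: weights.span_induct_alt)
    case base
    then show ?case by (simp add: zero_fun_def)
  next
    case (step c x y)
    then show ?case using J(2) by (simp add: wscale_def sum.distrib flip: sum_distrib_left)
  qed
  with \<beta>(2) J(1) show False by simp
qed

definition combination :: "weight set \<Rightarrow> (weight \<Rightarrow> nat) \<Rightarrow> weight" where
  "combination \<pi> c = (\<Sum>\<beta>\<in>\<pi>. wscale (of_nat (c \<beta>)) \<beta>)"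

lemma nonneg_span_eq: "nonneg_span \<pi> = range (combination \<pi>)"
  by (auto simp: nonneg_span_def combination_def)

lemma combination_add: "combination \<pi> c + combination \<pi> d = combination \<pi> (\<lambda>\<beta>. c \<beta> + d \<beta>)"
  unfolding combination_def by (simp add: sum.distrib weights.scale_left_distrib)

lemma nonneg_span_add: "x \<in> nonneg_span \<pi> \<Longrightarrow> y \<in> nonneg_span \<pi> \<Longrightarrow> x + y \<in> nonneg_span \<pi>"
  unfolding nonneg_span_eq using combination_add by auto

lemma combination_single:
  "finite \<pi> \<Longrightarrow> \<beta> \<in> \<pi> \<Longrightarrow> combination \<pi> (\<lambda>\<gamma>. if \<gamma> = \<beta> then 1 else 0) = \<beta>"
proof -
  assume "finite \<pi>" "\<beta> \<in> \<pi>"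
  have "combination \<pi> (\<lambda>\<gamma>. if \<gamma> = \<beta> then 1 else 0) = (\<Sum>\<gamma>\<in>\<pi>. if \<gamma> = \<beta> then \<gamma> else 0)"
    unfolding combination_def by (rule sum.cong) auto
  then show ?thesis using \<open>finite \<pi>\<close> \<open>\<beta> \<in> \<pi>\<close> by simp
qed

lemma nonneg_span_base: "finite \<pi> \<Longrightarrow> \<beta> \<in> \<pi> \<Longrightarrow> \<beta> \<in> nonneg_span \<pi>"
  unfolding nonneg_span_eq using combination_single by (metis rangeI)

lemma combination_inj:
  assumes "weights.independent \<pi>" "finite \<pi>" "combination \<pi> c = combination \<pi> d" "\<beta> \<in> \<pi>"
  shows "c \<beta> = d \<beta>"
proof -
  have "(\<Sum>\<beta>\<in>\<pi>. wscale (of_nat (c \<beta>) - of_nat (d \<beta>)) \<beta>) = combination \<pi> c - combination \<pi> d"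
    unfolding combination_def by (simp add: sum_subtractf weights.scale_left_diff_distrib)
  also have "\<dots> = 0" using assms(3) by simp
  finally have "of_nat (c \<beta>) - of_nat (d \<beta>) = (0 :: complex)"
    using weights.independentD[OF assms(1,2) subset_refl, of "\<lambda>\<beta>. of_nat (c \<beta>) - of_nat (d \<beta>)"] assms(4) by blast
  then show ?thesis by simp
qed

lemma combination_0: "(\<And>\<beta>. \<beta> \<in> \<pi> \<Longrightarrow> c \<beta> = 0) \<Longrightarrow> combination \<pi> c = 0"
  unfolding combination_def by (rule sum.neutral) simp

text \<open>
  A root and its negative are not both positive.
\<close>

lemma nonneg_span_pointed:
  assumes "weights.independent \<pi>" "finite \<pi>" "x \<in> nonneg_span \<pi>" "- x \<in> nonneg_span \<pi>"
  shows "x = 0"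
proof -
  obtain c d where c: "x = combination \<pi> c" and d: "- x = combination \<pi> d"
    using assms(3,4) unfolding nonneg_span_eq by blast
  have "combination \<pi> (\<lambda>\<beta>. c \<beta> + d \<beta>) = combination \<pi> (\<lambda>_. 0)"
    unfolding combination_add[symmetric] c[symmetric] d[symmetric] by (simp add: combination_0)
  from combination_inj[OF assms(1,2) this] have "c \<beta> = 0" if "\<beta> \<in> \<pi>" for \<beta> using that by fastforce
  then show ?thesis unfolding c by (rule combination_0)
qed

text \<open>
  The condition on the order says that the positive even roots are the standard ones.
\<close>

definition shuffle :: "nat \<Rightarrow> nat \<Rightarrow> nat list \<Rightarrow> bool" where
  "shuffle m n \<sigma> \<longleftrightarrow> distinct \<sigma> \<and> set \<sigma> = {..<m + n} \<and>
     (\<forall>a b. a < b \<and> b < m + n \<and> (a < m \<longleftrightarrow> b < m) \<longrightarrow> before \<sigma> a b)"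

definition adjacent_roots :: "nat list \<Rightarrow> weight set" where
  "adjacent_roots \<sigma> = {gl_root a b | a b. \<exists>u z. \<sigma> = u @ a # b # z}"

lemma before_split:
  assumes "distinct \<sigma>"
  shows "before \<sigma> a b \<longleftrightarrow> (\<exists>u w z. \<sigma> = u @ a # w @ b # z)"
proof
  assume b: "before \<sigma> a b"
  then obtain u y where s: "\<sigma> = u @ a # y" unfolding before_def by (meson split_list)
  have "b \<in> set y"
  proof -
    have "b \<noteq> a" "a \<notin> set u" using b s assms by (auto simp: before_def)
    moreover have "b \<notin> set u"
    proof
      assume "b \<in> set u"
      then have "pos \<sigma> b < length u" using s by (simp add: pos_append pos_less_length)
      moreover have "pos \<sigma> a = length u" using s \<open>a \<notin> set u\<close> by (simp add: pos_append)
      ultimately show False using b by (simp add: before_def)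
    qed
    ultimately show ?thesis using b s by (auto simp: before_def)
  qed
  then show "\<exists>u w z. \<sigma> = u @ a # w @ b # z" using s by (metis split_list)
next
  assume "\<exists>u w z. \<sigma> = u @ a # w @ b # z"
  then obtain u w z where s: "\<sigma> = u @ a # w @ b # z" by blast
  then show "before \<sigma> a b" using assms by (auto simp: before_def pos_append)
qed

lemma before_asym: "before \<sigma> a b \<Longrightarrow> \<not> before \<sigma> b a"
  and before_irrefl: "\<not> before \<sigma> a a"
  and before_trans: "before \<sigma> a b \<Longrightarrow> before \<sigma> b c \<Longrightarrow> before \<sigma> a c"
  by (auto simp: before_def)

lemma shuffle_before_iff:
  assumes "shuffle m n \<sigma>" "a < m + n" "b < m + n" "a < m \<longleftrightarrow> b < m"
  shows "before \<sigma> a b \<longleftrightarrow> a < b"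
  using assms before_asym before_irrefl unfolding shuffle_def by (metis linorder_neqE_nat)

lemma finite_adjacent_roots: "finite (adjacent_roots \<sigma>)"
proof -
  have "adjacent_roots \<sigma> \<subseteq> (\<lambda>(a, b). gl_root a b) ` (set \<sigma> \<times> set \<sigma>)"
    unfolding adjacent_roots_def by auto
  then show ?thesis by (rule finite_subset) simp
qed

lemma root_in_nonneg_span:
  assumes "distinct \<sigma>" "before \<sigma> a b"
  shows "gl_root a b \<in> nonneg_span (adjacent_roots \<sigma>)"
proof -
  obtain u w z where "\<sigma> = u @ a # w @ b # z" using assms before_split by blast
  then show ?thesis
  proof (induction w arbitrary: u a)
    case Nil
    then have "gl_root a b \<in> adjacent_roots \<sigma>" unfolding adjacent_roots_def by auto
    then show ?case by (rule nonneg_span_base[OF finite_adjacent_roots])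
  next
    case (Cons c w)
    have "gl_root a c \<in> adjacent_roots \<sigma>" using Cons.prems unfolding adjacent_roots_def by auto
    then have "gl_root a c \<in> nonneg_span (adjacent_roots \<sigma>)" by (rule nonneg_span_base[OF finite_adjacent_roots])
    moreover have "gl_root c b \<in> nonneg_span (adjacent_roots \<sigma>)"
      using Cons.IH[of "u @ [a]" c] Cons.prems by simp
    ultimately show ?case using nonneg_span_add root_add by metis
  qed
qed

lemma independent_adjacent_roots:
  assumes "distinct \<sigma>" shows "weights.independent (adjacent_roots \<sigma>)"
proof (rule independent_by_sums)
  fix \<beta> assume "\<beta> \<in> adjacent_roots \<sigma>"
  then obtain u a b z where \<beta>: "\<beta> = gl_root a b" "\<sigma> = u @ a # b # z" by (auto simp: adjacent_roots_def)
  have sum_root: "sum (gl_root c d) J = (if c \<in> J then 1 else 0) - (if d \<in> J then 1 else 0)" if "finite J" for c d J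
    using that by (simp add: root_apply sum_subtractf)
  let ?J = "insert a (set u)"
  have "sum \<beta> ?J \<noteq> 0"
    using assms \<beta> by (subst \<beta>(1), subst sum_root) auto
  moreover have "sum \<gamma> ?J = 0" if \<gamma>: "\<gamma> \<in> adjacent_roots \<sigma> - {\<beta>}" for \<gamma>
  proof -
    obtain u' c d z' where g: "\<gamma> = gl_root c d" "\<sigma> = u' @ c # d # z'"
      using \<gamma> by (auto simp: adjacent_roots_def)
    have "c \<in> ?J \<longleftrightarrow> d \<in> ?J"
    proof -
      have J: "x \<in> ?J \<longleftrightarrow> x \<in> set \<sigma> \<and> pos \<sigma> x \<le> length u" for x
        using assms pos_less_length[of x u] unfolding \<beta>(2) by (auto simp: pos_append)
      have p: "pos \<sigma> c = length u'" "pos \<sigma> d = Suc (length u')"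
        using assms unfolding g(2) by (auto simp: pos_append)
      have "length u' \<noteq> length u"
      proof
        assume "length u' = length u"
        then have "c = a \<and> d = b" using g(2) \<beta>(2) by simp
        then show False using \<gamma> g(1) \<beta>(1) by simp
      qed
      moreover have "c \<in> set \<sigma>" "d \<in> set \<sigma>" using g(2) by auto
      ultimately show ?thesis unfolding J p by auto
    qed
    then show ?thesis unfolding g(1) by (subst sum_root) auto
  qed
  ultimately show "\<exists>J. sum \<beta> J \<noteq> 0 \<and> (\<forall>\<gamma>\<in>adjacent_roots \<sigma> - {\<beta>}. sum \<gamma> J = 0)" by blast
qed

theorem simple_root_set_adjacent_roots:
  assumes "shuffle m n \<sigma>"
  shows "simple_root_set m n (adjacent_roots \<sigma>)"
    and "pos_roots m n (adjacent_roots \<sigma>) = {gl_root a b | a b. before \<sigma> a b}"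
proof -
  have d: "distinct \<sigma>" and s: "set \<sigma> = {..<m + n}" using assms by (auto simp: shuffle_def)
  note ind = independent_adjacent_roots[OF d]
  have sub: "before \<sigma> a b \<Longrightarrow> a < m + n \<and> b < m + n \<and> a \<noteq> b" for a b
    using s by (auto simp: before_def)
  show pos: "pos_roots m n (adjacent_roots \<sigma>) = {gl_root a b | a b. before \<sigma> a b}"
  proof
    show "pos_roots m n (adjacent_roots \<sigma>) \<subseteq> {gl_root a b | a b. before \<sigma> a b}"
    proof
      fix x assume x: "x \<in> pos_roots m n (adjacent_roots \<sigma>)"
      then obtain a b where ab: "x = gl_root a b" "a < m + n" "b < m + n" "a \<noteq> b"
        unfolding pos_roots_def roots_eq by auto
      have "\<not> before \<sigma> b a"
      proof
        assume "before \<sigma> b a"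
        then have "- x \<in> nonneg_span (adjacent_roots \<sigma>)"
          using root_in_nonneg_span[OF d] by (simp add: ab root_uminus)
        then have "x = 0"
          using nonneg_span_pointed[OF ind finite_adjacent_roots] x by (auto simp: pos_roots_def)
        then show False using ab root_neq_0 by simp
      qed
      then have "before \<sigma> a b" using before_linear[of a \<sigma> b] ab s by auto
      then show "x \<in> {gl_root a b | a b. before \<sigma> a b}" using ab(1) by blast
    qed
    show "{gl_root a b | a b. before \<sigma> a b} \<subseteq> pos_roots m n (adjacent_roots \<sigma>)"
      unfolding pos_roots_def roots_eq using root_in_nonneg_span[OF d] sub by blast
  qed
  show "simple_root_set m n (adjacent_roots \<sigma>)"
    unfolding simple_root_set_def
  proof (intro conjI ballI)
    show "adjacent_roots \<sigma> \<subseteq> roots m n"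
    proof
      fix x assume "x \<in> adjacent_roots \<sigma>"
      then obtain u a b z where "x = gl_root a b" "\<sigma> = u @ a # b # z" by (auto simp: adjacent_roots_def)
      moreover then have "before \<sigma> a b" using before_split[OF d] by (metis append_Nil)
      ultimately show "x \<in> roots m n" unfolding roots_eq using sub by blast
    qed
    show "weights.independent (adjacent_roots \<sigma>)" by (rule ind)
    show "\<alpha> \<in> nonneg_span (adjacent_roots \<sigma>) \<or> - \<alpha> \<in> nonneg_span (adjacent_roots \<sigma>)"
      if \<alpha>: "\<alpha> \<in> roots m n" for \<alpha>
    proof -
      obtain a b where "\<alpha> = gl_root a b" "a < m + n" "b < m + n" "a \<noteq> b" using \<alpha> unfolding roots_eq by blast
      then show ?thesis
        using before_linear[of a \<sigma> b] s root_in_nonneg_span[OF d] root_uminus by (metis lessThan_iff)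
    qed
    show "pos_roots m n (adjacent_roots \<sigma>) \<inter> even_roots m n = pos_even_roots m n"
    proof (intro equalityI subsetI)
      fix x assume "x \<in> pos_roots m n (adjacent_roots \<sigma>) \<inter> even_roots m n"
      then obtain a b c d where "x = gl_root a b" "before \<sigma> a b" "x = gl_root c d" "c < m + n" "d < m + n" "c \<noteq> d" "c < m \<longleftrightarrow> d < m"
        unfolding pos even_roots_eq by blast
      moreover then have "a = c" "b = d" using root_inj[of c d a b] by auto
      ultimately show "x \<in> pos_even_roots m n"
        unfolding pos_even_roots_eq using shuffle_before_iff[OF assms, of a b] by blast
    next
      fix x assume "x \<in> pos_even_roots m n"
      then obtain a b where x: "x = gl_root a b" "a < b" "b < m + n" "a < m \<longleftrightarrow> b < m"
        unfolding pos_even_roots_eq by blast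
      then have "before \<sigma> a b" using assms by (auto simp: shuffle_def)
      then show "x \<in> pos_roots m n (adjacent_roots \<sigma>) \<inter> even_roots m n"
        unfolding pos even_roots_eq using x by force
    qed
  qed
qed

text \<open>
  A root of \<open>\<pi>\<close> that is not a difference of neighbours would be a sum of two positive roots, which
  contradicts the linear independence of \<open>\<pi>\<close>.
\<close>

theorem simple_root_set_ordering:
  assumes "simple_root_set m n \<pi>"
  obtains \<sigma> where "shuffle m n \<sigma>" "pos_roots m n \<pi> = {gl_root a b | a b. before \<sigma> a b}"
    "\<pi> \<subseteq> adjacent_roots \<sigma>"
proof -
  have sub: "\<pi> \<subseteq> roots m n" and ind: "weights.independent \<pi>"
    and total: "\<And>\<alpha>. \<alpha> \<in> roots m n \<Longrightarrow> \<alpha> \<in> nonneg_span \<pi> \<or> - \<alpha> \<in> nonneg_span \<pi>"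
    and even: "pos_roots m n \<pi> \<inter> even_roots m n = pos_even_roots m n"
    using assms by (auto simp: simple_root_set_def)
  have fin: "finite \<pi>" using sub finite_roots by (rule finite_subset)
  define N where "N = m + n"
  define less where "less a b \<longleftrightarrow> a < N \<and> b < N \<and> a \<noteq> b \<and> gl_root a b \<in> nonneg_span \<pi>" for a b
  have asym: "\<not> less b a" if "less a b" for a b
  proof
    assume "less b a"
    then have "- gl_root a b \<in> nonneg_span \<pi>" by (simp add: less_def root_uminus)
    with that have "gl_root a b = 0" using nonneg_span_pointed[OF ind fin] by (auto simp: less_def)
    with that show False using root_neq_0 by (auto simp: less_def)
  qed
  have trans: "less a c" if "less a b" "less b c" for a b c
  proof -
    have "gl_root a c \<in> nonneg_span \<pi>" using that nonneg_span_add root_add unfolding less_def by metis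
    moreover have "a \<noteq> c" using that asym by blast
    ultimately show ?thesis using that by (auto simp: less_def)
  qed
  have linear: "less a b \<or> less b a" if "a < N" "b < N" "a \<noteq> b" for a b
  proof -
    have "gl_root a b \<in> roots m n" using that unfolding roots_eq N_def by blast
    from total[OF this] show ?thesis using that by (auto simp: less_def root_uminus)
  qed
  \<comment> \<open>The linear order is turned into a list by sorting with respect to the number of predecessors.\<close>
  define rank where "rank a = card {c. less c a}" for a
  have rank: "rank a < rank b" if "less a b" for a b
  proof -
    have "finite {c. less c b}" by (rule finite_subset[of _ "{..<N}"]) (auto simp: less_def)
    moreover have "{c. less c a} \<subset> {c. less c b}" using that trans asym by blast
    ultimately show ?thesis unfolding rank_def by (rule psubset_card_mono)
  qed
  define \<sigma> where "\<sigma> = sort_key rank [0..<N]"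
  have d: "distinct \<sigma>" and s: "set \<sigma> = {..<N}" and sorted: "sorted (map rank \<sigma>)"
    by (auto simp: \<sigma>_def)
  have before: "before \<sigma> a b \<longleftrightarrow> less a b" for a b
  proof -
    have imp: "less a b" if "before \<sigma> a b" for a b
    proof -
      obtain u w z where "\<sigma> = u @ a # w @ b # z" using before_split[OF d] \<open>before \<sigma> a b\<close> by blast
      then have "rank a \<le> rank b" using sorted by (auto simp: sorted_append)
      moreover have "a < N" "b < N" "a \<noteq> b" using that s by (auto simp: before_def)
      ultimately show ?thesis using linear rank by force
    qed
    show ?thesis
    proof
      assume l: "less a b"
      then have "a \<in> set \<sigma>" "b \<in> set \<sigma>" "a \<noteq> b" using s by (auto simp: less_def)
      then show "before \<sigma> a b" using before_linear imp asym l by blast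
    qed (rule imp)
  qed
  have pos: "pos_roots m n \<pi> = {gl_root a b | a b. before \<sigma> a b}"
    unfolding pos_roots_def roots_eq before less_def N_def by blast
  show thesis
  proof (rule that[of \<sigma>])
    show "pos_roots m n \<pi> = {gl_root a b | a b. before \<sigma> a b}" by (rule pos)
    show "shuffle m n \<sigma>" unfolding shuffle_def
    proof (intro conjI allI impI)
      show "set \<sigma> = {..<m + n}" using s by (simp add: N_def)
      fix a b assume ab: "a < b \<and> b < m + n \<and> (a < m \<longleftrightarrow> b < m)"
      then have "gl_root a b \<in> pos_even_roots m n" unfolding pos_even_roots_eq by blast
      then have "gl_root a b \<in> pos_roots m n \<pi>" using even by blast
      then obtain c e where "gl_root a b = gl_root c e" "before \<sigma> c e" unfolding pos by blast
      then show "before \<sigma> a b" using root_inj[of a b c e] ab by auto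
    qed (rule d)
    show "\<pi> \<subseteq> adjacent_roots \<sigma>"
    proof
      fix \<beta> assume \<beta>: "\<beta> \<in> \<pi>"
      then have "\<beta> \<in> pos_roots m n \<pi>"
        using sub nonneg_span_base[OF fin] by (auto simp: pos_roots_def)
      then obtain a b where ab: "\<beta> = gl_root a b" "before \<sigma> a b" unfolding pos by blast
      then obtain u w z where split: "\<sigma> = u @ a # w @ b # z" using before_split[OF d] by blast
      have "w = []"
      proof (rule ccontr)
        assume "w \<noteq> []"
        then obtain c w' where "w = c # w'" by (cases w) auto
        then have "\<sigma> = u @ a # [] @ c # w' @ b # z" "\<sigma> = (u @ [a]) @ c # w' @ b # z" using split by simp_all
        then have "before \<sigma> a c" "before \<sigma> c b" using before_split[OF d] by blast+
        then have lc: "less a c" "less c b" using before by auto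
        then obtain f g where f: "gl_root a c = combination \<pi> f" and g: "gl_root c b = combination \<pi> g"
          unfolding less_def nonneg_span_eq by blast
        have "combination \<pi> (\<lambda>\<gamma>. f \<gamma> + g \<gamma>) = combination \<pi> (\<lambda>\<gamma>. if \<gamma> = \<beta> then 1 else 0)"
        proof -
          have "combination \<pi> (\<lambda>\<gamma>. f \<gamma> + g \<gamma>) = gl_root a c + gl_root c b"
            by (simp only: combination_add f g)
          also have "\<dots> = \<beta>" by (simp only: root_add ab(1))
          finally show ?thesis by (simp only: combination_single[OF fin \<beta>])
        qed
        from combination_inj[OF ind fin this]
        have fg: "f \<gamma> + g \<gamma> = (if \<gamma> = \<beta> then 1 else 0)" if "\<gamma> \<in> \<pi>" for \<gamma> using that .
        show False
        proof (cases "f \<beta> = 0")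
          case True
          then have "combination \<pi> f = 0" using fg by (intro combination_0) (metis add_eq_0_iff_both_eq_0)
          then show False using f lc root_neq_0 by (auto simp: less_def)
        next
          case False
          then have "g \<beta> = 0" using fg[OF \<beta>] by simp
          then have "combination \<pi> g = 0" using fg by (intro combination_0) (metis add_eq_0_iff_both_eq_0)
          then show False using g lc root_neq_0 by (auto simp: less_def)
        qed
      qed
      then show "\<beta> \<in> adjacent_roots \<sigma>" using split ab(1) unfolding adjacent_roots_def by auto
    qed
  qed
qed

section \<open>The vector rho and isotropic sets of roots\<close>

lemma pos_upt: "x < N \<Longrightarrow> pos [0..<N] x = x"
proof -
  assume "x < N"
  then have "[0..<N] = [0..<x] @ x # [Suc x..<N]"
    using upt_add_eq_append[of 0 x "N - x"] by (simp add: upt_conv_Cons)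
  then show ?thesis by (simp add: pos_append)
qed

lemma before_upt: "before [0..<N] a b \<longleftrightarrow> a < b \<and> b < N"
  using pos_upt by (auto simp: before_def)

lemma shuffle_upt: "shuffle m n [0..<m + n]"
  by (auto simp: shuffle_def before_upt)

lemma pi_st_eq: "pi_st m n = adjacent_roots [0..<m + n]"
proof -
  have adj: "(\<exists>u z. [0..<m + n] = u @ a # b # z) \<longleftrightarrow> b = a + 1 \<and> a + 1 < m + n" for a b
  proof
    assume "\<exists>u z. [0..<m + n] = u @ a # b # z"
    then obtain u z where s: "[0..<m + n] = u @ a # b # z" by blast
    then have l: "length u + 1 < m + n" by (metis length_append length_Cons length_upt diff_zero less_add_Suc1 add_Suc_right Suc_eq_plus1 add.commute add_less_cancel_left)
    have "[0..<m + n] ! length u = a" "[0..<m + n] ! (length u + 1) = b" unfolding s by (simp_all add: nth_append)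
    then show "b = a + 1 \<and> a + 1 < m + n" using l by simp
  next
    assume b: "b = a + 1 \<and> a + 1 < m + n"
    then have "[0..<m + n] = [0..<a] @ a # b # [Suc b..<m + n]"
      using upt_add_eq_append[of 0 a "m + n - a"] by (simp add: upt_conv_Cons)
    then show "\<exists>u z. [0..<m + n] = u @ a # b # z" by blast
  qed
  have "adjacent_roots [0..<m + n] = {gl_root a (a + 1) | a. a + 1 < m + n}"
    unfolding adjacent_roots_def adj by blast
  also have "\<dots> = pi_st m n"
  proof
    show "{gl_root a (a + 1) | a. a + 1 < m + n} \<subseteq> pi_st m n"
    proof
      fix x assume "x \<in> {gl_root a (a + 1) | a. a + 1 < m + n}"
      then obtain a where x: "x = gl_root a (a + 1)" "a + 1 < m + n" by blast
      consider "a + 1 < m" | "a + 1 = m" | "m \<le> a" by linarith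
      then show "x \<in> pi_st m n"
      proof cases
        case 1
        then show ?thesis using x by (auto simp: pi_st_def gl_root_def)
      next
        case 2
        then show ?thesis using x by (auto simp: pi_st_def gl_root_def del_eq_eps)
      next
        case 3
        then have "\<exists>k. x = eps (m + k) - eps (m + (k + 1)) \<and> k + 1 < n"
          using x by (intro exI[of _ "a - m"]) (auto simp: gl_root_def)
        then show ?thesis unfolding pi_st_def del_eq_eps by blast
      qed
    qed
    show "pi_st m n \<subseteq> {gl_root a (a + 1) | a. a + 1 < m + n}"
    proof
      fix x assume "x \<in> pi_st m n"
      then consider i where "x = eps i - eps (i + 1)" "i + 1 < m"
        | "0 < m" "0 < n" "x = eps (m - 1) - eps m"
        | k where "x = eps (m + k) - eps (m + (k + 1))" "k + 1 < n"
        unfolding pi_st_def del_eq_eps by (auto split: if_splits)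
      then show "x \<in> {gl_root a (a + 1) | a. a + 1 < m + n}"
      proof cases
        case (1 i)
        then show ?thesis by (intro CollectI exI[of _ i]) (simp add: gl_root_def)
      next
        case 2
        then show ?thesis by (intro CollectI exI[of _ "m - 1"]) (simp add: gl_root_def)
      next
        case (3 k)
        then show ?thesis by (intro CollectI exI[of _ "m + k"]) (simp add: gl_root_def)
      qed
    qed
  qed
  finally show ?thesis by simp
qed

definition crossing :: "nat \<Rightarrow> nat list \<Rightarrow> nat \<Rightarrow> nat" where
  "crossing m \<sigma> a = card {b. before \<sigma> b a \<and> (b < m) \<noteq> (a < m)}"

text \<open>
  The coordinates of \<open>\<rho>\<close>: the even roots contribute the usual staircase, the odd ones one unit for each
  coordinate of the other type that comes before.
\<close>

definition rho_order :: "nat \<Rightarrow> nat \<Rightarrow> nat list \<Rightarrow> weight" where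
  "rho_order m n \<sigma> a =
     (if a < m then (of_nat m - of_nat n - 1) / 2 - of_nat a
      else (of_nat n - of_nat m - 1) / 2 - of_nat (a - m)) + of_nat (crossing m \<sigma> a)"

lemma sum_apply_fun: "(sum f A :: weight) a = (\<Sum>x\<in>A. f x a)"
  by (induction A rule: infinite_finite_induct) auto

lemma sum_roots_apply:
  assumes "finite R" "\<And>p q. (p, q) \<in> R \<Longrightarrow> p \<noteq> q"
  shows "(\<Sum>\<alpha>\<in>{gl_root p q | p q. (p, q) \<in> R}. \<alpha>) a =
    of_nat (card {q. (a, q) \<in> R}) - of_nat (card {p. (p, a) \<in> R})"
proof -
  have set: "{gl_root p q | p q. (p, q) \<in> R} = (\<lambda>(p, q). gl_root p q) ` R" by auto
  have inj: "inj_on (\<lambda>(p, q). gl_root p q) R"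
    using assms(2) root_inj by (auto intro!: inj_onI)
  have "(\<Sum>\<alpha>\<in>{gl_root p q | p q. (p, q) \<in> R}. \<alpha>) a = (\<Sum>x\<in>R. (case x of (p, q) \<Rightarrow> gl_root p q) a)"
    unfolding set sum_apply_fun by (subst sum.reindex[OF inj]) simp
  also have "\<dots> = (\<Sum>x\<in>R. (if fst x = a then 1 else 0)) - (\<Sum>x\<in>R. (if snd x = a then 1 else 0))"
    unfolding sum_subtractf[symmetric] by (intro sum.cong) (auto simp: root_apply)
  also have "(\<Sum>x\<in>R. (if fst x = a then 1 else 0)) = (of_nat (card {x \<in> R. fst x = a}) :: complex)"
    using assms(1) by (simp add: sum.If_cases Int_def)
  also have "{x \<in> R. fst x = a} = Pair a ` {q. (a, q) \<in> R}" by auto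
  also have "(\<Sum>x\<in>R. (if snd x = a then 1 else 0)) = (of_nat (card {x \<in> R. snd x = a}) :: complex)"
    using assms(1) by (simp add: sum.If_cases Int_def)
  also have "{x \<in> R. snd x = a} = (\<lambda>p. (p, a)) ` {p. (p, a) \<in> R}" by auto
  finally show ?thesis by (simp add: card_image inj_on_def)
qed

theorem rho_eq_rho_order:
  assumes \<sigma>: "shuffle m n \<sigma>" and pos: "pos_roots m n \<pi> = {gl_root a b | a b. before \<sigma> a b}" and a: "a < m + n"
  shows "rho m n \<pi> a = rho_order m n \<sigma> a"
proof -
  define E where "E = {(p, q). p < q \<and> q < m + n \<and> (p < m \<longleftrightarrow> q < m)}"
  define F where "F = {(p, q). before \<sigma> p q \<and> (p < m) \<noteq> (q < m)}"
  have s: "set \<sigma> = {..<m + n}" using \<sigma> by (simp add: shuffle_def)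
  have finE: "finite E" unfolding E_def by (rule finite_subset[of _ "{..<m + n} \<times> {..<m + n}"]) auto
  have finF: "finite F" unfolding F_def
    by (rule finite_subset[of _ "{..<m + n} \<times> {..<m + n}"]) (use s in \<open>auto simp: before_def\<close>)
  have even: "pos_even_roots m n = {gl_root p q | p q. (p, q) \<in> E}"
    unfolding pos_even_roots_eq E_def by auto
  have odd: "pos_roots m n \<pi> \<inter> odd_roots m n = {gl_root p q | p q. (p, q) \<in> F}"
  proof (intro equalityI subsetI)
    fix x assume "x \<in> pos_roots m n \<pi> \<inter> odd_roots m n"
    then obtain p q c d where x: "x = gl_root p q" "before \<sigma> p q" "x = gl_root c d" "(c < m) \<noteq> (d < m)"
      unfolding pos odd_roots_eq by blast
    then have "p = c" "q = d" using root_inj[of c d p q] by auto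
    then show "x \<in> {gl_root p q | p q. (p, q) \<in> F}" using x by (auto simp: F_def)
  next
    fix x assume "x \<in> {gl_root p q | p q. (p, q) \<in> F}"
    then obtain p q where x: "x = gl_root p q" "before \<sigma> p q" "(p < m) \<noteq> (q < m)" by (auto simp: F_def)
    moreover from this have "p < m + n" "q < m + n" using s by (auto simp: before_def)
    ultimately show "x \<in> pos_roots m n \<pi> \<inter> odd_roots m n" unfolding pos odd_roots_eq by blast
  qed
  have nE: "\<And>p q. (p, q) \<in> E \<Longrightarrow> p \<noteq> q" and nF: "\<And>p q. (p, q) \<in> F \<Longrightarrow> p \<noteq> q"
    by (auto simp: E_def F_def)
  have rho: "rho m n \<pi> a =
    (of_nat (card {q. (a, q) \<in> E}) - of_nat (card {p. (p, a) \<in> E})) / 2 -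
    (of_nat (card {q. (a, q) \<in> F}) - of_nat (card {p. (p, a) \<in> F})) / 2"
    unfolding rho_def even odd wscale_def fun_diff_def
    by (simp add: sum_roots_apply[OF finE nE] sum_roots_apply[OF finF nF])
  define other where "other = {b. b < m + n \<and> (b < m) \<noteq> (a < m)}"
  have before_F: "{p. (p, a) \<in> F} = {b. before \<sigma> b a \<and> (b < m) \<noteq> (a < m)}" by (auto simp: F_def)
  have after_F: "{q. (a, q) \<in> F} = other - {p. (p, a) \<in> F}"
  proof (rule Set.set_eqI)
    fix q
    have q_in: "before \<sigma> a q \<Longrightarrow> q < m + n" using s by (auto simp: before_def)
    have "before \<sigma> a q \<longleftrightarrow> \<not> before \<sigma> q a" if "q < m + n" "q \<noteq> a"
      using before_linear[of a \<sigma> q] before_asym[of \<sigma> a q] that a s by blast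
    then show "q \<in> {q. (a, q) \<in> F} \<longleftrightarrow> q \<in> other - {p. (p, a) \<in> F}"
      unfolding F_def other_def using q_in by (cases "q = a") auto
  qed
  have sub: "{p. (p, a) \<in> F} \<subseteq> other" using s by (auto simp: F_def other_def before_def)
  have fino: "finite other" by (simp add: other_def)
  have "card {q. (a, q) \<in> F} = card other - crossing m \<sigma> a" "crossing m \<sigma> a \<le> card other"
    unfolding after_F crossing_def before_F[symmetric]
    using card_Diff_subset[OF finite_subset[OF sub fino] sub] card_mono[OF fino sub] by auto
  then have F_after: "(of_nat (card {q. (a, q) \<in> F}) :: complex) = of_nat (card other) - of_nat (crossing m \<sigma> a)"
    by (simp add: of_nat_diff)
  have F_before: "card {p. (p, a) \<in> F} = crossing m \<sigma> a" by (simp add: crossing_def before_F)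
  show ?thesis
  proof (cases "a < m")
    case True
    have "other = {m..<m + n}" using True by (auto simp: other_def)
    moreover have "{q. (a, q) \<in> E} = {a<..<m}" "{p. (p, a) \<in> E} = {..<a}" using True by (auto simp: E_def)
    moreover have "(of_nat (m - Suc a) :: complex) = of_nat m - of_nat a - 1"
      using True by (simp add: of_nat_diff)
    ultimately have "rho m n \<pi> a = (of_nat m - of_nat a - 1 - of_nat a) / 2 -
        (of_nat n - of_nat (crossing m \<sigma> a) - of_nat (crossing m \<sigma> a)) / 2"
      unfolding rho F_after F_before by simp
    also have "\<dots> = rho_order m n \<sigma> a" using True by (simp add: rho_order_def field_simps)
    finally show ?thesis .
  next
    case False
    have "other = {..<m}" using False a by (auto simp: other_def)
    moreover have "{q. (a, q) \<in> E} = {a<..<m + n}" "{p. (p, a) \<in> E} = {m..<a}" using False a by (auto simp: E_def)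
    moreover have "(of_nat (m + n - Suc a) :: complex) = of_nat m + of_nat n - of_nat a - 1"
      "(of_nat (a - m) :: complex) = of_nat a - of_nat m"
      using False a by (simp_all add: of_nat_diff)
    ultimately have am: "(of_nat (a - m) :: complex) = of_nat a - of_nat m"
      and "rho m n \<pi> a = (of_nat m + of_nat n - of_nat a - 1 - (of_nat a - of_nat m)) / 2 -
        (of_nat m - of_nat (crossing m \<sigma> a) - of_nat (crossing m \<sigma> a)) / 2"
      unfolding rho F_after F_before by simp_all
    note this(2)
    also have "\<dots> = rho_order m n \<sigma> a" using False by (simp add: rho_order_def am field_simps)
    finally show ?thesis .
  qed
qed

lemma shuffle_swap:
  assumes "shuffle m n (u @ a # b # z)" "(a < m) \<noteq> (b < m)"
  shows "shuffle m n (u @ b # a # z)"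
  unfolding shuffle_def
proof (intro conjI allI impI)
  have d: "distinct (u @ b # a # z)" using assms by (auto simp: shuffle_def)
  show "distinct (u @ b # a # z)" "set (u @ b # a # z) = {..<m + n}" using assms by (auto simp: shuffle_def)
  fix c e assume ce: "c < e \<and> e < m + n \<and> (c < m \<longleftrightarrow> e < m)"
  then have "before (u @ a # b # z) c e" using assms by (auto simp: shuffle_def)
  moreover have "(c, e) \<noteq> (a, b)" using ce assms(2) by auto
  ultimately show "before (u @ b # a # z) c e" using before_adjacent(4)[OF d] by blast
qed

lemma before_swap:
  assumes "distinct (u @ a # b # z)"
  shows "before (u @ b # a # z) c d \<longleftrightarrow>
    before (u @ a # b # z) c d \<and> (c, d) \<noteq> (a, b) \<or> (c, d) = (b, a)"
proof -
  have d: "distinct (u @ b # a # z)" using assms by auto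
  note there = before_adjacent(1)[OF assms] before_adjacent(4)[OF assms, of c d]
  note swapped = before_adjacent(1)[OF d] before_adjacent(4)[OF d, of c d]
  consider "(c, d) = (a, b)" | "(c, d) = (b, a)" | "(c, d) \<noteq> (a, b)" "(c, d) \<noteq> (b, a)" by blast
  then show ?thesis
  proof cases
    case 1
    then show ?thesis using before_asym[OF swapped(1)] assms by auto
  next
    case 2
    then show ?thesis using swapped(1) by simp
  next
    case 3
    then show ?thesis using there(2) swapped(2) by blast
  qed
qed

lemma rho_order_swap:
  assumes "shuffle m n (u @ a # b # z)" "(a < m) \<noteq> (b < m)"
  shows "rho_order m n (u @ b # a # z) c = rho_order m n (u @ a # b # z) c + gl_root a b c"
proof -
  have d: "distinct (u @ a # b # z)" using assms by (simp add: shuffle_def)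
  define S where "S \<sigma> c = {x. before \<sigma> x c \<and> (x < m) \<noteq> (c < m)}" for \<sigma> c
  have fin: "finite (S \<sigma> c)" for \<sigma> c
    by (rule finite_subset[of _ "set \<sigma>"]) (auto simp: S_def before_def)
  have cr: "crossing m \<sigma> c = card (S \<sigma> c)" for \<sigma> c by (simp add: crossing_def S_def)
  have ab: "a \<noteq> b" using assms(2) by auto
  have "S (u @ b # a # z) a = insert b (S (u @ a # b # z) a)" "b \<notin> S (u @ a # b # z) a"
    using assms(2) ab before_adjacent(1)[OF d] before_asym by (auto simp: S_def before_swap[OF d])
  then have "card (S (u @ b # a # z) a) = Suc (card (S (u @ a # b # z) a))" using fin by simp
  moreover have "S (u @ a # b # z) b = insert a (S (u @ b # a # z) b)" "a \<notin> S (u @ b # a # z) b"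
    using assms(2) ab before_adjacent(1)[OF d] by (auto simp: S_def before_swap[OF d])
  then have "card (S (u @ a # b # z) b) = Suc (card (S (u @ b # a # z) b))" using fin by simp
  moreover have "S (u @ b # a # z) c = S (u @ a # b # z) c" if "c \<noteq> a" "c \<noteq> b"
    using that by (auto simp: S_def before_swap[OF d])
  ultimately show ?thesis
    using ab cr by (auto simp: rho_order_def root_apply)
qed

text \<open>
  An odd simple root is isotropic, hence orthogonal to \<open>\<rho>\<close>.
\<close>

lemma rho_order_adjacent_odd:
  assumes \<sigma>: "shuffle m n (u @ a # b # z)" and odd: "(a < m) \<noteq> (b < m)"
  shows "rho_order m n (u @ a # b # z) a + rho_order m n (u @ a # b # z) b = 0"
proof -
  let ?\<sigma> = "u @ a # b # z"
  have d: "distinct ?\<sigma>" and s: "set ?\<sigma> = {..<m + n}" using \<sigma> by (auto simp: shuffle_def)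
  have ab: "a < m + n" "b < m + n" using s by auto
  have bef: "before ?\<sigma> a b" by (rule before_adjacent(1)[OF d])
  have "{x. before ?\<sigma> x a \<and> (x < m) \<noteq> (a < m)} = {x. x < b \<and> (x < m \<longleftrightarrow> b < m)}"
  proof (intro equalityI subsetI)
    fix x assume x: "x \<in> {x. before ?\<sigma> x a \<and> (x < m) \<noteq> (a < m)}"
    then have "before ?\<sigma> x b" "x < m + n" using before_trans[OF _ bef] s by (auto simp: before_def)
    then show "x \<in> {x. x < b \<and> (x < m \<longleftrightarrow> b < m)}"
      using x odd shuffle_before_iff[OF \<sigma>, of x b] ab by auto
  next
    fix x assume x: "x \<in> {x. x < b \<and> (x < m \<longleftrightarrow> b < m)}"
    then have "before ?\<sigma> x b" using shuffle_before_iff[OF \<sigma>, of x b] ab by auto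
    moreover have "x \<noteq> a" using x odd by auto
    ultimately have "before ?\<sigma> x a" by (rule before_adjacent(2)[OF d])
    then show "x \<in> {x. before ?\<sigma> x a \<and> (x < m) \<noteq> (a < m)}" using x odd by auto
  qed
  then have ca: "crossing m ?\<sigma> a = card {x. x < b \<and> (x < m \<longleftrightarrow> b < m)}" by (simp add: crossing_def)
  have "{x. before ?\<sigma> x b \<and> (x < m) \<noteq> (b < m)} = {x. x \<le> a \<and> (x < m \<longleftrightarrow> a < m)}"
  proof (intro equalityI subsetI)
    fix x assume x: "x \<in> {x. before ?\<sigma> x b \<and> (x < m) \<noteq> (b < m)}"
    then have "x < m + n" "x = a \<or> before ?\<sigma> x a" using before_adjacent(2)[OF d, of x] s by (auto simp: before_def)
    then show "x \<in> {x. x \<le> a \<and> (x < m \<longleftrightarrow> a < m)}"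
      using x odd shuffle_before_iff[OF \<sigma>, of x a] ab by auto
  next
    fix x assume x: "x \<in> {x. x \<le> a \<and> (x < m \<longleftrightarrow> a < m)}"
    then have "x = a \<or> before ?\<sigma> x a" using shuffle_before_iff[OF \<sigma>, of x a] ab by auto
    then show "x \<in> {x. before ?\<sigma> x b \<and> (x < m) \<noteq> (b < m)}" using bef before_trans[of ?\<sigma> x a b] x odd by auto
  qed
  then have cb: "crossing m ?\<sigma> b = card {x. x \<le> a \<and> (x < m \<longleftrightarrow> a < m)}" by (simp add: crossing_def)
  show ?thesis
  proof (cases "a < m")
    case True
    then have "{x. x < b \<and> (x < m \<longleftrightarrow> b < m)} = {m..<b}" "{x. x \<le> a \<and> (x < m \<longleftrightarrow> a < m)} = {..a}"
      using odd by auto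
    with True odd show ?thesis unfolding rho_order_def ca cb by (simp add: field_simps)
  next
    case False
    then have "{x. x < b \<and> (x < m \<longleftrightarrow> b < m)} = {..<b}" "{x. x \<le> a \<and> (x < m \<longleftrightarrow> a < m)} = {m..a}"
      using odd by auto
    moreover have "(of_nat (Suc a - m) :: complex) = of_nat (a - m) + 1" using False by (simp add: of_nat_diff)
    ultimately show ?thesis using False odd unfolding rho_order_def ca cb by (simp add: field_simps)
  qed
qed

text \<open>
  The difference is positive, so strict inequalities for the shifted weight come from dominance.
\<close>

lemma rho_order_adjacent_even:
  assumes \<sigma>: "shuffle m n (u @ a # b # z)" and even: "a < m \<longleftrightarrow> b < m"
  shows "rho_order m n (u @ a # b # z) a - rho_order m n (u @ a # b # z) b = of_nat (b - a)" and "a < b"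
proof -
  let ?\<sigma> = "u @ a # b # z"
  have d: "distinct ?\<sigma>" and s: "set ?\<sigma> = {..<m + n}" using \<sigma> by (auto simp: shuffle_def)
  have ab: "a < m + n" "b < m + n" using s by auto
  have bef: "before ?\<sigma> a b" by (rule before_adjacent(1)[OF d])
  show lt: "a < b" using bef shuffle_before_iff[OF \<sigma> ab even] by simp
  have "{x. before ?\<sigma> x a \<and> (x < m) \<noteq> (a < m)} = {x. before ?\<sigma> x b \<and> (x < m) \<noteq> (b < m)}"
    using even before_trans[OF _ bef] before_adjacent(2)[OF d] by blast
  then have "crossing m ?\<sigma> a = crossing m ?\<sigma> b" by (simp add: crossing_def)
  moreover have "of_nat (b - m) - of_nat (a - m) = (of_nat b - of_nat a :: complex)" if "\<not> a < m"
    using that lt by (simp add: of_nat_diff)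
  ultimately show "rho_order m n ?\<sigma> a - rho_order m n ?\<sigma> b = of_nat (b - a)"
    using lt even by (cases "a < m") (auto simp: rho_order_def of_nat_diff)
qed

text \<open>
  The scalar product with the basis vector number \<open>a\<close>.
\<close>

definition entry :: "nat \<Rightarrow> weight \<Rightarrow> nat \<Rightarrow> complex" where
  "entry m \<nu> a = (if a < m then \<nu> a else - \<nu> a)"

lemma form_eps:
  assumes "a < m + n"
  shows "form m n \<nu> (eps a) = entry m \<nu> a"
proof (cases "a < m")
  case True
  have "(\<Sum>i<m. \<nu> i * eps a i) = (\<Sum>i<m. if i = a then \<nu> i else 0)"
    by (intro sum.cong) (auto simp: eps_apply)
  moreover have "(\<Sum>k<n. \<nu> (m + k) * eps a (m + k)) = 0"
    using True by (intro sum.neutral) (auto simp: eps_apply)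
  ultimately show ?thesis using True by (simp add: form_def entry_def)
next
  case False
  have "(\<Sum>k<n. \<nu> (m + k) * eps a (m + k)) = (\<Sum>k<n. if k = a - m then \<nu> (m + k) else 0)"
    using False by (intro sum.cong) (auto simp: eps_apply)
  moreover have "(\<Sum>i<m. \<nu> i * eps a i) = 0"
    using False by (intro sum.neutral) (auto simp: eps_apply)
  ultimately show ?thesis using False assms by (simp add: form_def entry_def)
qed

lemma form_diff: "form m n \<nu> (x - y) = form m n \<nu> x - form m n \<nu> y"
  by (simp add: form_def algebra_simps sum_subtractf)

lemma form_root:
  assumes "a < m + n" "b < m + n"
  shows "form m n \<nu> (gl_root a b) = entry m \<nu> a - entry m \<nu> b"
  by (simp add: gl_root_def form_diff form_eps assms)

lemma isotropic_root_odd: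
  assumes "S \<in> isotropic_sets m n \<nu>" "\<beta> \<in> S"
  obtains a b where "\<beta> = gl_root a b" "a < m + n" "b < m + n" "(a < m) \<noteq> (b < m)"
    "entry m \<nu> a = entry m \<nu> b"
proof -
  have "\<beta> \<in> roots m n" "form m n \<beta> \<beta> = 0" "form m n \<nu> \<beta> = 0"
    using assms by (auto simp: isotropic_sets_def)
  moreover then obtain a b where ab: "\<beta> = gl_root a b" "a < m + n" "b < m + n" "a \<noteq> b"
    unfolding roots_eq by blast
  ultimately have "entry m (gl_root a b) a = entry m (gl_root a b) b" "entry m \<nu> a = entry m \<nu> b"
    by (simp_all add: form_root)
  moreover from this have "(a < m) \<noteq> (b < m)" using ab(4) by (auto simp: entry_def root_apply split: if_splits)
  ultimately show thesis using that ab by blast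
qed

text \<open>
  Two orthogonal isotropic roots share both indices or none. If they share both, they are equal or
  opposite, and opposite roots are dependent.
\<close>

lemma isotropic_supports_disjoint:
  assumes S: "S \<in> isotropic_sets m n \<nu>" and in_S: "gl_root a b \<in> S" "gl_root c d \<in> S"
    and bounds: "a < m + n" "b < m + n" "c < m + n" "d < m + n"
    and odd: "(a < m) \<noteq> (b < m)" "(c < m) \<noteq> (d < m)"
    and neq: "gl_root a b \<noteq> gl_root c d"
  shows "{a, b} \<inter> {c, d} = {}"
proof -
  have "\<not> (a = d \<and> b = c)"
  proof
    assume "a = d \<and> b = c"
    then have "gl_root c d = wscale (- 1) (gl_root a b)" by (auto simp: wscale_def root_apply fun_eq_iff)
    moreover have "gl_root a b \<in> S - {gl_root c d}" using in_S neq by simp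
    ultimately have "gl_root c d \<in> weights.span (S - {gl_root c d})"
      using weights.span_scale weights.span_base by metis
    then have "weights.dependent S" using in_S unfolding weights.dependent_def by blast
    then show False using S by (simp add: isotropic_sets_def)
  qed
  moreover have "form m n (gl_root a b) (gl_root c d) = 0" using S in_S by (simp add: isotropic_sets_def)
  then have "entry m (gl_root a b) c = entry m (gl_root a b) d" using bounds by (simp add: form_root)
  ultimately show ?thesis
    using odd neq by (auto simp: entry_def root_apply split: if_splits)
qed

text \<open>
  The roots have different \<open>\<epsilon>\<close>-indices.
\<close>

lemma isotropic_card_le:
  assumes S: "S \<in> isotropic_sets m n \<nu>"
    and one: "\<And>a b. a < m \<Longrightarrow> m \<le> b \<Longrightarrow> b < m + n \<Longrightarrow> entry m \<nu> a = entry m \<nu> b \<Longrightarrow> a \<in> K"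
    and "finite K"
  shows "card S \<le> card K"
proof -
  have "\<exists>a b. \<beta> \<in> {gl_root a b, gl_root b a} \<and> a < m \<and> m \<le> b \<and> b < m + n \<and> entry m \<nu> a = entry m \<nu> b" if "\<beta> \<in> S" for \<beta>
  proof -
    obtain a b where ab: "\<beta> = gl_root a b" "a < m + n" "b < m + n" "(a < m) \<noteq> (b < m)"
      "entry m \<nu> a = entry m \<nu> b" using isotropic_root_odd[OF S \<open>\<beta> \<in> S\<close>] by blast
    show ?thesis
    proof (cases "a < m")
      case True
      then show ?thesis using ab by (intro exI[of _ a] exI[of _ b]) auto
    next
      case False
      then show ?thesis using ab by (intro exI[of _ b] exI[of _ a]) auto
    qed
  qed
  then obtain e f where ef: "\<And>\<beta>. \<beta> \<in> S \<Longrightarrow> \<beta> \<in> {gl_root (e \<beta>) (f \<beta>), gl_root (f \<beta>) (e \<beta>)} \<and> e \<beta> < m \<and> m \<le> f \<beta> \<and>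
    f \<beta> < m + n \<and> entry m \<nu> (e \<beta>) = entry m \<nu> (f \<beta>)" by metis
  have "inj_on e S"
  proof (rule inj_onI)
    fix \<beta> \<gamma> assume bg: "\<beta> \<in> S" "\<gamma> \<in> S" "e \<beta> = e \<gamma>"
    show "\<beta> = \<gamma>"
    proof (rule ccontr)
      assume neq: "\<beta> \<noteq> \<gamma>"
      obtain a b where b: "\<beta> = gl_root a b" "e \<beta> \<in> {a, b}" "a < m + n" "b < m + n" "(a < m) \<noteq> (b < m)"
        using ef[OF bg(1)] by auto
      obtain c d where g: "\<gamma> = gl_root c d" "e \<gamma> \<in> {c, d}" "c < m + n" "d < m + n" "(c < m) \<noteq> (d < m)"
        using ef[OF bg(2)] by auto
      have "{a, b} \<inter> {c, d} = {}"
        using isotropic_supports_disjoint[OF S _ _ b(3,4) g(3,4) b(5) g(5)] b(1) g(1) bg neq by blast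
      then show False using b(2) g(2) bg(3) by auto
    qed
  qed
  moreover have "e ` S \<subseteq> K"
    using ef one by blast
  ultimately show ?thesis using \<open>finite K\<close> by (rule card_inj_on_le)
qed

lemma isotropicI:
  assumes "\<And>\<beta>. \<beta> \<in> S \<Longrightarrow> \<exists>a b. \<beta> = gl_root a b \<and> a < m + n \<and> b < m + n \<and> (a < m) \<noteq> (b < m) \<and>
      entry m \<nu> a = entry m \<nu> b"
    and disjoint: "\<And>a b c d. gl_root a b \<in> S \<Longrightarrow> gl_root c d \<in> S \<Longrightarrow> a \<noteq> b \<Longrightarrow> c \<noteq> d \<Longrightarrow>
      gl_root a b \<noteq> gl_root c d \<Longrightarrow> {a, b} \<inter> {c, d} = {}"
  shows "S \<in> isotropic_sets m n \<nu>"
  unfolding isotropic_sets_def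
proof (intro CollectI conjI ballI)
  show "S \<subseteq> roots m n"
  proof
    fix \<beta> assume "\<beta> \<in> S"
    then obtain a b where "\<beta> = gl_root a b" "a < m + n" "b < m + n" "(a < m) \<noteq> (b < m)" using assms(1) by blast
    then show "\<beta> \<in> roots m n" unfolding roots_eq by blast
  qed
  show "weights.independent S"
  proof (rule independent_by_sums)
    fix \<beta> assume \<beta>: "\<beta> \<in> S"
    then obtain a b where ab: "\<beta> = gl_root a b" "a \<noteq> b" using assms(1) by blast
    show "\<exists>J. sum \<beta> J \<noteq> 0 \<and> (\<forall>\<gamma>\<in>S - {\<beta>}. sum \<gamma> J = 0)"
    proof (intro exI[of _ "{a}"] conjI ballI)
      show "sum \<beta> {a} \<noteq> 0" using ab by (simp add: root_apply)
      fix \<gamma> assume \<gamma>: "\<gamma> \<in> S - {\<beta>}"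
      then obtain c d where cd: "\<gamma> = gl_root c d" "c \<noteq> d" using assms(1) by blast
      then have "{a, b} \<inter> {c, d} = {}" using \<beta> \<gamma> ab by (intro disjoint) auto
      then have "a \<notin> {c, d}" by blast
      then show "sum \<gamma> {a} = 0" using cd by (simp add: root_apply)
    qed
  qed
  show "form m n \<nu> \<beta> = 0" if "\<beta> \<in> S" for \<beta>
    using assms(1)[OF that] by (auto simp: form_root)
  show "form m n \<beta> \<gamma> = 0" if bg: "\<beta> \<in> S" "\<gamma> \<in> S" for \<beta> \<gamma>
  proof -
    obtain a b where ab: "\<beta> = gl_root a b" "a < m + n" "b < m + n" "(a < m) \<noteq> (b < m)" using assms(1)[OF bg(1)] by blast
    obtain c d where cd: "\<gamma> = gl_root c d" "c < m + n" "d < m + n" "(c < m) \<noteq> (d < m)" using assms(1)[OF bg(2)] by blast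
    have "entry m (gl_root a b) c = entry m (gl_root a b) d"
    proof (cases "\<beta> = \<gamma>")
      case True
      then have "a = c" "b = d" using root_inj[of a b c d] ab cd by auto
      then show ?thesis using ab by (auto simp: entry_def root_apply)
    next
      case False
      then have "{a, b} \<inter> {c, d} = {}" using disjoint[of a b c d] bg ab cd by auto
      then show ?thesis by (auto simp: entry_def root_apply)
    qed
    then show ?thesis unfolding ab(1) cd(1) using cd(2,3) by (simp add: form_root)
  qed
qed

text \<open>
  Otherwise the root that joins \<open>a\<close> and \<open>b\<close> could be added.
\<close>

lemma maximal_isotropic_exhausts:
  assumes max: "maximal_isotropic m n \<nu> S"
    and ab: "a < m" "m \<le> b" "b < m + n" "entry m \<nu> a = entry m \<nu> b"
  shows "\<exists>c d. gl_root c d \<in> S \<and> c < m + n \<and> d < m + n \<and> (c < m) \<noteq> (d < m) \<and> {a, b} \<inter> {c, d} \<noteq> {}"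
proof (rule ccontr)
  assume free: "\<not> ?thesis"
  have S: "S \<in> isotropic_sets m n \<nu>" and best: "\<And>T. T \<in> isotropic_sets m n \<nu> \<Longrightarrow> card T \<le> card S"
    using max by (auto simp: maximal_isotropic_def)
  have a_neq_b: "a \<noteq> b" using ab by simp
  have repr: "\<exists>c d. \<beta> = gl_root c d \<and> c < m + n \<and> d < m + n \<and> (c < m) \<noteq> (d < m) \<and> entry m \<nu> c = entry m \<nu> d"
    if "\<beta> \<in> S" for \<beta>
    using isotropic_root_odd[OF S that] by blast
  have range: "c < m + n \<and> d < m + n \<and> (c < m) \<noteq> (d < m)" if "gl_root c d \<in> S" "c \<noteq> d" for c d
    using repr[OF that(1)] root_inj[OF that(2)] by metis
  have new: "gl_root a b \<notin> S"
  proof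
    assume "gl_root a b \<in> S"
    moreover have "a < m + n" "(a < m) \<noteq> (b < m)" "{a, b} \<inter> {a, b} \<noteq> {}" using ab by auto
    ultimately show False using free ab(3) by blast
  qed
  have "insert (gl_root a b) S \<in> isotropic_sets m n \<nu>"
  proof (rule isotropicI)
    show "\<exists>c d. \<beta> = gl_root c d \<and> c < m + n \<and> d < m + n \<and> (c < m) \<noteq> (d < m) \<and> entry m \<nu> c = entry m \<nu> d"
      if "\<beta> \<in> insert (gl_root a b) S" for \<beta>
      using that repr ab by (cases "\<beta> = gl_root a b") force+
    fix p q c d
    assume pq: "gl_root p q \<in> insert (gl_root a b) S" "p \<noteq> q" and cd: "gl_root c d \<in> insert (gl_root a b) S" "c \<noteq> d"
      and neq: "gl_root p q \<noteq> gl_root c d"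
    have other: "{a, b} \<inter> {c, d} = {}" if "gl_root c d \<in> S" "c \<noteq> d" for c d
      using free range[OF that] that(1) by blast
    consider "gl_root p q = gl_root a b" "gl_root c d \<in> S" | "gl_root c d = gl_root a b" "gl_root p q \<in> S"
      | "gl_root p q \<in> S" "gl_root c d \<in> S" using pq(1) cd(1) neq by auto
    then show "{p, q} \<inter> {c, d} = {}"
    proof cases
      case 1
      then show ?thesis using other[of c d] cd root_inj[OF pq(2)] by auto
    next
      case 2
      then show ?thesis using other[of p q] pq root_inj[OF cd(2)] by auto
    next
      case 3
      show ?thesis
        using isotropic_supports_disjoint[OF S 3] range[OF 3(1) pq(2)] range[OF 3(2) cd(2)] neq by blast
    qed
  qed
  moreover have "finite S"
    using S finite_roots by (auto simp: isotropic_sets_def intro: finite_subset)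
  ultimately show False using best[of "insert (gl_root a b) S"] new by simp
qed

section \<open>Modules over gl(m|n) through matrix units\<close>

definition unit_mat :: "nat \<Rightarrow> nat \<Rightarrow> nat \<Rightarrow> complex mat" where
  "unit_mat N a b = mat N N (\<lambda>(i, j). if i = a \<and> j = b then 1 else 0)"

lemma unit_mat_carrier [simp]: "unit_mat N a b \<in> carrier_mat N N"
  and unit_mat_dim [simp]: "dim_row (unit_mat N a b) = N" "dim_col (unit_mat N a b) = N"
  by (simp_all add: unit_mat_def)

lemma unit_mat_index: "i < N \<Longrightarrow> j < N \<Longrightarrow> unit_mat N a b $$ (i, j) = (if i = a \<and> j = b then 1 else 0)"
  by (simp add: unit_mat_def)

lemma unit_mat_times_index:
  assumes "x \<in> carrier_mat N N" "i < N" "j < N" "b < N"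
  shows "(unit_mat N a b * x) $$ (i, j) = (if i = a then x $$ (b, j) else 0)"
proof -
  have "(unit_mat N a b * x) $$ (i, j) = (\<Sum>k = 0..<N. unit_mat N a b $$ (i, k) * x $$ (k, j))"
    using assms by (simp add: scalar_prod_def)
  also have "\<dots> = (\<Sum>k = 0..<N. if k = b then (if i = a then x $$ (b, j) else 0) else 0)"
    using assms by (intro sum.cong) (auto simp: unit_mat_index)
  finally show ?thesis using assms by simp
qed

definition unit_parity :: "nat \<Rightarrow> nat \<Rightarrow> nat \<Rightarrow> nat" where
  "unit_parity m a b = (if (a < m) = (b < m) then 0 else 1)"

lemma unit_mat_part: "unit_mat (m + n) a b \<in> gl_part m n (unit_parity m a b)"
  by (auto simp: gl_part_def gl_def unit_parity_def unit_mat_index)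

lemma unit_mat_mult:
  assumes "b < N" "c < N"
  shows "unit_mat N a b * unit_mat N c d = (if b = c then 1 else 0) \<cdot>\<^sub>m unit_mat N a d"
proof (rule eq_matI, goal_cases)
  case (1 i j)
  then have ij: "i < N" "j < N" by simp_all
  show ?case
    unfolding unit_mat_times_index[OF unit_mat_carrier ij assms(1)]
    using ij assms by (simp add: unit_mat_index)
qed simp_all

lemma sbracket_unit_mat:
  assumes "a < m + n" "b < m + n" "c < m + n" "d < m + n"
  shows "sbracket p q (unit_mat (m + n) a b) (unit_mat (m + n) c d) =
    (if b = c then 1 else 0) \<cdot>\<^sub>m unit_mat (m + n) a d +
    (- ((- 1) ^ (p * q)) * (if d = a then 1 else 0)) \<cdot>\<^sub>m unit_mat (m + n) c b"
  unfolding sbracket_def unit_mat_mult[OF assms(2,3)] unit_mat_mult[OF assms(4,1)]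
  by (rule eq_matI) (simp_all add: unit_mat_index)

lemma cartan_unit_mat: "a < m + n \<Longrightarrow> unit_mat (m + n) a a \<in> cartan m n"
  by (auto simp: cartan_def gl_def diagonal_mat_def unit_mat_index)

lemma weight_eval_unit_mat: "a < m + n \<Longrightarrow> weight_eval m n \<mu> (unit_mat (m + n) a a) = \<mu> a"
proof -
  assume a: "a < m + n"
  have "weight_eval m n \<mu> (unit_mat (m + n) a a) = (\<Sum>c<m + n. if c = a then \<mu> a else 0)"
    unfolding weight_eval_def by (intro sum.cong) (auto simp: unit_mat_index)
  then show ?thesis using a by simp
qed

lemma diagonal_times_index:
  assumes "h \<in> cartan m n" "x \<in> carrier_mat (m + n) (m + n)" "i < m + n" "j < m + n"
  shows "(h * x - x * h) $$ (i, j) = (h $$ (i, i) - h $$ (j, j)) * x $$ (i, j)"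
proof -
  have h: "h \<in> carrier_mat (m + n) (m + n)" "\<And>k l. k < m + n \<Longrightarrow> l < m + n \<Longrightarrow> k \<noteq> l \<Longrightarrow> h $$ (k, l) = 0"
    using assms(1) by (auto simp: cartan_def gl_def diagonal_mat_def)
  have "(h * x) $$ (i, j) = (\<Sum>k = 0..<m + n. h $$ (i, k) * x $$ (k, j))"
    using assms h(1) by (simp add: scalar_prod_def)
  also have "\<dots> = (\<Sum>k = 0..<m + n. if k = i then h $$ (i, i) * x $$ (i, j) else 0)"
    using assms h by (intro sum.cong) auto
  finally have hx: "(h * x) $$ (i, j) = h $$ (i, i) * x $$ (i, j)" using assms by simp
  have "(x * h) $$ (i, j) = (\<Sum>k = 0..<m + n. x $$ (i, k) * h $$ (k, j))"
    using assms h(1) by (simp add: scalar_prod_def)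
  also have "\<dots> = (\<Sum>k = 0..<m + n. if k = j then x $$ (i, j) * h $$ (j, j) else 0)"
    using assms h by (intro sum.cong) auto
  finally have xh: "(x * h) $$ (i, j) = x $$ (i, j) * h $$ (j, j)" using assms by simp
  show ?thesis using hx xh assms h(1) by (simp add: algebra_simps)
qed

lemma weight_eval_root:
  assumes "a < m + n" "b < m + n"
  shows "weight_eval m n (gl_root a b) h = h $$ (a, a) - h $$ (b, b)"
proof -
  have "weight_eval m n (gl_root a b) h =
      (\<Sum>c<m + n. if c = a then h $$ (a, a) else 0) - (\<Sum>c<m + n. if c = b then h $$ (b, b) else 0)"
    unfolding weight_eval_def sum_subtractf[symmetric]
    by (intro sum.cong) (auto simp: root_apply)
  then show ?thesis using assms by simp
qed

lemma unit_mat_root_space: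
  assumes "a < m + n" "b < m + n"
  shows "unit_mat (m + n) a b \<in> root_space m n (gl_root a b)"
  unfolding root_space_def
proof (intro CollectI conjI ballI)
  show "unit_mat (m + n) a b \<in> gl m n" by (simp add: gl_def)
  fix h assume h: "h \<in> cartan m n"
  then have hc: "h \<in> carrier_mat (m + n) (m + n)" by (simp add: cartan_def gl_def)
  show "h * unit_mat (m + n) a b - unit_mat (m + n) a b * h =
      weight_eval m n (gl_root a b) h \<cdot>\<^sub>m unit_mat (m + n) a b"
  proof (rule eq_matI, goal_cases)
    case (1 i j)
    then have "i < m + n" "j < m + n" by auto
    then show ?case
      unfolding diagonal_times_index[OF h unit_mat_carrier \<open>i < m + n\<close> \<open>j < m + n\<close>] weight_eval_root[OF assms]
      by (auto simp: unit_mat_index)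
  qed (use hc in auto)
qed

text \<open>
  The diagonal matrix units distinguish the roots.
\<close>

lemma root_space_support:
  assumes "x \<in> root_space m n (gl_root a b)" "a \<noteq> b" "a < m + n" "b < m + n"
    and ij: "i < m + n" "j < m + n" "x $$ (i, j) \<noteq> 0"
  shows "i = a \<and> j = b"
proof -
  have x: "x \<in> carrier_mat (m + n) (m + n)" using assms(1) by (simp add: root_space_def gl_def)
  have eq: "gl_root a b c = gl_root i j c" if "c < m + n" for c
  proof -
    let ?h = "unit_mat (m + n) c c"
    have h: "?h \<in> cartan m n" using that by (rule cartan_unit_mat)
    have "?h * x - x * ?h = gl_root a b c \<cdot>\<^sub>m x"
      using assms(1) h weight_eval_unit_mat[OF that, of "gl_root a b"] by (auto simp: root_space_def)
    then have "(?h * x - x * ?h) $$ (i, j) = gl_root a b c * x $$ (i, j)"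
      using x assms by simp
    then have "?h $$ (i, i) - ?h $$ (j, j) = gl_root a b c"
      unfolding diagonal_times_index[OF h x ij(1,2)] using ij(3) by simp
    then show ?thesis using ij by (auto simp: unit_mat_index root_apply split: if_splits)
  qed
  show ?thesis
    using eq[OF assms(3)] eq[OF assms(4)] assms(2) by (simp add: root_apply split: if_splits)
qed

definition unit_act :: "nat \<Rightarrow> nat \<Rightarrow> ('v::ab_group_add) smodule \<Rightarrow> nat \<Rightarrow> nat \<Rightarrow> 'v \<Rightarrow> 'v" where
  "unit_act m n M a b = act M (unit_mat (m + n) a b)"

text \<open>
  Statements about the module can therefore be checked on matrix units.
\<close>

lemma act_expand:
  fixes M :: "('v::ab_group_add) smodule"
  assumes M: "gl_module m n M" and x: "x \<in> gl m n" and v: "v \<in> space M"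
  shows "act M x v = (\<Sum>p\<in>{..<m + n} \<times> {..<m + n}. scl M (x $$ p) (unit_act m n M (fst p) (snd p) v))"
proof -
  interpret vector_space "scl M" using M by (simp add: gl_module_def)
  have add: "act M (y + z) v = act M y v + act M z v" if "y \<in> gl m n" "z \<in> gl m n" for y z
    using M v that by (auto simp: gl_module_def)
  have scale: "act M (c \<cdot>\<^sub>m y) v = scl M c (act M y v)" if "y \<in> gl m n" for y c
    using M v that by (auto simp: gl_module_def)
  define part where "part F = mat (m + n) (m + n) (\<lambda>p. if p \<in> F then x $$ p else 0)" for F
  have part_gl: "part F \<in> gl m n" for F by (simp add: part_def gl_def)
  have expand: "act M (part F) v = (\<Sum>p\<in>F. scl M (x $$ p) (unit_act m n M (fst p) (snd p) v))"
    if "finite F" "F \<subseteq> {..<m + n} \<times> {..<m + n}" for F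
    using that
  proof (induction F rule: finite_induct)
    case empty
    have "part {} = 0 \<cdot>\<^sub>m part {}" by (rule eq_matI) (auto simp: part_def)
    then have "act M (part {}) v = scl M 0 (act M (part {}) v)" using scale[OF part_gl] by metis
    then show ?case by simp
  next
    case (insert p F)
    obtain a b where p: "p = (a, b)" by force
    have ab: "a < m + n" "b < m + n" using insert.prems p by auto
    have "part (insert p F) = x $$ p \<cdot>\<^sub>m unit_mat (m + n) a b + part F"
      using insert.hyps(2) p by (intro eq_matI) (auto simp: part_def unit_mat_index)
    then have "act M (part (insert p F)) v = act M (x $$ p \<cdot>\<^sub>m unit_mat (m + n) a b) v + act M (part F) v"
      using add[of "x $$ p \<cdot>\<^sub>m unit_mat (m + n) a b" "part F"] part_gl by (simp add: gl_def)
    also have "act M (x $$ p \<cdot>\<^sub>m unit_mat (m + n) a b) v = scl M (x $$ p) (unit_act m n M a b v)"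
      using scale by (simp add: unit_act_def gl_def)
    finally show ?case using insert p by simp
  qed
  have "part ({..<m + n} \<times> {..<m + n}) = x"
    using x by (intro eq_matI) (auto simp: part_def gl_def)
  with expand[of "{..<m + n} \<times> {..<m + n}"] show ?thesis by simp
qed

definition even_part :: "('v::ab_group_add) smodule \<Rightarrow> 'v set" where
  "even_part M = grade M 0"

definition odd_part :: "('v::ab_group_add) smodule \<Rightarrow> 'v set" where
  "odd_part M = grade M 1"

lemma gl_action_unit_act:
  fixes M :: "('v::ab_group_add) smodule"
  assumes M: "gl_module m n M"
  shows "gl_action (scl M) (even_part M) (odd_part M) (unit_act m n M) m n"
proof -
  interpret vector_space "scl M" using M by (simp add: gl_module_def)
  let ?E = "unit_mat (m + n)"
  have gl: "?E a b \<in> gl m n" for a b by (simp add: gl_def)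
  have sp: "space M = {v + w | v w. v \<in> even_part M \<and> w \<in> odd_part M}"
    by (simp only: space_def even_part_def odd_part_def)
  have grading: "act M x v \<in> grade M ((p + q) mod 2)"
    if "p \<in> {0, 1}" "q \<in> {0, 1}" "x \<in> gl_part m n p" "v \<in> grade M q" for p q x v
    using M that unfolding gl_module_def by blast
  have add: "act M (y + z) v = act M y v + act M z v" if "y \<in> gl m n" "z \<in> gl m n" "v \<in> space M" for y z v
    using M that by (auto simp: gl_module_def)
  have scale: "act M (c \<cdot>\<^sub>m y) v = scl M c (act M y v)" if "y \<in> gl m n" "v \<in> space M" for y c v
    using M that by (auto simp: gl_module_def)
  show ?thesis
  proof (unfold_locales, unfold sp[symmetric])
    show "subspace (even_part M)" "subspace (odd_part M)" "even_part M \<inter> odd_part M = {0}"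
      using M unfolding gl_module_def even_part_def odd_part_def by simp_all
    show "unit_act m n M a b (v + w) = unit_act m n M a b v + unit_act m n M a b w"
      if "v \<in> space M" "w \<in> space M" for a b v w
      using M gl that by (auto simp: gl_module_def unit_act_def)
    show "unit_act m n M a b (scl M c v) = scl M c (unit_act m n M a b v)" if "v \<in> space M" for a b c v
      using M gl that by (auto simp: gl_module_def unit_act_def)
    show "unit_act m n M a b ` even_part M \<subseteq> even_part M \<and> unit_act m n M a b ` odd_part M \<subseteq> odd_part M"
      if "(a < m) = (b < m)" for a b
      using that grading[OF _ _ unit_mat_part[of m n a b], of 0] grading[OF _ _ unit_mat_part[of m n a b], of 1]
      by (auto simp: unit_parity_def unit_act_def even_part_def odd_part_def)
    show "unit_act m n M a b ` even_part M \<subseteq> odd_part M \<and> unit_act m n M a b ` odd_part M \<subseteq> even_part M"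
      if "(a < m) \<noteq> (b < m)" for a b
      using that grading[OF _ _ unit_mat_part[of m n a b], of 0] grading[OF _ _ unit_mat_part[of m n a b], of 1]
      by (auto simp: unit_parity_def unit_act_def even_part_def odd_part_def)
    fix a b c d v
    assume bounds: "a < m + n" "b < m + n" "c < m + n" "d < m + n" and v: "v \<in> space M"
    define p where "p = unit_parity m a b"
    define q where "q = unit_parity m c d"
    define s where "s = (if (a < m) \<noteq> (b < m) \<and> (c < m) \<noteq> (d < m) then - 1 else 1 :: complex)"
    have s: "(- 1) ^ (p * q) = s" by (auto simp: s_def p_def q_def unit_parity_def)
    have pq: "p \<in> {0, 1}" "q \<in> {0, 1}" by (auto simp: p_def q_def unit_parity_def)
    have "act M (sbracket p q (?E a b) (?E c d)) v =
        act M (?E a b) (act M (?E c d) v) - scl M ((- 1) ^ (p * q)) (act M (?E c d) (act M (?E a b) v))"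
      using M pq v unit_mat_part[of m n a b] unit_mat_part[of m n c d]
      unfolding gl_module_def p_def q_def by blast
    moreover have "act M (sbracket p q (?E a b) (?E c d)) v =
        scl M (if b = c then 1 else 0) (act M (?E a d) v) + scl M (- s * (if d = a then 1 else 0)) (act M (?E c b) v)"
      unfolding sbracket_unit_mat[OF bounds] s using add scale gl v by (simp add: gl_def)
    ultimately have "act M (?E a b) (act M (?E c d) v) = scl M s (act M (?E c d) (act M (?E a b) v)) +
        (scl M (if b = c then 1 else 0) (act M (?E a d) v) + scl M (- s * (if d = a then 1 else 0)) (act M (?E c b) v))"
      unfolding s by (metis add.commute diff_add_cancel)
    then show "unit_act m n M a b (unit_act m n M c d v) =
        scl M (if (a < m) \<noteq> (b < m) \<and> (c < m) \<noteq> (d < m) then - 1 else 1) (unit_act m n M c d (unit_act m n M a b v)) +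
        (if b = c then unit_act m n M a d v else 0) -
        scl M (if (a < m) \<noteq> (b < m) \<and> (c < m) \<noteq> (d < m) then - 1 else 1) (if d = a then unit_act m n M c b v else 0)"
      unfolding s_def[symmetric] unit_act_def
      by (cases "b = c"; cases "d = a") simp_all
  qed
qed

theorem simple_gl_action_unit_act:
  fixes M :: "('v::ab_group_add) smodule"
  assumes M: "simple_module m n M"
  shows "simple_gl_action (scl M) (even_part M) (odd_part M) (unit_act m n M) m n"
proof -
  have gm: "gl_module m n M" using M by (simp add: simple_module_def)
  interpret gl_action "scl M" "even_part M" "odd_part M" "unit_act m n M" m n
    using gm by (rule gl_action_unit_act)
  have sp: "space M = V" unfolding V_def unfolding space_def even_part_def odd_part_def by (rule refl)
  show ?thesis
  proof unfold_locales
    fix W assume W: "stable W" "W \<noteq> {0}"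
    have sub: "subspace W" and gr: "graded W" and cl: "\<And>a b w. a < N \<Longrightarrow> b < N \<Longrightarrow> w \<in> W \<Longrightarrow> unit_act m n M a b w \<in> W"
      using W(1) by (auto simp: stable_def)
    have WV: "W \<subseteq> space M"
      using gr unfolding graded_def sp V_def by blast
    have "act M x w \<in> W" if "x \<in> gl m n" "w \<in> W" for x w
    proof -
      have "w \<in> space M" using that(2) WV by blast
      show ?thesis
        unfolding act_expand[OF gm that(1) \<open>w \<in> space M\<close>]
        by (rule subspace_sum[OF sub]) (auto intro!: subspace_scale[OF sub] cl that(2))
    qed
    then have "submodule m n M W"
      using sub gr unfolding graded_def unfolding submodule_def even_part_def odd_part_def by blast
    then show "W = V" using M W(2) by (auto simp: simple_module_def sp)
  qed
qed

text \<open>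
  The isomorphism transports the highest weight vector.
\<close>

lemma is_L_imp_hwv:
  fixes M N :: "('v::ab_group_add) smodule"
  assumes L: "is_L m n \<pi> \<mu> N" and iso: "module_iso m n M N" and M: "simple_module m n M"
    and \<sigma>: "set \<sigma> = {..<m + n}" "pos_roots m n \<pi> = {gl_root a b | a b. before \<sigma> a b}"
  shows "\<exists>v. gl_action.hwv (scl M) (even_part M) (odd_part M) (unit_act m n M) m n \<sigma> \<mu> v"
proof -
  interpret simple_gl_action "scl M" "even_part M" "odd_part M" "unit_act m n M" m n
    using M by (rule simple_gl_action_unit_act)
  have sp: "space M = V" unfolding V_def unfolding space_def even_part_def odd_part_def by (rule refl)
  have gmN: "gl_module m n N" using L by (simp add: is_L_def simple_module_def)
  interpret N: gl_action "scl N" "even_part N" "odd_part N" "unit_act m n N" m n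
    using gmN by (rule gl_action_unit_act)
  obtain u where u: "u \<in> even_part N \<union> odd_part N" "u \<noteq> 0"
    "\<And>h. h \<in> cartan m n \<Longrightarrow> act N h u = scl N (weight_eval m n \<mu> h) u"
    "\<And>\<alpha> x. \<alpha> \<in> pos_roots m n \<pi> \<Longrightarrow> x \<in> root_space m n \<alpha> \<Longrightarrow> act N x u = 0"
    using L unfolding is_L_def highest_weight_module_def even_part_def odd_part_def by blast
  obtain f where f: "bij_betw f (space M) (space N)"
    "\<And>v w. v \<in> space M \<Longrightarrow> w \<in> space M \<Longrightarrow> f (v + w) = f v + f w"
    "\<And>c v. v \<in> space M \<Longrightarrow> f (scl M c v) = scl N c (f v)"
    "f ` even_part M = even_part N" "f ` odd_part M = odd_part N"
    "\<And>x v. x \<in> gl m n \<Longrightarrow> v \<in> space M \<Longrightarrow> f (act M x v) = act N x (f v)"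
    using iso unfolding module_iso_def even_part_def odd_part_def by auto
  obtain v where v: "homogeneous v" "f v = u"
  proof -
    assume h: "\<And>v. homogeneous v \<Longrightarrow> f v = u \<Longrightarrow> thesis"
    from u(1) f(4,5) have "u \<in> f ` (even_part M \<union> odd_part M)" by blast
    then show thesis using h unfolding homogeneous_def by blast
  qed
  have vV: "v \<in> space M" using v(1) homogeneous_V sp by simp
  have zero: "0 \<in> space M" "f 0 = 0"
    using f(3)[of 0 0] V_closed(5) by (simp_all add: sp)
  have inj: "x = y" if "x \<in> space M" "y \<in> space M" "f x = f y" for x y
    using f(1) that by (auto simp: bij_betw_def dest: inj_onD)
  have gl: "unit_mat (m + n) a b \<in> gl m n" for a b by (simp add: gl_def)
  have "hwv \<sigma> \<mu> v" unfolding hwv_def weight_vector_def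
  proof (intro conjI allI impI)
    show "homogeneous v" by (rule v(1))
    show "v \<noteq> 0" using u(2) v(2) zero by auto
    show "v \<in> V" using vV sp by simp
    show "unit_act m n M a a v = scl M (\<mu> a) v" if "a < m + n" for a
    proof (rule inj)
      show "unit_act m n M a a v \<in> space M" "scl M (\<mu> a) v \<in> space M"
        using vV that by (simp_all add: sp V_closed)
      show "f (unit_act m n M a a v) = f (scl M (\<mu> a) v)"
        using f(3,6) vV gl u(3)[OF cartan_unit_mat[OF that]] v(2)
        by (simp add: unit_act_def weight_eval_unit_mat[OF that])
    qed
    show "unit_act m n M a b v = 0" if "before \<sigma> a b" for a b
    proof (rule inj)
      have ab: "a < m + n" "b < m + n" using that \<sigma>(1) by (auto simp: before_def)
      then show "unit_act m n M a b v \<in> space M" "0 \<in> space M"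
        using vV by (simp_all add: sp V_closed)
      have "gl_root a b \<in> pos_roots m n \<pi>" unfolding \<sigma>(2) using that by blast
      from u(4)[OF this unit_mat_root_space[OF ab]]
      show "f (unit_act m n M a b v) = f 0"
        using f(6) vV gl v(2) zero by (simp add: unit_act_def)
    qed
  qed
  then show ?thesis by blast
qed

lemma hwv_imp_is_L:
  fixes M :: "('v::ab_group_add) smodule"
  assumes M: "simple_module m n M"
    and hwv: "gl_action.hwv (scl M) (even_part M) (odd_part M) (unit_act m n M) m n \<sigma> \<mu> v"
    and \<sigma>: "set \<sigma> = {..<m + n}" "pos_roots m n \<pi> = {gl_root a b | a b. before \<sigma> a b}"
  shows "is_L m n \<pi> \<mu> M"
proof -
  interpret simple_gl_action "scl M" "even_part M" "odd_part M" "unit_act m n M" m n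
    using M by (rule simple_gl_action_unit_act)
  have gm: "gl_module m n M" using M by (simp add: simple_module_def)
  have sp: "space M = V" unfolding V_def unfolding space_def even_part_def odd_part_def by (rule refl)
  have v: "homogeneous v" "v \<noteq> 0" "weight_vector \<mu> v" "\<And>a b. before \<sigma> a b \<Longrightarrow> unit_act m n M a b v = 0"
    using hwv by (auto simp: hwv_def)
  have vV: "v \<in> space M" using v(1) homogeneous_V sp by simp
  have "highest_weight_module m n \<pi> \<mu> M"
    unfolding highest_weight_module_def
  proof (intro conjI bexI[of _ v] ballI allI impI)
    show "gl_module m n M" by (rule gm)
    show "v \<noteq> 0" by (rule v(2))
    show "v \<in> grade M 0 \<union> grade M 1" using v(1) unfolding homogeneous_def unfolding even_part_def odd_part_def by blast
    show "W = space M" if "submodule m n M W \<and> v \<in> W" for W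
      using M that v(2) unfolding simple_module_def by blast
    show "act M h v = scl M (weight_eval m n \<mu> h) v" if h: "h \<in> cartan m n" for h
    proof -
      have hg: "h \<in> gl m n" and diag: "\<And>a b. a < m + n \<Longrightarrow> b < m + n \<Longrightarrow> a \<noteq> b \<Longrightarrow> h $$ (a, b) = 0"
        using h by (auto simp: cartan_def gl_def diagonal_mat_def)
      have "act M h v = (\<Sum>a<m + n. \<Sum>b<m + n. scl M (h $$ (a, b)) (unit_act m n M a b v))"
        unfolding act_expand[OF gm hg vV] by (simp add: sum.cartesian_product case_prod_beta)
      also have "\<dots> = (\<Sum>a<m + n. \<Sum>b<m + n. if b = a then scl M (\<mu> a * h $$ (a, a)) v else 0)"
        using diag v(3) by (intro sum.cong refl) (auto simp: weight_vector_def mult.commute)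
      also have "\<dots> = scl M (weight_eval m n \<mu> h) v"
        by (simp add: weight_eval_def scale_sum_left)
      finally show ?thesis .
    qed
    show "act M x v = 0" if \<alpha>: "\<alpha> \<in> pos_roots m n \<pi>" and x: "x \<in> root_space m n \<alpha>" for \<alpha> x
    proof -
      obtain a b where ab: "\<alpha> = gl_root a b" "before \<sigma> a b" using \<alpha> unfolding \<sigma>(2) by blast
      then have bounds: "a < m + n" "b < m + n" "a \<noteq> b" using \<sigma>(1) by (auto simp: before_def)
      have xg: "x \<in> gl m n" using x by (simp add: root_space_def)
      show ?thesis
        unfolding act_expand[OF gm xg vV]
      proof (rule sum.neutral, rule ballI)
        fix p assume "p \<in> {..<m + n} \<times> {..<m + n}"
        then obtain i j where p: "p = (i, j)" "i < m + n" "j < m + n" by auto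
        show "scl M (x $$ p) (unit_act m n M (fst p) (snd p) v) = 0"
        proof (cases "x $$ p = 0")
          case False
          then have "i = a \<and> j = b"
            using root_space_support[OF x[unfolded ab(1)] bounds(3,1,2) p(2,3)] p(1) by simp
          then show ?thesis using v(4)[OF ab(2)] p(1) by simp
        qed simp
      qed
    qed
  qed
  then show ?thesis using M by (simp add: is_L_def)
qed

lemma module_iso_refl: "module_iso m n M M"
  unfolding module_iso_def by (rule exI[of _ id]) auto

section \<open>The words realized by a simple module\<close>

text \<open>
  In a shuffle the coordinates of one type appear in their natural order.
\<close>

lemma shuffle_index:
  assumes \<sigma>: "shuffle m n (u @ a # z)"
  shows "a = (if a < m then length (filter (\<lambda>x. x < m) u) else m + length (filter (\<lambda>x. \<not> x < m) u))"
proof -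
  let ?\<sigma> = "u @ a # z"
  have d: "distinct ?\<sigma>" and s: "set ?\<sigma> = {..<m + n}" using \<sigma> by (auto simp: shuffle_def)
  have a: "a < m + n" using s by auto
  have before: "before ?\<sigma> x a \<longleftrightarrow> x \<in> set u" for x
    using d by (auto simp: before_def pos_append dest: pos_less_length)
  have "set (filter (\<lambda>x. (x < m) = (a < m)) u) = {x. x < a \<and> (x < m) = (a < m)}"
  proof (rule Set.set_eqI)
    fix x
    show "x \<in> set (filter (\<lambda>x. (x < m) = (a < m)) u) \<longleftrightarrow> x \<in> {x. x < a \<and> (x < m) = (a < m)}"
    proof (cases "x < m + n \<and> (x < m) = (a < m)")
      case True
      then have "x \<in> set u \<longleftrightarrow> x < a"
        using before[of x] shuffle_before_iff[OF \<sigma>, of x a] a by blast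
      then show ?thesis using True by simp
    next
      case False
      have "x \<in> set u \<Longrightarrow> x < m + n" using s by (metis UnCI lessThan_iff set_append)
      then show ?thesis using False a by auto
    qed
  qed
  then have "length (filter (\<lambda>x. (x < m) = (a < m)) u) = card {x. x < a \<and> (x < m) = (a < m)}"
    using d distinct_card[of "filter (\<lambda>x. (x < m) = (a < m)) u"] by simp
  moreover have "{x. x < a \<and> (x < m) = (a < m)} = (if a < m then {..<a} else {m..<a})" by auto
  ultimately show ?thesis by (cases "a < m") simp_all
qed

lemma shuffle_determined:
  assumes "shuffle m n \<sigma>" "shuffle m n \<tau>" "map (\<lambda>a. a < m) \<sigma> = map (\<lambda>a. a < m) \<tau>"
  shows "\<sigma> = \<tau>"
proof -
  have len: "length \<sigma> = length \<tau>" using assms(3) by (metis length_map)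
  have "k \<le> length \<sigma> \<Longrightarrow> take k \<sigma> = take k \<tau>" for k
  proof (induction k)
    case (Suc k)
    then have k: "k < length \<sigma>" "k < length \<tau>" and t: "take k \<sigma> = take k \<tau>" using len by auto
    have type: "(\<sigma> ! k < m) = (\<tau> ! k < m)" using assms(3) k by (metis nth_map)
    have nth: "\<rho> ! k = (if \<rho> ! k < m then length (filter (\<lambda>x. x < m) (take k \<rho>))
        else m + length (filter (\<lambda>x. \<not> x < m) (take k \<rho>)))" if "shuffle m n \<rho>" "k < length \<rho>" for \<rho>
      by (rule shuffle_index[of m n _ _ "drop (Suc k) \<rho>"])
        (simp add: id_take_nth_drop[OF that(2), symmetric] that(1))
    have "\<sigma> ! k = \<tau> ! k"
      using nth[OF assms(1) k(1)] nth[OF assms(2) k(2)] type unfolding t by metis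
    then show ?case using t k by (simp add: take_Suc_conv_app_nth)
  qed simp
  from this[of "length \<sigma>"] show ?thesis using len by simp
qed

fun letter_at :: "nat \<Rightarrow> weight \<Rightarrow> nat \<Rightarrow> letter \<Rightarrow> bool" where
  "letter_at m \<nu> a (Ep t) \<longleftrightarrow> a < m \<and> \<nu> a = of_int t"
| "letter_at m \<nu> a (De t) \<longleftrightarrow> \<not> a < m \<and> \<nu> a = - of_int t"

fun is_Ep :: "letter \<Rightarrow> bool" where
  "is_Ep (Ep _) = True"
| "is_Ep (De _) = False"

lemma letter_at_types: "list_all2 (letter_at m \<nu>) \<sigma> x \<Longrightarrow> map (\<lambda>a. a < m) \<sigma> = map is_Ep x"
proof (induction rule: list_all2_induct)
  case (Cons a \<sigma> l x)
  then show ?case by (cases l) auto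
qed simp

lemma letter_at_unique:
  "list_all2 (letter_at m \<nu>) \<sigma> x \<Longrightarrow> list_all2 (letter_at m \<nu>) \<sigma> y \<Longrightarrow> x = y"
proof (induction \<sigma> arbitrary: x y)
  case (Cons a \<sigma>)
  then obtain l x' k y' where "x = l # x'" "y = k # y'" "letter_at m \<nu> a l" "letter_at m \<nu> a k"
    "list_all2 (letter_at m \<nu>) \<sigma> x'" "list_all2 (letter_at m \<nu>) \<sigma> y'"
    by (auto simp: list_all2_Cons1)
  then show ?case using Cons.IH[of x' y'] by (cases l; cases k) auto
qed simp

lemma letter_at_cong:
  assumes "list_all2 (letter_at m \<nu>) \<sigma> x" "\<And>a. a \<in> set \<sigma> \<Longrightarrow> \<nu>' a = \<nu> a"
  shows "list_all2 (letter_at m \<nu>') \<sigma> x"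
proof (rule list.rel_mono_strong[OF assms(1)])
  fix a l assume "a \<in> set \<sigma>" "letter_at m \<nu> a l"
  then show "letter_at m \<nu>' a l" using assms(2)[of a] by (cases l) auto
qed

context simple_gl_action begin

lemma hwv_cong: "(\<And>a. a < N \<Longrightarrow> \<mu> a = \<mu>' a) \<Longrightarrow> hwv \<sigma> \<mu> v \<longleftrightarrow> hwv \<sigma> \<mu>' v"
  by (simp add: hwv_def weight_vector_def)

text \<open>
  The words of the highest weights, shifted by \<open>\<rho>\<close>, for all orders.
\<close>

definition realized :: "letter list \<Rightarrow> bool" where
  "realized x \<longleftrightarrow> (\<exists>\<sigma> \<nu> v. shuffle m n \<sigma> \<and> list_all2 (letter_at m \<nu>) \<sigma> x \<and>
     hwv \<sigma> (\<nu> - rho_order m n \<sigma>) v)"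

lemma shuffle_ordering: "shuffle m n \<sigma> \<Longrightarrow> ordering \<sigma>"
  by (simp add: shuffle_def ordering_def)

text \<open>
  Neighbouring coordinates \<open>a\<close>, \<open>b\<close> of different types contribute nothing through \<open>\<rho>\<close>, so the condition
  in the odd reflection is one on the shifted weight. The vector \<open>\<rho>\<close> changes by the root, which cancels the
  change of the weight in the first case.
\<close>

lemma hwv_rho_swap:
  assumes \<sigma>: "shuffle m n (u @ a # b # z)" and odd: "(a < m) \<noteq> (b < m)"
    and v: "hwv (u @ a # b # z) (\<nu> - rho_order m n (u @ a # b # z)) v"
  shows "\<nu> a + \<nu> b \<noteq> 0 \<Longrightarrow> \<exists>w. hwv (u @ b # a # z) (\<nu> - rho_order m n (u @ b # a # z)) w"
    and "\<nu> a + \<nu> b = 0 \<Longrightarrow> hwv (u @ b # a # z) ((\<nu> + gl_root a b) - rho_order m n (u @ b # a # z)) v"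
proof -
  let ?\<sigma> = "u @ a # b # z" and ?\<tau> = "u @ b # a # z"
  have sum: "(\<nu> - rho_order m n ?\<sigma>) a + (\<nu> - rho_order m n ?\<sigma>) b = \<nu> a + \<nu> b"
    using rho_order_adjacent_odd[OF \<sigma> odd] by (simp add: algebra_simps)
  note R = odd_reflection[OF shuffle_ordering[OF \<sigma>] v odd]
  show "\<exists>w. hwv ?\<tau> (\<nu> - rho_order m n ?\<tau>) w" if "\<nu> a + \<nu> b \<noteq> 0"
  proof -
    have "(\<nu> - rho_order m n ?\<sigma>) + eps b - eps a = \<nu> - rho_order m n ?\<tau>"
      by (rule ext) (simp add: rho_order_swap[OF \<sigma> odd] gl_root_def)
    then show ?thesis using R(1) that sum by metis
  qed
  show "hwv ?\<tau> ((\<nu> + gl_root a b) - rho_order m n ?\<tau>) v" if "\<nu> a + \<nu> b = 0"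
  proof -
    have "\<nu> - rho_order m n ?\<sigma> = (\<nu> + gl_root a b) - rho_order m n ?\<tau>"
      by (rule ext) (simp add: rho_order_swap[OF \<sigma> odd])
    then show ?thesis using R(2) that sum by metis
  qed
qed

lemma realized_swap:
  assumes "realized (u @ k # l # z)" and odd: "is_Ep k \<noteq> is_Ep l"
    and typical: "\<And>\<nu> a b. letter_at m \<nu> a k \<Longrightarrow> letter_at m \<nu> b l \<Longrightarrow> \<nu> a + \<nu> b \<noteq> 0 \<Longrightarrow>
      letter_at m \<nu> b k' \<and> letter_at m \<nu> a l'"
    and atypical: "\<And>\<nu> a b. letter_at m \<nu> a k \<Longrightarrow> letter_at m \<nu> b l \<Longrightarrow> \<nu> a + \<nu> b = 0 \<Longrightarrow>
      letter_at m (\<nu> + gl_root a b) b k' \<and> letter_at m (\<nu> + gl_root a b) a l'"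
  shows "realized (u @ k' # l' # z)"
proof -
  obtain \<sigma> \<nu> v where \<sigma>: "shuffle m n \<sigma>" "list_all2 (letter_at m \<nu>) \<sigma> (u @ k # l # z)"
    "hwv \<sigma> (\<nu> - rho_order m n \<sigma>) v" using assms(1) by (auto simp: realized_def)
  then obtain su a b sz where s: "\<sigma> = su @ a # b # sz" and
    all: "list_all2 (letter_at m \<nu>) su u" "letter_at m \<nu> a k" "letter_at m \<nu> b l" "list_all2 (letter_at m \<nu>) sz z"
    by (auto simp: list_all2_append2 list_all2_Cons2)
  have ab: "(a < m) \<noteq> (b < m)" using all(2,3) odd by (cases k; cases l) auto
  note sh = \<sigma>(1)[unfolded s] and hv = \<sigma>(3)[unfolded s]
  have tau: "shuffle m n (su @ b # a # sz)" by (rule shuffle_swap[OF sh ab])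
  show ?thesis
  proof (cases "\<nu> a + \<nu> b = 0")
    case False
    then have "list_all2 (letter_at m \<nu>) (su @ b # a # sz) (u @ k' # l' # z)"
      using typical all by (auto intro: list_all2_appendI)
    then show ?thesis using hwv_rho_swap(1)[OF sh ab hv False] tau unfolding realized_def by blast
  next
    case True
    let ?\<nu> = "\<nu> + gl_root a b"
    have free: "a \<notin> set su \<union> set sz" "b \<notin> set su \<union> set sz" using sh by (auto simp: shuffle_def)
    have "list_all2 (letter_at m ?\<nu>) su u"
      by (rule letter_at_cong[OF all(1)]) (use free in \<open>auto simp: root_apply\<close>)
    moreover have "list_all2 (letter_at m ?\<nu>) sz z"
      by (rule letter_at_cong[OF all(4)]) (use free in \<open>auto simp: root_apply\<close>)
    ultimately have "list_all2 (letter_at m ?\<nu>) (su @ b # a # sz) (u @ k' # l' # z)"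
      using atypical[OF all(2,3) True] by (auto intro: list_all2_appendI)
    then show ?thesis using hwv_rho_swap(2)[OF sh ab hv True] tau unfolding realized_def by blast
  qed
qed

lemma reflection_closed_realized: "reflection_closed realized"
proof
  fix s t :: int and u z :: "letter list"
  assume st: "s \<noteq> t"
  show "realized (u @ Ep s # De t # z) = realized (u @ De t # Ep s # z)"
  proof
    assume "realized (u @ Ep s # De t # z)"
    then show "realized (u @ De t # Ep s # z)" by (rule realized_swap) (use st in auto)
  next
    assume "realized (u @ De t # Ep s # z)"
    then show "realized (u @ Ep s # De t # z)" by (rule realized_swap) (use st in auto)
  qed
next
  fix s :: int and u z :: "letter list"
  show "realized (u @ Ep s # De s # z) = realized (u @ De (s + 1) # Ep (s + 1) # z)"
  proof
    assume "realized (u @ Ep s # De s # z)"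
    then show "realized (u @ De (s + 1) # Ep (s + 1) # z)"
      by (rule realized_swap) (auto simp: root_apply)
  next
    assume "realized (u @ De (s + 1) # Ep (s + 1) # z)"
    then show "realized (u @ Ep s # De s # z)"
      by (rule realized_swap) (auto simp: root_apply)
  qed
qed

lemma realized_unique:
  assumes "realized x" "realized y" "map is_Ep x = map is_Ep y"
  shows "x = y"
proof -
  obtain \<sigma> \<nu> v where \<sigma>: "shuffle m n \<sigma>" "list_all2 (letter_at m \<nu>) \<sigma> x"
    "hwv \<sigma> (\<nu> - rho_order m n \<sigma>) v" using assms(1) by (auto simp: realized_def)
  obtain \<tau> \<nu>' w where \<tau>: "shuffle m n \<tau>" "list_all2 (letter_at m \<nu>') \<tau> y"
    "hwv \<tau> (\<nu>' - rho_order m n \<tau>) w" using assms(2) by (auto simp: realized_def)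
  have "\<sigma> = \<tau>"
    using shuffle_determined[OF \<sigma>(1) \<tau>(1)] letter_at_types[OF \<sigma>(2)] letter_at_types[OF \<tau>(2)] assms(3) by simp
  have "\<nu>' a = \<nu> a" if "a < N" for a
    using hwv_unique[OF shuffle_ordering[OF \<sigma>(1)] \<sigma>(3) \<tau>(3)[folded \<open>\<sigma> = \<tau>\<close>] that] \<open>\<sigma> = \<tau>\<close> by simp
  then have "list_all2 (letter_at m \<nu>) \<sigma> y"
    using \<sigma>(1) by (intro letter_at_cong[OF \<tau>(2)[folded \<open>\<sigma> = \<tau>\<close>]]) (auto simp: shuffle_def)
  then show ?thesis by (rule letter_at_unique[OF \<sigma>(2)])
qed

text \<open>
  Any shuffle is reached from any other one by odd reflections.
\<close>

lemma realized_types: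
  assumes "realized x" "mset ts = mset (map is_Ep x)"
  shows "\<exists>y. realized y \<and> map is_Ep y = ts"
proof -
  interpret reflection_closed realized by (rule reflection_closed_realized)
  show ?thesis
  proof (rule swap_invariant_perm[where Q = "\<lambda>ts. \<exists>y. realized y \<and> map is_Ep y = ts" and w' = "map is_Ep x"])
    show "mset (map is_Ep x) = mset ts" using assms(2) by simp
    show "\<exists>y. realized y \<and> map is_Ep y = map is_Ep x" using assms(1) by blast
    fix u p q z assume "\<exists>y. realized y \<and> map is_Ep y = u @ p # q # z"
    then obtain y where y: "realized y" "map is_Ep y = u @ p # q # z" by blast
    then obtain yu k l yz where s: "y = yu @ k # l # yz" and
      t: "map is_Ep yu = u" "is_Ep k = p" "is_Ep l = q" "map is_Ep yz = z"
      by (auto simp: map_eq_append_conv map_eq_Cons_conv)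
    have "\<exists>k' l'. realized (yu @ k' # l' # yz) \<and> is_Ep k' = q \<and> is_Ep l' = p"
    proof (cases k; cases l)
      fix a b assume kl: "k = Ep a" "l = De b"
      show ?thesis
      proof (cases "a = b")
        case True
        then have "realized (yu @ De (a + 1) # Ep (a + 1) # yz)" using y(1) kl by (simp add: s atypical)
        then show ?thesis using t kl by (intro exI conjI) auto
      next
        case False
        then have "realized (yu @ De b # Ep a # yz)" using y(1) kl by (simp add: s typical)
        then show ?thesis using t kl by (intro exI conjI) auto
      qed
    next
      fix a b assume kl: "k = De a" "l = Ep b"
      show ?thesis
      proof (cases "a = b")
        case True
        then have "realized (yu @ Ep (a - 1) # De (a - 1) # yz)" using y(1) kl by (simp add: s atypical)
        then show ?thesis using t kl by (intro exI conjI) auto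
      next
        case False
        then have "realized (yu @ Ep b # De a # yz)" using y(1) kl by (simp add: s typical)
        then show ?thesis using t kl by (intro exI conjI) auto
      qed
    next
      fix a b assume kl: "k = Ep a" "l = Ep b"
      then show ?thesis using y(1) s t by (intro exI[of _ k] exI[of _ l]) auto
    next
      fix a b assume kl: "k = De a" "l = De b"
      then show ?thesis using y(1) s t by (intro exI[of _ k] exI[of _ l]) auto
    qed
    then obtain k' l' where "realized (yu @ k' # l' # yz)" "is_Ep k' = q" "is_Ep l' = p" by blast
    then show "\<exists>y. realized y \<and> map is_Ep y = u @ q # p # z"
      using t by (intro exI[of _ "yu @ k' # l' # yz"]) simp
  qed
qed

text \<open>
  The lowering operator of an even simple root acts nilpotently, so the difference of the entries is a
  natural number, and \<open>\<rho>\<close> makes it positive.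
\<close>

lemma dominant_words_realized:
  assumes v: "hwv [0..<N] lam v"
    and dom: "\<And>c. Suc c < N \<Longrightarrow> (c < m) = (Suc c < m) \<Longrightarrow> lam c - lam (Suc c) \<in> \<nat>"
  shows "dominant_words realized"
proof -
  interpret reflection_closed realized by (rule reflection_closed_realized)
  have drop: "\<exists>a b \<nu> j. letter_at m \<nu> a k \<and> letter_at m \<nu> b l \<and> \<nu> a - \<nu> b = of_nat (Suc j)"
    if R: "realized (u @ k # l # z)" and same: "is_Ep k = is_Ep l" for u k l z
  proof -
    obtain \<sigma> \<nu> w where \<sigma>: "shuffle m n \<sigma>" "list_all2 (letter_at m \<nu>) \<sigma> (u @ k # l # z)"
      "hwv \<sigma> (\<nu> - rho_order m n \<sigma>) w" using R by (auto simp: realized_def)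
    then obtain su a b sz where s: "\<sigma> = su @ a # b # sz" and
      all: "letter_at m \<nu> a k" "letter_at m \<nu> b l"
      by (auto simp: list_all2_append2 list_all2_Cons2)
    have ab: "(a < m) = (b < m)" using all same by (cases k; cases l) auto
    note sh = \<sigma>(1)[unfolded s] and hv = \<sigma>(3)[unfolded s]
    have ord: "ordering (su @ a # b # sz)" by (rule shuffle_ordering[OF sh])
    note bounds = ordering_swap(2)[OF ord]
    have wV: "w \<in> V" using hv by (simp add: hwv_def homogeneous_V)
    obtain j where "(X b a ^^ j) w = 0"
      using dominant_locally_nilpotent[OF v dom _ _ _ _ wV, of b a] bounds ab by auto
    from nilpotent_imp_integral[OF ord hv ab this] obtain i where
      i: "(\<nu> - rho_order m n (su @ a # b # sz)) a - (\<nu> - rho_order m n (su @ a # b # sz)) b = of_nat i"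
      by (auto elim: Nats_cases)
    note even = rho_order_adjacent_even[OF sh ab]
    have "\<nu> a - \<nu> b = ((\<nu> - rho_order m n (su @ a # b # sz)) a - (\<nu> - rho_order m n (su @ a # b # sz)) b) +
        (rho_order m n (su @ a # b # sz) a - rho_order m n (su @ a # b # sz) b)"
      by simp
    also have "\<dots> = of_nat (i + (b - a))" unfolding i even(1) by simp
    also have "i + (b - a) = Suc (i + (b - a) - 1)" using even(2) by simp
    finally show ?thesis using all by blast
  qed
  show ?thesis
  proof
    fix u z :: "letter list" and a b :: int
    show "b < a" if R: "realized (u @ Ep a # Ep b # z)"
    proof -
      obtain j where "of_int a - of_int b = (of_nat (Suc j) :: complex)" using drop[OF R] by auto
      then have "(of_int (a - b) :: complex) = of_int (int (Suc j))" by simp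
      then have "a - b = int (Suc j)" by (simp only: of_int_eq_iff)
      then show ?thesis by simp
    qed
    show "a < b" if R: "realized (u @ De a # De b # z)"
    proof -
      obtain j where "of_int b - of_int a = (of_nat (Suc j) :: complex)" using drop[OF R] by auto
      then have "(of_int (b - a) :: complex) = of_int (int (Suc j))" by simp
      then have "b - a = int (Suc j)" by (simp only: of_int_eq_iff)
      then show ?thesis by simp
    qed
  qed
qed

end

text \<open>
  The chosen roots are cut out of the word from the left to the right. The remaining letters belong to
  coordinates outside all chosen roots.
\<close>

lemma parse_pairs:
  assumes "list_all2 (letter_at m \<nu>) \<tau> x" "distinct \<tau>"
    and "\<And>a b. (a, b) \<in> P \<Longrightarrow> (a < m) \<noteq> (b < m) \<and> entry m \<nu> a = entry m \<nu> b"
    and "\<And>a b. (a, b) \<in> P \<Longrightarrow> a \<in> set \<tau> \<or> b \<in> set \<tau> \<Longrightarrow> \<exists>u z. \<tau> = u @ a # b # z"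
    and "\<And>a b c d. (a, b) \<in> P \<Longrightarrow> (c, d) \<in> P \<Longrightarrow> (a, b) \<noteq> (c, d) \<Longrightarrow> {a, b} \<inter> {c, d} = {}"
  shows "\<exists>bs. block_word bs = x \<and>
    (\<forall>t. CE t \<in> set bs \<longrightarrow> (\<exists>a\<in>set \<tau>. a < m \<and> entry m \<nu> a = of_int t \<and> (\<forall>b. (a, b) \<notin> P \<and> (b, a) \<notin> P))) \<and>
    (\<forall>t. CD t \<in> set bs \<longrightarrow> (\<exists>a\<in>set \<tau>. \<not> a < m \<and> entry m \<nu> a = of_int t \<and> (\<forall>b. (a, b) \<notin> P \<and> (b, a) \<notin> P)))"
  using assms(1,2,4)
proof (induction "length \<tau>" arbitrary: \<tau> x rule: less_induct)
  case less
  show ?case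
  proof (cases \<tau>)
    case Nil
    then show ?thesis using less.prems(1) by (intro exI[of _ "[]"]) simp
  next
    case (Cons a \<tau>')
    show ?thesis
    proof (cases "\<exists>b. (a, b) \<in> P")
      case True
      then obtain b where P: "(a, b) \<in> P" by blast
      then obtain u z where "\<tau> = u @ a # b # z" using less.prems(3)[OF P] Cons by auto
      then have \<tau>: "\<tau> = a # b # z" using less.prems(2) Cons by (cases u) auto
      obtain k l y where x: "x = k # l # y" "letter_at m \<nu> a k" "letter_at m \<nu> b l" "list_all2 (letter_at m \<nu>) z y"
        using less.prems(1) unfolding \<tau> by (auto simp: list_all2_Cons1)
      have "\<exists>bk. letters bk = [k, l] \<and> (\<forall>t. bk \<noteq> CE t \<and> bk \<noteq> CD t)"
      proof (cases k; cases l)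
        fix s t assume "k = Ep s" "l = De t"
        with assms(3)[OF P] x show ?thesis by (intro exI[of _ "ED s"]) (auto simp: entry_def)
      next
        fix s t assume "k = De s" "l = Ep t"
        with assms(3)[OF P] x show ?thesis by (intro exI[of _ "DE s"]) (auto simp: entry_def)
      qed (use assms(3)[OF P] x in auto)
      then obtain bk where bk: "letters bk = [k, l]" "\<And>t. bk \<noteq> CE t \<and> bk \<noteq> CD t" by blast
      have adj: "\<exists>u z'. z = u @ c # d # z'" if cd: "(c, d) \<in> P" "c \<in> set z \<or> d \<in> set z" for c d
      proof -
        have "(c, d) \<noteq> (a, b)" using cd(2) less.prems(2) \<tau> by auto
        then have dis: "{a, b} \<inter> {c, d} = {}" using assms(5)[OF P cd(1)] by auto
        obtain u z' where uz: "a # b # z = u @ c # d # z'" using less.prems(3)[OF cd(1)] cd(2) \<tau> by auto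
        obtain u' where "u = a # b # u'"
        proof (cases u)
          case Nil
          then show ?thesis using uz dis by auto
        next
          case (Cons p u1)
          then show ?thesis using uz dis that by (cases u1) auto
        qed
        then show ?thesis using uz by auto
      qed
      have "length z < length \<tau>" "distinct z" using \<tau> less.prems(2) by auto
      from less.hyps[OF this(1) x(4) this(2) adj] obtain bs where bs: "block_word bs = y"
        "\<forall>t. CE t \<in> set bs \<longrightarrow> (\<exists>a\<in>set z. a < m \<and> entry m \<nu> a = of_int t \<and> (\<forall>b. (a, b) \<notin> P \<and> (b, a) \<notin> P))"
        "\<forall>t. CD t \<in> set bs \<longrightarrow> (\<exists>a\<in>set z. \<not> a < m \<and> entry m \<nu> a = of_int t \<and> (\<forall>b. (a, b) \<notin> P \<and> (b, a) \<notin> P))"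
        by blast
      show ?thesis
        using bs bk x(1) unfolding \<tau> by (intro exI[of _ "bk # bs"]) fastforce
    next
      case False
      have no: "\<forall>b. (a, b) \<notin> P \<and> (b, a) \<notin> P"
      proof (intro allI conjI notI)
        fix b assume "(b, a) \<in> P"
        then obtain u z where "\<tau> = u @ b # a # z" using less.prems(3)[of b a] Cons by auto
        then show False using less.prems(2) Cons by (cases u) auto
      qed (use False in blast)
      obtain k y where x: "x = k # y" "letter_at m \<nu> a k" "list_all2 (letter_at m \<nu>) \<tau>' y"
        using less.prems(1) unfolding Cons by (auto simp: list_all2_Cons1)
      have adj: "\<exists>u z'. \<tau>' = u @ c # d # z'" if cd: "(c, d) \<in> P" "c \<in> set \<tau>' \<or> d \<in> set \<tau>'" for c d
      proof -
        obtain u z' where uz: "a # \<tau>' = u @ c # d # z'" using less.prems(3)[OF cd(1)] cd(2) Cons by auto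
        have "c \<noteq> a" using no cd(1) by blast
        then show ?thesis using uz by (cases u) auto
      qed
      have "length \<tau>' < length \<tau>" "distinct \<tau>'" using Cons less.prems(2) by auto
      from less.hyps[OF this(1) x(3) this(2) adj] obtain bs where bs: "block_word bs = y"
        "\<forall>t. CE t \<in> set bs \<longrightarrow> (\<exists>a\<in>set \<tau>'. a < m \<and> entry m \<nu> a = of_int t \<and> (\<forall>b. (a, b) \<notin> P \<and> (b, a) \<notin> P))"
        "\<forall>t. CD t \<in> set bs \<longrightarrow> (\<exists>a\<in>set \<tau>'. \<not> a < m \<and> entry m \<nu> a = of_int t \<and> (\<forall>b. (a, b) \<notin> P \<and> (b, a) \<notin> P))"
        by blast
      show ?thesis
      proof (cases k)
        case (Ep t)
        then show ?thesis using bs x no unfolding Cons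
          by (intro exI[of _ "CE t # bs"]) (auto simp: entry_def)
      next
        case (De t)
        then show ?thesis using bs x no unfolding Cons
          by (intro exI[of _ "CD t # bs"]) (auto simp: entry_def)
      qed
    qed
  qed
qed

lemma pairs_positions:
  assumes "list_all2 (letter_at m \<nu>) \<tau> (pairs k s)" "distinct \<tau>"
  shows "\<exists>P. finite P \<and> card P = k \<and> fst ` P = {a \<in> set \<tau>. a < m} \<and>
    (\<forall>a b. (a, b) \<in> P \<longrightarrow> (\<exists>u z. \<tau> = u @ a # b # z) \<and> a < m \<and> \<not> b < m \<and> \<nu> a = of_int s \<and> \<nu> b = - of_int s) \<and>
    (\<forall>a b c d. (a, b) \<in> P \<longrightarrow> (c, d) \<in> P \<longrightarrow> (a, b) \<noteq> (c, d) \<longrightarrow> {a, b} \<inter> {c, d} = {})"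
  using assms
proof (induction k arbitrary: \<tau>)
  case 0
  then show ?case by (intro exI[of _ "{}"]) simp
next
  case (Suc k)
  obtain a b \<tau>' where \<tau>: "\<tau> = a # b # \<tau>'" and ab: "letter_at m \<nu> a (Ep s)" "letter_at m \<nu> b (De s)"
    and rest: "list_all2 (letter_at m \<nu>) \<tau>' (pairs k s)"
    using Suc.prems(1) by (auto simp: pairs_Suc list_all2_Cons2)
  have d: "distinct \<tau>'" using Suc.prems(2) \<tau> by simp
  from Suc.IH[OF rest d] obtain P where P: "finite P" "card P = k" "fst ` P = {a \<in> set \<tau>'. a < m}"
    and each: "\<forall>a b. (a, b) \<in> P \<longrightarrow> (\<exists>u z. \<tau>' = u @ a # b # z) \<and> a < m \<and> \<not> b < m \<and> \<nu> a = of_int s \<and> \<nu> b = - of_int s"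
    and apart: "\<forall>a b c d. (a, b) \<in> P \<longrightarrow> (c, d) \<in> P \<longrightarrow> (a, b) \<noteq> (c, d) \<longrightarrow> {a, b} \<inter> {c, d} = {}"
    by (elim exE conjE)
  have fresh: "{a, b} \<inter> {c, d} = {}" if cd: "(c, d) \<in> P" for c d
  proof -
    obtain u z where "\<tau>' = u @ c # d # z" using each cd by blast
    then have "c \<in> set \<tau>'" "d \<in> set \<tau>'" by auto
    moreover have "a \<notin> set \<tau>'" "b \<notin> set \<tau>'" using Suc.prems(2) \<tau> by auto
    ultimately show ?thesis by auto
  qed
  have new: "(a, b) \<notin> P" using fresh[of a b] by auto
  show ?case
  proof (intro exI[of _ "insert (a, b) P"] conjI allI impI)
    show "finite (insert (a, b) P)" "card (insert (a, b) P) = Suc k" using P(1,2) new by auto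
    show "fst ` insert (a, b) P = {a \<in> set \<tau>. a < m}" using P(3) \<tau> ab by auto
  next
    fix c e assume cd: "(c, e) \<in> insert (a, b) P"
    have vals: "c < m \<and> \<not> e < m \<and> \<nu> c = of_int s \<and> \<nu> e = - of_int s"
      using cd each ab by (cases "(c, e) = (a, b)") auto
    then show "c < m" "\<not> e < m" "\<nu> c = of_int s" "\<nu> e = - of_int s" by blast+
    show "\<exists>u z. \<tau> = u @ c # e # z"
    proof (cases "(c, e) = (a, b)")
      case True
      then have "\<tau> = [] @ c # e # \<tau>'" using \<tau> by simp
      then show ?thesis by blast
    next
      case False
      then obtain u z where "\<tau>' = u @ c # e # z" using cd each by blast
      then have "\<tau> = (a # b # u) @ c # e # z" using \<tau> by simp
      then show ?thesis by blast
    qed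
  next
    fix c e f g
    assume ce: "(c, e) \<in> insert (a, b) P" and fg: "(f, g) \<in> insert (a, b) P" and neq: "(c, e) \<noteq> (f, g)"
    consider "c = a" "e = b" "(f, g) \<in> P" | "f = a" "g = b" "(c, e) \<in> P" | "(c, e) \<in> P" "(f, g) \<in> P"
      using ce fg neq by blast
    then show "{c, e} \<inter> {f, g} = {}"
    proof cases
      case 1
      then show ?thesis using fresh[of f g] by simp
    next
      case 2
      then show ?thesis using fresh[of c e] by auto
    next
      case 3
      then show ?thesis using apart neq by blast
    qed
  qed
qed

section \<open>Kazhdan-Lusztig polynomials and connectedness\<close>

lemma KL_monomial:
  assumes fin: "finite_diagram (diagram_of m n \<mu>)"
    and tc: "\<And>x y t. diagram_of m n lam x = Times \<Longrightarrow> diagram_of m n lam y = Times \<Longrightarrow>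
      x < t \<Longrightarrow> t < y \<Longrightarrow> diagram_of m n lam t \<noteq> Empty"
    and nz: "KL m n lam \<mu> \<noteq> 0"
  shows "KL m n lam \<mu> = monom 1 (trivial_length m n lam \<mu>)"
proof -
  let ?P = "right_paths (diagram_of m n \<mu>) (diagram_of m n lam)"
  have "?P \<noteq> {}" using nz by (auto simp: KL_def)
  then obtain \<theta> where \<theta>: "\<theta> \<in> ?P" by blast
  have triv: "trivial_path (diagram_of m n \<mu>) (diagram_of m n lam) \<theta>'" if "\<theta>' \<in> ?P" for \<theta>'
    by (rule right_path_to_connected_is_trivial[OF fin tc that])
  have unique: "\<theta>' = \<theta>" if "trivial_path (diagram_of m n \<mu>) (diagram_of m n lam) \<theta>'" for \<theta>'
    by (rule trivial_path_unique[OF fin that triv[OF \<theta>]])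
  have "?P = {\<theta>}" using \<theta> triv unique by blast
  moreover have "(THE \<theta>. trivial_path (diagram_of m n \<mu>) (diagram_of m n lam) \<theta>) = \<theta>"
    using triv[OF \<theta>] unique by (rule the_equality)
  ultimately show ?thesis by (simp add: KL_def trivial_length_def)
qed

text \<open>
  All coefficients are counts of paths, so nothing cancels.
\<close>

lemma KL_not_monomial:
  assumes fin: "finite_diagram (diagram_of m n \<mu>)"
    and paths: "\<theta>1 \<in> right_paths (diagram_of m n \<mu>) (diagram_of m n lam)"
      "\<theta>2 \<in> right_paths (diagram_of m n \<mu>) (diagram_of m n lam)" "length \<theta>1 \<noteq> length \<theta>2"
  shows "KL m n lam \<mu> \<noteq> 0" "\<not> is_monomial (KL m n lam \<mu>)"
proof -
  let ?P = "right_paths (diagram_of m n \<mu>) (diagram_of m n lam)"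
  have finP: "finite ?P" by (rule finite_right_paths[OF fin])
  have coeff: "coeff (KL m n lam \<mu>) (length \<theta>) \<noteq> 0" if "\<theta> \<in> ?P" for \<theta>
  proof -
    have "coeff (KL m n lam \<mu>) (length \<theta>) = (\<Sum>\<theta>'\<in>?P. if length \<theta>' = length \<theta> then 1 else 0)"
      by (simp add: KL_def coeff_sum)
    also have "\<dots> > 0"
      using finP that by (intro sum_pos2[of _ \<theta>]) auto
    finally show ?thesis by simp
  qed
  show "KL m n lam \<mu> \<noteq> 0" using coeff[OF paths(1)] by auto
  show "\<not> is_monomial (KL m n lam \<mu>)"
  proof
    assume "is_monomial (KL m n lam \<mu>)"
    then obtain c k where "KL m n lam \<mu> = monom c k" by (auto simp: is_monomial_def)
    then have "length \<theta>1 = k" "length \<theta>2 = k"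
      using coeff[OF paths(1)] coeff[OF paths(2)] by (auto split: if_splits)
    then show False using paths(3) by simp
  qed
qed

lemma rho_st:
  assumes "a < m + n"
  shows "rho m n (pi_st m n) a = rho_order m n [0..<m + n] a"
  using rho_eq_rho_order[OF shuffle_upt _ assms] simple_root_set_adjacent_roots(2)[OF shuffle_upt]
  by (simp add: pi_st_eq)

lemma rho_st_diff:
  assumes "a \<le> b" "b < m + n" "a < m \<longleftrightarrow> b < m"
  shows "rho m n (pi_st m n) a - rho m n (pi_st m n) b = of_nat (b - a)"
proof -
  have "{x. before [0..<m + n] x a \<and> (x < m) \<noteq> (a < m)} = {x. before [0..<m + n] x b \<and> (x < m) \<noteq> (b < m)}"
    using assms by (auto simp: before_upt)
  then have "crossing m [0..<m + n] a = crossing m [0..<m + n] b" by (simp add: crossing_def)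
  then show ?thesis using assms by (cases "a < m") (auto simp: rho_st rho_order_def of_nat_diff)
qed

lemma dominance_ratio:
  assumes "a < b" "b < m + n" "a < m \<longleftrightarrow> b < m"
  shows "2 * form m n \<mu> (gl_root a b) / form m n (gl_root a b) (gl_root a b) = \<mu> a - \<mu> b"
  using assms by (auto simp: form_root entry_def root_apply field_simps)

lemma strict_decreasing_gap:
  fixes f :: "nat \<Rightarrow> int"
  assumes "\<And>i j. i < j \<Longrightarrow> j < m \<Longrightarrow> f j < f i"
  shows "i \<le> j \<Longrightarrow> j < m \<Longrightarrow> int (j - i) \<le> f i - f j"
proof (induction j)
  case (Suc j)
  show ?case
  proof (cases "i = Suc j")
    case False
    then have "int (j - i) \<le> f i - f j" using Suc by simp
    moreover have "f (Suc j) < f j" using Suc.prems by (intro assms) auto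
    ultimately show ?thesis using Suc.prems False by (simp add: Suc_diff_le)
  qed simp
qed simp

definition decreasing_below :: "nat \<Rightarrow> (nat \<Rightarrow> int) \<Rightarrow> bool" where
  "decreasing_below m f \<longleftrightarrow> (\<forall>i j. i < j \<longrightarrow> j < m \<longrightarrow> f j < f i)"

text \<open>
  Here \<open>f i\<close> is \<open>a\<^bsub>i+1\<^esub>\<close> and \<open>g k\<close> is \<open>- b\<^bsub>k+1\<^esub>\<close>, so both sequences decrease.
\<close>

definition shifted_coordinates :: "nat \<Rightarrow> nat \<Rightarrow> weight \<Rightarrow> (nat \<Rightarrow> int) \<Rightarrow> (nat \<Rightarrow> int) \<Rightarrow> bool" where
  "shifted_coordinates m n \<mu> f g \<longleftrightarrow>
     (\<forall>i<m. (\<mu> + rho m n (pi_st m n)) i = of_int (f i)) \<and>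
     (\<forall>k<n. (\<mu> + rho m n (pi_st m n)) (m + k) = of_int (g k)) \<and>
     decreasing_below m f \<and> decreasing_below n g"

lemma P_plus_dominant:
  assumes "\<mu> \<in> P_plus m n" "a < b" "b < m + n" "a < m \<longleftrightarrow> b < m"
  shows "\<mu> a - \<mu> b \<in> \<nat>"
proof -
  have "gl_root a b \<in> pos_even_roots m n" unfolding pos_even_roots_eq using assms by blast
  then show ?thesis using assms(1) dominance_ratio[OF assms(2-4), of \<mu>] by (auto simp: P_plus_def)
qed

lemma P_plus_coordinates:
  assumes \<mu>: "\<mu> \<in> P_plus m n"
  obtains f g where "shifted_coordinates m n \<mu> f g"
proof -
  let ?\<nu> = "\<mu> + rho m n (pi_st m n)"
  have "\<forall>i. \<exists>z. i < m \<longrightarrow> ?\<nu> i = of_int z"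
  proof (intro allI)
    fix i
    have "?\<nu> i \<in> \<int>" if "i < m"
      using \<mu> that form_eps[of i m n ?\<nu>] by (auto simp: P_plus_def entry_def)
    then show "\<exists>z. i < m \<longrightarrow> ?\<nu> i = of_int z" by (blast elim: Ints_cases)
  qed
  from choice[OF this] obtain f where f: "\<And>i. i < m \<Longrightarrow> ?\<nu> i = of_int (f i)" by blast
  have "\<forall>k. \<exists>z. k < n \<longrightarrow> ?\<nu> (m + k) = of_int z"
  proof (intro allI)
    fix k
    have "?\<nu> (m + k) \<in> \<int>" if "k < n"
    proof -
      have "- ?\<nu> (m + k) \<in> \<int>"
        using \<mu> that form_eps[of "m + k" m n ?\<nu>] by (auto simp: P_plus_def entry_def del_eq_eps)
      from Ints_minus[OF this] show ?thesis by (simp add: add.commute)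
    qed
    then show "\<exists>z. k < n \<longrightarrow> ?\<nu> (m + k) = of_int z" by (blast elim: Ints_cases)
  qed
  from choice[OF this] obtain g where g: "\<And>k. k < n \<Longrightarrow> ?\<nu> (m + k) = of_int (g k)" by blast
  have less: "y < x" if ab: "a < b" "b < m + n" "a < m \<longleftrightarrow> b < m" and xy: "?\<nu> a = of_int x" "?\<nu> b = of_int y" for a b x y
  proof -
    obtain i where i: "\<mu> a - \<mu> b = of_nat i" using P_plus_dominant[OF \<mu> ab] by (auto elim: Nats_cases)
    have "of_int (x - y) = ?\<nu> a - ?\<nu> b" using xy by simp
    also have "\<dots> = (\<mu> a - \<mu> b) + (rho m n (pi_st m n) a - rho m n (pi_st m n) b)" by simp
    also have "\<dots> = of_int (int (i + (b - a)))"
      using i rho_st_diff[of a b m n] ab by simp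
    finally have "x - y = int (i + (b - a))" by (simp only: of_int_eq_iff)
    then show ?thesis using ab by simp
  qed
  show thesis
  proof (rule that[of f g])
    show "shifted_coordinates m n \<mu> f g"
      unfolding shifted_coordinates_def decreasing_below_def
    proof (intro conjI allI impI)
      show "f j < f i" if "i < j" "j < m" for i j using that f by (intro less[of i j]) auto
      show "g j < g i" if "i < j" "j < n" for i j using that g by (intro less[of "m + i" "m + j"]) auto
    qed (use f g in auto)
  qed
qed

text \<open>
  Strictly decreasing integers drop by at least one in each step, which is what \<open>\<rho>\<close> contributes.
\<close>

lemma coordinates_P_plus:
  assumes f: "decreasing_below m f" and g: "decreasing_below n g"
  obtains \<mu> where "\<mu> \<in> P_plus m n" "shifted_coordinates m n \<mu> f g"
proof -
  let ?r = "rho m n (pi_st m n)"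
  define h where "h a = (if a < m then f a else g (a - m))" for a
  define \<mu> where "\<mu> a = (if a < m + n then of_int (h a) - ?r a else 0)" for a
  have \<nu>: "(\<mu> + ?r) a = of_int (h a)" if "a < m + n" for a using that by (simp add: \<mu>_def)
  have sc: "shifted_coordinates m n \<mu> f g"
    unfolding shifted_coordinates_def using f g \<nu> by (simp add: h_def)
  have gap: "int (b - a) \<le> h a - h b" if "a < b" "b < m + n" "a < m \<longleftrightarrow> b < m" for a b
  proof (cases "a < m")
    case True
    then show ?thesis
      using that strict_decreasing_gap[of m f a b] f by (simp add: h_def decreasing_below_def)
  next
    case False
    have "int ((b - m) - (a - m)) \<le> g (a - m) - g (b - m)"
      by (rule strict_decreasing_gap[of n g]) (use that False g in \<open>auto simp: decreasing_below_def\<close>)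
    then show ?thesis using that False by (simp add: h_def)
  qed
  have dom: "\<mu> a - \<mu> b \<in> \<nat>" if ab: "a < b" "b < m + n" "a < m \<longleftrightarrow> b < m" for a b
  proof -
    have "\<mu> a - \<mu> b = of_int (h a - h b) - (?r a - ?r b)" using ab by (simp add: \<mu>_def)
    also have "\<dots> = of_int (h a - h b - int (b - a))" using rho_st_diff[of a b m n] ab by simp
    also have "\<dots> = of_nat (nat (h a - h b - int (b - a)))" using gap[OF ab] by simp
    finally show ?thesis by simp
  qed
  have "\<mu> \<in> P_plus m n"
    unfolding P_plus_def
  proof (intro CollectI conjI ballI allI impI)
    show "\<mu> \<in> weights m n" by (simp add: weights_def \<mu>_def)
    show "2 * form m n \<mu> \<alpha> / form m n \<alpha> \<alpha> \<in> \<nat>" if \<alpha>: "\<alpha> \<in> pos_even_roots m n" for \<alpha>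
    proof -
      obtain a b where ab: "\<alpha> = gl_root a b" "a < b" "b < m + n" "a < m \<longleftrightarrow> b < m"
        using \<alpha> unfolding pos_even_roots_eq by blast
      show ?thesis unfolding ab(1) dominance_ratio[OF ab(2-4)] by (rule dom[OF ab(2-4)])
    qed
    show "form m n (\<mu> + ?r) (eps i) \<in> \<int>" if "i < m" for i
      using that \<nu>[of i] by (simp add: form_eps entry_def del: plus_fun_apply)
    show "form m n (\<mu> + ?r) (del m k) \<in> \<int>" if "k < n" for k
      using that \<nu>[of "m + k"] by (simp add: form_eps entry_def del_eq_eps del: plus_fun_apply)
  qed
  then show thesis using sc that by blast
qed

text \<open>
  A weight diagram is determined by the set of the \<open>a\<^sub>i\<close> and the set of the \<open>b\<^sub>j\<close>.
\<close>

definition diagram_on :: "int set \<Rightarrow> int set \<Rightarrow> diagram" where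
  "diagram_on A B = (\<lambda>t. if t \<in> A \<and> t \<in> B then Times else if t \<in> A then Gt
     else if t \<in> B then Lt else Empty)"

lemma diagram_on_simps:
  "diagram_on A B t = Times \<longleftrightarrow> t \<in> A \<inter> B" "diagram_on A B t = Gt \<longleftrightarrow> t \<in> A - B"
  "diagram_on A B t = Lt \<longleftrightarrow> t \<in> B - A" "diagram_on A B t = Empty \<longleftrightarrow> t \<notin> A \<union> B"
  by (auto simp: diagram_on_def)

lemma diagram_of_coordinates:
  assumes "shifted_coordinates m n \<mu> f g"
  shows "diagram_of m n \<mu> = diagram_on (f ` {..<m}) ((\<lambda>k. - g k) ` {..<n})"
proof -
  let ?\<nu> = "\<mu> + rho m n (pi_st m n)"
  have A: "{t :: int. \<exists>i<m. ?\<nu> i = of_int t} = f ` {..<m}"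
    using assms by (auto simp: shifted_coordinates_def)
  have "- ?\<nu> (m + k) = of_int t \<longleftrightarrow> t = - g k" if "k < n" for k t
  proof -
    have "- ?\<nu> (m + k) = of_int (- g k)" using assms that by (simp add: shifted_coordinates_def)
    then show ?thesis by (simp only: of_int_eq_iff) blast
  qed
  then have B: "{t :: int. \<exists>k<n. - ?\<nu> (m + k) = of_int t} = (\<lambda>k. - g k) ` {..<n}"
    by auto
  show ?thesis
    unfolding diagram_of_def Let_def A B diagram_on_def by simp
qed

lemma finite_diagram_on: "finite A \<Longrightarrow> finite B \<Longrightarrow> finite_diagram (diagram_on A B)"
  unfolding finite_diagram_def by (rule finite_subset[of _ "A \<union> B"]) (auto simp: diagram_on_def)

lemma decreasing_below_image:
  assumes "decreasing_below m f"
  shows "desc (f ` {..<m}) = map f [0..<m]" "card (f ` {..<m}) = m"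
proof -
  have sorted: "sorted_wrt (>) (map f [0..<m])"
    using assms by (auto simp: decreasing_below_def sorted_wrt_map sorted_wrt_iff_nth_less)
  have set: "set (map f [0..<m]) = f ` {..<m}" by (auto simp: lessThan_atLeast0)
  show "desc (f ` {..<m}) = map f [0..<m]" using desc_eqI[OF sorted] by (simp only: set)
  have "inj_on f {..<m}"
  proof (rule linorder_inj_onI)
    fix i j assume "i < j" "i \<in> {..<m}" "j \<in> {..<m}"
    then show "f i \<noteq> f j" using assms by (force simp: decreasing_below_def)
  qed auto
  then show "card (f ` {..<m}) = m" by (simp add: card_image)
qed

lemma decreasing_enumeration:
  fixes A :: "int set"
  assumes "finite A"
  obtains f where "decreasing_below (card A) f" "f ` {..<card A} = A"
proof
  let ?f = "\<lambda>i. desc A ! i"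
  have len: "length (desc A) = card A" by (simp add: desc_def)
  show "decreasing_below (card A) ?f"
    using sorted_desc[of A] by (auto simp: decreasing_below_def sorted_wrt_iff_nth_less len)
  show "?f ` {..<card A} = A"
    using nth_image[of "card A" "desc A"] assms by (simp add: len lessThan_atLeast0)
qed

lemma asc_uminus_image:
  assumes "decreasing_below n g"
  shows "asc ((\<lambda>k. - g k) ` {..<n}) = map (\<lambda>k. - g k) [0..<n]" "card ((\<lambda>k. - g k) ` {..<n}) = n"
proof -
  have sorted: "sorted_wrt (<) (map (\<lambda>k. - g k) [0..<n])"
    using assms by (auto simp: decreasing_below_def sorted_wrt_map sorted_wrt_iff_nth_less)
  have set: "set (map (\<lambda>k. - g k) [0..<n]) = (\<lambda>k. - g k) ` {..<n}" by (auto simp: lessThan_atLeast0)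
  show "asc ((\<lambda>k. - g k) ` {..<n}) = map (\<lambda>k. - g k) [0..<n]" using asc_eqI[OF sorted] by (simp only: set)
  have "card ((\<lambda>k. - g k) ` {..<n}) = card (uminus ` g ` {..<n})" by (simp add: image_image)
  then show "card ((\<lambda>k. - g k) ` {..<n}) = n"
    using decreasing_below_image(2)[OF assms] by (simp add: card_image)
qed

text \<open>
  If there is a gap, the source diagram with two right paths has the same core and the same number of
  crosses, so it is the diagram of a dominant weight.
\<close>

theorem monomial_iff_totally_connected:
  assumes lam: "shifted_coordinates m n lam f g"
  defines "A \<equiv> f ` {..<m}" and "B \<equiv> (\<lambda>k. - g k) ` {..<n}"
  shows "(\<forall>\<mu>\<in>P_plus m n. KL m n lam \<mu> \<noteq> 0 \<longrightarrow> is_monomial (KL m n lam \<mu>)) \<longleftrightarrow> totally_connected A B"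
    and "totally_connected A B \<Longrightarrow>
      \<forall>\<mu>\<in>P_plus m n. KL m n lam \<mu> \<noteq> 0 \<longrightarrow> KL m n lam \<mu> = monom 1 (trivial_length m n lam \<mu>)"
proof -
  have D: "diagram_of m n lam = diagram_on A B"
    unfolding A_def B_def by (rule diagram_of_coordinates[OF lam])
  have finAB: "finite A" "finite B" by (auto simp: A_def B_def)
  have finP: "finite_diagram (diagram_of m n \<mu>)" if "\<mu> \<in> P_plus m n" for \<mu>
    using P_plus_coordinates[OF that] diagram_of_coordinates finite_diagram_on by (metis finite_imageI finite_lessThan)
  show trivial: "\<forall>\<mu>\<in>P_plus m n. KL m n lam \<mu> \<noteq> 0 \<longrightarrow> KL m n lam \<mu> = monom 1 (trivial_length m n lam \<mu>)"
    if tc: "totally_connected A B"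
  proof (intro ballI impI)
    fix \<mu> assume "\<mu> \<in> P_plus m n" and nz: "KL m n lam \<mu> \<noteq> 0"
    show "KL m n lam \<mu> = monom 1 (trivial_length m n lam \<mu>)"
    proof (rule KL_monomial[OF finP[OF \<open>\<mu> \<in> P_plus m n\<close>] _ nz])
      show "diagram_of m n lam t \<noteq> Empty"
        if "diagram_of m n lam x = Times" "diagram_of m n lam y = Times" "x < t" "t < y" for x y t
        using tc that unfolding D totally_connected_def diagram_on_simps by blast
    qed
  qed
  have "\<exists>\<mu>\<in>P_plus m n. KL m n lam \<mu> \<noteq> 0 \<and> \<not> is_monomial (KL m n lam \<mu>)" if not_tc: "\<not> totally_connected A B"
  proof -
    obtain x y e where "x \<in> A \<inter> B" "y \<in> A \<inter> B" "x < e" "e < y" "e \<notin> A \<union> B"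
      using not_tc unfolding totally_connected_def by blast
    then have xy: "diagram_on A B x = Times" "diagram_on A B e = Empty" "diagram_on A B y = Times" "x < e" "e < y"
      unfolding diagram_on_simps by auto
    obtain D0 \<theta>1 \<theta>2 where D0: "finite_diagram D0" "\<And>t. D0 t = Gt \<longleftrightarrow> diagram_on A B t = Gt"
      "\<And>t. D0 t = Lt \<longleftrightarrow> diagram_on A B t = Lt"
      "card {t. D0 t = Times} = card {t. diagram_on A B t = Times}"
      "\<theta>1 \<in> right_paths D0 (diagram_on A B)" "\<theta>2 \<in> right_paths D0 (diagram_on A B)" "length \<theta>1 \<noteq> length \<theta>2"
      by (rule two_right_paths[OF finite_diagram_on[OF finAB] xy]) (rule that)
    define A' where "A' = {t. D0 t = Times} \<union> (A - B)"
    define B' where "B' = {t. D0 t = Times} \<union> (B - A)"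
    have Gt: "D0 t = Gt \<longleftrightarrow> t \<in> A - B" and Lt: "D0 t = Lt \<longleftrightarrow> t \<in> B - A" for t
      unfolding D0(2,3) diagram_on_simps by simp_all
    have finT: "finite {t. D0 t = Times}"
      using D0(1) unfolding finite_diagram_def by (rule rev_finite_subset) auto
    have T: "card {t. D0 t = Times} = card (A \<inter> B)"
      unfolding D0(4) diagram_on_simps by (simp add: Int_def)
    have dis: "{t. D0 t = Times} \<inter> (A - B) = {}" "{t. D0 t = Times} \<inter> (B - A) = {}"
      using Gt Lt by force+
    have "card A' = card (A \<inter> B) + card (A - B)" "card B' = card (A \<inter> B) + card (B - A)"
      unfolding A'_def B'_def using finT finAB dis T by (simp_all add: card_Un_disjoint)
    moreover have "card A = card (A \<inter> B) + card (A - B)" "card B = card (A \<inter> B) + card (B - A)"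
      using card_Int_Diff[of A B] card_Int_Diff[of B A] finAB by (simp_all add: Int_commute)
    ultimately have cards: "card A' = m" "card B' = n"
      using decreasing_below_image(2)[of m f] asc_uminus_image(2)[of n g] lam
      by (simp_all add: A_def[symmetric] B_def[symmetric] shifted_coordinates_def)
    have fin': "finite A'" "finite B'" using finT finAB by (auto simp: A'_def B'_def)
    obtain f' where f': "decreasing_below m f'" "f' ` {..<m} = A'"
      using decreasing_enumeration[OF fin'(1)] cards by metis
    have "card (uminus ` B') = n" using cards(2) by (simp add: card_image)
    then obtain g' where g': "decreasing_below n g'" "g' ` {..<n} = uminus ` B'"
      using decreasing_enumeration[of "uminus ` B'"] fin'(2) by (metis finite_imageI)
    have B'g: "(\<lambda>k. - g' k) ` {..<n} = B'"
    proof -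
      have "(\<lambda>k. - g' k) ` {..<n} = uminus ` g' ` {..<n}" by (simp add: image_image)
      also have "\<dots> = B'" unfolding g'(2) by (simp add: image_image)
      finally show ?thesis .
    qed
    obtain \<mu> where \<mu>: "\<mu> \<in> P_plus m n" "shifted_coordinates m n \<mu> f' g'"
      using coordinates_P_plus[OF f'(1) g'(1)] by blast
    have "diagram_of m n \<mu> = D0"
    proof (rule ext)
      fix t
      have "diagram_of m n \<mu> t = diagram_on A' B' t"
        using diagram_of_coordinates[OF \<mu>(2)] f'(2) B'g by simp
      also have "\<dots> = D0 t"
        using Gt[of t] Lt[of t] dis by (cases "D0 t") (auto simp: diagram_on_def A'_def B'_def)
      finally show "diagram_of m n \<mu> t = D0 t" .
    qed
    then have "\<theta>1 \<in> right_paths (diagram_of m n \<mu>) (diagram_of m n lam)"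
      "\<theta>2 \<in> right_paths (diagram_of m n \<mu>) (diagram_of m n lam)"
      using D0(5,6) by (simp_all add: D)
    from KL_not_monomial[OF finP[OF \<mu>(1)] this D0(7)] \<mu>(1) show ?thesis by blast
  qed
  moreover have "is_monomial (monom 1 k :: int poly)" for k
    unfolding is_monomial_def by (intro exI[of _ 1] exI[of _ k]) simp
  ultimately show "(\<forall>\<mu>\<in>P_plus m n. KL m n lam \<mu> \<noteq> 0 \<longrightarrow> is_monomial (KL m n lam \<mu>)) \<longleftrightarrow> totally_connected A B"
  proof (intro iffI, goal_cases)
    case 1
    then show ?case by blast
  next
    case 2
    from trivial[OF 2(3)] 2(2) show ?case by (metis (no_types, lifting))
  qed
qed

section \<open>KW-modules and connectedness\<close>

lemma std_word_realized_types:
  assumes "finite A" "finite B"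
  shows "map is_Ep (std_word A B) = replicate (card A) True @ replicate (card B) False"
proof -
  have "map is_Ep (map Ep xs) = replicate (length xs) True" "map is_Ep (map De xs) = replicate (length xs) False" for xs
    by (induction xs) auto
  then show ?thesis by (simp add: std_word_def desc_def asc_def del: map_map)
qed

lemma std_word_inject:
  assumes "finite A" "finite B" "finite A'" "finite B'" "std_word A B = std_word A' B'"
  shows "A = A' \<and> B = B'"
proof -
  have "Ep t \<in> set (std_word A B) \<longleftrightarrow> t \<in> A" "De t \<in> set (std_word A B) \<longleftrightarrow> t \<in> B"
    "Ep t \<in> set (std_word A' B') \<longleftrightarrow> t \<in> A'" "De t \<in> set (std_word A' B') \<longleftrightarrow> t \<in> B'" for t
    using assms(1-4) by (auto simp: std_word_def)
  then show ?thesis using assms(5) by auto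
qed

context simple_gl_action begin

lemma realized_mset_types:
  assumes "realized x"
  shows "mset (map is_Ep x) = mset (replicate m True @ replicate n False)"
proof -
  obtain \<sigma> \<nu> v where \<sigma>: "shuffle m n \<sigma>" "list_all2 (letter_at m \<nu>) \<sigma> x"
    using assms by (auto simp: realized_def)
  have "mset \<sigma> = mset [0..<m + n]"
    using \<sigma>(1) by (subst set_eq_iff_mset_eq_distinct[symmetric]) (auto simp: shuffle_def)
  then have "mset (map (\<lambda>a. a < m) \<sigma>) = mset (map (\<lambda>a. a < m) [0..<m + n])" by simp
  also have "map (\<lambda>a. a < m) [0..<m + n] = replicate m True @ replicate n False"
    by (rule nth_equalityI) (auto simp: nth_append)
  finally show ?thesis by (simp only: letter_at_types[OF \<sigma>(2)])
qed

lemma realized_std_word_card: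
  assumes "realized (std_word A B)" "finite A" "finite B"
  shows "card A = m" "card B = n"
proof -
  have eq: "mset (replicate (card A) True @ replicate (card B) False) = mset (replicate m True @ replicate n False)"
    using realized_mset_types[OF assms(1)] by (simp only: std_word_realized_types[OF assms(2,3)])
  have "count (mset (replicate (card A) True @ replicate (card B) False)) b = count (mset (replicate m True @ replicate n False)) b" for b
    by (simp only: eq)
  from this[of True] this[of False] show "card A = m" "card B = n" by simp_all
qed

lemma realized_std_word_unique:
  assumes "realized (std_word A B)" "realized (std_word A' B')" "finite A" "finite B" "finite A'" "finite B'"
  shows "A = A' \<and> B = B'"
proof (rule std_word_inject[OF assms(3-6)], rule realized_unique[OF assms(1,2)])
  show "map is_Ep (std_word A B) = map is_Ep (std_word A' B')"
    by (simp only: std_word_realized_types[OF assms(3,4)] std_word_realized_types[OF assms(5,6)]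
        realized_std_word_card[OF assms(1,3,4)] realized_std_word_card[OF assms(2,5,6)])
qed

text \<open>
  Applied to an arbitrary set of simple roots, this shows that the shifted highest weight has integral
  coordinates there as well.
\<close>

lemma realized_at_ordering:
  assumes "realized x" and \<sigma>: "shuffle m n \<sigma>" and v: "hwv \<sigma> \<mu> v"
    and \<nu>: "\<And>a. a < N \<Longrightarrow> \<nu> a = \<mu> a + rho_order m n \<sigma> a"
  obtains y where "realized y" "list_all2 (letter_at m \<nu>) \<sigma> y"
proof -
  have "mset \<sigma> = mset [0..<m + n]"
    using \<sigma> by (subst set_eq_iff_mset_eq_distinct[symmetric]) (auto simp: shuffle_def)
  then have "mset (map (\<lambda>a. a < m) \<sigma>) = mset (map (\<lambda>a. a < m) [0..<m + n])" by simp
  also have "map (\<lambda>a. a < m) [0..<m + n] = replicate m True @ replicate n False"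
    by (rule nth_equalityI) (auto simp: nth_append)
  finally have "mset (map (\<lambda>a. a < m) \<sigma>) = mset (map is_Ep x)"
    by (simp only: realized_mset_types[OF assms(1)])
  from realized_types[OF assms(1) this] obtain y where y: "realized y" "map is_Ep y = map (\<lambda>a. a < m) \<sigma>"
    by blast
  obtain \<tau> \<nu>' w where \<tau>: "shuffle m n \<tau>" "list_all2 (letter_at m \<nu>') \<tau> y"
    "hwv \<tau> (\<nu>' - rho_order m n \<tau>) w" using y(1) by (auto simp: realized_def)
  have eq: "\<tau> = \<sigma>"
    using shuffle_determined[OF \<tau>(1) \<sigma>] letter_at_types[OF \<tau>(2)] y(2) by simp
  have "\<nu> a = \<nu>' a" if "a < N" for a
    using hwv_unique[OF shuffle_ordering[OF \<sigma>] v \<tau>(3)[unfolded eq] that] \<nu>[OF that] by (simp add: algebra_simps)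
  then have "list_all2 (letter_at m \<nu>) \<sigma> y"
    using \<sigma> by (intro letter_at_cong[OF \<tau>(2)[unfolded eq]]) (auto simp: shuffle_def)
  with y(1) that show thesis by blast
qed

end

text \<open>
  Maximality leaves no orthogonal root between unchosen coordinates, so the core letters of both types
  have no value in common.
\<close>

lemma maximal_isotropic_blocks:
  assumes \<sigma>: "shuffle m n \<sigma>" and S: "S \<subseteq> adjacent_roots \<sigma>" "maximal_isotropic m n \<nu> S"
    and x: "list_all2 (letter_at m \<nu>) \<sigma> x"
  obtains bs where "block_word bs = x" "core_disjoint bs"
proof -
  have d: "distinct \<sigma>" and s: "set \<sigma> = {..<m + n}" using \<sigma> by (auto simp: shuffle_def)
  have iso: "S \<in> isotropic_sets m n \<nu>" using S(2) by (simp add: maximal_isotropic_def)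
  define P where "P = {(a, b). gl_root a b \<in> S \<and> a \<noteq> b}"
  have P: "a < m + n \<and> b < m + n \<and> (a < m) \<noteq> (b < m) \<and> entry m \<nu> a = entry m \<nu> b" if "(a, b) \<in> P" for a b
  proof -
    have ab: "gl_root a b \<in> S" "a \<noteq> b" using that by (auto simp: P_def)
    obtain c e where "gl_root a b = gl_root c e" "c < m + n" "e < m + n" "(c < m) \<noteq> (e < m)"
      "entry m \<nu> c = entry m \<nu> e" using isotropic_root_odd[OF iso ab(1)] by blast
    then show ?thesis using root_inj[OF ab(2), of c e] by simp
  qed
  have adj: "\<exists>u z. \<sigma> = u @ a # b # z" if "(a, b) \<in> P" for a b
  proof -
    have ab: "gl_root a b \<in> adjacent_roots \<sigma>" "a \<noteq> b" using that S(1) by (auto simp: P_def)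
    then obtain c e u z where "gl_root a b = gl_root c e" "\<sigma> = u @ c # e # z"
      unfolding adjacent_roots_def by blast
    then show ?thesis using root_inj[OF ab(2), of c e] by blast
  qed
  have apart: "{a, b} \<inter> {c, e} = {}" if ab: "(a, b) \<in> P" and ce: "(c, e) \<in> P" and neq: "(a, b) \<noteq> (c, e)" for a b c e
  proof (rule isotropic_supports_disjoint[OF iso])
    show "gl_root a b \<in> S" "gl_root c e \<in> S" using ab ce by (auto simp: P_def)
    show "gl_root a b \<noteq> gl_root c e" using neq ab root_inj[of a b c e] by (auto simp: P_def)
  qed (use P[OF ab] P[OF ce] in auto)
  have "\<exists>bs. block_word bs = x \<and>
    (\<forall>t. CE t \<in> set bs \<longrightarrow> (\<exists>a\<in>set \<sigma>. a < m \<and> entry m \<nu> a = of_int t \<and> (\<forall>b. (a, b) \<notin> P \<and> (b, a) \<notin> P))) \<and>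
    (\<forall>t. CD t \<in> set bs \<longrightarrow> (\<exists>a\<in>set \<sigma>. \<not> a < m \<and> entry m \<nu> a = of_int t \<and> (\<forall>b. (a, b) \<notin> P \<and> (b, a) \<notin> P)))"
    by (rule parse_pairs[OF x d]) (use P adj apart in blast)+
  then obtain bs where bs: "block_word bs = x"
    "\<And>t. CE t \<in> set bs \<Longrightarrow> \<exists>a\<in>set \<sigma>. a < m \<and> entry m \<nu> a = of_int t \<and> (\<forall>b. (a, b) \<notin> P \<and> (b, a) \<notin> P)"
    "\<And>t. CD t \<in> set bs \<Longrightarrow> \<exists>a\<in>set \<sigma>. \<not> a < m \<and> entry m \<nu> a = of_int t \<and> (\<forall>b. (a, b) \<notin> P \<and> (b, a) \<notin> P)"
    by blast
  have "core_disjoint bs"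
    unfolding core_disjoint_def
  proof (intro allI impI notI)
    fix t assume t: "CE t \<in> set bs" "CD t \<in> set bs"
    obtain a where a: "a < m" "entry m \<nu> a = of_int t" "\<And>b. (a, b) \<notin> P \<and> (b, a) \<notin> P" using bs(2)[OF t(1)] by blast
    obtain b where b: "b \<in> set \<sigma>" "\<not> b < m" "entry m \<nu> b = of_int t" "\<And>c. (b, c) \<notin> P \<and> (c, b) \<notin> P" using bs(3)[OF t(2)] by blast
    have "m \<le> b" "b < m + n" "entry m \<nu> a = entry m \<nu> b" using a b s by auto
    from maximal_isotropic_exhausts[OF S(2) a(1) this] obtain c e where
      ce: "gl_root c e \<in> S" "(c < m) \<noteq> (e < m)" "{a, b} \<inter> {c, e} \<noteq> {}" by blast
    then have "(c, e) \<in> P" by (auto simp: P_def)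
    then show False using ce(3) a(3) b(4) by auto
  qed
  then show thesis using that bs(1) by blast
qed

text \<open>
  Only the value \<open>s\<close> can be shared by an \<open>\<epsilon>\<close> and a \<open>\<delta>\<close>, and only the \<open>k\<close> coordinates \<open>\<epsilon>\<close> in the pairs
  have this value. An isotropic set has at most one root for each of them.
\<close>

lemma pairs_maximal_isotropic:
  assumes \<sigma>: "shuffle m n \<sigma>" and x: "list_all2 (letter_at m \<nu>) \<sigma> (u @ pairs k s @ z)"
    and core: "\<And>a. Ep a \<in> set (u @ z) \<Longrightarrow> De a \<notin> set (u @ z)"
    and only: "k > 0 \<Longrightarrow> Ep s \<notin> set (u @ z) \<and> De s \<notin> set (u @ z)"
  shows "\<exists>S\<subseteq>adjacent_roots \<sigma>. maximal_isotropic m n \<nu> S"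
proof -
  have d: "distinct \<sigma>" and set: "set \<sigma> = {..<m + n}" using \<sigma> by (auto simp: shuffle_def)
  obtain \<sigma>u \<sigma>p \<sigma>z where split: "\<sigma> = \<sigma>u @ \<sigma>p @ \<sigma>z" and
    all: "list_all2 (letter_at m \<nu>) \<sigma>u u" "list_all2 (letter_at m \<nu>) \<sigma>p (pairs k s)" "list_all2 (letter_at m \<nu>) \<sigma>z z"
    using x by (auto simp: list_all2_append2)
  have dp: "distinct \<sigma>p" using d split by simp
  from pairs_positions[OF all(2) dp] obtain P where P: "finite P" "card P = k" "fst ` P = {a \<in> set \<sigma>p. a < m}"
    and each: "\<forall>a b. (a, b) \<in> P \<longrightarrow> (\<exists>u z. \<sigma>p = u @ a # b # z) \<and> a < m \<and> \<not> b < m \<and> \<nu> a = of_int s \<and> \<nu> b = - of_int s"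
    and apart: "\<forall>a b c d. (a, b) \<in> P \<longrightarrow> (c, d) \<in> P \<longrightarrow> (a, b) \<noteq> (c, d) \<longrightarrow> {a, b} \<inter> {c, d} = {}"
    by (elim exE conjE)
  define S where "S = (\<lambda>(a, b). gl_root a b) ` P"
  have in_S: "(a, b) \<in> P" if "gl_root a b \<in> S" "a \<noteq> b" for a b
  proof -
    obtain c e where "gl_root a b = gl_root c e" "(c, e) \<in> P" using \<open>gl_root a b \<in> S\<close> by (auto simp: S_def)
    then show ?thesis using root_inj[OF \<open>a \<noteq> b\<close>] by simp
  qed
  have "inj_on (\<lambda>(a, b). gl_root a b) P"
  proof (rule inj_onI, clarify)
    fix a b c e assume p: "(a, b) \<in> P" and eq: "gl_root a b = gl_root c e"
    have "a \<noteq> b" using each p by blast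
    from root_inj[OF this] eq show "a = c \<and> b = e" by blast
  qed
  then have cardS: "card S = k" unfolding S_def by (simp add: card_image P(2))
  have bounds: "a < m + n \<and> b < m + n" if p: "(a, b) \<in> P" for a b
  proof -
    obtain u' z' where "\<sigma>p = u' @ a # b # z'" using each p by blast
    then have "a \<in> set \<sigma>" "b \<in> set \<sigma>" using split by auto
    then show ?thesis using set by auto
  qed
  have sub: "S \<subseteq> adjacent_roots \<sigma>"
  proof
    fix \<beta> assume "\<beta> \<in> S"
    then obtain a b where \<beta>: "\<beta> = gl_root a b" "(a, b) \<in> P" by (auto simp: S_def)
    then obtain u' z' where "\<sigma>p = u' @ a # b # z'" using each by blast
    then have "\<sigma> = (\<sigma>u @ u') @ a # b # (z' @ \<sigma>z)" using split by simp
    then show "\<beta> \<in> adjacent_roots \<sigma>" unfolding adjacent_roots_def \<beta>(1) by blast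
  qed
  have iso: "S \<in> isotropic_sets m n \<nu>"
  proof (rule isotropicI)
    fix \<beta> assume "\<beta> \<in> S"
    then obtain a b where \<beta>: "\<beta> = gl_root a b" "(a, b) \<in> P" by (auto simp: S_def)
    have "(a < m) \<noteq> (b < m) \<and> entry m \<nu> a = entry m \<nu> b" using each \<beta>(2) by (simp add: entry_def)
    then show "\<exists>a b. \<beta> = gl_root a b \<and> a < m + n \<and> b < m + n \<and> (a < m) \<noteq> (b < m) \<and> entry m \<nu> a = entry m \<nu> b"
      using \<beta>(1) bounds[OF \<beta>(2)] by blast
  next
    fix a b c e assume "gl_root a b \<in> S" "gl_root c e \<in> S" "a \<noteq> b" "c \<noteq> e" and neq: "gl_root a b \<noteq> gl_root c e"
    then have "(a, b) \<in> P" "(c, e) \<in> P" using in_S by auto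
    moreover have "(a, b) \<noteq> (c, e)" using neq by auto
    ultimately show "{a, b} \<inter> {c, e} = {}" using apart by blast
  qed
  have letter: "\<exists>l\<in>set y. letter_at m \<nu> a l" if "list_all2 (letter_at m \<nu>) \<tau> y" "a \<in> set \<tau>" for a \<tau> y
    using that by (auto simp: list_all2_conv_all_nth in_set_conv_nth) (metis nth_mem)
  have "card T \<le> card S" if T: "T \<in> isotropic_sets m n \<nu>" for T
  proof -
    have "card T \<le> card (fst ` P)"
    proof (rule isotropic_card_le[OF T])
      show "finite (fst ` P)" using P(1) by simp
      fix a b assume ab: "a < m" "m \<le> b" "b < m + n" "entry m \<nu> a = entry m \<nu> b"
      have in_\<sigma>: "a \<in> set \<sigma>" "b \<in> set \<sigma>" using ab set by auto
      have pairs_letters: "set (pairs k s) \<subseteq> {Ep s, De s}" "set (pairs k s) \<noteq> {} \<Longrightarrow> k > 0"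
        by (induction k) (auto simp: pairs_Suc)
      obtain p where p: "p \<in> set (u @ pairs k s @ z)" "letter_at m \<nu> a p" using letter[OF x in_\<sigma>(1)] by blast
      obtain q where q: "q \<in> set (u @ pairs k s @ z)" "letter_at m \<nu> b q" using letter[OF x in_\<sigma>(2)] by blast
      obtain t where t: "p = Ep t" "\<nu> a = of_int t" using p(2) ab(1) by (cases p) auto
      obtain t' where t': "q = De t'" "\<nu> b = - of_int t'" using q(2) ab(2) by (cases q) auto
      have "(of_int t :: complex) = of_int t'" using ab t t' by (simp add: entry_def)
      then have "t' = t" by simp
      have k: "t = s \<and> k > 0"
      proof (rule ccontr)
        assume no: "\<not> (t = s \<and> k > 0)"
        then have "Ep t \<notin> set (pairs k s)" "De t \<notin> set (pairs k s)" using pairs_letters by auto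
        then have "Ep t \<in> set (u @ z)" "De t \<in> set (u @ z)" using p(1) q(1) t t' \<open>t' = t\<close> by auto
        then show False using core by blast
      qed
      have "a \<notin> set \<sigma>u \<and> a \<notin> set \<sigma>z"
      proof (intro conjI notI)
        assume "a \<in> set \<sigma>u"
        then obtain l where l: "l \<in> set u" "letter_at m \<nu> a l" using letter[OF all(1)] by blast
        have "l = Ep s" using l(2) t k ab(1) by (cases l) auto
        then show False using l(1) only k by auto
      next
        assume "a \<in> set \<sigma>z"
        then obtain l where l: "l \<in> set z" "letter_at m \<nu> a l" using letter[OF all(3)] by blast
        have "l = Ep s" using l(2) t k ab(1) by (cases l) auto
        then show False using l(1) only k by auto
      qed
      then show "a \<in> fst ` P" unfolding P(3) using in_\<sigma>(1) split ab(1) by auto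
    qed
    also have "\<dots> \<le> card P" by (rule card_image_le[OF P(1)])
    finally show ?thesis using cardS P(2) by simp
  qed
  then have "maximal_isotropic m n \<nu> S" using iso by (simp add: maximal_isotropic_def)
  then show ?thesis using sub by blast
qed

text \<open>
  A KW-module yields a word with chosen pairs, and a word with chosen pairs yields a set of simple roots
  and a highest weight for \<open>L\<close> itself.
\<close>

theorem KW_iff_totally_connected:
  fixes L :: "('v::ab_group_add) smodule"
  assumes lam: "lam \<in> P_plus m n" and L: "is_L m n (pi_st m n) lam L"
    and fg: "shifted_coordinates m n lam f g"
  defines "A \<equiv> f ` {..<m}" and "B \<equiv> (\<lambda>k. - g k) ` {..<n}"
  shows "KW_module m n L \<longleftrightarrow> totally_connected A B"
proof -
  have simple_L: "simple_module m n L" using L by (simp add: is_L_def)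
  interpret simple_gl_action "scl L" "even_part L" "odd_part L" "unit_act m n L" m n
    using simple_L by (rule simple_gl_action_unit_act)
  have sp: "space L = V" unfolding V_def unfolding space_def even_part_def odd_part_def by (rule refl)
  note st = shuffle_upt[of m n]
  have pos_st: "pos_roots m n (pi_st m n) = {gl_root a b | a b. before [0..<m + n] a b}"
    unfolding pi_st_eq by (rule simple_root_set_adjacent_roots(2)[OF st])
  have set_st: "set [0..<m + n] = {..<m + n}" by auto
  obtain v where v: "hwv [0..<N] lam v"
    using is_L_imp_hwv[OF L module_iso_refl simple_L set_st pos_st] by blast
  have dom: "lam c - lam (Suc c) \<in> \<nat>" if "Suc c < N" "(c < m) = (Suc c < m)" for c
    using P_plus_dominant[OF lam, of c "Suc c"] that by simp
  interpret dominant_words realized by (rule dominant_words_realized[OF v dom])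
  have finAB: "finite A" "finite B" by (simp_all add: A_def B_def)
  have std: "realized (std_word A B)"
  proof -
    let ?\<nu> = "lam + rho m n (pi_st m n)"
    have "hwv [0..<N] (?\<nu> - rho_order m n [0..<N]) v"
      using v by (subst hwv_cong[of _ lam]) (simp_all add: rho_st)
    moreover have "list_all2 (letter_at m ?\<nu>) [0..<m + n] (std_word A B)"
    proof -
      have word: "std_word A B = map Ep (map f [0..<m]) @ map De (map (\<lambda>k. - g k) [0..<n])"
        unfolding std_word_def A_def B_def
        using decreasing_below_image(1)[of m f] asc_uminus_image(1)[of n g] fg
        by (simp add: shifted_coordinates_def)
      have "list_all2 (letter_at m ?\<nu>) [0..<m] (map Ep (map f [0..<m]))"
        using fg by (auto simp: list_all2_conv_all_nth shifted_coordinates_def)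
      moreover have "list_all2 (letter_at m ?\<nu>) [m..<m + n] (map De (map (\<lambda>k. - g k) [0..<n]))"
        using fg by (auto simp: list_all2_conv_all_nth shifted_coordinates_def)
      moreover have "[0..<m + n] = [0..<m] @ [m..<m + n]" using upt_add_eq_append[of 0 m n] by simp
      ultimately show ?thesis unfolding word by (simp only: list_all2_appendI)
    qed
    ultimately show ?thesis using st unfolding realized_def by blast
  qed
  show ?thesis
  proof
    assume "KW_module m n L"
    then obtain \<pi> \<mu> S and M :: "'v smodule" where KW: "simple_root_set m n \<pi>" "is_L m n \<pi> \<mu> M"
      "module_iso m n L M" "S \<subseteq> \<pi>" "maximal_isotropic m n (\<mu> + rho m n \<pi>) S"
      unfolding KW_module_def by blast
    obtain \<sigma> where \<sigma>: "shuffle m n \<sigma>" "pos_roots m n \<pi> = {gl_root a b | a b. before \<sigma> a b}"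
      "\<pi> \<subseteq> adjacent_roots \<sigma>" using simple_root_set_ordering[OF KW(1)] by blast
    have set\<sigma>: "set \<sigma> = {..<m + n}" using \<sigma>(1) by (simp add: shuffle_def)
    obtain w where w: "hwv \<sigma> \<mu> w" using is_L_imp_hwv[OF KW(2,3) simple_L set\<sigma> \<sigma>(2)] by blast
    have "(\<mu> + rho m n \<pi>) a = \<mu> a + rho_order m n \<sigma> a" if "a < N" for a
      using rho_eq_rho_order[OF \<sigma>(1,2) that] by simp
    from realized_at_ordering[OF std \<sigma>(1) w this] obtain y where
      y: "realized y" "list_all2 (letter_at m (\<mu> + rho m n \<pi>)) \<sigma> y" by blast
    obtain bs where "block_word bs = y" "core_disjoint bs"
      using maximal_isotropic_blocks[OF \<sigma>(1) _ KW(5) y(2)] KW(4) \<sigma>(3) by blast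
    with y(1) obtain A' B' where "finite A'" "finite B'" "totally_connected A' B'" "realized (std_word A' B')"
      using blocks_imp_totally_connected[of bs] by blast
    then show "totally_connected A B"
      using realized_std_word_unique[OF std] finAB by blast
  next
    assume tc: "totally_connected A B"
    obtain u k s z where R: "realized (u @ pairs k s @ z)"
      and core: "\<And>a. Ep a \<in> set (u @ z) \<Longrightarrow> De a \<notin> set (u @ z)"
      and only: "k > 0 \<Longrightarrow> Ep s \<notin> set (u @ z) \<and> De s \<notin> set (u @ z)"
      by (rule totally_connected_imp_pairs[OF finAB tc std]) (rule that)
    obtain \<sigma> \<nu> w where \<sigma>: "shuffle m n \<sigma>" "list_all2 (letter_at m \<nu>) \<sigma> (u @ pairs k s @ z)"
      "hwv \<sigma> (\<nu> - rho_order m n \<sigma>) w" using R unfolding realized_def by blast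
    have set\<sigma>: "set \<sigma> = {..<m + n}" using \<sigma>(1) by (simp add: shuffle_def)
    define \<pi> where "\<pi> = adjacent_roots \<sigma>"
    define \<mu> where "\<mu> a = (if a < m + n then \<nu> a - rho_order m n \<sigma> a else 0)" for a
    have simple_\<pi>: "simple_root_set m n \<pi>" and pos: "pos_roots m n \<pi> = {gl_root a b | a b. before \<sigma> a b}"
      unfolding \<pi>_def by (rule simple_root_set_adjacent_roots[OF \<sigma>(1)])+
    have "hwv \<sigma> \<mu> w" using \<sigma>(3) by (subst hwv_cong[of _ "\<nu> - rho_order m n \<sigma>"]) (simp_all add: \<mu>_def)
    from hwv_imp_is_L[OF simple_L this set\<sigma> pos] have is_L: "is_L m n \<pi> \<mu> L" .
    have \<nu>: "(\<mu> + rho m n \<pi>) a = \<nu> a" if "a < m + n" for a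
      using rho_eq_rho_order[OF \<sigma>(1) pos that] that by (simp add: \<mu>_def)
    have "list_all2 (letter_at m (\<mu> + rho m n \<pi>)) \<sigma> (u @ pairs k s @ z)"
      by (rule letter_at_cong[OF \<sigma>(2)]) (use \<nu> set\<sigma> in auto)
    from pairs_maximal_isotropic[OF \<sigma>(1) this core only]
    have "\<exists>S\<subseteq>\<pi>. maximal_isotropic m n (\<mu> + rho m n \<pi>) S" by (simp only: \<pi>_def)
    moreover have "finite_dim L"
      unfolding finite_dim_def sp by (rule dominant_finite_dimensional[OF v dom])
    moreover have "\<mu> \<in> weights m n" by (simp add: weights_def \<mu>_def)
    ultimately show "KW_module m n L"
      unfolding KW_module_def using simple_L simple_\<pi> is_L module_iso_refl by blast
  qed
qed

theorem corollary30:
  fixes m n :: nat and lam :: weight and L :: "('v::ab_group_add) smodule"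
  assumes "lam \<in> P_plus m n"
    and "is_L m n (pi_st m n) lam L"
  shows "(KW_module m n L \<longleftrightarrow>
            (\<forall>\<mu>\<in>P_plus m n. KL m n lam \<mu> \<noteq> 0 \<longrightarrow> is_monomial (KL m n lam \<mu>))) \<and>
         (KW_module m n L \<longrightarrow>
            (\<forall>\<mu>\<in>P_plus m n. KL m n lam \<mu> \<noteq> 0 \<longrightarrow>
               KL m n lam \<mu> = monom 1 (trivial_length m n lam \<mu>)))"
proof -
  obtain f g where fg: "shifted_coordinates m n lam f g"
    using P_plus_coordinates[OF assms(1)] by blast
  show ?thesis
    using KW_iff_totally_connected[OF assms fg] monomial_iff_totally_connected[OF fg] by blast
qed

end
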